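(* For $n,q\ge2$, let $[\rho]\in\pi_{n-1}(SO(q+1))$ be in the image of $\iota_*:\pi_{n-1}(SO(q))\to\pi_{n-1}(SO(q+1))$, induced by the inclusion $\iota:SO(q)\hookrightarrow SO(q+1)$. Then $J[\rho]\in\pi_{n+q}(S^{q+1})$ is a suspension (that is, lies in the image of the suspension homomorphism $\Sigma:\pi_{n+q-1}(S^q)\to\pi_{n+q}(S^{q+1})$). In particular, $J[\rho]=-\Sigma\{\mathrm{Id}_{S^n},\mathrm{Id}_{S^q}\}_s$, where the brace product is taken in the sphere bundle $S^q\hookrightarrow E\to S^n$ characterized by $\rho$, which admits a section $s$.
   Context: $J:\pi_{n-1}(SO(q+1))\to\pi_{n+q}(S^{q+1})$ is the classical $J$-homomorphism. It is defined as follows: $SO(q+1)$ acts on $S^{q+1}=\mathbb R^{q+1}\cup\{\infty\}$ fixing $\infty$, so $\rho$ gives $\rho:S^{n-1}\to Map_\bullet(S^{q+1},S^{q+1})$. With $X=S^{n-1}$, $Y=S^{q}$, define $\tilde\rho:CX\times Y\cup X\times CY\to\Sigma Y$ by $([x,t],y)\mapsto\bullet$, $(x,[y,t])\mapsto\rho(x)[y,t]$, and $J[\rho]=[\tilde\rho\circ\mu]$ with $\mu:\Sigma X\wedge Y\to CX\times Y\cup X\times CY$ a homotopy inverse of the quotient map from the (reduced) join to $\Sigma X\wedge Y$. The bundle characterized by $\rho$ is $E=D^n_+\times S^q\cup_\rho D^n_-\times S^q$, glued by the clutching function $\rho:S^{n-1}\to SO(q+1)$ acting linearly on $S^q$. Brace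 product: for a fibration $F\overset{i}{\hookrightarrow}E\xrightarrow{p}B$ with (homotopy) section $s$, $i_*:\pi_r(F)\to\pi_r(E)$ is injective with image $\ker p_*$, and $\{\alpha,\beta\}_s\in\pi_{k+l-1}(F)$ is the unique element with $i_*\{\alpha,\beta\}_s=[s_*\alpha,i_*\beta]$ (Whitehead product in $\pi_*(E)$), for $\alpha\in\pi_k(B)$, $\beta\in\pi_l(F)$. *)

theory Defs
  imports "HOL-Analysis.Analysis" "Jordan_Normal_Form.Determinant"
begin

text \<open>Spheres are the library's \<open>nsphere k\<close> (unit vectors with coordinates \<open>0, \<dots>, k\<close>, all later
  coordinates being \<open>0\<close>), so \<open>nsphere k\<close> is literally the equator of \<open>nsphere (Suc k)\<close>. Every
  sphere is pointed by the first unit vector.\<close>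

definition base :: "nat \<Rightarrow> real"
  where "base = (\<lambda>i. if i = 0 then 1 else 0)"

section \<open>Reduced suspensions, smash products, cones and joins of spheres\<close>

text \<open>\<open>susp_pt k y t\<close> is the point \<open>[y, t]\<close> of the reduced suspension
  \<open>\<Sigma> S\<^sup>k = S\<^sup>k \<and> S\<^sup>1 \<cong> S\<^bsup>k+1\<^esup>\<close>. As \<open>t\<close> runs from 0 to 1 it traverses the circle having the segment
  from \<open>base\<close> to \<open>y\<close> as a diameter and lying in the plane spanned by that segment and the new
  (last) coordinate direction; it starts at \<open>base\<close> into the upper hemisphere and passes
  through \<open>y\<close> at \<open>t = 1/2\<close>. The map collapses exactly \<open>S\<^sup>k \<times> {0,1} \<union> {base} \<times> [0,1]\<close> to \<open>base\<close>.\<close>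

definition susp_pt :: "nat \<Rightarrow> (nat \<Rightarrow> real) \<Rightarrow> real \<Rightarrow> (nat \<Rightarrow> real)"
  where "susp_pt k y t = (\<lambda>i. (base i + y i) / 2 + cos (2 * pi * t) * ((base i - y i) / 2)
     + (if i = Suc k then sin (2 * pi * t) * (sqrt (\<Sum>j\<le>k. (base j - y j)\<^sup>2) / 2) else 0))"

text \<open>Some suspension coordinates \<open>(y, t)\<close> of a point. They are unique except at \<open>base\<close>; all uses
  below are independent of the choice.\<close>

definition susp_coords :: "nat \<Rightarrow> (nat \<Rightarrow> real) \<Rightarrow> (nat \<Rightarrow> real) \<times> real"
  where "susp_coords k z =
    (SOME (y, t). y \<in> topspace (nsphere k) \<and> t \<in> {0..1} \<and> susp_pt k y t = z)"

text \<open>\<open>smash a b x y\<close> is the image of \<open>(x, y)\<close> under the quotient map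
  \<open>S\<^sup>a \<times> S\<^sup>b \<rightarrow> S\<^sup>a \<and> S\<^sup>b \<cong> S\<^bsup>a+b\<^esup>\<close>, where the homeomorphism comes from \<open>S\<^bsup>b+1\<^esup> = S\<^sup>b \<and> S\<^sup>1\<close> and
  \<open>S\<^sup>a \<and> (S\<^sup>b \<and> S\<^sup>1) = (S\<^sup>a \<and> S\<^sup>b) \<and> S\<^sup>1\<close>.\<close>

fun smash :: "nat \<Rightarrow> nat \<Rightarrow> (nat \<Rightarrow> real) \<Rightarrow> (nat \<Rightarrow> real) \<Rightarrow> (nat \<Rightarrow> real)" where
  "smash a 0 x y = (if y = base then base else x)"
| "smash a (Suc b) x z = (case susp_coords b z of (y, t) \<Rightarrow> susp_pt (a + b) (smash a b x y) t)"

text \<open>The reduced cone \<open>C S\<^sup>k = (S\<^sup>k \<times> [0,1]) / (S\<^sup>k \<times> {0} \<union> {base} \<times> [0,1])\<close> is realized as the unit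
  disc of dimension \<open>k + 1\<close>: \<open>[x, t]\<close> is the point \<open>(1 - t) base + t x\<close> of the chord from
  \<open>base\<close> to \<open>x\<close>. Thus the cone point is \<open>base\<close>, and \<open>S\<^sup>k \<subseteq> C S\<^sup>k\<close> is the boundary sphere \<open>t = 1\<close>.\<close>

definition cone :: "nat \<Rightarrow> (nat \<Rightarrow> real) topology"
  where "cone k = subtopology (Euclidean_space (Suc k)) {x. (\<Sum>i\<le>k. (x i)\<^sup>2) \<le> 1}"

definition cone_pt :: "(nat \<Rightarrow> real) \<Rightarrow> real \<Rightarrow> (nat \<Rightarrow> real)"
  where "cone_pt x t = (\<lambda>i. (1 - t) * base i + t * x i)"

definition cone_coords :: "nat \<Rightarrow> (nat \<Rightarrow> real) \<Rightarrow> (nat \<Rightarrow> real) \<times> real"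
  where "cone_coords k u =
    (SOME (x, t). x \<in> topspace (nsphere k) \<and> t \<in> {0..1} \<and> cone_pt x t = u)"

text \<open>The reduced join \<open>CX \<times> Y \<union> X \<times> CY\<close> of \<open>X = S\<^sup>a\<close> and \<open>Y = S\<^sup>b\<close>, pointed by \<open>(base, base)\<close>.\<close>

definition join :: "nat \<Rightarrow> nat \<Rightarrow> ((nat \<Rightarrow> real) \<times> (nat \<Rightarrow> real)) topology"
  where "join a b = subtopology (prod_topology (cone a) (cone b))
    {(u, v). u \<in> topspace (nsphere a) \<or> v \<in> topspace (nsphere b)}"

text \<open>The map on the join given by \<open>([x, t], y) \<mapsto> f x t y\<close> and \<open>(x, [y, t]) \<mapsto> g x y t\<close>, for \<open>f\<close> and
  \<open>g\<close> that agree on \<open>X \<times> Y\<close> and respect the identifications of the cones.\<close>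

definition join_fun ::
    "nat \<Rightarrow> nat \<Rightarrow> ((nat \<Rightarrow> real) \<Rightarrow> real \<Rightarrow> (nat \<Rightarrow> real) \<Rightarrow> 'c) \<Rightarrow>
     ((nat \<Rightarrow> real) \<Rightarrow> (nat \<Rightarrow> real) \<Rightarrow> real \<Rightarrow> 'c) \<Rightarrow> (nat \<Rightarrow> real) \<times> (nat \<Rightarrow> real) \<Rightarrow> 'c"
  where "join_fun a b f g = (\<lambda>(u, v).
     if v \<in> topspace (nsphere b) then (case cone_coords a u of (x, t) \<Rightarrow> f x t v)
     else (case cone_coords b v of (y, t) \<Rightarrow> g u y t))"

text \<open>The quotient map from the join to \<open>\<Sigma>(X \<and> Y) \<cong> S\<^bsup>a+b+1\<^esup>\<close>, which collapses
  \<open>CX \<times> {base} \<union> {base} \<times> CY\<close>; the suspension coordinate increases from the cone point of \<open>CX\<close>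
  (value 0) through \<open>X \<times> Y\<close> (value 1/2) to the cone point of \<open>CY\<close> (value 1).\<close>

definition join_quot :: "nat \<Rightarrow> nat \<Rightarrow> (nat \<Rightarrow> real) \<times> (nat \<Rightarrow> real) \<Rightarrow> (nat \<Rightarrow> real)"
  where "join_quot a b = join_fun a b
     (\<lambda>x t y. susp_pt (a + b) (smash a b x y) (t / 2))
     (\<lambda>x y t. susp_pt (a + b) (smash a b x y) (1 - t / 2))"

definition pointed_homotopic ::
    "'a topology \<Rightarrow> 'a \<Rightarrow> 'b topology \<Rightarrow> 'b \<Rightarrow> ('a \<Rightarrow> 'b) \<Rightarrow> ('a \<Rightarrow> 'b) \<Rightarrow> bool"
  where "pointed_homotopic X a Y b f g \<longleftrightarrow> homotopic_with (\<lambda>h. h a = b) X Y f g"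

text \<open>The map \<open>\<mu>\<close>: a pointed homotopy inverse of \<open>join_quot\<close>, unique up to pointed homotopy.\<close>

definition join_inv :: "nat \<Rightarrow> nat \<Rightarrow> (nat \<Rightarrow> real) \<Rightarrow> (nat \<Rightarrow> real) \<times> (nat \<Rightarrow> real)"
  where "join_inv a b = (SOME \<mu>.
     continuous_map (nsphere (Suc (a + b))) (join a b) \<mu> \<and> \<mu> base = (base, base) \<and>
     pointed_homotopic (join a b) (base, base) (join a b) (base, base)
       (\<mu> \<circ> join_quot a b) id \<and>
     pointed_homotopic (nsphere (Suc (a + b))) base (nsphere (Suc (a + b))) base
       (join_quot a b \<circ> \<mu>) id)"

section \<open>Homotopy groups\<close>

definition htpy_class ::
    "nat \<Rightarrow> 'b topology \<Rightarrow> 'b \<Rightarrow> ((nat \<Rightarrow> real) \<Rightarrow> 'b) \<Rightarrow> ((nat \<Rightarrow> real) \<Rightarrow> 'b) set"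
  where "htpy_class k Y b f = {g. pointed_homotopic (nsphere k) base Y b f g}"

text \<open>The sum of two maps on \<open>S\<^sup>k = \<Sigma> S\<^bsup>k-1\<^esup>\<close> (\<open>k \<ge> 1\<close>), by concatenation in the suspension
  coordinate.\<close>

definition sphere_concat ::
    "nat \<Rightarrow> ((nat \<Rightarrow> real) \<Rightarrow> 'b) \<Rightarrow> ((nat \<Rightarrow> real) \<Rightarrow> 'b) \<Rightarrow> (nat \<Rightarrow> real) \<Rightarrow> 'b"
  where "sphere_concat k f g z = (case susp_coords (k - 1) z of (y, t) \<Rightarrow>
     if t \<le> 1/2 then f (susp_pt (k - 1) y (2 * t)) else g (susp_pt (k - 1) y (2 * t - 1)))"

text \<open>Operations on homotopy classes are given on representatives; as usual for quotients, the union
  over all representatives is the common value.\<close>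

definition homotopy_group ::
    "nat \<Rightarrow> 'b topology \<Rightarrow> 'b \<Rightarrow> ((nat \<Rightarrow> real) \<Rightarrow> 'b) set monoid"
  where "homotopy_group k Y b =
    \<lparr> carrier = htpy_class k Y b ` {f. continuous_map (nsphere k) Y f \<and> f base = b},
      mult = (\<lambda>\<alpha> \<beta>. \<Union>f\<in>\<alpha>. \<Union>g\<in>\<beta>. htpy_class k Y b (sphere_concat k f g)),
      one = htpy_class k Y b (\<lambda>_. b) \<rparr>"

text \<open>\<open>\<phi>\<^sub>* : \<pi>\<^sub>k(X) \<rightarrow> \<pi>\<^sub>k(Y)\<close> for a pointed map \<open>\<phi>\<close> from \<open>X\<close> to \<open>(Y, b)\<close>.\<close>

definition induced ::
    "nat \<Rightarrow> 'b topology \<Rightarrow> 'b \<Rightarrow> ('a \<Rightarrow> 'b) \<Rightarrow> ((nat \<Rightarrow> real) \<Rightarrow> 'a) set \<Rightarrow> ((nat \<Rightarrow> real) \<Rightarrow> 'b) set"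
  where "induced k Y b \<phi> \<alpha> = (\<Union>f\<in>\<alpha>. htpy_class k Y b (\<phi> \<circ> f))"

text \<open>The suspension homomorphism \<open>\<pi>\<^sub>k(S\<^sup>m) \<rightarrow> \<pi>\<^bsub>k+1\<^esub>(S\<^bsup>m+1\<^esup>)\<close>, \<open>(\<Sigma>f)[y, t] = [f y, t]\<close>.\<close>

definition suspension_hom ::
    "nat \<Rightarrow> nat \<Rightarrow> ((nat \<Rightarrow> real) \<Rightarrow> nat \<Rightarrow> real) set \<Rightarrow> ((nat \<Rightarrow> real) \<Rightarrow> nat \<Rightarrow> real) set"
  where "suspension_hom k m \<alpha> = (\<Union>f\<in>\<alpha>. htpy_class (Suc k) (nsphere (Suc m)) base
     (\<lambda>z. case susp_coords k z of (y, t) \<Rightarrow> susp_pt m (f y) t))"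

text \<open>The Whitehead product \<open>\<pi>\<^sub>k(Z) \<times> \<pi>\<^sub>l(Z) \<rightarrow> \<pi>\<^bsub>k+l-1\<^esub>(Z)\<close> for \<open>k, l \<ge> 1\<close>: with \<open>X = S\<^bsup>k-1\<^esup>\<close> and
  \<open>Y = S\<^bsup>l-1\<^esup>\<close>, the class of \<open>([x, t], y) \<mapsto> f[x, t]\<close>, \<open>(x, [y, t]) \<mapsto> g[y, t]\<close> composed with \<open>\<mu>\<close>.\<close>

definition whitehead_product ::
    "nat \<Rightarrow> nat \<Rightarrow> 'b topology \<Rightarrow> 'b \<Rightarrow>
     ((nat \<Rightarrow> real) \<Rightarrow> 'b) set \<Rightarrow> ((nat \<Rightarrow> real) \<Rightarrow> 'b) set \<Rightarrow> ((nat \<Rightarrow> real) \<Rightarrow> 'b) set"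
  where "whitehead_product k l Z z \<alpha> \<beta> = (\<Union>f\<in>\<alpha>. \<Union>g\<in>\<beta>. htpy_class (k + l - 1) Z z
     (join_fun (k - 1) (l - 1)
        (\<lambda>x t y. f (susp_pt (k - 1) x t)) (\<lambda>x y t. g (susp_pt (l - 1) y t))
      \<circ> join_inv (k - 1) (l - 1)))"

text \<open>The brace product \<open>{\<alpha>, \<beta>}\<^sub>s \<in> \<pi>\<^bsub>k+l-1\<^esub>(F, f0)\<close>, for \<open>i : (F, f0) \<rightarrow> (E, e0)\<close> the inclusion of the
  fibre and \<open>s\<close> a pointed section into \<open>(E, e0)\<close>.\<close>

definition brace_product ::
    "'f topology \<Rightarrow> 'f \<Rightarrow> 'e topology \<Rightarrow> 'e \<Rightarrow> ('f \<Rightarrow> 'e) \<Rightarrow> ('b \<Rightarrow> 'e) \<Rightarrow> nat \<Rightarrow> nat \<Rightarrow>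
     ((nat \<Rightarrow> real) \<Rightarrow> 'b) set \<Rightarrow> ((nat \<Rightarrow> real) \<Rightarrow> 'f) set \<Rightarrow> ((nat \<Rightarrow> real) \<Rightarrow> 'f) set"
  where "brace_product F f0 E e0 i s k l \<alpha> \<beta> = (THE \<gamma>.
     \<gamma> \<in> carrier (homotopy_group (k + l - 1) F f0) \<and>
     induced (k + l - 1) E e0 i \<gamma>
       = whitehead_product k l E e0 (induced k E e0 s \<alpha>) (induced l E e0 i \<beta>))"

section \<open>Rotation groups and the J-homomorphism\<close>

definition SO_set :: "nat \<Rightarrow> real mat set"
  where "SO_set m =
    {A \<in> carrier_mat m m. A * transpose_mat A = 1\<^sub>m m \<and> Determinant.det A = 1}"

definition SO :: "nat \<Rightarrow> real mat topology"
  where "SO m = pullback_topology (SO_set m)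
     (\<lambda>A (i, j). if i < m \<and> j < m then A $$ (i, j) else 0) (powertop_real UNIV)"

text \<open>The inclusion of \<open>SO(m)\<close> in \<open>SO(m + 1)\<close> as the stabilizer of the base point: \<open>A \<mapsto> diag(1, A)\<close>.\<close>

definition SO_incl :: "real mat \<Rightarrow> real mat"
  where "SO_incl A = four_block_mat (1\<^sub>m 1) (0\<^sub>m 1 (dim_col A)) (0\<^sub>m (dim_row A) 1) A"

definition rotate :: "real mat \<Rightarrow> (nat \<Rightarrow> real) \<Rightarrow> (nat \<Rightarrow> real)"
  where "rotate A x = (\<lambda>i. if i < dim_row A then \<Sum>j<dim_col A. A $$ (i, j) * x j else 0)"

text \<open>The map \<open>\<rho>\<^sup>~ : CX \<times> Y \<union> X \<times> CY \<rightarrow> \<Sigma>Y\<close> for \<open>X = S\<^bsup>n-1\<^esup>\<close>, \<open>Y = S\<^sup>q\<close>. The action of \<open>SO(q + 1)\<close> on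
  \<open>S\<^bsup>q+1\<^esup> = \<real>\<^bsup>q+1\<^esup> \<union> {\<infinity>}\<close>, with \<open>\<infinity>\<close> the base point, becomes under stereographic projection from
  \<open>base\<close> the linear action of \<open>diag(1, A)\<close> on \<open>nsphere (q + 1)\<close>.\<close>

definition J_join_map ::
    "nat \<Rightarrow> nat \<Rightarrow> ((nat \<Rightarrow> real) \<Rightarrow> real mat) \<Rightarrow> (nat \<Rightarrow> real) \<times> (nat \<Rightarrow> real) \<Rightarrow> (nat \<Rightarrow> real)"
  where "J_join_map n q \<rho> = join_fun (n - 1) q
     (\<lambda>x t y. base) (\<lambda>x y t. rotate (SO_incl (\<rho> x)) (susp_pt q y t))"

definition J_hom ::
    "nat \<Rightarrow> nat \<Rightarrow> ((nat \<Rightarrow> real) \<Rightarrow> real mat) set \<Rightarrow> ((nat \<Rightarrow> real) \<Rightarrow> nat \<Rightarrow> real) set"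
  where "J_hom n q \<alpha> = (\<Union>\<rho>\<in>\<alpha>. htpy_class (n + q) (nsphere (q + 1)) base
     (J_join_map n q \<rho> \<circ> join_inv (n - 1) q))"

section \<open>Sphere bundles over spheres\<close>

definition quotient_topology :: "'a topology \<Rightarrow> ('a \<Rightarrow> 'b) \<Rightarrow> 'b topology"
  where "quotient_topology X f = topology (\<lambda>U.
     U \<subseteq> f ` topspace X \<and> openin X {x \<in> topspace X. f x \<in> U})"

lemma openin_quotient_topology:
  "openin (quotient_topology X f) U \<longleftrightarrow>
     U \<subseteq> f ` topspace X \<and> openin X {x \<in> topspace X. f x \<in> U}"
proof -
  have "istopology (\<lambda>U. U \<subseteq> f ` topspace X \<and> openin X {x \<in> topspace X. f x \<in> U})"
    unfolding istopology_def
  proof (intro conjI allI impI)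
    fix S T
    assume S: "S \<subseteq> f ` topspace X \<and> openin X {x \<in> topspace X. f x \<in> S}"
      and T: "T \<subseteq> f ` topspace X \<and> openin X {x \<in> topspace X. f x \<in> T}"
    show "S \<inter> T \<subseteq> f ` topspace X" using S by blast
    have "{x \<in> topspace X. f x \<in> S \<inter> T}
      = {x \<in> topspace X. f x \<in> S} \<inter> {x \<in> topspace X. f x \<in> T}" by blast
    then show "openin X {x \<in> topspace X. f x \<in> S \<inter> T}" using S T by auto
  next
    fix \<K>
    assume K: "\<forall>K\<in>\<K>. K \<subseteq> f ` topspace X \<and> openin X {x \<in> topspace X. f x \<in> K}"
    then show "\<Union>\<K> \<subseteq> f ` topspace X" by blast
    have "{x \<in> topspace X. f x \<in> \<Union>\<K>} = (\<Union>K\<in>\<K>. {x \<in> topspace X. f x \<in> K})" by blast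
    then show "openin X {x \<in> topspace X. f x \<in> \<Union>\<K>}" using K by auto
  qed
  then show ?thesis unfolding quotient_topology_def by simp
qed

lemma quotient_map_quotient_topology: "quotient_map X (quotient_topology X f) f"
proof -
  have "{x \<in> topspace X. f x \<in> f ` topspace X} = topspace X" by blast
  then have "openin (quotient_topology X f) (f ` topspace X)"
    by (simp add: openin_quotient_topology)
  then have "topspace (quotient_topology X f) = f ` topspace X"
    by (metis openin_quotient_topology openin_subset openin_topspace subset_antisym)
  then show ?thesis
    unfolding quotient_map_def by (simp add: openin_quotient_topology)
qed

text \<open>\<open>D\<^sup>n\<^sub>+\<close> (for \<open>True\<close>) and \<open>D\<^sup>n\<^sub>-\<close> (for \<open>False\<close>).\<close>

definition hemisphere :: "nat \<Rightarrow> bool \<Rightarrow> (nat \<Rightarrow> real) topology"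
  where "hemisphere n p = subtopology (nsphere n) {x. if p then 0 \<le> x n else x n \<le> 0}"

text \<open>The gluing along the equator identifies \<open>(x, y) \<in> D\<^sup>n\<^sub>+ \<times> S\<^sup>q\<close> with \<open>(x, \<rho>(x) y) \<in> D\<^sup>n\<^sub>- \<times> S\<^sup>q\<close>.
  \<open>glue n \<rho>\<close> sends a point of the disjoint union to the representative of its equivalence class,
  taken in \<open>D\<^sup>n\<^sub>- \<times> S\<^sup>q\<close> over the equator, so the fibres of \<open>glue n \<rho>\<close> are the classes.\<close>

definition glue ::
    "nat \<Rightarrow> ((nat \<Rightarrow> real) \<Rightarrow> real mat) \<Rightarrow> bool \<times> (nat \<Rightarrow> real) \<times> (nat \<Rightarrow> real) \<Rightarrow>
     bool \<times> (nat \<Rightarrow> real) \<times> (nat \<Rightarrow> real)"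
  where "glue n \<rho> = (\<lambda>(p, x, y).
     if p \<and> x n = 0 then (False, x, rotate (\<rho> x) y) else (p, x, y))"

definition sphere_bundle ::
    "nat \<Rightarrow> nat \<Rightarrow> ((nat \<Rightarrow> real) \<Rightarrow> real mat) \<Rightarrow> (bool \<times> (nat \<Rightarrow> real) \<times> (nat \<Rightarrow> real)) topology"
  where "sphere_bundle n q \<rho> = quotient_topology
     (sum_topology (\<lambda>p. prod_topology (hemisphere n p) (nsphere q)) UNIV) (glue n \<rho>)"

definition bundle_proj :: "bool \<times> (nat \<Rightarrow> real) \<times> (nat \<Rightarrow> real) \<Rightarrow> (nat \<Rightarrow> real)"
  where "bundle_proj = (\<lambda>(p, x, y). x)"

text \<open>The inclusion of the fibre over \<open>base\<close>, which lies on the equator. For \<open>\<rho>(base) = 1\<close> both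
  trivializations restrict to the same inclusion.\<close>

definition fibre_incl :: "(nat \<Rightarrow> real) \<Rightarrow> bool \<times> (nat \<Rightarrow> real) \<times> (nat \<Rightarrow> real)"
  where "fibre_incl y = (False, base, y)"

definition pointed_section ::
    "nat \<Rightarrow> nat \<Rightarrow> ((nat \<Rightarrow> real) \<Rightarrow> real mat) \<Rightarrow>
     ((nat \<Rightarrow> real) \<Rightarrow> bool \<times> (nat \<Rightarrow> real) \<times> (nat \<Rightarrow> real)) \<Rightarrow> bool"
  where "pointed_section n q \<rho> s \<longleftrightarrow>
     continuous_map (nsphere n) (sphere_bundle n q \<rho>) s \<and>
     (\<forall>x \<in> topspace (nsphere n). bundle_proj (s x) = x) \<and>
     s base = fibre_incl base"

end

theory Submission
  imports Defs
begin

text \<open>Homotopy classes of maps on \<open>S\<^bsup>a+b+1\<^esup> = \<Sigma>(S\<^sup>a \<and> S\<^sup>b)\<close> are compared after pulling the maps back to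
  the cylinder \<open>(S\<^sup>a \<times> S\<^sup>b) \<times> [0,1]\<close>. There a map is a family of loops parametrized by
  \<open>S\<^sup>a \<times> S\<^sup>b\<close>, families of loops can be concatenated, reversed and cancelled, and no information is
  lost (\<open>smash_pull_inj\<close>): in the Puppe sequence of \<open>S\<^sup>a \<or> S\<^sup>b \<rightarrow> S\<^sup>a \<times> S\<^sup>b \<rightarrow> S\<^sup>a \<and> S\<^sup>b\<close> the
  first map splits after one suspension. So every identity of homotopy classes needed here
  becomes a cancellation of loops.

  The map on the join that is constant on \<open>CX \<times> Y\<close> and is \<open>G x [y,t]\<close> on \<open>X \<times> CY\<close> pulls back, after
  composition with \<open>\<mu>\<close>, to the loop \<open>G base [y,t]\<close> followed by the reverse of the loop \<open>G x [y,t]\<close>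
  (\<open>join_pullback\<close>). Let \<open>\<rho> = diag(1, A)\<close> up to homotopy and \<open>n = a + 1\<close>. For \<open>J[\<rho>]\<close> the map
  \<open>G x\<close> is \<open>diag(1, 1, A x)\<close>. A rotation of the coordinate axes deforms it to the map that fixes the
  suspension coordinate of \<open>S\<^bsup>q+1\<^esup> = \<Sigma>S\<^sup>q\<close>, so the pullback of \<open>J[\<rho>]\<close> is \<open>[y,t] - [A x y,t]\<close>
  (\<open>J_pullback\<close>). On the other hand let \<open>c A : S\<^bsup>a+q\<^esup> \<rightarrow> S\<^sup>q\<close> be the same construction one
  dimension lower. Its suspension is a family of double loops, for which the two directions of
  concatenation agree, and therefore pulls back to the same expression
  (\<open>J_rep_pullback\<close>). Hence \<open>J[\<rho>] = \<Sigma> c(A)\<close> (\<open>J_eq_suspension\<close>).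

  The inverse comes from replacing \<open>A\<close> by its transpose. The pullback of \<open>\<Sigma> c(A\<^sup>T)\<close> is
  \<open>[y,t] - [A\<^sup>T x y,t]\<close>, and composition with the shear \<open>(x,y) \<mapsto> (x, A x y)\<close> turns this into
  \<open>[A x y,t] - [y,t]\<close>. On the smash product the shear is homotopic to the identity, so it
  does not change a pullback (\<open>shear_homotopy\<close>). Thus \<open>J[\<rho>] + \<Sigma> c(A\<^sup>T) = 0\<close>
  (\<open>J_add_suspension\<close>).

  It remains to see that \<open>\<Sigma>{Id, Id}\<^sub>s = \<Sigma> c(A\<^sup>T)\<close> for every section \<open>s\<close>. Over the disc
  \<open>D\<^sup>n \<rightarrow> S\<^sup>n\<close> that collapses the boundary the bundle is trivial, so \<open>s\<close> becomes a map \<open>D\<^sup>n \<rightarrow> S\<^sup>q\<close>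
  that is \<open>x \<mapsto> \<rho>(x)\<^sup>T base\<close> on the boundary. Contracting the disc moves the Whitehead
  product of \<open>s\<close> and the fibre inclusion into the fibre, where it is this map on \<open>CX \<times> Y\<close> and
  \<open>\<rho>(x)\<^sup>T [y,t]\<close> on \<open>X \<times> CY\<close> (\<open>whitehead_into_fibre\<close>). That this determines the brace product
  needs the injectivity of \<open>\<pi>\<^sub>k(F) \<rightarrow> \<pi>\<^sub>k(E)\<close> in the presence of a section (\<open>fibre_incl_inj\<close>),
  which is proved by transporting fibres along paths. Finally, \<open>\<rho>\<close> may be deformed to
  \<open>diag(1, A)\<close>, which fixes \<open>base\<close>, so that the map is \<open>base\<close> on \<open>X \<times> Y\<close>. After
  one suspension it then becomes the sum of its restrictions to the two halves of the join, and
  the half that depends on \<open>s\<close> is null-homotopic because a disc is contractible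
  (\<open>suspend_join_split\<close>, \<open>suspend_brace_map\<close>).\<close>

section \<open>Continuous maps and relative homotopies\<close>

lemma cm_comp:
  assumes "continuous_map (top_of_set T) W g" "continuous_on S f" "\<And>x. x \<in> S \<Longrightarrow> f x \<in> T"
  shows "continuous_map (top_of_set S) W (\<lambda>x. g (f x))"
proof -
  have "continuous_map (top_of_set S) (top_of_set T) f"
    using assms by (simp add: Pi_iff)
  from continuous_map_compose[OF this assms(1)] show ?thesis by (simp add: o_def)
qed

lemma cm_cong:
  assumes "continuous_map (top_of_set T) W g" "\<And>x. x \<in> T \<Longrightarrow> f x = g x"
  shows "continuous_map (top_of_set T) W f"
  using continuous_map_eq[OF assms(1), of f] assms(2) by simp

lemma cm_paste:
  assumes S: "closedin (top_of_set D) S1" "closedin (top_of_set D) S2" "D \<subseteq> S1 \<union> S2"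
    and f: "continuous_map (top_of_set S1) W f" "continuous_map (top_of_set S2) W f"
  shows "continuous_map (top_of_set D) W f"
proof -
  have *: "D \<inter> S1 = S1" "D \<inter> S2 = S2"
    using closedin_subset[OF S(1)] closedin_subset[OF S(2)] by auto
  have a: "continuous_map (subtopology (top_of_set D) S1) W f" "continuous_map (subtopology (top_of_set D) S2) W f"
    using f by (simp_all only: subtopology_subtopology *)
  show ?thesis
    unfolding continuous_map_closedin
  proof (intro conjI allI impI)
    show "f \<in> topspace (top_of_set D) \<rightarrow> topspace W"
      using f S(3) unfolding continuous_map_def by fastforce
    fix C assume C: "closedin W C"
    have "closedin (top_of_set S1) {x \<in> S1. f x \<in> C}" "closedin (top_of_set S2) {x \<in> S2. f x \<in> C}"
      using f C unfolding continuous_map_closedin by auto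
    then have "closedin (top_of_set D) {x \<in> S1. f x \<in> C}" "closedin (top_of_set D) {x \<in> S2. f x \<in> C}"
      using S(1,2) closedin_trans by blast+
    then have "closedin (top_of_set D) ({x \<in> S1. f x \<in> C} \<union> {x \<in> S2. f x \<in> C})" by blast
    moreover have "{x \<in> S1. f x \<in> C} \<union> {x \<in> S2. f x \<in> C} = {x \<in> topspace (top_of_set D). f x \<in> C}"
      using * S(3) by auto
    ultimately show "closedin (top_of_set D) {x \<in> topspace (top_of_set D). f x \<in> C}" by simp
  qed
qed

lemma cm_if:
  fixes p :: "'a::topological_space \<Rightarrow> real"
  assumes p: "continuous_on D p"
    and f: "continuous_map (top_of_set {x \<in> D. p x \<le> c}) W f"
    and g: "continuous_map (top_of_set {x \<in> D. c \<le> p x}) W g"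
    and fg: "\<And>x. x \<in> D \<Longrightarrow> p x = c \<Longrightarrow> f x = g x"
  shows "continuous_map (top_of_set D) W (\<lambda>x. if p x \<le> c then f x else g x)"
proof (rule cm_paste)
  show "closedin (top_of_set D) {x \<in> D. p x \<le> c}"
  proof -
    have "{x \<in> D. p x \<le> c} = D \<inter> p -` {..c}" by auto
    then show ?thesis using continuous_closedin_preimage[OF p, of "{..c}"] by simp
  qed
  show "closedin (top_of_set D) {x \<in> D. c \<le> p x}"
  proof -
    have "{x \<in> D. c \<le> p x} = D \<inter> p -` {c..}" by auto
    then show ?thesis using continuous_closedin_preimage[OF p, of "{c..}"] by simp
  qed
  show "D \<subseteq> {x \<in> D. p x \<le> c} \<union> {x \<in> D. c \<le> p x}" by auto
  show "continuous_map (top_of_set {x \<in> D. p x \<le> c}) W (\<lambda>x. if p x \<le> c then f x else g x)"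
    by (rule cm_cong[OF f]) simp
  show "continuous_map (top_of_set {x \<in> D. c \<le> p x}) W (\<lambda>x. if p x \<le> c then f x else g x)"
    by (rule cm_cong[OF g]) (simp add: fg)
qed

lemma continuous_onI_if:
  fixes p :: "'a::topological_space \<Rightarrow> real" and f :: "'a \<Rightarrow> 'b::topological_space"
  assumes "continuous_on D p"
    and "continuous_on {x \<in> D. p x \<le> c} f" "continuous_on {x \<in> D. c \<le> p x} g"
    and "\<And>x. x \<in> D \<Longrightarrow> p x = c \<Longrightarrow> f x = g x"
  shows "continuous_on D (\<lambda>x. if p x \<le> c then f x else g x)"
  using cm_if[OF assms(1), of c euclidean f g] assms(2-4) by simp

text \<open>A continuous surjection from a compact space onto a Hausdorff space is a quotient map. All
  spaces below that are described by coordinates with identifications (cones, suspensions, joins,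
  smash products) are handled through this fact.\<close>

lemma cm_descend:
  fixes p :: "'a::topological_space \<Rightarrow> 'b::t2_space"
  assumes A: "compact A" and p: "continuous_on A p" "p ` A = B"
    and F: "continuous_map (top_of_set A) W F" and f: "\<And>a. a \<in> A \<Longrightarrow> f (p a) = F a"
  shows "continuous_map (top_of_set B) W f"
proof -
  have "quotient_map (top_of_set A) (top_of_set B) p"
  proof (rule continuous_closed_imp_quotient_map)
    show "continuous_map (top_of_set A) (top_of_set B) p" using p by auto
    show "closed_map (top_of_set A) (top_of_set B) p"
      unfolding closed_map_def
    proof (intro allI impI)
      fix U assume "closedin (top_of_set A) U"
      then obtain C where "closed C" "U = A \<inter> C" by (auto simp: closedin_closed)
      then have "compact U" "U \<subseteq> A" using A by (auto simp: compact_Int_closed)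
      then have "compact (p ` U)" by (meson compact_continuous_image continuous_on_subset p(1))
      then show "closedin (top_of_set B) (p ` U)"
        using \<open>U \<subseteq> A\<close> p(2) by (intro closed_subset) (auto simp: compact_imp_closed)
    qed
  qed (use p in auto)
  moreover have "continuous_map (top_of_set A) W (f \<circ> p)"
    by (rule cm_cong[OF F]) (simp add: f)
  ultimately show ?thesis using continuous_compose_quotient_map by blast
qed

lemma continuous_on_descend:
  fixes p :: "'a::topological_space \<Rightarrow> 'b::t2_space"
  assumes "compact A" "continuous_on A p" "p ` A = B"
    and "continuous_on A F" "\<And>a. a \<in> A \<Longrightarrow> f (p a) = F a"
  shows "continuous_on B f"
  using cm_descend[OF assms(1-3), of euclidean F f] assms(4,5) by simp

lemma continuous_on_comp:
  assumes "continuous_on T g" "continuous_on S f" "\<And>x. x \<in> S \<Longrightarrow> f x \<in> T"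
  shows "continuous_on S (\<lambda>x. g (f x))"
  using assms by (intro continuous_on_compose2[OF assms(1,2)]) auto

text \<open>Homotopy through maps that send all of \<open>C\<close> to the point \<open>w\<close>. For a singleton \<open>C\<close> this is pointed
  homotopy. Since \<open>homotopic_rel D C W w f f\<close> says that \<open>f\<close> is continuous and sends \<open>C\<close> to \<open>w\<close>,
  the reflexive instances serve as well-formedness conditions throughout.\<close>

definition homotopic_rel :: "'a::topological_space set \<Rightarrow> 'a set \<Rightarrow> 'b topology \<Rightarrow> 'b \<Rightarrow>
    ('a \<Rightarrow> 'b) \<Rightarrow> ('a \<Rightarrow> 'b) \<Rightarrow> bool"
  where "homotopic_rel D C W w f g \<longleftrightarrow> C \<subseteq> D \<and>
    homotopic_with (\<lambda>h. \<forall>x\<in>C. h x = w) (top_of_set D) W f g"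

lemma homotopic_relI:
  assumes "continuous_map (top_of_set ({0..1} \<times> D)) W (\<lambda>p. h (fst p) (snd p))" "C \<subseteq> D"
    and "\<And>x. x \<in> D \<Longrightarrow> f x = h (0::real) x" "\<And>x. x \<in> D \<Longrightarrow> g x = h 1 x"
    and "\<And>s x. 0 \<le> s \<Longrightarrow> s \<le> 1 \<Longrightarrow> x \<in> C \<Longrightarrow> h s x = w"
  shows "homotopic_rel D C W w f g"
proof -
  have "homotopic_with (\<lambda>h. \<forall>x\<in>C. h x = w) (top_of_set D) W (h 0) (h 1)"
    unfolding homotopic_with_def
    by (rule exI[of _ "\<lambda>p. h (fst p) (snd p)"])
      (use assms(1,5) in \<open>auto simp: prod_topology_subtopology_eu\<close>)
  then have "homotopic_with (\<lambda>h. \<forall>x\<in>C. h x = w) (top_of_set D) W f g"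
  proof (rule homotopic_with_eq)
    show "(\<forall>x\<in>C. h x = w) \<longleftrightarrow> (\<forall>x\<in>C. k x = w)"
      if "\<And>x. x \<in> topspace (top_of_set D) \<Longrightarrow> h x = k x" for h k
      using that assms(2) by (metis (no_types, lifting) subsetD topspace_euclidean_subtopology)
  qed (use assms(3,4) in auto)
  then show ?thesis using assms(2) by (simp add: homotopic_rel_def)
qed

lemma homotopic_relE:
  assumes "homotopic_rel D C W w f g"
  obtains h where "continuous_map (top_of_set ({0..1} \<times> D)) W (\<lambda>p. h (fst p) (snd p))" "C \<subseteq> D"
    "\<And>x. x \<in> D \<Longrightarrow> h (0::real) x = f x" "\<And>x. x \<in> D \<Longrightarrow> h 1 x = g x"
    "\<And>s x. 0 \<le> s \<Longrightarrow> s \<le> 1 \<Longrightarrow> x \<in> C \<Longrightarrow> h s x = w"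
proof -
  from assms obtain k where k: "C \<subseteq> D"
    "continuous_map (prod_topology (top_of_set {0..1}) (top_of_set D)) W k"
    "\<forall>x. k (0::real, x) = f x" "\<forall>x. k (1,x) = g x" "\<forall>t\<in>{0..1}. \<forall>x\<in>C. k (t,x) = w"
    unfolding homotopic_rel_def homotopic_with_def by auto
  show ?thesis
    by (rule that[of "\<lambda>s x. k (s,x)"]) (use k in \<open>auto simp: prod_topology_subtopology_eu\<close>)
qed

lemma homotopic_rel_refl:
  assumes "continuous_map (top_of_set D) W f" "C \<subseteq> D" "\<And>x. x \<in> C \<Longrightarrow> f x = w"
  shows "homotopic_rel D C W w f f"
  using assms by (auto simp: homotopic_rel_def)

lemma homotopic_rel_sym: "homotopic_rel D C W w f g \<Longrightarrow> homotopic_rel D C W w g f"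
  by (simp add: homotopic_rel_def homotopic_with_sym)

lemma homotopic_rel_trans [trans]: "homotopic_rel D C W w f g \<Longrightarrow> homotopic_rel D C W w g h \<Longrightarrow> homotopic_rel D C W w f h"
  unfolding homotopic_rel_def by (meson homotopic_with_trans)

lemma homotopic_rel_reflL: "homotopic_rel D C W w f g \<Longrightarrow> homotopic_rel D C W w f f"
  by (meson homotopic_rel_sym homotopic_rel_trans)

lemma homotopic_rel_reflR: "homotopic_rel D C W w f g \<Longrightarrow> homotopic_rel D C W w g g"
  by (meson homotopic_rel_sym homotopic_rel_trans)

lemma homotopic_rel_cont: "homotopic_rel D C W w f f \<Longrightarrow> continuous_map (top_of_set D) W f"
  unfolding homotopic_rel_def using homotopic_with_imp_continuous_maps by blast

lemma homotopic_rel_base: "homotopic_rel D C W w f f \<Longrightarrow> x \<in> C \<Longrightarrow> f x = w"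
  unfolding homotopic_rel_def using homotopic_with_imp_property by blast

lemma homotopic_rel_cong:
  assumes "homotopic_rel D C W w f g" "\<And>x. x \<in> D \<Longrightarrow> f' x = f x" "\<And>x. x \<in> D \<Longrightarrow> g' x = g x"
  shows "homotopic_rel D C W w f' g'"
proof -
  have C: "C \<subseteq> D" and h: "homotopic_with (\<lambda>h. \<forall>x\<in>C. h x = w) (top_of_set D) W f g"
    using assms(1) by (auto simp: homotopic_rel_def)
  have "homotopic_with (\<lambda>h. \<forall>x\<in>C. h x = w) (top_of_set D) W f' g'"
  proof (rule homotopic_with_eq[OF h])
    show "(\<forall>x\<in>C. h x = w) \<longleftrightarrow> (\<forall>x\<in>C. k x = w)"
      if "\<And>x. x \<in> topspace (top_of_set D) \<Longrightarrow> h x = k x" for h k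
      using that C by (metis (no_types, lifting) subsetD topspace_euclidean_subtopology)
  qed (use assms in auto)
  with C show ?thesis by (simp add: homotopic_rel_def)
qed

lemma homotopic_rel_pre:
  assumes "homotopic_rel D C W w f g" "continuous_on D' k" "\<And>x. x \<in> D' \<Longrightarrow> k x \<in> D"
    "\<And>x. x \<in> C' \<Longrightarrow> k x \<in> C" "C' \<subseteq> D'"
  shows "homotopic_rel D' C' W w (\<lambda>x. f (k x)) (\<lambda>x. g (k x))"
proof -
  from assms(1) obtain h where h: "continuous_map (top_of_set ({0..1} \<times> D)) W (\<lambda>p. h (fst p) (snd p))"
    "C \<subseteq> D" "\<And>x. x \<in> D \<Longrightarrow> h (0::real) x = f x" "\<And>x. x \<in> D \<Longrightarrow> h 1 x = g x"
    "\<And>s x. 0 \<le> s \<Longrightarrow> s \<le> 1 \<Longrightarrow> x \<in> C \<Longrightarrow> h s x = w" by (rule homotopic_relE) blast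
  have "continuous_on ({0..1} \<times> D') (\<lambda>p. (fst p, k (snd p)))"
    by (intro continuous_intros continuous_on_compose2[OF assms(2)]) auto
  from cm_comp[OF h(1) this] show ?thesis
    by (intro homotopic_relI[where h="\<lambda>s x. h s (k x)"]) (use assms(3-5) h(3-5) in auto)
qed

lemma homotopic_rel_post:
  assumes "homotopic_rel D C W w f g" "continuous_map W W' k" "k w = w'"
  shows "homotopic_rel D C W' w' (\<lambda>x. k (f x)) (\<lambda>x. k (g x))"
proof -
  have "homotopic_with (\<lambda>h. \<forall>x\<in>C. h x = w') (top_of_set D) W' (k \<circ> f) (k \<circ> g)"
    by (rule homotopic_with_compose_continuous_map_left[where p="\<lambda>h. \<forall>x\<in>C. h x = w"])
      (use assms in \<open>auto simp: homotopic_rel_def o_def\<close>)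
  then show ?thesis using assms by (auto simp: homotopic_rel_def o_def)
qed

text \<open>A homotopy that is constant on \<open>C'\<close> passes to the quotient by any map that identifies only points
  of \<open>C'\<close>.\<close>

lemma homotopic_rel_descend:
  fixes p :: "'a::topological_space \<Rightarrow> 'b::t2_space"
  assumes "homotopic_rel D' C' W w (\<lambda>x. f (p x)) (\<lambda>x. g (p x))"
    and D': "compact D'" and p: "continuous_on D' p" "p ` D' = D"
    and C: "C \<subseteq> p ` C'"
    and inj: "\<And>x y. x \<in> D' \<Longrightarrow> y \<in> D' \<Longrightarrow> p x = p y \<Longrightarrow> x = y \<or> x \<in> C' \<and> y \<in> C'"
  shows "homotopic_rel D C W w f g"
proof -
  from assms(1) obtain h where h: "continuous_map (top_of_set ({0..1} \<times> D')) W (\<lambda>p. h (fst p) (snd p))"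
    "C' \<subseteq> D'" "\<And>x. x \<in> D' \<Longrightarrow> h (0::real) x = f (p x)" "\<And>x. x \<in> D' \<Longrightarrow> h 1 x = g (p x)"
    "\<And>s x. 0 \<le> s \<Longrightarrow> s \<le> 1 \<Longrightarrow> x \<in> C' \<Longrightarrow> h s x = w" by (rule homotopic_relE) blast
  define H where "H s y = h s (SOME x. x \<in> D' \<and> p x = y)" for s y
  have H: "H s (p x) = h s x" if "x \<in> D'" "0 \<le> s" "s \<le> 1" for s x
  proof -
    have ex: "\<exists>z. z \<in> D' \<and> p z = p x" using that by blast
    define z where "z = (SOME z. z \<in> D' \<and> p z = p x)"
    have z: "z \<in> D'" "p z = p x" using someI_ex[OF ex] by (simp_all add: z_def)
    have "h s z = h s x" using inj[OF z(1) that(1) z(2)] h(5)[OF that(2,3), of x] h(5)[OF that(2,3), of z] by metis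
    then show ?thesis unfolding H_def z_def .
  qed
  have "continuous_map (top_of_set ({0..1} \<times> D)) W (\<lambda>p. H (fst p) (snd p))"
  proof (rule cm_descend[OF _ _ _ h(1), of "\<lambda>z. (fst z, p (snd z))"])
    show "compact ({0..1::real} \<times> D')" using D' by (simp add: compact_Times)
    show "continuous_on ({0..1} \<times> D') (\<lambda>z. (fst z, p (snd z)))"
      by (intro continuous_intros continuous_on_compose2[OF p(1)]) auto
    show "(\<lambda>z. (fst z, p (snd z))) ` ({0..1} \<times> D') = {0..1} \<times> D"
      unfolding p(2)[symmetric] image_def by fastforce
    show "H (fst (fst a, p (snd a))) (snd (fst a, p (snd a))) = h (fst a) (snd a)"
      if "a \<in> {0..1} \<times> D'" for a
      using that H[of "snd a" "fst a"] by auto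
  qed
  moreover have "C \<subseteq> D" using C p(2) h(2) by blast
  ultimately show ?thesis
  proof (rule homotopic_relI)
    fix y assume "y \<in> D"
    then obtain x where x: "x \<in> D'" "y = p x" using p(2) by auto
    show "f y = H 0 y" "g y = H 1 y" using x H h(3,4) by auto
  next
    fix s :: real and y assume s: "0 \<le> s" "s \<le> 1" "y \<in> C"
    then obtain x where x: "x \<in> C'" "y = p x" using C by auto
    have "x \<in> D'" using h(2) x(1) by auto
    then show "H s y = w" using H[OF _ s(1,2)] h(5)[OF s(1,2) x(1)] x(2) by simp
  qed
qed

section \<open>Families of loops\<close>

text \<open>Families of loops at \<open>w\<close> with parameter space \<open>K\<close>, constant over \<open>A\<close>, are maps on \<open>K \<times> [0,1]\<close>. The
  homotopies fix \<open>w\<close> over \<open>A\<close> and at both ends.\<close>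

definition loop_homotopic :: "'k::topological_space set \<Rightarrow> 'k set \<Rightarrow> 'b topology \<Rightarrow> 'b \<Rightarrow>
    ('k \<times> real \<Rightarrow> 'b) \<Rightarrow> ('k \<times> real \<Rightarrow> 'b) \<Rightarrow> bool"
  where "loop_homotopic K A W w f g \<longleftrightarrow> A \<subseteq> K \<and> homotopic_rel (K \<times> {0..1}) (A \<times> {0..1} \<union> K \<times> {0,1}) W w f g"

definition loop_cat :: "('k \<times> real \<Rightarrow> 'b) \<Rightarrow> ('k \<times> real \<Rightarrow> 'b) \<Rightarrow> 'k \<times> real \<Rightarrow> 'b"
  where "loop_cat f g = (\<lambda>x. if snd x \<le> 1/2 then f (fst x, 2 * snd x) else g (fst x, 2 * snd x - 1))"

definition loop_rev :: "('k \<times> real \<Rightarrow> 'b) \<Rightarrow> 'k \<times> real \<Rightarrow> 'b"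
  where "loop_rev f = (\<lambda>x. f (fst x, 1 - snd x))"

lemma loop_homotopic_sym: "loop_homotopic K A W w f g \<Longrightarrow> loop_homotopic K A W w g f"
  unfolding loop_homotopic_def by (meson homotopic_rel_sym)

lemma loop_homotopic_trans [trans]: "loop_homotopic K A W w f g \<Longrightarrow> loop_homotopic K A W w g h \<Longrightarrow> loop_homotopic K A W w f h"
  unfolding loop_homotopic_def by (meson homotopic_rel_trans)

lemma loop_homotopic_reflL: "loop_homotopic K A W w f g \<Longrightarrow> loop_homotopic K A W w f f"
  by (meson loop_homotopic_sym loop_homotopic_trans)

lemma loop_homotopic_reflR: "loop_homotopic K A W w f g \<Longrightarrow> loop_homotopic K A W w g g"
  by (meson loop_homotopic_sym loop_homotopic_trans)

lemma loop_homotopic_base: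
  assumes "loop_homotopic K A W w f f"
  shows "\<And>k t. k \<in> A \<Longrightarrow> 0 \<le> t \<Longrightarrow> t \<le> 1 \<Longrightarrow> f (k, t) = w"
    "\<And>k. k \<in> K \<Longrightarrow> f (k, 0) = w" "\<And>k. k \<in> K \<Longrightarrow> f (k, 1) = w"
proof -
  have *: "f x = w" if "x \<in> A \<times> {0..1} \<union> K \<times> {0,1}" for x
    by (rule homotopic_rel_base[OF conjunct2[OF assms[unfolded loop_homotopic_def]] that])
  show "\<And>k t. k \<in> A \<Longrightarrow> 0 \<le> t \<Longrightarrow> t \<le> 1 \<Longrightarrow> f (k, t) = w"
    "\<And>k. k \<in> K \<Longrightarrow> f (k, 0) = w" "\<And>k. k \<in> K \<Longrightarrow> f (k, 1) = w" by (rule *, simp)+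
qed

lemma loop_homotopicI:
  assumes "continuous_map (top_of_set ({0..1} \<times> (K \<times> {0..1}))) W (\<lambda>p. h (fst p) (snd p))" "A \<subseteq> K"
    and "\<And>k t. k \<in> K \<Longrightarrow> 0 \<le> t \<Longrightarrow> t \<le> 1 \<Longrightarrow> f (k,t) = h (0::real) (k,t)"
    and "\<And>k t. k \<in> K \<Longrightarrow> 0 \<le> t \<Longrightarrow> t \<le> 1 \<Longrightarrow> g (k,t) = h 1 (k,t)"
    and "\<And>s k t. 0 \<le> s \<Longrightarrow> s \<le> 1 \<Longrightarrow> k \<in> A \<Longrightarrow> 0 \<le> t \<Longrightarrow> t \<le> 1 \<Longrightarrow> h s (k,t) = w"
    and "\<And>s k. 0 \<le> s \<Longrightarrow> s \<le> 1 \<Longrightarrow> k \<in> K \<Longrightarrow> h s (k,0) = w"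
    and "\<And>s k. 0 \<le> s \<Longrightarrow> s \<le> 1 \<Longrightarrow> k \<in> K \<Longrightarrow> h s (k,1) = w"
  shows "loop_homotopic K A W w f g"
  unfolding loop_homotopic_def
proof (intro conjI assms(2), rule homotopic_relI[OF assms(1)])
  show "h s x = w" if "0 \<le> s" "s \<le> 1" "x \<in> A \<times> {0..1} \<union> K \<times> {0,1}" for s x
    using that assms(5-7)[of s "fst x"] by (cases x) auto
qed (use assms(2-4) in auto)

lemma loop_homotopic_cong:
  assumes "loop_homotopic K A W w f g" "\<And>k t. k \<in> K \<Longrightarrow> 0 \<le> t \<Longrightarrow> t \<le> 1 \<Longrightarrow> f' (k,t) = f (k,t)"
    "\<And>k t. k \<in> K \<Longrightarrow> 0 \<le> t \<Longrightarrow> t \<le> 1 \<Longrightarrow> g' (k,t) = g (k,t)"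
  shows "loop_homotopic K A W w f' g'"
  unfolding loop_homotopic_def
proof (intro conjI)
  show "A \<subseteq> K" using assms(1) by (simp add: loop_homotopic_def)
  show "homotopic_rel (K \<times> {0..1}) (A \<times> {0..1} \<union> K \<times> {0,1}) W w f' g'"
    by (rule homotopic_rel_cong[OF conjunct2[OF assms(1)[unfolded loop_homotopic_def]]]) (use assms(2,3) in auto)
qed

lemma loop_homotopic_eq:
  assumes "loop_homotopic K A W w f f" "\<And>k t. k \<in> K \<Longrightarrow> 0 \<le> t \<Longrightarrow> t \<le> 1 \<Longrightarrow> g (k,t) = f (k,t)"
  shows "loop_homotopic K A W w f g"
  using loop_homotopic_cong[OF assms(1), of f g] assms(2) by auto

lemma loop_homotopicE:
  assumes "loop_homotopic K A W w f g"
  obtains h where "continuous_map (top_of_set ({0..1} \<times> (K \<times> {0..1}))) W (\<lambda>p. h (fst p) (snd p))" "A \<subseteq> K"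
    "\<And>k t. k \<in> K \<Longrightarrow> 0 \<le> t \<Longrightarrow> t \<le> 1 \<Longrightarrow> h (0::real) (k,t) = f (k,t)"
    "\<And>k t. k \<in> K \<Longrightarrow> 0 \<le> t \<Longrightarrow> t \<le> 1 \<Longrightarrow> h 1 (k,t) = g (k,t)"
    "\<And>s k t. 0 \<le> s \<Longrightarrow> s \<le> 1 \<Longrightarrow> k \<in> A \<Longrightarrow> 0 \<le> t \<Longrightarrow> t \<le> 1 \<Longrightarrow> h s (k,t) = w"
    "\<And>s k. 0 \<le> s \<Longrightarrow> s \<le> 1 \<Longrightarrow> k \<in> K \<Longrightarrow> h s (k,0) = w"
    "\<And>s k. 0 \<le> s \<Longrightarrow> s \<le> 1 \<Longrightarrow> k \<in> K \<Longrightarrow> h s (k,1) = w"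
proof -
  from assms have A: "A \<subseteq> K" and "homotopic_rel (K \<times> {0..1}) (A \<times> {0..1} \<union> K \<times> {0,1}) W w f g"
    by (auto simp: loop_homotopic_def)
  from this(2) obtain h where
    "continuous_map (top_of_set ({0..1} \<times> (K \<times> {0..1}))) W (\<lambda>p. h (fst p) (snd p))"
    and h: "\<And>x. x \<in> K \<times> {0..1} \<Longrightarrow> h (0::real) x = f x" "\<And>x. x \<in> K \<times> {0..1} \<Longrightarrow> h 1 x = g x"
    "\<And>s x. 0 \<le> s \<Longrightarrow> s \<le> 1 \<Longrightarrow> x \<in> A \<times> {0..1} \<union> K \<times> {0,1} \<Longrightarrow> h s x = w" by (rule homotopic_relE) blast
  then show ?thesis using A by (intro that[of h]) auto
qed

lemma loop_homotopic_cont: "loop_homotopic K A W w f f \<Longrightarrow> continuous_map (top_of_set (K \<times> {0..1})) W f"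
  
  by (rule homotopic_rel_cont[OF conjunct2[OF iffD1[OF loop_homotopic_def]]])

lemma loop_homotopic_sub: "loop_homotopic K A W w f g \<Longrightarrow> A \<subseteq> K"
  unfolding loop_homotopic_def by blast

lemma loop_homotopic_const: "w \<in> topspace W \<Longrightarrow> A \<subseteq> K \<Longrightarrow> loop_homotopic K A W w (\<lambda>_. w) (\<lambda>_. w)"
  unfolding loop_homotopic_def by (auto intro!: homotopic_rel_refl)

lemma loop_homotopic_refl:
  assumes "continuous_map (top_of_set (K \<times> {0..1})) W f" "A \<subseteq> K"
   "\<And>k t. k \<in> A \<Longrightarrow> 0 \<le> t \<Longrightarrow> t \<le> 1 \<Longrightarrow> f (k, t) = w"
    "\<And>k. k \<in> K \<Longrightarrow> f (k, 0) = w" "\<And>k. k \<in> K \<Longrightarrow> f (k, 1) = w"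
  shows "loop_homotopic K A W w f f"
  using assms unfolding loop_homotopic_def by (auto intro!: homotopic_rel_refl)

text \<open>Two reparametrizations of \<open>[0,1]\<close> with equal endpoints are joined by the straight line between
  them. The group laws for loops are instances.\<close>

lemma loop_homotopic_reparam:
  assumes f: "loop_homotopic K A W w f f"
    and c: "continuous_on {0..1} \<phi>" "continuous_on {0..1} \<psi>"
    and im: "\<And>t. 0 \<le> t \<Longrightarrow> t \<le> 1 \<Longrightarrow> \<phi> t \<in> {0..1::real}" "\<And>t. 0 \<le> t \<Longrightarrow> t \<le> 1 \<Longrightarrow> \<psi> t \<in> {0..1}"
    and ends: "\<phi> 0 = \<psi> 0" "\<phi> 1 = \<psi> 1" "\<phi> 0 \<in> {0,1}" "\<phi> 1 \<in> {0,1}"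
  shows "loop_homotopic K A W w (\<lambda>x. f (fst x, \<phi> (snd x))) (\<lambda>x. f (fst x, \<psi> (snd x)))"
proof (rule loop_homotopicI[where h="\<lambda>s x. f (fst x, (1 - s) * \<phi> (snd x) + s * \<psi> (snd x))"])
  have im': "(1 - s) * \<phi> t + s * \<psi> t \<in> {0..1}" if "0 \<le> s" "s \<le> 1" "0 \<le> t" "t \<le> 1" for s t
    using im[OF that(3,4)] that convex_bound_le[of "\<phi> t" 1 "\<psi> t" "1-s" s] by auto
  show "continuous_map (top_of_set ({0..1} \<times> K \<times> {0..1})) W
     (\<lambda>p. f (fst (snd p), (1 - fst p) * \<phi> (snd (snd p)) + fst p * \<psi> (snd (snd p))))"
    by (rule cm_comp[OF loop_homotopic_cont[OF f]])
      (use im' in \<open>auto intro!: continuous_intros continuous_on_compose2[OF c(1)] continuous_on_compose2[OF c(2)]\<close>)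
  fix s k assume s: "0 \<le> (s::real)" "s \<le> 1"
  { fix t assume "k \<in> A" "0 \<le> (t::real)" "t \<le> 1"
    then show "f (fst (k, t), (1 - s) * \<phi> (snd (k, t)) + s * \<psi> (snd (k, t))) = w"
      using loop_homotopic_base(1)[OF f] im'[OF s] by auto }
  assume k: "k \<in> K"
  have *: "(1 - s) * \<phi> 0 + s * \<psi> 0 = \<phi> 0" "(1 - s) * \<phi> 1 + s * \<psi> 1 = \<phi> 1"
    using ends by (auto simp: algebra_simps)
  show "f (fst (k, 0), (1 - s) * \<phi> (snd (k, 0)) + s * \<psi> (snd (k, 0))) = w"
    "f (fst (k, 1), (1 - s) * \<phi> (snd (k, 1)) + s * \<psi> (snd (k, 1))) = w"
    using * loop_homotopic_base(2,3)[OF f k] ends by auto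
qed (use loop_homotopic_sub[OF f] in auto)

lemma loop_cat_cong:
  assumes "loop_homotopic K A W w f f'" "loop_homotopic K A W w g g'"
  shows "loop_homotopic K A W w (loop_cat f g) (loop_cat f' g')"
proof -
  from assms(1) obtain h where
    h: "continuous_map (top_of_set ({0..1} \<times> (K \<times> {0..1}))) W (\<lambda>p. h (fst p) (snd p))" "A \<subseteq> K"
    "\<And>k t. k \<in> K \<Longrightarrow> 0 \<le> t \<Longrightarrow> t \<le> 1 \<Longrightarrow> h (0::real) (k,t) = f (k,t)"
    "\<And>k t. k \<in> K \<Longrightarrow> 0 \<le> t \<Longrightarrow> t \<le> 1 \<Longrightarrow> h 1 (k,t) = f' (k,t)"
    "\<And>s k t. 0 \<le> s \<Longrightarrow> s \<le> 1 \<Longrightarrow> k \<in> A \<Longrightarrow> 0 \<le> t \<Longrightarrow> t \<le> 1 \<Longrightarrow> h s (k,t) = w"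
    "\<And>s k. 0 \<le> s \<Longrightarrow> s \<le> 1 \<Longrightarrow> k \<in> K \<Longrightarrow> h s (k,0) = w"
    "\<And>s k. 0 \<le> s \<Longrightarrow> s \<le> 1 \<Longrightarrow> k \<in> K \<Longrightarrow> h s (k,1) = w" by (rule loop_homotopicE) blast
  from assms(2) obtain h' where
    h': "continuous_map (top_of_set ({0..1} \<times> (K \<times> {0..1}))) W (\<lambda>p. h' (fst p) (snd p))"
    "\<And>k t. k \<in> K \<Longrightarrow> 0 \<le> t \<Longrightarrow> t \<le> 1 \<Longrightarrow> h' (0::real) (k,t) = g (k,t)"
    "\<And>k t. k \<in> K \<Longrightarrow> 0 \<le> t \<Longrightarrow> t \<le> 1 \<Longrightarrow> h' 1 (k,t) = g' (k,t)"
    "\<And>s k t. 0 \<le> s \<Longrightarrow> s \<le> 1 \<Longrightarrow> k \<in> A \<Longrightarrow> 0 \<le> t \<Longrightarrow> t \<le> 1 \<Longrightarrow> h' s (k,t) = w"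
    "\<And>s k. 0 \<le> s \<Longrightarrow> s \<le> 1 \<Longrightarrow> k \<in> K \<Longrightarrow> h' s (k,0) = w"
    "\<And>s k. 0 \<le> s \<Longrightarrow> s \<le> 1 \<Longrightarrow> k \<in> K \<Longrightarrow> h' s (k,1) = w" by (rule loop_homotopicE) blast
  show ?thesis
  proof (rule loop_homotopicI[where h="\<lambda>s x. loop_cat (h s) (h' s) x"])
    have 1: "continuous_map (top_of_set {x \<in> {0..1} \<times> K \<times> {0..1}. snd (snd x) \<le> 1/2}) W
        (\<lambda>p. h (fst p) (fst (snd p), 2 * snd (snd p)))"
      using cm_comp[OF h(1), of "{x \<in> {0..1} \<times> K \<times> {0..1}. snd (snd x) \<le> 1/2}"
        "\<lambda>p. (fst p, (fst (snd p), 2 * snd (snd p)))"] by (force intro!: continuous_intros)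
    have 2: "continuous_map (top_of_set {x \<in> {0..1} \<times> K \<times> {0..1}. 1/2 \<le> snd (snd x)}) W
        (\<lambda>p. h' (fst p) (fst (snd p), 2 * snd (snd p) - 1))"
      using cm_comp[OF h'(1), of "{x \<in> {0..1} \<times> K \<times> {0..1}. 1/2 \<le> snd (snd x)}"
        "\<lambda>p. (fst p, (fst (snd p), 2 * snd (snd p) - 1))"] by (force intro!: continuous_intros)
    show "continuous_map (top_of_set ({0..1} \<times> K \<times> {0..1})) W
       (\<lambda>p. loop_cat (h (fst p)) (h' (fst p)) (snd p))"
      unfolding loop_cat_def
    proof (intro cm_if[OF _ 1 2])
      fix x :: "real \<times> 'a \<times> real"
      assume x: "x \<in> {0..1} \<times> K \<times> {0..1}" "snd (snd x) = 1/2"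
      then show "h (fst x) (fst (snd x), 2 * snd (snd x)) = h' (fst x) (fst (snd x), 2 * snd (snd x) - 1)"
        using h(7)[of "fst x" "fst (snd x)"] h'(5)[of "fst x" "fst (snd x)"] by (auto simp: field_simps)
    qed (auto intro!: continuous_intros)
  qed (use h(2-7) h'(2-6) in \<open>auto simp: loop_cat_def\<close>)
qed

lemma loop_rev_cong:
  assumes "loop_homotopic K A W w f f'"
  shows "loop_homotopic K A W w (loop_rev f) (loop_rev f')"
proof -
  have A: "A \<subseteq> K" and h: "homotopic_rel (K \<times> {0..1}) (A \<times> {0..1} \<union> K \<times> {0,1}) W w f f'"
    using assms by (simp_all add: loop_homotopic_def)
  have c: "continuous_on (K \<times> {0..1::real}) (\<lambda>x. (fst x, 1 - snd x))"
    by (intro continuous_intros)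
  have "homotopic_rel (K \<times> {0..1}) (A \<times> {0..1} \<union> K \<times> {0, 1}) W w
      (\<lambda>x. f (fst x, 1 - snd x)) (\<lambda>x. f' (fst x, 1 - snd x))"
    by (rule homotopic_rel_pre[OF h c]) (use A in auto)
  with A show ?thesis by (simp add: loop_homotopic_def loop_rev_def)
qed

lemma loop_cat_unitR: assumes "loop_homotopic K A W w f f" shows "loop_homotopic K A W w (loop_cat f (\<lambda>_. w)) f"
proof -
  have "loop_homotopic K A W w (\<lambda>x. f (fst x, min 1 (2 * snd x))) (\<lambda>x. f (fst x, snd x))"
    by (rule loop_homotopic_reparam[OF assms]) (auto intro!: continuous_intros)
  then show ?thesis
    by (rule loop_homotopic_cong) (use loop_homotopic_base(3)[OF assms] in \<open>auto simp: loop_cat_def min.absorb1 min.absorb2\<close>)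
qed

lemma loop_cat_unitL: assumes "loop_homotopic K A W w f f" shows "loop_homotopic K A W w (loop_cat (\<lambda>_. w) f) f"
proof -
  have "loop_homotopic K A W w (\<lambda>x. f (fst x, max 0 (2 * snd x - 1))) (\<lambda>x. f (fst x, snd x))"
    by (rule loop_homotopic_reparam[OF assms]) (auto intro!: continuous_intros)
  then show ?thesis
    by (rule loop_homotopic_cong) (use loop_homotopic_base(2)[OF assms] in \<open>auto simp: loop_cat_def max.absorb1 max.absorb2\<close>)
qed

lemma loop_cat_inv:
  assumes f: "loop_homotopic K A W w f f"
  shows "loop_homotopic K A W w (loop_cat f (loop_rev f)) (\<lambda>_. w)" "loop_homotopic K A W w (loop_cat (loop_rev f) f) (\<lambda>_. w)"
proof -
  have "loop_homotopic K A W w (\<lambda>x. f (fst x, min (2 * snd x) (2 - 2 * snd x))) (\<lambda>x. f (fst x, 0))"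
    by (rule loop_homotopic_reparam[OF assms]) (auto intro!: continuous_intros)
  then show "loop_homotopic K A W w (loop_cat f (loop_rev f)) (\<lambda>_. w)"
    by (rule loop_homotopic_cong) (use loop_homotopic_base(2)[OF f] in \<open>auto simp: loop_cat_def loop_rev_def min.absorb1 min.absorb2 algebra_simps\<close>)
  have "loop_homotopic K A W w (\<lambda>x. f (fst x, \<bar>1 - 2 * snd x\<bar>)) (\<lambda>x. f (fst x, 1))"
    by (rule loop_homotopic_reparam[OF assms]) (auto intro!: continuous_intros)
  then show "loop_homotopic K A W w (loop_cat (loop_rev f) f) (\<lambda>_. w)"
    by (rule loop_homotopic_cong) (use loop_homotopic_base(3)[OF f] in \<open>auto simp: loop_cat_def loop_rev_def abs_if\<close>)
qed

lemma loop_cat_assoc: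
  assumes f: "loop_homotopic K A W w f f" "loop_homotopic K A W w g g" "loop_homotopic K A W w h h"
  shows "loop_homotopic K A W w (loop_cat (loop_cat f g) h) (loop_cat f (loop_cat g h))"
proof -
  let ?\<phi> = "\<lambda>t::real. max (t/2) (max (t - 1/4) (2 * t - 1))"
  have "loop_homotopic K A W w (\<lambda>x. loop_cat (loop_cat f g) h (fst x, snd x)) (\<lambda>x. loop_cat (loop_cat f g) h (fst x, ?\<phi> (snd x)))"
    by (rule loop_homotopic_reparam) (auto intro!: continuous_intros loop_cat_cong f simp: le_max_iff_disj)
  then show ?thesis
  proof (rule loop_homotopic_cong)
    fix k and t :: real assume k: "k \<in> K" "0 \<le> t" "t \<le> 1"
    consider "t \<le> 1/2" | "1/2 < t" "t \<le> 3/4" | "3/4 < t" by linarith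
    then show "loop_cat f (loop_cat g h) (k, t) = loop_cat (loop_cat f g) h (fst (k, t), ?\<phi> (snd (k, t)))"
    proof cases
      case 1 then have "?\<phi> t = t/2" by (auto simp: max_def)
      with 1 show ?thesis using k by (auto simp: loop_cat_def)
    next
      case 2 then have "?\<phi> t = t - 1/4" by (auto simp: max_def)
      with 2 show ?thesis using k by (auto simp: loop_cat_def algebra_simps)
    next
      case 3 then have "?\<phi> t = 2 * t - 1" by (auto simp: max_def)
      with 3 show ?thesis using k by (auto simp: loop_cat_def algebra_simps)
    qed
  qed auto
qed

lemma loop_cat_cancelR:
  assumes fg: "loop_homotopic K A W w (loop_cat f h) (loop_cat g h)"
    and f: "loop_homotopic K A W w f f" "loop_homotopic K A W w g g" "loop_homotopic K A W w h h"
  shows "loop_homotopic K A W w f g"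
proof -
  let ?c = "\<lambda>_. w"
  have r: "loop_homotopic K A W w (loop_rev h) (loop_rev h)" by (rule loop_rev_cong[OF f(3)])
  have *: "loop_homotopic K A W w (loop_cat (loop_cat f h) (loop_rev h)) f" if f': "loop_homotopic K A W w f f" for f
  proof -
    have "loop_homotopic K A W w (loop_cat (loop_cat f h) (loop_rev h)) (loop_cat f (loop_cat h (loop_rev h)))"
      by (rule loop_cat_assoc[OF f' f(3) r])
    also have "loop_homotopic K A W w (loop_cat f (loop_cat h (loop_rev h))) (loop_cat f ?c)"
      by (rule loop_cat_cong[OF f' loop_cat_inv(1)[OF f(3)]])
    also have "loop_homotopic K A W w (loop_cat f ?c) f" by (rule loop_cat_unitR[OF f'])
    finally show ?thesis .
  qed
  have "loop_homotopic K A W w f (loop_cat (loop_cat f h) (loop_rev h))" by (rule loop_homotopic_sym[OF *[OF f(1)]])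
  also have "loop_homotopic K A W w (loop_cat (loop_cat f h) (loop_rev h)) (loop_cat (loop_cat g h) (loop_rev h))"
    by (rule loop_cat_cong[OF fg r])
  also have "loop_homotopic K A W w (loop_cat (loop_cat g h) (loop_rev h)) g" by (rule *[OF f(2)])
  finally show ?thesis .
qed

lemma loop_homotopic_pre:
  assumes "loop_homotopic K A W w f g" and k: "continuous_on K' k" "\<And>x. x \<in> K' \<Longrightarrow> k x \<in> K" "\<And>x. x \<in> A' \<Longrightarrow> k x \<in> A"
    and A': "A' \<subseteq> K'"
  shows "loop_homotopic K' A' W w (\<lambda>x. f (k (fst x), snd x)) (\<lambda>x. g (k (fst x), snd x))"
proof -
  have h: "homotopic_rel (K \<times> {0..1}) (A \<times> {0..1} \<union> K \<times> {0,1}) W w f g"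
    using assms(1) by (simp add: loop_homotopic_def)
  have c: "continuous_on (K' \<times> {0..1::real}) (\<lambda>x. (k (fst x), snd x))"
    by (intro continuous_intros continuous_on_compose2[OF k(1)]) auto
  have "homotopic_rel (K' \<times> {0..1}) (A' \<times> {0..1} \<union> K' \<times> {0, 1}) W w
      (\<lambda>x. f (k (fst x), snd x)) (\<lambda>x. g (k (fst x), snd x))"
    by (rule homotopic_rel_pre[OF h c]) (use A' k in auto)
  with A' show ?thesis by (simp add: loop_homotopic_def)
qed

declare continuous_on_coordinatewise_then_product [continuous_intros del]

section \<open>Cones and suspensions of spheres\<close>

text \<open>The library's tuple topology on a sphere is the subspace topology of \<open>nat \<Rightarrow> real\<close>. The two
  abbreviations for point sets allow the calculus of \<open>continuous_on\<close> to be used.\<close>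

abbreviation sph :: "nat \<Rightarrow> (nat \<Rightarrow> real) set" where "sph k \<equiv> topspace (nsphere k)"
abbreviation disc :: "nat \<Rightarrow> (nat \<Rightarrow> real) set" where "disc k \<equiv> topspace (cone k)"
abbreviation sqnorm :: "nat \<Rightarrow> (nat \<Rightarrow> real) \<Rightarrow> real" where "sqnorm k x \<equiv> (\<Sum>i\<le>k. (x i)\<^sup>2)"

lemma sph_iff: "x \<in> sph k \<longleftrightarrow> sqnorm k x = 1 \<and> (\<forall>i>k. x i = 0)"
  by (auto simp: nsphere)

lemma disc_iff: "x \<in> disc k \<longleftrightarrow> sqnorm k x \<le> 1 \<and> (\<forall>i>k. x i = 0)"
  by (auto simp: cone_def topspace_Euclidean_space Suc_le_eq)

lemma nsphere_eq: "nsphere k = top_of_set (sph k)"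
  by (simp add: nsphere euclidean_product_topology)

lemma cone_eq: "cone k = top_of_set (disc k)"
proof -
  have "cone k = top_of_set {x. (\<forall>i\<ge>Suc k. x i = 0) \<and> sqnorm k x \<le> 1}"
    by (simp add: cone_def Euclidean_space_def euclidean_product_topology subtopology_subtopology Collect_conj_eq)
  then show ?thesis by simp
qed

lemma sph_disc: "x \<in> sph k \<Longrightarrow> x \<in> disc k" by (simp add: sph_iff disc_iff)

lemma cont_coord: "continuous_on S f \<Longrightarrow> continuous_on S (\<lambda>x. (f x :: nat \<Rightarrow> real) i)"
  by (rule continuous_on_product_then_coordinatewise)

lemma compact_disc: "compact (disc k)"
proof -
  let ?B = "\<lambda>i. if i \<le> k then {-1..1} else {0::real}"
  have "compactin (product_topology (\<lambda>i. euclideanreal) UNIV) (PiE UNIV ?B)"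
    by (subst compactin_PiE) auto
  then have c: "compact (PiE UNIV ?B)"
    by (simp add: euclidean_product_topology)
  have eq: "disc k = PiE UNIV ?B \<inter> {x. sqnorm k x \<le> 1}"
  proof (intro Set.set_eqI iffI)
    fix x assume x: "x \<in> disc k"
    have "x i \<in> ?B i" for i
    proof (cases "i \<le> k")
      case True
      then have "(x i)\<^sup>2 \<le> sqnorm k x" by (intro member_le_sum) auto
      with x have "(x i)\<^sup>2 \<le> 1" by (simp add: disc_iff)
      then show ?thesis using True abs_le_square_iff[of "x i" 1] by auto
    qed (use x in \<open>simp add: disc_iff\<close>)
    with x show "x \<in> PiE UNIV ?B \<inter> {x. sqnorm k x \<le> 1}" by (auto simp: disc_iff)
  next
    fix x assume "x \<in> PiE UNIV ?B \<inter> {x. sqnorm k x \<le> 1}"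
    then have "x i \<in> ?B i" "sqnorm k x \<le> 1" for i by (auto simp: PiE_iff)
    then show "x \<in> disc k" unfolding disc_iff by (metis not_le singletonD)
  qed
  have "closed {x::nat\<Rightarrow>real. sqnorm k x \<le> 1}"
    by (intro closed_Collect_le continuous_intros cont_coord)
  then show ?thesis unfolding eq using c by (rule compact_Int_closed[rotated])
qed

lemma compact_sph: "compact (sph k)"
proof -
  have "sph k = disc k \<inter> {x. sqnorm k x = 1}" by (auto simp: sph_iff disc_iff)
  moreover have "closed {x::nat\<Rightarrow>real. sqnorm k x = 1}"
    by (intro closed_Collect_eq continuous_intros cont_coord)
  ultimately show ?thesis using compact_disc[of k] by (metis compact_Int_closed)
qed

lemma sum_base: "(\<Sum>i\<le>k. base i * f i) = f 0"
  using sum.delta[of "{..k}" 0 f] by (simp add: base_def if_distrib[of "\<lambda>x. x * _"] cong: if_cong)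

lemma sqnorm_base: "sqnorm k base = 1"
  using sum_base[of base k] by (simp add: power2_eq_square base_def)

lemma base0: "base 0 = 1" by (simp add: base_def)

lemma base_sph [simp]: "base \<in> sph k" by (simp add: sph_iff sqnorm_base) (simp add: base_def)

lemma base_disc [simp]: "base \<in> disc k" using base_sph by (rule sph_disc)

lemma sqnorm_dist_base: "(\<Sum>i\<le>k. (base i - y i)\<^sup>2) = 1 - 2 * y 0 + sqnorm k y"
proof -
  have "(\<Sum>i\<le>k. (base i - y i)\<^sup>2) = sqnorm k base - 2 * (\<Sum>i\<le>k. base i * y i) + sqnorm k y"
    by (simp add: power2_diff sum.distrib sum_subtractf sum_distrib_left mult.assoc)
  then show ?thesis by (simp add: sqnorm_base sum_base)
qed

lemma sph_dist: "y \<in> sph k \<Longrightarrow> (\<Sum>i\<le>k. (base i - y i)\<^sup>2) = 2 * (1 - y 0)"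
  by (simp add: sqnorm_dist_base sph_iff)

lemma eq_baseI:
  assumes "(\<Sum>i\<le>k. (base i - y i)\<^sup>2) \<le> 0" "\<And>i. i > k \<Longrightarrow> y i = 0"
  shows "y = base"
proof
  fix i
  have "(\<Sum>i\<le>k. (base i - y i)\<^sup>2) = 0" using assms(1) by (intro antisym sum_nonneg) auto
  then have "\<forall>i\<le>k. base i = y i" by (subst (asm) sum_nonneg_eq_0_iff) auto
  then show "y i = base i" using assms(2)[of i] by (cases "i \<le> k") (auto simp: base_def)
qed

lemma dsc0_less: "v \<in> disc k \<Longrightarrow> v \<noteq> base \<Longrightarrow> v 0 < 1"
  using eq_baseI[of v k] by (force simp: disc_iff sqnorm_dist_base)

lemma sph0_less: "v \<in> sph k \<Longrightarrow> v \<noteq> base \<Longrightarrow> v 0 < 1"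
  using dsc0_less sph_disc by blast

lemma sph0_le: "v \<in> sph k \<Longrightarrow> v 0 \<le> 1"
  using sph0_less by (cases "v = base") (force simp: base_def)+

lemma dsc0_le: "v \<in> disc k \<Longrightarrow> v 0 \<le> 1"
  using dsc0_less by (cases "v = base") (force simp: base_def)+

lemma cone_pt_0: "cone_pt y t 0 = 1 - t * (1 - y 0)"
  by (simp add: cone_pt_def base_def algebra_simps)

lemma sqnorm_cone_pt: "sqnorm k (cone_pt y t) = (1 - t)\<^sup>2 + 2 * t * (1 - t) * y 0 + t\<^sup>2 * sqnorm k y"
proof -
  have "(cone_pt y t i)\<^sup>2 = (1-t)\<^sup>2 * (base i)\<^sup>2 + 2 * t * (1 - t) * (base i * y i) + t\<^sup>2 * (y i)\<^sup>2" for i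
    by (simp add: cone_pt_def power2_eq_square algebra_simps)
  then have "sqnorm k (cone_pt y t) = (1-t)\<^sup>2 * sqnorm k base + 2 * t * (1 - t) * (\<Sum>i\<le>k. base i * y i) + t\<^sup>2 * sqnorm k y"
    by (simp add: sum.distrib sum_distrib_left)
  then show ?thesis by (simp add: sqnorm_base sum_base)
qed

lemma sqnorm_cone_pt_sph: "y \<in> sph k \<Longrightarrow> sqnorm k (cone_pt y t) = 1 - 2 * t * (1 - t) * (1 - y 0)"
  unfolding sqnorm_cone_pt by (simp add: sph_iff power2_eq_square algebra_simps)

lemma cone_pt_beyond: "y \<in> disc k \<Longrightarrow> i > k \<Longrightarrow> cone_pt y t i = 0"
  by (simp add: cone_pt_def disc_iff base_def)

lemma cone_pt_disc:
  assumes "y \<in> sph k" "0 \<le> t" "t \<le> 1"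
  shows "cone_pt y t \<in> disc k"
  using assms cone_pt_beyond[OF sph_disc[OF assms(1)]] sph0_le[OF assms(1)]
  unfolding disc_iff sqnorm_cone_pt_sph[OF assms(1)] by auto

lemma cone_pt_base [simp]: "cone_pt base t = base" by (auto simp: cone_pt_def algebra_simps)
lemma cone_pt_t0 [simp]: "cone_pt y 0 = base" by (auto simp: cone_pt_def)
lemma cone_pt_t1 [simp]: "cone_pt y 1 = y" by (auto simp: cone_pt_def)

lemma cone_pt_eq_base: "y \<in> sph k \<Longrightarrow> cone_pt y t = base \<longleftrightarrow> t = 0 \<or> y = base"
  using cone_pt_0[of y t] sph0_less[of y k] by (auto simp: base0)

lemma cone_pt_sph:
  assumes "y \<in> sph k" "cone_pt y t \<in> sph k"
  shows "t = 0 \<or> t = 1 \<or> y = base"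
  using assms sqnorm_cone_pt_sph[OF assms(1), of t] sph0_less[OF assms(1)] by (auto simp: sph_iff)

lemma cone_pt_inj:
  assumes y: "y \<in> sph k" "y' \<in> sph k" and eq: "cone_pt y t = cone_pt y' t'"
  shows "y = y' \<and> t = t' \<or> cone_pt y t = base"
proof (cases "cone_pt y t = base")
  case False
  then have nz: "t \<noteq> 0" "y \<noteq> base" "t' \<noteq> 0" "y' \<noteq> base"
    using cone_pt_eq_base[OF y(1)] cone_pt_eq_base[OF y(2)] eq by metis+
  define u where "u = t * (1 - y 0)"
  have u: "u = t' * (1 - y' 0)" using eq cone_pt_0[of y t] cone_pt_0[of y' t'] by (simp add: u_def)
  have "u \<noteq> 0" using nz sph0_less[OF y(1)] by (auto simp: u_def)
  have "2 * (1 - t) * u = 2 * (1 - t') * u"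
  proof -
    have "sqnorm k (cone_pt y t) = 1 - 2 * (1 - t) * u"
      unfolding sqnorm_cone_pt_sph[OF y(1)] u_def by (simp add: algebra_simps)
    moreover have "sqnorm k (cone_pt y' t') = 1 - 2 * (1 - t') * u"
      unfolding sqnorm_cone_pt_sph[OF y(2)] u by (simp add: algebra_simps)
    ultimately show ?thesis using eq by auto
  qed
  with \<open>u \<noteq> 0\<close> have t: "t = t'" by simp
  have "y i = y' i" for i
    using fun_cong[OF eq, of i] nz t by (simp add: cone_pt_def)
  with t show ?thesis by auto
qed simp

text \<open>The ray from \<open>base\<close> through a point of the disc leaves the disc at a point of the sphere.\<close>

lemma cone_pt_surj:
  assumes v: "v \<in> disc k"
  obtains y t where "y \<in> sph k" "0 \<le> t" "t \<le> 1" "cone_pt y t = v"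
proof (cases "v = base")
  case True then show ?thesis using that[of base 1] by simp
next
  case False
  define D where "D = 1 - 2 * v 0 + sqnorm k v"
  define t where "t = D / (2 * (1 - v 0))"
  define y where "y = (\<lambda>i. base i + (v i - base i) / t)"
  have v0: "v 0 < 1" using dsc0_less[OF v False] .
  have D: "D = (\<Sum>i\<le>k. (base i - v i)\<^sup>2)" by (simp add: D_def sqnorm_dist_base)
  have "D > 0" using eq_baseI[of v k] False v D by (force simp: disc_iff)
  then have t0: "t > 0" using v0 by (simp add: t_def)
  have "D \<le> 2 * (1 - v 0)" using v by (simp add: D_def disc_iff)
  then have t1: "t \<le> 1" using v0 by (simp add: t_def)
  have cy: "cone_pt y t = v" using t0 by (auto simp: cone_pt_def y_def field_simps)
  have y0: "t * (1 - y 0) = 1 - v 0" using t0 by (simp add: y_def base0)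
  have "sqnorm k v = (1 - t)\<^sup>2 + 2 * t * (1 - t) * y 0 + t\<^sup>2 * sqnorm k y"
    using sqnorm_cone_pt[of y t k] cy by simp
  also have "2 * t * (1 - t) * y 0 = 2 * (1 - t) * t - 2 * (1 - t) * (1 - v 0)"
    unfolding y0[symmetric] by (simp add: algebra_simps)
  finally have "t\<^sup>2 * sqnorm k y = sqnorm k v - (1-t)\<^sup>2 - 2 * (1 - t) * t + 2 * (1 - t) * (1 - v 0)" by simp
  moreover have "2 * t * (1 - v 0) = D" using v0 by (simp add: t_def field_simps)
  then have "2 * (1 - t) * (1 - v 0) = 1 - sqnorm k v" by (simp add: D_def algebra_simps)
  ultimately have "t\<^sup>2 * sqnorm k y = 1 - (1 - t)\<^sup>2 - 2 * (1 - t) * t" by simp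
  also have "\<dots> = t\<^sup>2" by (simp add: power2_eq_square algebra_simps)
  finally have "sqnorm k y = 1" using t0 by simp
  then have "y \<in> sph k" using v by (auto simp: sph_iff disc_iff y_def base_def)
  then show ?thesis using that[of y t] t0 t1 cy by simp
qed

lemma cone_coords:
  assumes v: "v \<in> disc k"
  obtains y t where "cone_coords k v = (y, t)" "y \<in> sph k" "0 \<le> t" "t \<le> 1" "cone_pt y t = v"
proof -
  from cone_pt_surj[OF v] obtain y t where "y \<in> sph k" "0 \<le> t" "t \<le> 1" "cone_pt y t = v" .
  then have "\<exists>z. case z of (x, t) \<Rightarrow> x \<in> sph k \<and> t \<in> {0..1} \<and> cone_pt x t = v"
    by (intro exI[of _ "(y,t)"]) auto
  from someI_ex[OF this] show ?thesis
    using that[of "fst (cone_coords k v)" "snd (cone_coords k v)"]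
    by (auto simp: cone_coords_def split: prod.splits)
qed

lemma cont_cone_pt [continuous_intros]:
  assumes "continuous_on S f" "continuous_on S g"
  shows "continuous_on S (\<lambda>x. cone_pt (f x) (g x))"
proof -
  have "continuous_on S (\<lambda>x. f x i)" for i by (rule cont_coord[OF assms(1)])
  then have "continuous_on S (\<lambda>x. cone_pt (f x) (g x) i)" for i
    unfolding cone_pt_def by (intro continuous_intros assms(2))
  then show ?thesis by (rule continuous_on_coordinatewise_then_product)
qed

text \<open>The first coordinates of \<open>[y,t]\<close> move on the chord from \<open>base\<close> to \<open>y\<close>, so questions about
  suspension coordinates reduce to cone coordinates together with the sign of the last coordinate.\<close>

lemma susp_le: "i \<le> k \<Longrightarrow> susp_pt k y t i = cone_pt y ((1 - cos (2 * pi * t)) / 2) i"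
  by (simp add: susp_pt_def cone_pt_def field_simps)

lemma susp_last: "y \<in> sph k \<Longrightarrow> susp_pt k y t (Suc k) = sin (2 * pi * t) * (sqrt (2 * (1 - y 0)) / 2)"
proof -
  assume y: "y \<in> sph k"
  then have "base (Suc k) = 0" "y (Suc k) = 0" by (auto simp: base_def sph_iff)
  then show ?thesis unfolding susp_pt_def sph_dist[OF y] by simp
qed

lemma susp_beyond: "y \<in> sph k \<Longrightarrow> i > Suc k \<Longrightarrow> susp_pt k y t i = 0"
  by (simp add: susp_pt_def base_def sph_iff)

lemma susp_sph: assumes y: "y \<in> sph k" shows "susp_pt k y t \<in> sph (Suc k)"
proof -
  let ?c = "(1 - cos (2 * pi * t)) / 2"
  have "sqnorm k (susp_pt k y t) = sqnorm k (cone_pt y ?c)" by (simp add: susp_le)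
  then have "sqnorm (Suc k) (susp_pt k y t) = 1 - 2 * ?c * (1 - ?c) * (1 - y 0) + (sin (2 * pi * t) * (sqrt (2 * (1 - y 0)) / 2))\<^sup>2"
    by (simp add: sqnorm_cone_pt_sph[OF y] susp_last[OF y])
  also have "(sin (2 * pi * t) * (sqrt (2 * (1 - y 0)) / 2))\<^sup>2 = (sin (2 * pi * t))\<^sup>2 * (1 - y 0) / 2"
    using sph0_le[OF y] by (simp add: power_mult_distrib power_divide)
  also have "(sin (2 * pi * t))\<^sup>2 = 1 - (cos (2 * pi * t))\<^sup>2" by (simp add: sin_squared_eq)
  also have "1 - 2 * ?c * (1 - ?c) * (1 - y 0) + (1 - (cos (2 * pi * t))\<^sup>2) * (1 - y 0) / 2 = 1"
    by (simp add: field_simps power2_eq_square)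
  finally show ?thesis using susp_beyond[OF y] by (auto simp: sph_iff)
qed

lemma susp_base [simp]: "susp_pt k base t = base"
  by (rule ext) (auto simp: susp_pt_def)
lemma susp_t0 [simp]: "susp_pt k y 0 = base"
  by (rule ext) (auto simp: susp_pt_def field_simps)
lemma susp_t1 [simp]: "susp_pt k y 1 = base"
  by (rule ext) (auto simp: susp_pt_def field_simps)

lemma cos_2pi_eq_1: "0 \<le> t \<Longrightarrow> t \<le> 1 \<Longrightarrow> cos (2 * pi * t) = 1 \<Longrightarrow> t = 0 \<or> t = 1"
proof -
  assume t: "0 \<le> t" "t \<le> 1" "cos (2 * pi * t) = 1"
  then obtain n :: int where "2 * pi * t = of_int n * 2 * pi" by (auto simp: cos_one_2pi_int)
  then have n: "t = of_int n" by simp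
  with t have "0 \<le> n" "n \<le> 1" by auto
  then have "n = 0 \<or> n = 1" by auto
  with n show ?thesis by auto
qed

definition cut :: "nat \<Rightarrow> (nat \<Rightarrow> real) \<Rightarrow> nat \<Rightarrow> real"
  where "cut k z = (\<lambda>i. if i \<le> k then z i else 0)"

lemma susp_cut: "y \<in> sph k \<Longrightarrow> cut k (susp_pt k y t) = cone_pt y ((1 - cos (2 * pi * t)) / 2)"
  using cone_pt_beyond[OF sph_disc] by (auto simp: susp_le cut_def fun_eq_iff)

lemma base_cut: "cut k base = base" by (auto simp: base_def cut_def)

lemma susp_eq_base:
  assumes "y \<in> sph k" "0 \<le> t" "t \<le> 1"
  shows "susp_pt k y t = base \<longleftrightarrow> y = base \<or> t = 0 \<or> t = 1"
proof
  assume "susp_pt k y t = base"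
  then have "cone_pt y ((1 - cos (2 * pi * t)) / 2) = base"
    using susp_cut[OF assms(1), of t] by (simp add: base_cut)
  then show "y = base \<or> t = 0 \<or> t = 1"
    using cone_pt_eq_base[OF assms(1)] cos_2pi_eq_1[OF assms(2,3)] by auto
qed auto

lemma susp_inj:
  assumes y: "y \<in> sph k" "y' \<in> sph k" and t: "0 \<le> t" "t \<le> 1" "0 \<le> t'" "t' \<le> 1"
    and eq: "susp_pt k y t = susp_pt k y' t'"
  shows "y = y' \<and> t = t' \<or> susp_pt k y t = base"
proof (cases "susp_pt k y t = base")
  case False
  then have nz: "y \<noteq> base" "t \<noteq> 0" "t \<noteq> 1" "y' \<noteq> base" "t' \<noteq> 0" "t' \<noteq> 1"
    using susp_eq_base[OF y(1) t(1,2)] susp_eq_base[OF y(2) t(3,4)] eq by auto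
  let ?c = "\<lambda>t. (1 - cos (2 * pi * t)) / 2"
  have "cone_pt y (?c t) = cone_pt y' (?c t')"
    using susp_cut[OF y(1), of t] susp_cut[OF y(2), of t'] eq by simp
  moreover have "cone_pt y (?c t) \<noteq> base"
    using cone_pt_eq_base[OF y(1)] cos_2pi_eq_1[OF t(1,2)] nz by auto
  ultimately have *: "y = y'" "?c t = ?c t'" using cone_pt_inj[OF y, of "?c t" "?c t'"] by auto
  then have "cos (2 * pi * t) = cos (2 * pi * t')" by simp
  moreover have "sin (2 * pi * t) = sin (2 * pi * t')"
    using fun_cong[OF eq, of "Suc k"] sph0_less[OF y(1) nz(1)] unfolding susp_last[OF y(1)] susp_last[OF y(2)]
    by (simp add: *(1))
  ultimately obtain n :: int where "2 * pi * t = 2 * pi * t' + 2 * pi * n"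
    using sin_cos_eq_iff by metis
  then have "2 * pi * t = 2 * pi * (t' + n)" by (simp add: algebra_simps)
  then have n: "t = t' + n" by simp
  with t nz have "real_of_int n < 1" "real_of_int n > -1" by auto
  then have "n = 0" by linarith
  with n * show ?thesis by simp
qed simp

lemma susp_surj:
  assumes z: "z \<in> sph (Suc k)"
  obtains y t where "y \<in> sph k" "0 \<le> t" "t \<le> 1" "susp_pt k y t = z"
proof -
  let ?v = "cut k z"
  have sqv: "sqnorm k ?v = 1 - (z (Suc k))\<^sup>2" using z by (simp add: sph_iff cut_def)
  then have "?v \<in> disc k" by (auto simp: disc_iff cut_def)
  then obtain y c where y: "y \<in> sph k" "0 \<le> c" "c \<le> 1" "cone_pt y c = ?v" by (rule cone_pt_surj)
  show ?thesis
  proof (cases "y = base")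
    case True
    then have "?v = base" using y(4) by simp
    then have "sqnorm k ?v = 1" by (simp only: sqnorm_base)
    then have "z (Suc k) = 0" using sqv by simp
    have "z i = base i" for i
    proof -
      consider "i \<le> k" | "i = Suc k" | "i > Suc k" by linarith
      then show ?thesis
        using fun_cong[OF \<open>?v = base\<close>, of i] z \<open>z (Suc k) = 0\<close>
        by cases (auto simp: cut_def sph_iff base_def)
    qed
    then have "z = base" by blast
    then show ?thesis using that[of base 0] by simp
  next
    case False
    define S where "S = sqrt (2 * (1 - y 0)) / 2"
    have y0: "y 0 < 1" using sph0_less[OF y(1) False] .
    then have S: "S > 0" "S\<^sup>2 = (1 - y 0) / 2" by (auto simp: S_def power_divide)
    have "(z (Suc k))\<^sup>2 = 2 * c * (1 - c) * (1 - y 0)"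
      using sqv sqnorm_cone_pt_sph[OF y(1), of c] y(4) by simp
    then have "(z (Suc k) / S)\<^sup>2 = 4 * c * (1 - c)"
      using y0 by (simp add: power_divide S(2) field_simps)
    then have "(1 - 2 * c)\<^sup>2 + (z (Suc k) / S)\<^sup>2 = 1"
      by (simp add: power2_eq_square algebra_simps)
    then obtain \<theta> where th: "0 \<le> \<theta>" "\<theta> < 2 * pi" "1 - 2 * c = cos \<theta>" "z (Suc k) / S = sin \<theta>"
      using sincos_total_2pi by metis
    define t where "t = \<theta> / (2 * pi)"
    have t: "0 \<le> t" "t \<le> 1" "2 * pi * t = \<theta>" using th by (auto simp: t_def field_simps)
    have "susp_pt k y t i = z i" for i
    proof -
      consider "i \<le> k" | "i = Suc k" | "i > Suc k" by linarith
      then show ?thesis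
      proof cases
        case 1
        have "(1 - cos (2 * pi * t)) / 2 = c" using t th by simp
        then show ?thesis using 1 fun_cong[OF y(4), of i] by (simp add: susp_le cut_def)
      next
        case 2
        then show ?thesis using th(4) S(1) t(3) susp_last[OF y(1), of t] by (simp add: S_def field_simps)
      next
        case 3
        then show ?thesis using susp_beyond[OF y(1)] z by (simp add: sph_iff)
      qed
    qed
    then show ?thesis using that y(1) t by blast
  qed
qed

lemma susp_coords:
  assumes v: "v \<in> sph (Suc k)"
  obtains y t where "susp_coords k v = (y, t)" "y \<in> sph k" "0 \<le> t" "t \<le> 1" "susp_pt k y t = v"
proof -
  from susp_surj[OF v] obtain y t where "y \<in> sph k" "0 \<le> t" "t \<le> 1" "susp_pt k y t = v" .
  then have "\<exists>z. case z of (x, t) \<Rightarrow> x \<in> sph k \<and> t \<in> {0..1} \<and> susp_pt k x t = v"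
    by (intro exI[of _ "(y,t)"]) auto
  from someI_ex[OF this] show ?thesis
    using that[of "fst (susp_coords k v)" "snd (susp_coords k v)"]
    by (auto simp: susp_coords_def split: prod.splits)
qed

text \<open>The choice of suspension coordinates is immaterial for a function that is constant on the
  collapsed set.\<close>

lemma susp_coords_eq:
  assumes y: "y \<in> sph k" and t: "0 \<le> t" "t \<le> 1"
    and F: "\<And>y t. y \<in> sph k \<Longrightarrow> 0 \<le> t \<Longrightarrow> t \<le> 1 \<Longrightarrow> y = base \<or> t = 0 \<or> t = 1 \<Longrightarrow> F y t = w"
  shows "(case susp_coords k (susp_pt k y t) of (y', t') \<Rightarrow> F y' t') = F y t"
proof -
  obtain y' t' where *: "susp_coords k (susp_pt k y t) = (y', t')" "y' \<in> sph k" "0 \<le> t'" "t' \<le> 1"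
    "susp_pt k y' t' = susp_pt k y t"
    using susp_coords[OF susp_sph[OF y]] by metis
  have "F y' t' = F y t"
    using susp_inj[OF *(2) y *(3,4) t *(5)] susp_eq_base[OF *(2-4)] susp_eq_base[OF y t] F[OF *(2-4)] F[OF y t] *(5)
    by auto
  then show ?thesis by (simp add: *(1))
qed

lemma cont_susp_pt [continuous_intros]:
  assumes "continuous_on S f" "continuous_on S g"
  shows "continuous_on S (\<lambda>x. susp_pt k (f x) (g x))"
proof -
  have f: "continuous_on S (\<lambda>x. f x i)" for i by (rule cont_coord[OF assms(1)])
  have th: "continuous_on S (\<lambda>x. 2 * pi * g x)" by (intro continuous_intros assms(2))
  have c: "continuous_on S (\<lambda>x. cos (2 * pi * g x))"
    by (rule continuous_on_compose2[OF _ th, of UNIV]) (auto intro: continuous_intros)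
  have sn: "continuous_on S (\<lambda>x. sin (2 * pi * g x))"
    by (rule continuous_on_compose2[OF _ th, of UNIV]) (auto intro: continuous_intros)
  have "continuous_on S (\<lambda>x. susp_pt k (f x) (g x) i)" for i
    unfolding susp_pt_def
    by (cases "i = Suc k") (auto intro!: continuous_intros assms(2) f c sn)
  then show ?thesis by (rule continuous_on_coordinatewise_then_product)
qed

lemma susp_half: "y \<in> sph k \<Longrightarrow> susp_pt k y (1/2) = y"
  by (auto simp: susp_pt_def field_simps)

lemma compact_unit_interval: "compact {0..1::real}" by simp

section \<open>Smash products\<close>

lemma sph0_cases: "y \<in> sph 0 \<Longrightarrow> y = base \<or> y = (\<lambda>i. if i = 0 then -1 else 0)"
  by (auto simp: sph_iff base_def power2_eq_1_iff fun_eq_iff)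

lemma smash_susp_aux:
  assumes sm: "\<And>y. y \<in> sph b \<Longrightarrow> y = base \<Longrightarrow> smash a b x y = base"
    and y: "y \<in> sph b" "0 \<le> t" "t \<le> 1"
  shows "smash a (Suc b) x (susp_pt b y t) = susp_pt (a + b) (smash a b x y) t"
  unfolding smash.simps
  by (rule susp_coords_eq[where F="\<lambda>y t. susp_pt (a+b) (smash a b x y) t" and w=base, OF y]) (use sm in auto)

lemma smash_props:
  assumes "x \<in> sph a" "y \<in> sph b"
  shows "smash a b x y \<in> sph (a + b) \<and> (smash a b x y = base \<longleftrightarrow> x = base \<or> y = base)"
  using assms
proof (induction b arbitrary: y)
  case 0
  then show ?case by simp
next
  case (Suc b)
  obtain z t where z: "z \<in> sph b" "0 \<le> t" "t \<le> 1" "y = susp_pt b z t"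
    using susp_surj[OF Suc.prems(2)] by metis
  have IH: "smash a b x z \<in> sph (a + b)" "smash a b x z = base \<longleftrightarrow> x = base \<or> z = base" if "z \<in> sph b" for z
    using Suc.IH[OF Suc.prems(1) that] by auto
  have eq: "smash a (Suc b) x y = susp_pt (a + b) (smash a b x z) t"
    unfolding z(4) by (rule smash_susp_aux[OF _ z(1-3)]) (use IH in auto)
  show ?case
    unfolding eq using susp_sph[OF IH(1)[OF z(1)], of t] susp_eq_base[OF IH(1)[OF z(1)] z(2,3)] IH(2)[OF z(1)]
      susp_eq_base[OF z(1-3)] z(4) by auto
qed

lemma smash_sph: "x \<in> sph a \<Longrightarrow> y \<in> sph b \<Longrightarrow> smash a b x y \<in> sph (a + b)"
  and smash_eq_base: "x \<in> sph a \<Longrightarrow> y \<in> sph b \<Longrightarrow> smash a b x y = base \<longleftrightarrow> x = base \<or> y = base"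
  using smash_props by blast+

lemma smash_susp:
  assumes "x \<in> sph a" "y \<in> sph b" "0 \<le> t" "t \<le> 1"
  shows "smash a (Suc b) x (susp_pt b y t) = susp_pt (a + b) (smash a b x y) t"
  by (rule smash_susp_aux[OF _ assms(2-)]) (use smash_eq_base assms in auto)

declare smash.simps(2) [simp del]

lemma smash_inj:
  assumes "x \<in> sph a" "y \<in> sph b" "x' \<in> sph a" "y' \<in> sph b" "smash a b x y = smash a b x' y'"
  shows "x = x' \<and> y = y' \<or> smash a b x y = base"
  using assms
proof (induction b arbitrary: y y')
  case 0
  then show ?case using sph0_cases[of y] sph0_cases[of y'] by (auto split: if_splits)
next
  case (Suc b)
  obtain z t where z: "z \<in> sph b" "0 \<le> t" "t \<le> 1" "y = susp_pt b z t"
    using susp_surj[OF Suc.prems(2)] by metis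
  obtain z' t' where z': "z' \<in> sph b" "0 \<le> t'" "t' \<le> 1" "y' = susp_pt b z' t'"
    using susp_surj[OF Suc.prems(4)] by metis
  have e: "susp_pt (a+b) (smash a b x z) t = susp_pt (a+b) (smash a b x' z') t'"
    using Suc.prems(5) smash_susp[OF Suc.prems(1) z(1-3)] smash_susp[OF Suc.prems(3) z'(1-3)] z(4) z'(4) by simp
  have y: "smash a (Suc b) x y = susp_pt (a+b) (smash a b x z) t"
    using smash_susp[OF Suc.prems(1) z(1-3)] z(4) by simp
  from susp_inj[OF smash_sph[OF Suc.prems(1) z(1)] smash_sph[OF Suc.prems(3) z'(1)] z(2,3) z'(2,3) e]
  show ?case
  proof
    assume *: "smash a b x z = smash a b x' z' \<and> t = t'"
    then have "x = x' \<and> z = z' \<or> smash a b x z = base" using Suc.IH[OF Suc.prems(1) z(1) Suc.prems(3) z'(1)] by simp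
    then show ?case using * z z' y by auto
  qed (use y in simp)
qed

lemma smash_surj:
  assumes "w \<in> sph (a + b)"
  obtains x y where "x \<in> sph a" "y \<in> sph b" "smash a b x y = w"
proof -
  have "\<exists>x\<in>sph a. \<exists>y\<in>sph b. smash a b x y = w"
    using assms
  proof (induction b arbitrary: w)
    case 0
    let ?n = "\<lambda>i::nat. if i = 0 then -1 else (0::real)"
    have "?n \<in> sph 0" "?n \<noteq> base" by (auto simp: sph_iff base_def fun_eq_iff)
    then show ?case using 0 by (intro bexI[of _ w] bexI[of _ ?n]) auto
  next
    case (Suc b)
    then obtain v t where v: "v \<in> sph (a+b)" "0 \<le> t" "t \<le> 1" "susp_pt (a+b) v t = w"
      using susp_surj[of w "a+b"] by auto
    obtain x y where "x \<in> sph a" "y \<in> sph b" "smash a b x y = v" using Suc.IH[OF v(1)] by auto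
    then show ?case using v smash_susp[of x a y b t] susp_sph[of y b t]
      by (intro bexI[of _ x] bexI[of _ "susp_pt b y t"]) auto
  qed
  then show ?thesis using that by blast
qed

lemma cont_smash: "continuous_on (sph a \<times> sph b) (\<lambda>p. smash a b (fst p) (snd p))"
proof (induction b)
  case 0
  have "continuous_map (top_of_set (sph a \<times> sph 0)) euclidean
      (\<lambda>p. if snd p 0 \<le> 0 then fst p else (base::nat\<Rightarrow>real))"
  proof (rule cm_if)
    show "continuous_on (sph a \<times> sph 0) (\<lambda>p. snd p 0)"
      by (rule cont_coord) (intro continuous_intros)
    show "continuous_map (top_of_set {p \<in> sph a \<times> sph 0. snd p 0 \<le> 0}) euclidean fst"
      by (simp add: continuous_on_fst)
  qed (auto dest!: sph0_cases simp: base_def)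
  then have "continuous_on (sph a \<times> sph 0) (\<lambda>p. if snd p 0 \<le> 0 then fst p else (base::nat\<Rightarrow>real))" by simp
  then show ?case
    by (rule continuous_on_eq) (auto dest!: sph0_cases simp: base_def fun_eq_iff split: if_splits)
next
  case (Suc b)
  let ?A = "sph a \<times> (sph b \<times> {0..1::real})"
  let ?p = "\<lambda>z. (fst z, susp_pt b (fst (snd z)) (snd (snd z)))"
  show ?case
  proof (rule continuous_on_descend)
    show "compact ?A" by (intro compact_Times compact_sph compact_unit_interval)
    show "continuous_on ?A ?p" by (intro continuous_intros)
    show "?p ` ?A = sph a \<times> sph (Suc b)"
    proof (intro Set.set_eqI iffI)
      fix z assume z: "z \<in> sph a \<times> sph (Suc b)"
      then have "snd z \<in> sph (Suc b)" by auto
      then obtain y t where "y \<in> sph b" "0 \<le> t" "t \<le> 1" "susp_pt b y t = snd z"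
        by (rule susp_surj)
      with z show "z \<in> ?p ` ?A" by (intro image_eqI[of _ _ "(fst z, (y, t))"]) auto
    qed (auto simp: susp_sph)
    show "continuous_on ?A (\<lambda>z. susp_pt (a+b) (smash a b (fst z) (fst (snd z))) (snd (snd z)))"
      by (intro continuous_intros continuous_on_compose2[OF Suc.IH, where f="\<lambda>z. (fst z, fst (snd z))", simplified]) auto
  qed (auto simp: smash_susp)
qed

lemma cont_smash' [continuous_intros]:
  assumes "continuous_on S f" "continuous_on S g" "\<And>x. x \<in> S \<Longrightarrow> f x \<in> sph a" "\<And>x. x \<in> S \<Longrightarrow> g x \<in> sph b"
  shows "continuous_on S (\<lambda>x. smash a b (f x) (g x))"
  using continuous_on_compose2[OF cont_smash[of a b], of S "\<lambda>x. (f x, g x)"] assms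
  by (auto intro!: continuous_intros)

section \<open>Maps on the join\<close>

abbreviation join_set :: "nat \<Rightarrow> nat \<Rightarrow> ((nat \<Rightarrow> real) \<times> (nat \<Rightarrow> real)) set" where "join_set a b \<equiv> topspace (join a b)"

lemma join_set_iff: "p \<in> join_set a b \<longleftrightarrow> fst p \<in> disc a \<and> snd p \<in> disc b \<and> (fst p \<in> sph a \<or> snd p \<in> sph b)"
  by (cases p) (auto simp: join_def)

lemma join_eq: "join a b = top_of_set (join_set a b)"
proof -
  have "prod_topology (top_of_set (disc a)) (top_of_set (disc b)) = top_of_set (disc a \<times> disc b)"
    by (rule prod_topology_subtopology_eu)
  then have "prod_topology (cone a) (cone b) = top_of_set (disc a \<times> disc b)"
    by (metis cone_eq)
  then have "join a b = subtopology (top_of_set (disc a \<times> disc b)) {(u, v). u \<in> sph a \<or> v \<in> sph b}"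
    by (simp only: join_def)
  also have "\<dots> = top_of_set (disc a \<times> disc b \<inter> {(u, v). u \<in> sph a \<or> v \<in> sph b})"
    by (rule subtopology_subtopology)
  also have "disc a \<times> disc b \<inter> {(u, v). u \<in> sph a \<or> v \<in> sph b} = join_set a b"
    by (auto simp: join_def)
  finally show ?thesis .
qed

lemma base_join_set [simp]: "(base, base) \<in> join_set a b" by (simp add: join_set_iff)

text \<open>For fixed \<open>x\<close> and \<open>z\<close>, the path in the join from the cone point of \<open>CX\<close> (at \<open>t = 0\<close>) through \<open>(x, z)\<close>
  to the cone point of \<open>CZ\<close> (at \<open>t = 1\<close>). Under the join quotient it becomes the
  suspension coordinate line over \<open>x \<and> z\<close>.\<close>

definition join_path :: "(nat \<Rightarrow> real) \<Rightarrow> (nat \<Rightarrow> real) \<Rightarrow> real \<Rightarrow> (nat \<Rightarrow> real) \<times> (nat \<Rightarrow> real)"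
  where "join_path x z t = (if t \<le> 1/2 then (cone_pt x (2 * t), z) else (x, cone_pt z (2 - 2 * t)))"

lemma join_path_mem: "x \<in> sph a \<Longrightarrow> z \<in> sph b \<Longrightarrow> 0 \<le> t \<Longrightarrow> t \<le> 1 \<Longrightarrow> join_path x z t \<in> join_set a b"
  by (auto simp: join_path_def join_set_iff cone_pt_disc sph_disc)

lemma cont_join_path: "continuous_on ((sph a \<times> sph b) \<times> {0..1}) (\<lambda>q. join_path (fst (fst q)) (snd (fst q)) (snd q))"
  unfolding join_path_def
proof (rule continuous_onI_if)
  show "(cone_pt (fst (fst q)) (2 * snd q), snd (fst q)) = (fst (fst q), cone_pt (snd (fst q)) (2 - 2 * snd q))"
    if e: "snd q = 1/2" for q :: "((nat \<Rightarrow> real) \<times> (nat \<Rightarrow> real)) \<times> real" unfolding e by simp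
qed (auto intro!: continuous_intros)

lemma cont_join_path' [continuous_intros]:
  assumes "continuous_on S f" "continuous_on S g" "continuous_on S h"
    "\<And>x. x \<in> S \<Longrightarrow> f x \<in> sph a" "\<And>x. x \<in> S \<Longrightarrow> g x \<in> sph b" "\<And>x. x \<in> S \<Longrightarrow> h x \<in> {0..1}"
  shows "continuous_on S (\<lambda>x. join_path (f x) (g x) (h x))"
proof -
  have "continuous_on S (\<lambda>x. ((f x, g x), h x))" by (intro continuous_intros assms)
  moreover have "(\<lambda>x. ((f x, g x), h x)) ` S \<subseteq> (sph a \<times> sph b) \<times> {0..1}" using assms(4-6) by blast
  ultimately show ?thesis using continuous_on_compose2[OF cont_join_path[of a b]] by fastforce
qed

lemma join_path_surj:
  assumes "p \<in> join_set a b"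
  obtains x z t where "x \<in> sph a" "z \<in> sph b" "0 \<le> t" "t \<le> 1" "join_path x z t = p"
proof (cases "snd p \<in> sph b")
  case True
  have "fst p \<in> disc a" using assms by (simp add: join_set_iff)
  then obtain x t where "x \<in> sph a" "0 \<le> t" "t \<le> 1" "cone_pt x t = fst p" by (rule cone_pt_surj)
  with True show ?thesis by (intro that[of x "snd p" "t/2"]) (auto simp: join_path_def)
next
  case False
  then have "fst p \<in> sph a" "snd p \<in> disc b" using assms by (auto simp: join_set_iff)
  from this(2) obtain z t where z: "z \<in> sph b" "0 \<le> t" "t \<le> 1" "cone_pt z t = snd p" by (rule cone_pt_surj)
  with False have "t \<noteq> 1" by auto
  with z \<open>fst p \<in> sph a\<close> show ?thesis by (intro that[of "fst p" z "1 - t/2"]) (auto simp: join_path_def)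
qed

lemma join_path_image: "(\<lambda>q. join_path (fst (fst q)) (snd (fst q)) (snd q)) ` ((sph a \<times> sph b) \<times> {0..1}) = join_set a b"
proof (intro equalityI subsetI)
  fix p assume "p \<in> join_set a b"
  then obtain x z t where "x \<in> sph a" "z \<in> sph b" "0 \<le> t" "t \<le> 1" "join_path x z t = p" by (rule join_path_surj)
  then show "p \<in> (\<lambda>q. join_path (fst (fst q)) (snd (fst q)) (snd q)) ` ((sph a \<times> sph b) \<times> {0..1})"
    by (intro image_eqI[of _ _ "((x,z),t)"]) auto
qed (auto simp: join_path_mem)

lemma compact_cylinder: "compact ((sph a \<times> sph b) \<times> {0..1::real})"
  by (intro compact_Times compact_sph compact_unit_interval)

lemma compact_join_set: "compact (join_set a b)"
  unfolding join_path_image[symmetric] by (intro compact_continuous_image cont_join_path compact_cylinder)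

lemma cone_coords_eq:
  assumes y: "y \<in> sph k" and t: "0 \<le> t" "t \<le> 1"
    and F: "\<And>y t. y \<in> sph k \<Longrightarrow> 0 \<le> t \<Longrightarrow> t \<le> 1 \<Longrightarrow> y = base \<or> t = 0 \<Longrightarrow> F y t = w"
  shows "(case cone_coords k (cone_pt y t) of (y', t') \<Rightarrow> F y' t') = F y t"
proof -
  obtain y' t' where *: "cone_coords k (cone_pt y t) = (y', t')" "y' \<in> sph k" "0 \<le> t'" "t' \<le> 1"
    "cone_pt y' t' = cone_pt y t"
    using cone_coords[OF cone_pt_disc[OF assms(1-3)]] by metis
  have "F y' t' = F y t"
    using cone_pt_inj[OF *(2) y *(5)] cone_pt_eq_base[OF *(2), of t'] cone_pt_eq_base[OF y, of t] F[OF *(2-4)] F[OF y t] *(5)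
    by auto
  then show ?thesis by (simp add: *(1))
qed

text \<open>The quotient map from the disc to the sphere that collapses the boundary.\<close>

definition cone_collapse :: "nat \<Rightarrow> (nat \<Rightarrow> real) \<Rightarrow> nat \<Rightarrow> real"
  where "cone_collapse k v = (case cone_coords k v of (y, t) \<Rightarrow> susp_pt k y t)"

lemma cone_collapse_cone: "y \<in> sph k \<Longrightarrow> 0 \<le> t \<Longrightarrow> t \<le> 1 \<Longrightarrow> cone_collapse k (cone_pt y t) = susp_pt k y t"
  unfolding cone_collapse_def by (rule cone_coords_eq[where w=base]) auto

lemma cone_collapse_sph [simp]: "y \<in> sph k \<Longrightarrow> cone_collapse k y = base"
  using cone_collapse_cone[of y k 1] by simp

lemma cone_collapse_mem: assumes "v \<in> disc k" shows "cone_collapse k v \<in> sph (Suc k)"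
  using cone_pt_surj[OF assms] cone_collapse_cone susp_sph by metis

lemma cone_image: "(\<lambda>q. cone_pt (fst q) (snd q)) ` (sph k \<times> {0..1}) = disc k"
proof (intro equalityI subsetI)
  fix p assume "p \<in> disc k"
  then obtain x t where "x \<in> sph k" "0 \<le> t" "t \<le> 1" "cone_pt x t = p" by (rule cone_pt_surj)
  then show "p \<in> (\<lambda>q. cone_pt (fst q) (snd q)) ` (sph k \<times> {0..1})"
    by (intro image_eqI[of _ _ "(x,t)"]) auto
qed (auto simp: cone_pt_disc)

lemma susp_image: "(\<lambda>q. susp_pt k (fst q) (snd q)) ` (sph k \<times> {0..1}) = sph (Suc k)"
proof (intro equalityI subsetI)
  fix p assume "p \<in> sph (Suc k)"
  then obtain x t where "x \<in> sph k" "0 \<le> t" "t \<le> 1" "susp_pt k x t = p" by (rule susp_surj)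
  then show "p \<in> (\<lambda>q. susp_pt k (fst q) (snd q)) ` (sph k \<times> {0..1})"
    by (intro image_eqI[of _ _ "(x,t)"]) auto
qed (auto simp: susp_sph)

lemma cont_cone_collapse: "continuous_on (disc k) (cone_collapse k)"
proof (rule continuous_on_descend[OF _ _ cone_image])
  show "compact (sph k \<times> {0..1::real})" by (intro compact_Times compact_sph compact_unit_interval)
  show "continuous_on (sph k \<times> {0..1}) (\<lambda>q. susp_pt k (fst q) (snd q))" by (intro continuous_intros)
qed (auto intro!: continuous_intros simp: cone_collapse_cone)

lemma cont_cone_collapse' [continuous_intros]:
  assumes "continuous_on S f" "\<And>x. x \<in> S \<Longrightarrow> f x \<in> disc k"
  shows "continuous_on S (\<lambda>x. cone_collapse k (f x))"
  using continuous_on_compose2[OF cont_cone_collapse[of k] assms(1)] assms(2) by auto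

text \<open>All maps on the join that occur below have the form \<open>F\<close> on \<open>CX \<times> Y\<close>, independently of \<open>Y\<close>, and
  \<open>G x\<close> on \<open>X \<times> CY\<close> via the quotient \<open>CY \<rightarrow> \<Sigma>Y\<close>. Both maps in the definitions of the
  J-homomorphism and of the Whitehead product are of this kind.\<close>

definition join_map :: "nat \<Rightarrow> ((nat \<Rightarrow> real) \<Rightarrow> 'c) \<Rightarrow> ((nat \<Rightarrow> real) \<Rightarrow> (nat \<Rightarrow> real) \<Rightarrow> 'c) \<Rightarrow>
    (nat \<Rightarrow> real) \<times> (nat \<Rightarrow> real) \<Rightarrow> 'c"
  where "join_map b F G p = (if snd p \<in> sph b then F (fst p) else G (fst p) (cone_collapse b (snd p)))"

lemma join_map_join_fun1:
  "join_fun a b (\<lambda>x t y. w) (\<lambda>x y t. G x (susp_pt b y t)) = join_map b (\<lambda>_. w) G"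
  by (auto simp: join_fun_def join_map_def cone_collapse_def fun_eq_iff split: prod.splits)

lemma join_map_join_fun2:
  "join_fun a b (\<lambda>x t y. f (susp_pt a x t)) (\<lambda>x y t. g (susp_pt b y t)) = join_map b (\<lambda>u. f (cone_collapse a u)) (\<lambda>_. g)"
  by (auto simp: join_fun_def join_map_def cone_collapse_def fun_eq_iff split: prod.splits)

lemma closed_sph: "closed (sph k)" by (intro compact_imp_closed compact_sph)

lemma join_map_cont:
  assumes F: "continuous_map (top_of_set (P \<times> disc a)) W (\<lambda>q. F (fst q) (snd q))"
    and G: "continuous_map (top_of_set (P \<times> (sph a \<times> sph (Suc b)))) W (\<lambda>q. G (fst q) (fst (snd q)) (snd (snd q)))"
    and FG: "\<And>p x. p \<in> P \<Longrightarrow> x \<in> sph a \<Longrightarrow> F p x = G p x base"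
  shows "continuous_map (top_of_set (P \<times> join_set a b)) W (\<lambda>q. join_map b (F (fst q)) (G (fst q)) (snd q))"
proof (rule cm_paste)
  let ?S1 = "{q \<in> P \<times> join_set a b. snd (snd q) \<in> sph b}"
  let ?S2 = "{q \<in> P \<times> join_set a b. fst (snd q) \<in> sph a}"
  have 1: "?S1 = P \<times> join_set a b \<inter> (\<lambda>q. snd (snd q)) -` sph b" by auto
  show "closedin (top_of_set (P \<times> join_set a b)) ?S1"
    unfolding 1 by (intro continuous_closedin_preimage continuous_intros closed_sph)
  have 2: "?S2 = P \<times> join_set a b \<inter> (\<lambda>q. fst (snd q)) -` sph a" by auto
  show "closedin (top_of_set (P \<times> join_set a b)) ?S2"
    unfolding 2 by (intro continuous_closedin_preimage continuous_intros closed_sph)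
  show "P \<times> join_set a b \<subseteq> ?S1 \<union> ?S2" by (auto simp: join_set_iff)
  have "continuous_on ?S1 (\<lambda>q. (fst q, fst (snd q)))" by (intro continuous_intros)
  from cm_comp[OF F this] have "continuous_map (top_of_set ?S1) W (\<lambda>q. F (fst q) (fst (snd q)))"
    by (auto simp: join_set_iff)
  then show "continuous_map (top_of_set ?S1) W (\<lambda>q. join_map b (F (fst q)) (G (fst q)) (snd q))"
    by (rule cm_cong) (auto simp: join_map_def)
  have "continuous_on ?S2 (\<lambda>q. (fst q, fst (snd q), cone_collapse b (snd (snd q))))"
    by (intro continuous_intros) (auto simp: join_set_iff)
  from cm_comp[OF G this]
  have "continuous_map (top_of_set ?S2) W (\<lambda>q. G (fst q) (fst (snd q)) (cone_collapse b (snd (snd q))))"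
    by (auto simp: join_set_iff cone_collapse_mem)
  then show "continuous_map (top_of_set ?S2) W (\<lambda>q. join_map b (F (fst q)) (G (fst q)) (snd q))"
    by (rule cm_cong) (auto simp: join_map_def FG)
qed

lemma join_map_cont1:
  assumes F: "continuous_map (top_of_set (disc a)) W F"
    and G: "continuous_map (top_of_set (sph a \<times> sph (Suc b))) W (\<lambda>q. G (fst q) (snd q))"
    and FG: "\<And>x. x \<in> sph a \<Longrightarrow> F x = G x base"
  shows "continuous_map (top_of_set (join_set a b)) W (join_map b F G)"
proof -
  have "continuous_map (top_of_set ({0::real} \<times> join_set a b)) W (\<lambda>q. join_map b ((\<lambda>_. F) (fst q)) ((\<lambda>_. G) (fst q)) (snd q))"
  proof (rule join_map_cont)
    show "continuous_map (top_of_set ({0::real} \<times> disc a)) W (\<lambda>q. F (snd q))"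
      by (rule cm_comp[OF F]) (auto intro!: continuous_intros)
    show "continuous_map (top_of_set ({0::real} \<times> (sph a \<times> sph (Suc b)))) W (\<lambda>q. G (fst (snd q)) (snd (snd q)))"
      by (rule cm_comp[OF G]) (auto intro!: continuous_intros)
  qed (use FG in auto)
  note c = this
  have "continuous_on (join_set a b) (\<lambda>p. (0::real,p))" by (intro continuous_intros)
  from cm_comp[OF c this] show ?thesis by auto
qed

lemma join_map_homotopic_rel:
  assumes h: "homotopic_rel (sph a \<times> sph (Suc b)) (sph a \<times> {base}) W w (\<lambda>p. G (fst p) (snd p)) (\<lambda>p. G' (fst p) (snd p))"
    and w: "w \<in> topspace W"
  shows "homotopic_rel (join_set a b) {(base,base)} W w (join_map b (\<lambda>_. w) G) (join_map b (\<lambda>_. w) G')"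
proof -
  from h obtain k where k: "continuous_map (top_of_set ({0..1} \<times> (sph a \<times> sph (Suc b)))) W (\<lambda>p. k (fst p) (snd p))"
    "\<And>p. p \<in> sph a \<times> sph (Suc b) \<Longrightarrow> k (0::real) p = G (fst p) (snd p)"
    "\<And>p. p \<in> sph a \<times> sph (Suc b) \<Longrightarrow> k 1 p = G' (fst p) (snd p)"
    "\<And>s p. 0 \<le> s \<Longrightarrow> s \<le> 1 \<Longrightarrow> p \<in> sph a \<times> {base} \<Longrightarrow> k s p = w" by (rule homotopic_relE) blast
  show ?thesis
  proof (rule homotopic_relI[where h="\<lambda>s. join_map b (\<lambda>_. w) (\<lambda>x v. k s (x, v))"])
    show "continuous_map (top_of_set ({0..1} \<times> join_set a b)) W (\<lambda>p. join_map b (\<lambda>_. w) (\<lambda>x v. k (fst p) (x, v)) (snd p))"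
      by (rule join_map_cont[where F="\<lambda>_ _. w" and G="\<lambda>s x v. k s (x, v)"]) (use k(1,4) w in auto)
  qed (use k in \<open>auto simp: join_map_def join_set_iff cone_collapse_mem\<close>)
qed

lemma join_map_join_path:
  assumes "x \<in> sph a" "z \<in> sph b" "0 \<le> t" "t \<le> 1" and FG: "F x = G x base"
  shows "join_map b F G (join_path x z t) = (if t \<le> 1/2 then F (cone_pt x (2 * t)) else G x (susp_pt b z (2 - 2 * t)))"
proof (cases "t \<le> 1/2")
  case False
  have k: "cone_collapse b (cone_pt z (2 - 2 * t)) = susp_pt b z (2 - 2 * t)"
    using assms False by (intro cone_collapse_cone) auto
  show ?thesis
  proof (cases "cone_pt z (2 - 2 * t) \<in> sph b")
    case True
    then have "cone_collapse b (cone_pt z (2 - 2 * t)) = base" by simp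
    with k True False FG show ?thesis by (simp add: join_map_def join_path_def)
  qed (use k False in \<open>simp add: join_map_def join_path_def\<close>)
qed (use assms in \<open>simp add: join_map_def join_path_def\<close>)

lemma join_fun_join_path:
  assumes x: "x \<in> sph a" "z \<in> sph b" "0 \<le> t" "t \<le> 1"
   and F: "\<And>x t z. x \<in> sph a \<Longrightarrow> z \<in> sph b \<Longrightarrow> 0 \<le> t \<Longrightarrow> t \<le> 1 \<Longrightarrow> x = base \<or> t = 0 \<Longrightarrow> f x t z = c z"
   and G: "\<And>x t z. x \<in> sph a \<Longrightarrow> z \<in> sph b \<Longrightarrow> 0 \<le> t \<Longrightarrow> t \<le> 1 \<Longrightarrow> z = base \<or> t = 0 \<Longrightarrow> g x z t = d x"
   and FG: "\<And>x z. x \<in> sph a \<Longrightarrow> z \<in> sph b \<Longrightarrow> f x 1 z = g x z 1"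
  shows "join_fun a b f g (join_path x z t) = (if t \<le> 1/2 then f x (2 * t) z else g x z (2 - 2 * t))"
proof -
  have Fc: "(case cone_coords a (cone_pt x t) of (x', t') \<Rightarrow> f x' t' z) = f x t z"
    if "0 \<le> t" "t \<le> 1" "z \<in> sph b" for t z
    by (rule cone_coords_eq[OF x(1) that(1,2), where F="\<lambda>x t. f x t z" and w="c z"]) (use F that in auto)
  have Gc: "(case cone_coords b (cone_pt z t) of (z', t') \<Rightarrow> g x z' t') = g x z t"
    if "0 \<le> t" "t \<le> 1" for t
    by (rule cone_coords_eq[OF x(2) that(1,2), where F="\<lambda>z t. g x z t" and w="d x"]) (use G x in auto)
  show ?thesis
  proof (cases "t \<le> 1/2")
    case True
    then show ?thesis using Fc[of "2 * t" z] x by (simp add: join_path_def join_fun_def)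
  next
    case False
    show ?thesis
    proof (cases "cone_pt z (2 - 2 * t) \<in> sph b")
      case True
      then have *: "2 - 2 * t = 0 \<or> z = base" using cone_pt_sph[OF x(2) True] False by auto
      then have cb: "cone_pt z (2 - 2 * t) = base" by auto
      have "join_fun a b f g (join_path x z t) = f x 1 base"
        using Fc[of 1 base] False by (simp add: join_path_def join_fun_def cb)
      also have "\<dots> = d x" using FG[of x base] G[of x base 1] x by simp
      also have "\<dots> = g x z (2 - 2 * t)" using G[of x z "2 - 2 * t"] x False * by auto
      finally show ?thesis using False by simp
    next
      case nm: False
      then show ?thesis using False Gc[of "2 - 2 * t"] x by (simp add: join_path_def join_fun_def)
    qed
  qed
qed

lemma join_quot_join_path:
  assumes x: "x \<in> sph a" "z \<in> sph b" "0 \<le> t" "t \<le> 1"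
  shows "join_quot a b (join_path x z t) = susp_pt (a + b) (smash a b x z) t"
proof -
  have "join_quot a b (join_path x z t) = (if t \<le> 1/2 then susp_pt (a + b) (smash a b x z) (2 * t / 2)
     else susp_pt (a + b) (smash a b x z) (1 - (2 - 2 * t) / 2))"
    unfolding join_quot_def
    by (rule join_fun_join_path[OF x, where c="\<lambda>_. base" and d="\<lambda>_. base"]) (auto simp: smash_eq_base[THEN iffD2])
  also have "1 - (2 - 2 * t) / 2 = t" by (simp add: field_simps)
  finally show ?thesis by simp
qed

lemma cont_join_quot: "continuous_on (join_set a b) (join_quot a b)"
  by (rule continuous_on_descend[OF compact_cylinder cont_join_path join_path_image,
      where F="\<lambda>q. susp_pt (a+b) (smash a b (fst (fst q)) (snd (fst q))) (snd q)"])
    (auto intro!: continuous_intros simp: join_quot_join_path)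

lemma join_quot_mem: "p \<in> join_set a b \<Longrightarrow> join_quot a b p \<in> sph (Suc (a + b))"
  by (erule join_path_surj) (auto simp: join_quot_join_path susp_sph smash_sph)

lemma join_path_base:
  assumes "x \<in> sph a" "z \<in> sph b" "0 \<le> t" "t \<le> 1"
  shows "fst (join_path x z t) = base \<or> snd (join_path x z t) = base \<longleftrightarrow> x = base \<or> z = base \<or> t = 0 \<or> t = 1"
  using cone_pt_eq_base[OF assms(1)] cone_pt_eq_base[OF assms(2)] by (auto simp: join_path_def)

lemma join_quot_base:
  assumes "p \<in> join_set a b"
  shows "join_quot a b p = base \<longleftrightarrow> fst p = base \<or> snd p = base"
proof -
  from assms obtain x z t where p: "x \<in> sph a" "z \<in> sph b" "0 \<le> t" "t \<le> 1" "join_path x z t = p" by (rule join_path_surj)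
  show ?thesis
    unfolding p(5)[symmetric] join_quot_join_path[OF p(1-4)] join_path_base[OF p(1-4)] susp_eq_base[OF smash_sph[OF p(1,2)] p(3,4)]
      smash_eq_base[OF p(1,2)] by auto
qed

text \<open>The join quotient collapses nothing but the two axes \<open>CX \<times> {base} \<union> {base} \<times> CY\<close>.\<close>

lemma join_quot_inj:
  assumes "p \<in> join_set a b" "p' \<in> join_set a b" "join_quot a b p = join_quot a b p'"
  shows "p = p' \<or> (fst p = base \<or> snd p = base) \<and> (fst p' = base \<or> snd p' = base)"
proof -
  from assms(1) obtain x z t where p: "x \<in> sph a" "z \<in> sph b" "0 \<le> t" "t \<le> 1" "join_path x z t = p" by (rule join_path_surj)
  from assms(2) obtain x' z' t' where p': "x' \<in> sph a" "z' \<in> sph b" "0 \<le> t'" "t' \<le> 1" "join_path x' z' t' = p'" by (rule join_path_surj)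
  have e: "susp_pt (a + b) (smash a b x z) t = susp_pt (a + b) (smash a b x' z') t'"
    using assms(3) join_quot_join_path[OF p(1-4)] join_quot_join_path[OF p'(1-4)] p(5) p'(5) by simp
  show ?thesis
  proof (cases "join_quot a b p = base")
    case True
    then show ?thesis using join_quot_base assms by metis
  next
    case False
    then have nb: "susp_pt (a + b) (smash a b x z) t \<noteq> base" using join_quot_join_path[OF p(1-4)] p(5) by simp
    then have 1: "smash a b x z = smash a b x' z'" "t = t'"
      using susp_inj[OF smash_sph[OF p(1,2)] smash_sph[OF p'(1,2)] p(3,4) p'(3,4) e] by auto
    moreover have "smash a b x z \<noteq> base" using nb by auto
    ultimately have "x = x'" "z = z'" using smash_inj[OF p(1,2) p'(1,2)] by auto
    with 1 p p' show ?thesis by auto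
  qed
qed

lemma join_quot_image: "join_quot a b ` join_set a b = sph (Suc (a + b))"
proof (intro equalityI subsetI)
  fix w assume "w \<in> sph (Suc (a + b))"
  then obtain v t where v: "v \<in> sph (a + b)" "0 \<le> t" "t \<le> 1" "susp_pt (a + b) v t = w" by (rule susp_surj)
  from v(1) obtain x y where "x \<in> sph a" "y \<in> sph b" "smash a b x y = v" by (rule smash_surj)
  with v show "w \<in> join_quot a b ` join_set a b"
    by (intro image_eqI[of _ _ "join_path x y t"]) (auto simp: join_quot_join_path join_path_mem)
qed (auto simp: join_quot_mem)

section \<open>An explicit homotopy inverse of the join quotient\<close>

text \<open>The homotopy inverse is obtained from a deformation of the join that contracts the
  collapsed axes to the base point. The building block is a deformation \<open>push\<close> of the disc which keeps
  the boundary sphere and \<open>base\<close> invariant and at time 1 sends the cap \<open>v 0 \<ge> 1/2\<close> to \<open>base\<close>. It is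
  composed of a radial expansion, after which the cap lies in the boundary, and a rotation towards
  \<open>base\<close>.\<close>

definition radial :: "nat \<Rightarrow> real \<Rightarrow> (nat \<Rightarrow> real) \<Rightarrow> nat \<Rightarrow> real"
  where "radial k s v = (\<lambda>i. v i / max (1 / (1 + s)) (sqrt (sqnorm k v)))"

definition squeeze :: "real \<Rightarrow> (nat \<Rightarrow> real) \<Rightarrow> real"
  where "squeeze s v = 1 - s * min 1 (2 * max 0 (v 0))"

text \<open>The coordinates \<open>i > 0\<close> are shrunk and coordinate \<open>0\<close> is enlarged so that the norm does not
  change. Points with \<open>v 0 \<le> 0\<close> do not move.\<close>

definition tilt :: "nat \<Rightarrow> real \<Rightarrow> (nat \<Rightarrow> real) \<Rightarrow> nat \<Rightarrow> real"
  where "tilt k s v = (\<lambda>i. if i = 0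
     then min 0 (v 0) + sqrt ((max 0 (v 0))\<^sup>2 + (1 - (squeeze s v)\<^sup>2) * (sqnorm k v - (v 0)\<^sup>2))
     else squeeze s v * v i)"

definition push :: "nat \<Rightarrow> real \<Rightarrow> (nat \<Rightarrow> real) \<Rightarrow> nat \<Rightarrow> real"
  where "push k s v = tilt k s (radial k s v)"

lemma squeeze_bounds:
  assumes "0 \<le> s" "s \<le> 1"
  shows "0 \<le> squeeze s v" "squeeze s v \<le> 1"
proof -
  have "0 \<le> min 1 (2 * max 0 (v 0))" "min 1 (2 * max 0 (v 0)) \<le> 1" by auto
  then have "0 \<le> s * min 1 (2 * max 0 (v 0))" "s * min 1 (2 * max 0 (v 0)) \<le> 1"
    using assms by (simp, metis mult_le_one)
  then show "0 \<le> squeeze s v" "squeeze s v \<le> 1" by (simp_all add: squeeze_def)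
qed

lemma sqnorm_split: "sqnorm k v = (v 0)\<^sup>2 + (\<Sum>i\<in>{1..k}. (v i)\<^sup>2)"
proof -
  have "{..k} = insert 0 {1..k}" by auto
  then show ?thesis by simp
qed

lemma sqnorm_tilt:
  assumes s: "0 \<le> s" "s \<le> 1"
  shows "sqnorm k (tilt k s v) = sqnorm k v"
proof -
  let ?m = "squeeze s v"
  have R: "sqnorm k v - (v 0)\<^sup>2 = (\<Sum>i\<in>{1..k}. (v i)\<^sup>2)" unfolding sqnorm_split by simp
  have R0: "0 \<le> sqnorm k v - (v 0)\<^sup>2" unfolding R by (intro sum_nonneg) auto
  have m: "0 \<le> 1 - ?m\<^sup>2" using squeeze_bounds[OF s, of v] by (simp add: power_le_one)
  have 0: "(tilt k s v 0)\<^sup>2 = (v 0)\<^sup>2 + (1 - ?m\<^sup>2) * (sqnorm k v - (v 0)\<^sup>2)"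
  proof (cases "v 0 \<le> 0")
    case True
    then have "?m = 1" by (simp add: squeeze_def)
    with True show ?thesis by (simp add: tilt_def min_def max_def)
  next
    case False
    have "0 \<le> (v 0)\<^sup>2 + (1 - ?m\<^sup>2) * (sqnorm k v - (v 0)\<^sup>2)" using R0 m by simp
    with False show ?thesis by (simp add: tilt_def)
  qed
  have 1: "(\<Sum>i\<in>{1..k}. (tilt k s v i)\<^sup>2) = ?m\<^sup>2 * (\<Sum>i\<in>{1..k}. (v i)\<^sup>2)"
    unfolding sum_distrib_left by (rule sum.cong) (auto simp: tilt_def power_mult_distrib)
  have "sqnorm k (tilt k s v) = (tilt k s v 0)\<^sup>2 + (\<Sum>i\<in>{1..k}. (tilt k s v i)\<^sup>2)" by (rule sqnorm_split)
  also have "\<dots> = sqnorm k v" unfolding 0 1 R[symmetric] by (simp add: algebra_simps)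
  finally show ?thesis .
qed

lemma sqnorm_nonneg: "0 \<le> sqnorm k v" by (intro sum_nonneg) auto

lemma radial_den:
  assumes "0 \<le> s" shows "0 < max (1 / (1 + s)) (sqrt (sqnorm k v))"
  using assms by (intro less_le_trans[OF _ max.cobounded1]) simp

lemma sqnorm_radial: "sqnorm k (radial k s v) = sqnorm k v / (max (1 / (1 + s)) (sqrt (sqnorm k v)))\<^sup>2"
  by (simp add: radial_def power_divide sum_divide_distrib)

lemma radial_disc:
  assumes s: "0 \<le> s" and v: "v \<in> disc k" shows "radial k s v \<in> disc k"
proof -
  have "sqrt (sqnorm k v) ^ 2 \<le> (max (1 / (1 + s)) (sqrt (sqnorm k v)))\<^sup>2"
    by (rule power_mono) (auto simp: sqnorm_nonneg)
  then have "sqnorm k v \<le> (max (1 / (1 + s)) (sqrt (sqnorm k v)))\<^sup>2" by (simp add: sqnorm_nonneg)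
  then have "sqnorm k (radial k s v) \<le> 1"
    unfolding sqnorm_radial using radial_den[OF s, of v k] by (simp add: divide_le_eq_1)
  then show ?thesis using v by (auto simp: disc_iff radial_def)
qed

lemma radial_id: "sqrt (sqnorm k v) \<le> 1 \<Longrightarrow> (s = 0 \<or> sqnorm k v = 1 \<and> 0 \<le> s) \<Longrightarrow> radial k s v = v"
  by (auto simp: radial_def max_def field_simps)

lemma tilt_disc: "0 \<le> s \<Longrightarrow> s \<le> 1 \<Longrightarrow> v \<in> disc k \<Longrightarrow> tilt k s v \<in> disc k"
  unfolding disc_iff using sqnorm_tilt[of s k v] by (auto simp: tilt_def)

lemma tilt_sph: "0 \<le> s \<Longrightarrow> s \<le> 1 \<Longrightarrow> v \<in> sph k \<Longrightarrow> tilt k s v \<in> sph k"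
  unfolding sph_iff using sqnorm_tilt[of s k v] by (auto simp: tilt_def)

lemma push_disc: "0 \<le> s \<Longrightarrow> s \<le> 1 \<Longrightarrow> v \<in> disc k \<Longrightarrow> push k s v \<in> disc k"
  unfolding push_def by (intro tilt_disc radial_disc)

lemma push_sph:
  assumes "0 \<le> s" "s \<le> 1" "v \<in> sph k" shows "push k s v \<in> sph k"
proof -
  have "radial k s v = v" using assms by (intro radial_id) (auto simp: sph_iff)
  then show ?thesis unfolding push_def using tilt_sph assms by simp
qed

lemma push_0: assumes "v \<in> disc k" shows "push k 0 v = v"
proof -
  have "radial k 0 v = v" using assms by (intro radial_id) (auto simp: disc_iff)
  then show ?thesis by (auto simp: push_def tilt_def squeeze_def min_def max_def)
qed

lemma push_base: "0 \<le> s \<Longrightarrow> s \<le> 1 \<Longrightarrow> push k s base = base"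
proof -
  assume s: "0 \<le> s" "s \<le> 1"
  have "radial k s base = base" using s by (intro radial_id) (auto simp: sqnorm_base)
  moreover have "tilt k s base i = base i" for i
  proof (cases "i = 0")
    case False
    then show ?thesis by (simp add: tilt_def base_def)
  qed (simp add: tilt_def sqnorm_base base0)
  ultimately have "tilt k s base = base" "radial k s base = base" by blast+
  then show ?thesis by (simp add: push_def)
qed

lemma push_1: assumes v: "v \<in> disc k" and h: "v 0 \<ge> 1/2" shows "push k 1 v = base"
proof -
  let ?n = "sqrt (sqnorm k v)"
  have "(v 0)\<^sup>2 \<le> sqnorm k v" unfolding sqnorm_split by (simp add: sum_nonneg)
  then have "sqrt ((v 0)\<^sup>2) \<le> ?n" by (rule real_sqrt_le_mono)
  then have n: "v 0 \<le> ?n" "1/2 \<le> ?n" using h by auto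
  have n1: "?n \<le> 1" using v by (simp add: disc_iff)
  define w where "w = radial k 1 v"
  have w: "w i = v i / ?n" for i using n by (simp add: w_def radial_def max_def)
  have "0 < ?n" using n(2) by linarith
  then have pos: "sqnorm k v > 0" by (simp only: real_sqrt_gt_0_iff)
  have "max (1 / (1 + 1)) ?n = ?n" using n by (intro max.absorb2) simp
  then have "sqnorm k w = sqnorm k v / ?n\<^sup>2" unfolding w_def sqnorm_radial by simp
  also have "\<dots> = 1" using pos by simp
  finally have sw: "sqnorm k w = 1" .
  have "v 0 * ?n \<le> v 0" using n1 h by (intro mult_left_le) auto
  then have "v 0 \<le> w 0" unfolding w by (simp add: pos_le_divide_eq[OF \<open>0 < ?n\<close>])
  then have w0: "w 0 \<ge> 1/2" using h by simp
  then have m: "squeeze 1 w = 0" by (simp add: squeeze_def)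
  have "tilt k 1 w i = base i" for i
    using w0 by (cases "i = 0") (simp_all add: tilt_def m sw base_def)
  then have "tilt k 1 w = base" by blast
  then show ?thesis by (simp add: push_def w_def)
qed

lemma cont_push:
  "continuous_on ({0..1} \<times> UNIV) (\<lambda>q. push k (fst q) (snd q))"
proof -
  let ?D = "{0..1} \<times> UNIV :: (real \<times> (nat \<Rightarrow> real)) set"
  have c: "continuous_on ?D (\<lambda>q. snd q i)" for i by (rule cont_coord) (intro continuous_intros)
  have d: "continuous_on ?D (\<lambda>q. radial k (fst q) (snd q) i)" for i
    unfolding radial_def
  proof (intro continuous_intros c ballI)
    show "max (1 / (1 + fst q)) (sqrt (sqnorm k (snd q))) \<noteq> 0" if "q \<in> ?D" for q
      using radial_den[of "fst q" "snd q" k] that by auto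
  qed auto
  have m: "continuous_on ?D (\<lambda>q. squeeze (fst q) (radial k (fst q) (snd q)))"
    unfolding squeeze_def by (intro continuous_intros d)
  have "continuous_on ?D (\<lambda>q. push k (fst q) (snd q) i)" for i
    unfolding push_def tilt_def by (cases "i = 0") (auto intro!: continuous_intros d m)
  then show ?thesis by (rule continuous_on_coordinatewise_then_product)
qed

lemma cont_push' [continuous_intros]:
  assumes "continuous_on S f" "continuous_on S g" "\<And>x. x \<in> S \<Longrightarrow> f x \<in> {0..1}"
  shows "continuous_on S (\<lambda>x. push k (f x) (g x))"
proof -
  have "continuous_on S (\<lambda>x. (f x, g x))" by (intro continuous_intros assms)
  moreover have "(\<lambda>x. (f x, g x)) ` S \<subseteq> {0..1} \<times> UNIV" using assms(3) by blast
  ultimately show ?thesis using continuous_on_compose2[OF cont_push] by fastforce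
qed

lemma cone_pt_disc':
  assumes y: "y \<in> disc k" and t: "0 \<le> t" "t \<le> 1" shows "cone_pt y t \<in> disc k"
proof -
  have "sqnorm k (cone_pt y t) \<le> (1 - t)\<^sup>2 + 2 * t * (1 - t) * 1 + t\<^sup>2 * 1"
    unfolding sqnorm_cone_pt using y t dsc0_le[OF y]
    by (intro add_mono mult_left_mono) (auto simp: disc_iff)
  also have "\<dots> = 1" by (simp add: power2_eq_square algebra_simps)
  finally show ?thesis using cone_pt_beyond[OF y] by (auto simp: disc_iff)
qed

text \<open>This weight is \<open>1\<close> on both axes and vanishes unless one of the two components lies in the cap that
  \<open>push\<close> sends to \<open>base\<close>.\<close>

definition axis_weight :: "(nat \<Rightarrow> real) \<times> (nat \<Rightarrow> real) \<Rightarrow> real"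
  where "axis_weight p = max 0 (2 * max (fst p 0) (snd p 0) - 1)"

text \<open>In the first half both components are pushed. In the second half both are
  contracted to \<open>base\<close> with speed given by the weight: wherever it is positive one component already
  is \<open>base\<close>, so the other one may leave its boundary sphere without leaving the join.\<close>

definition join_deform :: "nat \<Rightarrow> nat \<Rightarrow> real \<Rightarrow> (nat \<Rightarrow> real) \<times> (nat \<Rightarrow> real) \<Rightarrow> (nat \<Rightarrow> real) \<times> (nat \<Rightarrow> real)"
  where "join_deform a b s p =
    (cone_pt (push a (min 1 (2 * s)) (fst p)) (1 - max 0 (2 * s - 1) * axis_weight p),
     cone_pt (push b (min 1 (2 * s)) (snd p)) (1 - max 0 (2 * s - 1) * axis_weight p))"

lemma axis_weight_bounds:
  assumes "p \<in> join_set a b" shows "0 \<le> axis_weight p" "axis_weight p \<le> 1"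
  using assms dsc0_le[of "fst p" a] dsc0_le[of "snd p" b] by (auto simp: axis_weight_def join_set_iff)

lemma axis_weight_base: assumes "p \<in> join_set a b" "fst p = base \<or> snd p = base" shows "axis_weight p = 1"
  using assms dsc0_le[of "fst p" a] dsc0_le[of "snd p" b] by (auto simp: axis_weight_def join_set_iff base0)

lemma join_deform_r:
  assumes "p \<in> join_set a b" "0 \<le> s" "s \<le> 1"
  shows "0 \<le> 1 - max 0 (2 * s - 1) * axis_weight p" "1 - max 0 (2 * s - 1) * axis_weight p \<le> 1"
  using axis_weight_bounds[OF assms(1)] assms(2,3) by (auto intro!: mult_le_one)

lemma join_deform_join_set:
  assumes p: "p \<in> join_set a b" and s: "0 \<le> s" "s \<le> 1"
  shows "join_deform a b s p \<in> join_set a b"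
proof -
  let ?r = "max 0 (2 * s - 1) * axis_weight p" and ?s = "min 1 (2 * s)"
  have s': "0 \<le> ?s" "?s \<le> 1" using s by auto
  have d: "push a ?s (fst p) \<in> disc a" "push b ?s (snd p) \<in> disc b"
    using p push_disc[OF s'] by (auto simp: join_set_iff)
  have m: "fst (join_deform a b s p) \<in> disc a" "snd (join_deform a b s p) \<in> disc b"
    using cone_pt_disc'[OF d(1) join_deform_r[OF p s]] cone_pt_disc'[OF d(2) join_deform_r[OF p s]] by (auto simp: join_deform_def)
  show ?thesis
  proof (cases "?r = 0")
    case True
    then have "join_deform a b s p = (push a ?s (fst p), push b ?s (snd p))" unfolding join_deform_def True by simp
    then show ?thesis using p push_sph[OF s'] push_disc[OF s'] by (auto simp: join_set_iff)
  next
    case False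
    then have "2 * s - 1 > 0" "axis_weight p > 0" using axis_weight_bounds[OF p] by (auto simp: max_def split: if_splits)
    then have "?s = 1" "fst p 0 \<ge> 1/2 \<or> snd p 0 \<ge> 1/2" by (auto simp: axis_weight_def)
    then have "push a ?s (fst p) = base \<or> push b ?s (snd p) = base" using p push_1 by (auto simp: join_set_iff)
    then have "fst (join_deform a b s p) = base \<or> snd (join_deform a b s p) = base" by (auto simp: join_deform_def)
    then show ?thesis using m by (auto simp: join_set_iff)
  qed
qed

lemma join_deform_0: "p \<in> join_set a b \<Longrightarrow> join_deform a b 0 p = p"
  by (simp add: join_deform_def push_0 join_set_iff)

lemma join_deform_axis1: "0 \<le> s \<Longrightarrow> s \<le> 1 \<Longrightarrow> fst p = base \<Longrightarrow> fst (join_deform a b s p) = base"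
  by (simp add: join_deform_def push_base)

lemma join_deform_axis2: "0 \<le> s \<Longrightarrow> s \<le> 1 \<Longrightarrow> snd p = base \<Longrightarrow> snd (join_deform a b s p) = base"
  by (simp add: join_deform_def push_base)

lemma join_deform_1: "p \<in> join_set a b \<Longrightarrow> fst p = base \<or> snd p = base \<Longrightarrow> join_deform a b 1 p = (base, base)"
  using axis_weight_base[of p a b] by (simp add: join_deform_def)

lemma cont_join_deform: "continuous_on ({0..1} \<times> join_set a b) (\<lambda>q. join_deform a b (fst q) (snd q))"
proof -
  let ?D = "{0..1} \<times> join_set a b"
  have 1: "continuous_on ?D (\<lambda>q. fst (snd q) 0)" "continuous_on ?D (\<lambda>q. snd (snd q) 0)"
    by (rule cont_coord; intro continuous_intros)+
  show ?thesis
    unfolding join_deform_def axis_weight_def by (intro continuous_intros 1) auto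
qed

lemma cont_join_deform' [continuous_intros]:
  assumes "continuous_on S f" "continuous_on S g" "\<And>x. x \<in> S \<Longrightarrow> f x \<in> {0..1}" "\<And>x. x \<in> S \<Longrightarrow> g x \<in> join_set a b"
  shows "continuous_on S (\<lambda>x. join_deform a b (f x) (g x))"
proof -
  have "continuous_on S (\<lambda>x. (f x, g x))" by (intro continuous_intros assms)
  moreover have "(\<lambda>x. (f x, g x)) ` S \<subseteq> {0..1} \<times> join_set a b" using assms(3,4) by blast
  ultimately show ?thesis using continuous_on_compose2[OF cont_join_deform] by fastforce
qed

text \<open>At time 1 the deformation sends the axes to the base point and hence factors through the join
  quotient. The factor is the homotopy inverse, and the deformation itself provides both
  homotopies.\<close>

definition join_inv_explicit :: "nat \<Rightarrow> nat \<Rightarrow> (nat \<Rightarrow> real) \<Rightarrow> (nat \<Rightarrow> real) \<times> (nat \<Rightarrow> real)"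
  where "join_inv_explicit a b z = join_deform a b 1 (SOME p. p \<in> join_set a b \<and> join_quot a b p = z)"

lemma join_inv_explicit_join_quot: assumes p: "p \<in> join_set a b" shows "join_inv_explicit a b (join_quot a b p) = join_deform a b 1 p"
proof -
  define p' where "p' = (SOME p'. p' \<in> join_set a b \<and> join_quot a b p' = join_quot a b p)"
  have "\<exists>p'. p' \<in> join_set a b \<and> join_quot a b p' = join_quot a b p" using p by blast
  from someI_ex[OF this] have p': "p' \<in> join_set a b" "join_quot a b p' = join_quot a b p"
    unfolding p'_def by auto
  have "join_deform a b 1 p' = join_deform a b 1 p"
    using join_quot_inj[OF p'(1) p p'(2)] join_deform_1[OF p'(1)] join_deform_1[OF p] by metis
  then show ?thesis by (simp add: join_inv_explicit_def p'_def)
qed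

lemma cont_join_inv_explicit: "continuous_on (sph (Suc (a + b))) (join_inv_explicit a b)"
  by (rule continuous_on_descend[OF compact_join_set cont_join_quot join_quot_image, where F="join_deform a b 1"])
    (auto intro!: continuous_intros simp: join_inv_explicit_join_quot)

lemma join_inv_explicit_mem: assumes "z \<in> sph (Suc (a + b))" shows "join_inv_explicit a b z \<in> join_set a b"
proof -
  have "z \<in> join_quot a b ` join_set a b" using assms by (simp add: join_quot_image)
  then show ?thesis by (auto simp: join_inv_explicit_join_quot join_deform_join_set)
qed

lemma join_quot_base_pt [simp]: "join_quot a b (base, base) = base"
  using join_quot_base[of "(base,base)" a b] by simp

lemma join_inv_explicit_base [simp]: "join_inv_explicit a b base = (base, base)"
  using join_inv_explicit_join_quot[of "(base,base)" a b] join_deform_1[of "(base,base)" a b] by simp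

lemma pointed_homotopic_iff: "pointed_homotopic (top_of_set D) x W w f g \<longleftrightarrow> homotopic_rel D {x} W w f g" if "x \<in> D"
  using that by (simp add: pointed_homotopic_def homotopic_rel_def)

lemma pointed_homotopic_sph: "pointed_homotopic (nsphere k) base W w f g \<longleftrightarrow> homotopic_rel (sph k) {base} W w f g"
  using pointed_homotopic_iff[of base "sph k"] by (metis base_sph nsphere_eq)

lemma pointed_homotopic_join_set: "pointed_homotopic (join a b) (base,base) W w f g \<longleftrightarrow> homotopic_rel (join_set a b) {(base,base)} W w f g"
  using pointed_homotopic_iff[of "(base,base)" "join_set a b"] by (metis base_join_set join_eq)

lemma cm_join_set: "continuous_map (top_of_set D) (join a b) f \<longleftrightarrow> continuous_on D f \<and> f ` D \<subseteq> join_set a b"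
  by (subst join_eq) (auto simp: image_subset_iff)

lemma cm_sph: "continuous_map (top_of_set D) (nsphere k) f \<longleftrightarrow> continuous_on D f \<and> f ` D \<subseteq> sph k"
  by (subst nsphere_eq) (auto simp: image_subset_iff)

lemma join_inv_explicit_left: "homotopic_rel (join_set a b) {(base,base)} (join a b) (base,base) (\<lambda>p. join_inv_explicit a b (join_quot a b p)) (\<lambda>p. p)"
proof (rule homotopic_relI[where h="\<lambda>s p. join_deform a b (1 - s) p"])
  show "continuous_map (top_of_set ({0..1} \<times> join_set a b)) (join a b) (\<lambda>q. join_deform a b (1 - fst q) (snd q))"
    unfolding cm_join_set by (auto intro!: continuous_intros join_deform_join_set)
  show "join_deform a b (1 - s) x = (base, base)" if "0 \<le> s" "s \<le> 1" "x \<in> {(base, base)}" for s x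
    using that join_deform_axis1[of "1 - s" x a b] join_deform_axis2[of "1 - s" x a b] by (auto simp: prod_eq_iff)
qed (auto simp: join_inv_explicit_join_quot join_deform_0)

lemma join_inv_explicit_right: "homotopic_rel (sph (Suc (a + b))) {base} (nsphere (Suc (a + b))) base (\<lambda>z. join_quot a b (join_inv_explicit a b z)) (\<lambda>z. z)"
proof (rule homotopic_rel_descend[where p="join_quot a b" and D'="join_set a b" and C'="{p \<in> join_set a b. fst p = base \<or> snd p = base}"])
  show "homotopic_rel (join_set a b) {p \<in> join_set a b. fst p = base \<or> snd p = base} (nsphere (Suc (a + b))) base
     (\<lambda>x. join_quot a b (join_inv_explicit a b (join_quot a b x))) (\<lambda>x. join_quot a b x)"
  proof (rule homotopic_relI[where h="\<lambda>s p. join_quot a b (join_deform a b (1 - s) p)"])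
    have "continuous_on ({0..1} \<times> join_set a b) (\<lambda>q. join_quot a b (join_deform a b (1 - fst q) (snd q)))"
      by (rule continuous_on_compose2[OF cont_join_quot]) (auto intro!: continuous_intros join_deform_join_set)
    then show "continuous_map (top_of_set ({0..1} \<times> join_set a b)) (nsphere (Suc (a + b)))
       (\<lambda>q. join_quot a b (join_deform a b (1 - fst q) (snd q)))"
      unfolding cm_sph by (auto intro!: join_quot_mem join_deform_join_set simp del: add_Suc)
    show "join_quot a b (join_deform a b (1 - s) x) = base"
      if "0 \<le> s" "s \<le> 1" "x \<in> {p \<in> join_set a b. fst p = base \<or> snd p = base}" for s x
      using that join_deform_axis1[of "1 - s" x a b] join_deform_axis2[of "1 - s" x a b] join_quot_base[OF join_deform_join_set[of x a b "1 - s"]]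
      by auto
  qed (auto simp: join_inv_explicit_join_quot join_deform_0)
  show "{base} \<subseteq> join_quot a b ` {p \<in> join_set a b. fst p = base \<or> snd p = base}"
    by (auto intro!: image_eqI[of _ _ "(base,base)"])
  show "x = y \<or> x \<in> {p \<in> join_set a b. fst p = base \<or> snd p = base} \<and> y \<in> {p \<in> join_set a b. fst p = base \<or> snd p = base}"
    if "x \<in> join_set a b" "y \<in> join_set a b" "join_quot a b x = join_quot a b y" for x y
    using join_quot_inj[OF that] that by blast
qed (rule compact_join_set cont_join_quot join_quot_image)+

lemma join_inv_spec:
  "continuous_map (nsphere (Suc (a + b))) (join a b) (join_inv a b) \<and> join_inv a b base = (base, base) \<and>
     pointed_homotopic (join a b) (base, base) (join a b) (base, base)
       (join_inv a b \<circ> join_quot a b) id \<and>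
     pointed_homotopic (nsphere (Suc (a + b))) base (nsphere (Suc (a + b))) base
       (join_quot a b \<circ> join_inv a b) id"
  unfolding join_inv_def
proof (rule someI[of _ "join_inv_explicit a b"], intro conjI)
  show "continuous_map (nsphere (Suc (a + b))) (join a b) (join_inv_explicit a b)"
    using cont_join_inv_explicit[of a b] join_inv_explicit_mem[of _ a b] cm_join_set[of "sph (Suc (a + b))" a b "join_inv_explicit a b"]
    by (metis image_subsetI nsphere_eq)
  show "pointed_homotopic (join a b) (base, base) (join a b) (base, base) (join_inv_explicit a b \<circ> join_quot a b) id"
    using join_inv_explicit_left[of a b] by (simp add: pointed_homotopic_join_set o_def id_def)
  show "pointed_homotopic (nsphere (Suc (a + b))) base (nsphere (Suc (a + b))) base (join_quot a b \<circ> join_inv_explicit a b) id"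
    using join_inv_explicit_right[of a b] by (simp add: pointed_homotopic_sph o_def id_def)
qed simp

text \<open>Homotopy inverses are unique up to homotopy.\<close>

lemma join_inv_homotopic_explicit: "homotopic_rel (sph (Suc (a + b))) {base} (join a b) (base, base) (join_inv a b) (join_inv_explicit a b)"
proof -
  let ?S = "sph (Suc (a + b))"
  note spec = join_inv_spec[of a b]
  have l: "homotopic_rel (join_set a b) {(base,base)} (join a b) (base,base) (\<lambda>p. join_inv a b (join_quot a b p)) (\<lambda>p. p)"
    using spec by (simp add: pointed_homotopic_join_set o_def id_def)
  have "homotopic_rel ?S {base} (join a b) (base,base) (\<lambda>z. join_inv a b (join_quot a b (join_inv_explicit a b z))) (\<lambda>z. join_inv a b z)"
    by (rule homotopic_rel_post[OF join_inv_explicit_right]) (use spec in auto)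
  then have "homotopic_rel ?S {base} (join a b) (base,base) (\<lambda>z. join_inv a b z) (\<lambda>z. join_inv a b (join_quot a b (join_inv_explicit a b z)))"
    by (rule homotopic_rel_sym)
  also have "homotopic_rel ?S {base} (join a b) (base,base) (\<lambda>z. join_inv a b (join_quot a b (join_inv_explicit a b z))) (\<lambda>z. join_inv_explicit a b z)"
    by (rule homotopic_rel_pre[OF l cont_join_inv_explicit]) (auto simp: join_inv_explicit_mem simp del: add_Suc)
  finally show ?thesis by simp
qed

lemma join_inv_cong:
  assumes "homotopic_rel (join_set a b) {(base,base)} W w f g"
  shows "homotopic_rel (sph (Suc (a + b))) {base} W w (\<lambda>z. f (join_inv a b z)) (\<lambda>z. g (join_inv_explicit a b z))"
proof -
  have f: "homotopic_rel (join_set a b) {(base,base)} W w f f" using assms by (rule homotopic_rel_reflL)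
  have "continuous_map (join a b) W f" using homotopic_rel_cont[OF f] by (metis join_eq)
  moreover have "f (base,base) = w" using homotopic_rel_base[OF f] by simp
  ultimately have "homotopic_rel (sph (Suc (a + b))) {base} W w (\<lambda>z. f (join_inv a b z)) (\<lambda>z. f (join_inv_explicit a b z))"
    by (rule homotopic_rel_post[OF join_inv_homotopic_explicit])
  also have "homotopic_rel (sph (Suc (a + b))) {base} W w (\<lambda>z. f (join_inv_explicit a b z)) (\<lambda>z. g (join_inv_explicit a b z))"
    by (rule homotopic_rel_pre[OF assms cont_join_inv_explicit]) (auto simp: join_inv_explicit_mem simp del: add_Suc)
  finally show ?thesis .
qed

lemma join_inv_homotopic_rel:
  assumes "homotopic_rel (join_set a b) {(base,base)} W w f g"
  shows "homotopic_rel (sph (Suc (a + b))) {base} W w (\<lambda>z. f (join_inv a b z)) (\<lambda>z. g (join_inv a b z))"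
  using join_inv_cong[OF assms] join_inv_cong[OF homotopic_rel_reflR[OF assms]] by (meson homotopic_rel_sym homotopic_rel_trans)

section \<open>Pulling maps back along the smash product\<close>

text \<open>The pullback of a map on \<open>\<Sigma>(S\<^sup>a \<and> S\<^sup>b)\<close>, as a family of loops over \<open>S\<^sup>a \<times> S\<^sup>b\<close>.\<close>

definition smash_pull :: "nat \<Rightarrow> nat \<Rightarrow> ((nat \<Rightarrow> real) \<Rightarrow> 'b) \<Rightarrow> ((nat \<Rightarrow> real) \<times> (nat \<Rightarrow> real)) \<times> real \<Rightarrow> 'b"
  where "smash_pull a b \<phi> = (\<lambda>q. \<phi> (susp_pt (a + b) (smash a b (fst (fst q)) (snd (fst q))) (snd q)))"

text \<open>The loop \<open>t \<mapsto> G x [y,t]\<close> over \<open>(x, y)\<close>.\<close>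

definition family_loop :: "nat \<Rightarrow> ((nat \<Rightarrow> real) \<Rightarrow> (nat \<Rightarrow> real) \<Rightarrow> 'b) \<Rightarrow> ((nat \<Rightarrow> real) \<times> (nat \<Rightarrow> real)) \<times> real \<Rightarrow> 'b"
  where "family_loop b G = (\<lambda>q. G (fst (fst q)) (susp_pt b (snd (fst q)) (snd q)))"

lemma smash_pull_loop_homotopic:
  assumes "homotopic_rel (sph (Suc (a + b))) {base} W w \<phi> \<psi>"
  shows "loop_homotopic (sph a \<times> sph b) (sph a \<times> {base}) W w (smash_pull a b \<phi>) (smash_pull a b \<psi>)"
  unfolding loop_homotopic_def
proof (intro conjI)
  show "sph a \<times> {base} \<subseteq> sph a \<times> sph b" by auto
  have c: "continuous_on ((sph a \<times> sph b) \<times> {0..1})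
     (\<lambda>q. susp_pt (a + b) (smash a b (fst (fst q)) (snd (fst q))) (snd q))"
    by (intro continuous_intros) auto
  show "homotopic_rel ((sph a \<times> sph b) \<times> {0..1}) ((sph a \<times> {base}) \<times> {0..1} \<union> (sph a \<times> sph b) \<times> {0, 1}) W w
     (smash_pull a b \<phi>) (smash_pull a b \<psi>)"
    unfolding smash_pull_def
  proof (rule homotopic_rel_pre[OF assms c])
    show "susp_pt (a + b) (smash a b (fst (fst x)) (snd (fst x))) (snd x) \<in> {base}"
      if "x \<in> (sph a \<times> {base}) \<times> {0..1} \<union> (sph a \<times> sph b) \<times> {0, 1}" for x
      using that smash_eq_base[of "fst (fst x)" a base b] by auto
  qed (auto simp: susp_sph smash_sph)
qed

lemma family_loop_loop_homotopic:
  assumes "homotopic_rel (sph a \<times> sph (Suc b)) (sph a \<times> {base}) W w (\<lambda>p. G (fst p) (snd p)) (\<lambda>p. G' (fst p) (snd p))"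
  shows "loop_homotopic (sph a \<times> sph b) (sph a \<times> {base}) W w (family_loop b G) (family_loop b G')"
  unfolding loop_homotopic_def
proof (intro conjI)
  show "sph a \<times> {base} \<subseteq> sph a \<times> sph b" by auto
  have c: "continuous_on ((sph a \<times> sph b) \<times> {0..1})
     (\<lambda>q. (fst (fst q), susp_pt b (snd (fst q)) (snd q)))"
    by (intro continuous_intros)
  have "homotopic_rel ((sph a \<times> sph b) \<times> {0..1}) ((sph a \<times> {base}) \<times> {0..1} \<union> (sph a \<times> sph b) \<times> {0, 1}) W w
     (\<lambda>q. G (fst ((fst (fst q), susp_pt b (snd (fst q)) (snd q)))) (snd (fst (fst q), susp_pt b (snd (fst q)) (snd q))))
     (\<lambda>q. G' (fst ((fst (fst q), susp_pt b (snd (fst q)) (snd q)))) (snd (fst (fst q), susp_pt b (snd (fst q)) (snd q))))"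
    by (rule homotopic_rel_pre[OF assms c]) (auto simp: susp_sph)
  then show "homotopic_rel ((sph a \<times> sph b) \<times> {0..1}) ((sph a \<times> {base}) \<times> {0..1} \<union> (sph a \<times> sph b) \<times> {0, 1}) W w
     (family_loop b G) (family_loop b G')"
    by (simp add: family_loop_def)
qed

lemma join_map_cone:
  assumes "u \<in> sph a" "z \<in> sph b" "0 \<le> t" "t \<le> 1" "F u = G u base"
  shows "join_map b F G (u, cone_pt z t) = G u (susp_pt b z t)"
  using cone_collapse_cone[OF assms(2-4)] cone_collapse_sph[of "cone_pt z t" b] assms(5) by (auto simp: join_map_def)

text \<open>On the join path over \<open>(x, y)\<close> the map is constant along \<open>CX\<close> and then runs through \<open>G x [y,t]\<close>
  backwards. Deforming the join to make the axes collapse drags the starting point of this path along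
  the axis \<open>{base} \<times> CY\<close>, which adds the loop \<open>G base [y,t]\<close> in front.\<close>

lemma join_pullback:
  assumes G: "continuous_map (top_of_set (sph a \<times> sph (Suc b))) W (\<lambda>p. G (fst p) (snd p))"
    and Gb: "\<And>x. x \<in> sph a \<Longrightarrow> G x base = w"
  shows "loop_homotopic (sph a \<times> sph b) (sph a \<times> {base}) W w
     (smash_pull a b (\<lambda>z. join_map b (\<lambda>_. w) G (join_inv_explicit a b z))) (loop_cat (family_loop b (\<lambda>_. G base)) (loop_rev (family_loop b G)))"
proof -
  let ?K = "sph a \<times> sph b" and ?A = "sph a \<times> {base}"
  have AK: "?A \<subseteq> ?K" by auto
  define f where "f = join_map b (\<lambda>_. w) G"
  define N where "N s p = f (join_deform a b (1 - s) p)" for s p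
  have wW: "w \<in> topspace W"
    using continuous_map_image_subset_topspace[OF G] Gb[of base] by (force simp: image_subset_iff)
  have fc: "continuous_map (top_of_set (join_set a b)) W f"
    unfolding f_def by (rule join_map_cont1[OF _ G]) (use Gb wW in auto)
  have fbase: "f p = w" if "p \<in> join_set a b" "snd p = base" for p
    using that by (simp add: f_def join_map_def)
  have Nc: "continuous_map (top_of_set S) W (\<lambda>x. N (g x) (h x))"
    if "continuous_on S g" "continuous_on S h" "\<And>x. x \<in> S \<Longrightarrow> g x \<in> {0..1}" "\<And>x. x \<in> S \<Longrightarrow> h x \<in> join_set a b"
    for S and g :: "'z::topological_space \<Rightarrow> real" and h
    unfolding N_def
    by (rule cm_comp[OF fc]) (use that(3,4) in \<open>auto intro!: continuous_intros that(1,2) join_deform_join_set\<close>)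
  have N0: "N 0 p = w" if "p \<in> join_set a b" "fst p = base \<or> snd p = base" for p
    using join_deform_1[OF that] fbase[of "(base,base)"] by (simp add: N_def)
  have Nb: "N s p = w" if "p \<in> join_set a b" "snd p = base" "0 \<le> s" "s \<le> 1" for s p
    unfolding N_def using that join_deform_axis2[of "1 - s" p a b] by (intro fbase join_deform_join_set) auto
  have N1: "N 1 p = f p" if "p \<in> join_set a b" for p using that by (simp add: N_def join_deform_0)
  have bz: "(base, cone_pt z t) \<in> join_set a b" if "z \<in> sph b" "0 \<le> t" "t \<le> 1" for z t
    using cone_pt_disc[OF that] by (simp add: join_set_iff)
  have bz': "(base, z) \<in> join_set a b" if "z \<in> sph b" for z
    using that sph_disc by (simp add: join_set_iff)
  have sp: "smash_pull a b (\<lambda>z. f (join_inv_explicit a b z)) ((x,z),t) = N 0 (join_path x z t)"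
    if "x \<in> sph a" "z \<in> sph b" "0 \<le> t" "t \<le> 1" for x z t
    unfolding smash_pull_def using join_quot_join_path[OF that] join_inv_explicit_join_quot[OF join_path_mem[OF that]] by (simp add: N_def)
  \<comment> \<open>\<open>?n\<close> is the track of the starting point of the join paths under the deformation.\<close>
  let ?n = "\<lambda>q::(((nat \<Rightarrow> real) \<times> (nat \<Rightarrow> real)) \<times> real). N (snd q) (base, snd (fst q))"
  let ?g = "family_loop b G" and ?gb = "family_loop b (\<lambda>_. G base)" and ?c = "\<lambda>_. w"
  let ?f = "\<lambda>q::(((nat \<Rightarrow> real) \<times> (nat \<Rightarrow> real)) \<times> real). f (join_path (fst (fst q)) (snd (fst q)) (snd q))"
  let ?s = "smash_pull a b (\<lambda>z. f (join_inv_explicit a b z))"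
  have g: "loop_homotopic ?K ?A W w ?g ?g"
    by (intro family_loop_loop_homotopic homotopic_rel_refl G) (auto simp: Gb)
  have "continuous_on (sph a \<times> sph (Suc b)) (\<lambda>p. (base::nat\<Rightarrow>real, snd p))" by (intro continuous_intros)
  from cm_comp[OF G this] have Gb': "continuous_map (top_of_set (sph a \<times> sph (Suc b))) W (\<lambda>p. G base (snd p))" by auto
  have gb: "loop_homotopic ?K ?A W w ?gb ?gb"
    by (rule family_loop_loop_homotopic, rule homotopic_rel_refl[OF Gb']) (auto simp: Gb)
  have "homotopic_rel (sph (Suc (a + b))) {base} W w (\<lambda>z. f (join_inv_explicit a b z)) (\<lambda>z. f (join_inv_explicit a b z))"
    by (rule homotopic_rel_refl[OF cm_comp[OF fc cont_join_inv_explicit]]) (auto simp: join_inv_explicit_mem fbase simp del: add_Suc)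
  from smash_pull_loop_homotopic[OF this] have s: "loop_homotopic ?K ?A W w ?s ?s" .
  have n: "loop_homotopic ?K ?A W w ?n ?n"
  proof (rule loop_homotopic_refl)
    show "continuous_map (top_of_set (?K \<times> {0..1})) W ?n"
      by (rule Nc) (auto intro!: continuous_intros bz')
  qed (auto simp: Nb N0 N1 bz' fbase, simp add: f_def join_map_def)
  \<comment> \<open>On the square \<open>(s, t) \<mapsto> N s (base, [z,t])\<close> two sides are constant. Passing from one way
    around the square to the other identifies the loops along the other two sides.\<close>
  have "loop_homotopic ?K ?A W w (loop_cat ?c ?n) (loop_cat ?c ?gb)"
  proof (rule loop_homotopicI[where h="\<lambda>s q. N ((1 - s) * max 0 (2 * snd q - 1) + s * min 1 (2 * snd q))
        (base, cone_pt (snd (fst q)) ((1 - s) * min 1 (2 * snd q) + s * max 0 (2 * snd q - 1)))"])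
    have ab: "(1 - s) * u + s * v \<in> {0..1}" if "s \<in> {0..1}" "u \<in> {0..1}" "v \<in> {0..1}" for s u v :: real
      using that convex_bound_le[of u 1 v "1-s" s] by auto
    have mm: "max 0 (2 * t - 1) \<in> {0..1}" "min 1 (2 * t) \<in> {0..1}" if "0 \<le> t" "t \<le> 1" for t :: real
      using that by auto
    show "continuous_map (top_of_set ({0..1} \<times> (?K \<times> {0..1}))) W (\<lambda>p. N ((1 - fst p) * max 0 (2 * snd (snd p) - 1) + fst p * min 1 (2 * snd (snd p)))
        (base, cone_pt (snd (fst (snd p))) ((1 - fst p) * min 1 (2 * snd (snd p)) + fst p * max 0 (2 * snd (snd p) - 1))))"
    proof (rule Nc)
      fix p assume "p \<in> {0..1::real} \<times> (?K \<times> {0..1::real})"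
      then show "(1 - fst p) * max 0 (2 * snd (snd p) - 1) + fst p * min 1 (2 * snd (snd p)) \<in> {0..1}"
        "(base, cone_pt (snd (fst (snd p))) ((1 - fst p) * min 1 (2 * snd (snd p)) + fst p * max 0 (2 * snd (snd p) - 1))) \<in> join_set a b"
        using ab[of "fst p" "max 0 (2 * snd (snd p) - 1)" "min 1 (2 * snd (snd p))"]
          ab[of "fst p" "min 1 (2 * snd (snd p))" "max 0 (2 * snd (snd p) - 1)"] mm[of "snd (snd p)"] by (auto intro!: bz)
    qed (intro continuous_intros)+
    fix s t :: real and k assume s: "0 \<le> s" "s \<le> 1" and k: "k \<in> ?A" and t: "0 \<le> t" "t \<le> 1"
    show "N ((1 - s) * max 0 (2 * snd (k, t) - 1) + s * min 1 (2 * snd (k, t)))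
        (base, cone_pt (snd (fst (k, t))) ((1 - s) * min 1 (2 * snd (k, t)) + s * max 0 (2 * snd (k, t) - 1))) = w"
      using ab[of s "max 0 (2 * t - 1)" "min 1 (2 * t)"] mm[OF t] s k by (auto intro!: Nb)
  next
    fix k and t :: real assume k: "k \<in> ?K" "0 \<le> t" "t \<le> 1"
    show "loop_cat ?c ?n (k,t) = N ((1 - 0) * max 0 (2 * snd (k, t) - 1) + 0 * min 1 (2 * snd (k, t)))
        (base, cone_pt (snd (fst (k, t))) ((1 - 0) * min 1 (2 * snd (k, t)) + 0 * max 0 (2 * snd (k, t) - 1)))"
      using k bz[of "snd k" "2 * t"] by (cases "t \<le> 1/2") (auto simp: loop_cat_def N0)
    have "f (base, cone_pt (snd k) (2 * t - 1)) = G base (susp_pt b (snd k) (2 * t - 1))" if "\<not> t \<le> 1/2"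
      unfolding f_def by (rule join_map_cone[of base a]) (use k that Gb[of base] in auto)
    then show "loop_cat ?c ?gb (k,t) = N ((1 - 1) * max 0 (2 * snd (k, t) - 1) + 1 * min 1 (2 * snd (k, t)))
        (base, cone_pt (snd (fst (k, t))) ((1 - 1) * min 1 (2 * snd (k, t)) + 1 * max 0 (2 * snd (k, t) - 1)))"
      using k bz[of "snd k" "2 * t - 1"]
      by (cases "t \<le> 1/2") (auto simp: loop_cat_def Nb N1 family_loop_def)
  qed (use AK in \<open>auto simp: N0 N1 bz' fbase\<close>, simp add: f_def join_map_def)
  then have nb: "loop_homotopic ?K ?A W w ?n ?gb"
    using loop_cat_unitL[OF n] loop_cat_unitL[OF gb] by (meson loop_homotopic_sym loop_homotopic_trans)
  have gr: "loop_homotopic ?K ?A W w (loop_rev ?g) (loop_rev ?g)" by (rule loop_rev_cong[OF g])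
  have "loop_homotopic ?K ?A W w (loop_cat ?c (loop_rev ?g)) ?f"
  proof (rule loop_homotopic_eq)
    show "loop_homotopic ?K ?A W w (loop_cat ?c (loop_rev ?g)) (loop_cat ?c (loop_rev ?g))"
      using loop_cat_unitL[OF gr] by (rule loop_homotopic_reflL)
    fix k and t :: real assume k: "k \<in> ?K" "0 \<le> t" "t \<le> 1"
    then show "f (join_path (fst (fst (k, t))) (snd (fst (k, t))) (snd (k, t))) = loop_cat ?c (loop_rev ?g) (k, t)"
      unfolding f_def using join_map_join_path[of "fst k" a "snd k" b t "\<lambda>_. w" G] Gb[of "fst k"]
      by (auto simp: loop_cat_def loop_rev_def family_loop_def algebra_simps)
  qed
  then have ff: "loop_homotopic ?K ?A W w ?f (loop_rev ?g)"
    using loop_cat_unitL[OF gr] by (meson loop_homotopic_sym loop_homotopic_trans)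
  have "loop_homotopic ?K ?A W w ?s (loop_cat ?c ?s)" by (rule loop_homotopic_sym[OF loop_cat_unitL[OF s]])
  \<comment> \<open>At time \<open>s\<close> the join path is traversed under \<open>N s\<close>, after the part of the track up to \<open>s\<close>.\<close>
  also have "loop_homotopic ?K ?A W w (loop_cat ?c ?s) (loop_cat ?n ?f)"
  proof (rule loop_homotopicI[where h="\<lambda>s q. if snd q \<le> 1/2 then N (2 * snd q * s) (base, snd (fst q))
        else N s (join_path (fst (fst q)) (snd (fst q)) (2 * snd q - 1))"])
    show "continuous_map (top_of_set ({0..1} \<times> (?K \<times> {0..1}))) W
      (\<lambda>p. if snd (snd p) \<le> 1/2 then N (2 * snd (snd p) * fst p) (base, snd (fst (snd p)))
        else N (fst p) (join_path (fst (fst (snd p))) (snd (fst (snd p))) (2 * snd (snd p) - 1)))"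
    proof (rule cm_if)
      show "continuous_map (top_of_set {x \<in> {0..1} \<times> ?K \<times> {0..1}. snd (snd x) \<le> 1/2}) W
        (\<lambda>p. N (2 * snd (snd p) * fst p) (base, snd (fst (snd p))))"
      proof (rule Nc)
        fix x :: "real \<times> ((nat \<Rightarrow> real) \<times> (nat \<Rightarrow> real)) \<times> real"
        assume "x \<in> {x \<in> {0..1} \<times> ?K \<times> {0..1}. snd (snd x) \<le> 1/2}"
        then show "2 * snd (snd x) * fst x \<in> {0..1}" "(base, snd (fst (snd x))) \<in> join_set a b"
          using mult_le_one[of "2 * snd (snd x)" "fst x"] by (auto intro!: bz')
      qed (intro continuous_intros)+
      show "continuous_map (top_of_set {x \<in> {0..1} \<times> ?K \<times> {0..1}. 1/2 \<le> snd (snd x)}) W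
        (\<lambda>p. N (fst p) (join_path (fst (fst (snd p))) (snd (fst (snd p))) (2 * snd (snd p) - 1)))"
        by (rule Nc) (auto intro!: continuous_intros join_path_mem)
      fix x :: "real \<times> ((nat \<Rightarrow> real) \<times> (nat \<Rightarrow> real)) \<times> real" assume e: "snd (snd x) = 1/2"
      show "N (2 * snd (snd x) * fst x) (base, snd (fst (snd x))) =
         N (fst x) (join_path (fst (fst (snd x))) (snd (fst (snd x))) (2 * snd (snd x) - 1))"
        unfolding e by (simp add: join_path_def)
    qed (intro continuous_intros)
    fix k and t :: real assume k: "k \<in> ?K" "0 \<le> t" "t \<le> 1"
    show "loop_cat ?c ?s (k, t) = (if snd (k, t) \<le> 1/2 then N (2 * snd (k, t) * 0) (base, snd (fst (k, t)))
        else N 0 (join_path (fst (fst (k, t))) (snd (fst (k, t))) (2 * snd (k, t) - 1)))"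
      using k sp[of "fst k" "snd k" "2 * t - 1"] by (auto simp: loop_cat_def N0 bz')
    show "loop_cat ?n ?f (k, t) = (if snd (k, t) \<le> 1/2 then N (2 * snd (k, t) * 1) (base, snd (fst (k, t)))
        else N 1 (join_path (fst (fst (k, t))) (snd (fst (k, t))) (2 * snd (k, t) - 1)))"
      using k by (auto simp: loop_cat_def N1 join_path_mem)
  next
    fix s t :: real and k assume s: "0 \<le> s" "s \<le> 1" and k: "k \<in> ?A" and t: "0 \<le> t" "t \<le> 1"
    have "2 * t * s \<le> 1" if "t \<le> 1/2" using mult_le_one[of "2 * t" s] that t s by auto
    then show "(if snd (k, t) \<le> 1/2 then N (2 * snd (k, t) * s) (base, snd (fst (k, t)))
        else N s (join_path (fst (fst (k, t))) (snd (fst (k, t))) (2 * snd (k, t) - 1))) = w"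
      using s k t join_path_mem[of "fst k" a "snd k" b "2 * t - 1"]
      by (auto intro!: Nb simp: join_path_def)
  next
    fix s :: real and k assume s: "0 \<le> s" "s \<le> 1" and k: "k \<in> ?K"
    show "(if snd (k, 0::real) \<le> 1/2 then N (2 * snd (k, 0::real) * s) (base, snd (fst (k, 0::real)))
        else N s (join_path (fst (fst (k, 0::real))) (snd (fst (k, 0::real))) (2 * snd (k, 0) - 1))) = w"
      using s k by (auto simp: N0 bz')
    show "(if snd (k, 1::real) \<le> 1/2 then N (2 * snd (k, 1::real) * s) (base, snd (fst (k, 1::real)))
        else N s (join_path (fst (fst (k, 1::real))) (snd (fst (k, 1::real))) (2 * snd (k, 1) - 1))) = w"
      using s k join_path_mem[of "fst k" a "snd k" b 1] by (auto intro!: Nb simp: join_path_def)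
  qed (rule AK)
  also have "loop_homotopic ?K ?A W w (loop_cat ?n ?f) (loop_cat ?gb (loop_rev ?g))"
    by (rule loop_cat_cong[OF nb ff])
  finally show ?thesis unfolding f_def .
qed

text \<open>A null-homotopy of the pullback is constant over \<open>S\<^sup>a \<times> {base}\<close> but need not be so over
  \<open>{base} \<times> S\<^sup>b\<close>, so it does not descend to the smash product. Over \<open>{base} \<times> S\<^sup>b\<close> it is a
  null-homotopy of the constant family, which can be run backwards: after a neighbourhood
  of \<open>base\<close> in \<open>S\<^sup>a\<close> has been pushed to \<open>base\<close>, the given homotopy is stopped early there and then
  undone.\<close>

lemma smash_pull_null:
  assumes null: "loop_homotopic (sph a \<times> sph b) (sph a \<times> {base}) W w (smash_pull a b \<phi>) (\<lambda>_. w)"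
    and \<phi>: "homotopic_rel (sph (Suc (a + b))) {base} W w \<phi> \<phi>"
  shows "homotopic_rel (sph (Suc (a + b))) {base} W w \<phi> (\<lambda>_. w)"
proof -
  let ?K = "sph a \<times> sph b" and ?A = "sph a \<times> {base}"
  let ?D = "?K \<times> {0..1::real}"
  let ?C = "{q \<in> ?D. fst (fst q) = base \<or> snd (fst q) = base \<or> snd q = 0 \<or> snd q = 1}"
  let ?p = "\<lambda>q. susp_pt (a + b) (smash a b (fst (fst q)) (snd (fst q))) (snd q)"
  from null obtain N where Nc: "continuous_map (top_of_set ({0..1} \<times> ?D)) W (\<lambda>p. N (fst p) (snd p))"
    and N0: "\<And>k t. k \<in> ?K \<Longrightarrow> 0 \<le> t \<Longrightarrow> t \<le> 1 \<Longrightarrow> N (0::real) (k,t) = smash_pull a b \<phi> (k,t)"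
    and N1: "\<And>k t. k \<in> ?K \<Longrightarrow> 0 \<le> t \<Longrightarrow> t \<le> 1 \<Longrightarrow> N 1 (k,t) = w"
    and NA: "\<And>s k t. 0 \<le> s \<Longrightarrow> s \<le> 1 \<Longrightarrow> k \<in> ?A \<Longrightarrow> 0 \<le> t \<Longrightarrow> t \<le> 1 \<Longrightarrow> N s (k,t) = w"
    and Ne: "\<And>s k. 0 \<le> s \<Longrightarrow> s \<le> 1 \<Longrightarrow> k \<in> ?K \<Longrightarrow> N s (k,0) = w"
     "\<And>s k. 0 \<le> s \<Longrightarrow> s \<le> 1 \<Longrightarrow> k \<in> ?K \<Longrightarrow> N s (k,1) = w" by (rule loop_homotopicE) blast
  have \<phi>c: "continuous_map (top_of_set (sph (Suc (a + b)))) W \<phi>" by (rule homotopic_rel_cont[OF \<phi>])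
  have \<phi>b: "\<phi> base = w" using homotopic_rel_base[OF \<phi>] by simp
  \<comment> \<open>\<open>l\<close> is the time for which the null-homotopy is run. It vanishes at \<open>base\<close> and is 1
    wherever \<open>push a 1\<close> does not lead to \<open>base\<close>.\<close>
  define l where "l x = min 1 (2 * (1 - x 0))" for x :: "nat \<Rightarrow> real"
  have l: "0 \<le> l x" "l x \<le> 1" if "x \<in> sph a" for x using sph0_le[OF that] by (auto simp: l_def)
  have lb: "l base = 0" by (simp add: l_def base0)
  have l1: "l x = 1 \<or> push a 1 x = base" if "x \<in> sph a" for x
    using push_1[OF sph_disc[OF that]] by (cases "x 0 \<ge> 1/2") (auto simp: l_def)
  have sl: "0 \<le> s * l x" "s * l x \<le> 1" if "0 \<le> s" "s \<le> 1" "x \<in> sph a" for s x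
    using l[OF that(3)] that(1,2) by (auto intro: mult_le_one)
  have lc: "continuous_on S (\<lambda>q. l (g q))" if "continuous_on S g" for S :: "(real \<times> ((nat \<Rightarrow> real) \<times> (nat \<Rightarrow> real)) \<times> real) set" and g
    unfolding l_def by (intro continuous_intros cont_coord[OF that])
  have zero: "smash_pull a b \<phi> ((base,z),t) = w" if "z \<in> sph b" for z t
    using that smash_eq_base[of base a z b] \<phi>b by (simp add: smash_pull_def)
  have CD: "?C \<subseteq> ?D" by auto
  have "homotopic_rel ?D ?C W w (smash_pull a b \<phi>) (\<lambda>q. smash_pull a b \<phi> ((push a 1 (fst (fst q)), snd (fst q)), snd q))"
  proof (rule homotopic_relI[where h="\<lambda>s q. smash_pull a b \<phi> ((push a s (fst (fst q)), snd (fst q)), snd q)"])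
    show "continuous_map (top_of_set ({0..1} \<times> ?D)) W
      (\<lambda>p. smash_pull a b \<phi> ((push a (fst p) (fst (fst (snd p))), snd (fst (snd p))), snd (snd p)))"
      unfolding smash_pull_def
      by (rule cm_comp[OF \<phi>c]) (auto intro!: continuous_intros susp_sph smash_sph push_sph)
    show "smash_pull a b \<phi> ((push a s (fst (fst q)), snd (fst q)), snd q) = w"
      if "0 \<le> s" "s \<le> 1" "q \<in> ?C" for s q
      using that push_base[OF that(1,2), of a] push_sph[OF that(1,2)]
        smash_eq_base[of "push a s (fst (fst q))" a "snd (fst q)" b] \<phi>b
      by (auto simp: smash_pull_def)
  qed (use CD in \<open>auto simp: push_0 sph_disc\<close>)
  also have "homotopic_rel ?D ?C W w (\<lambda>q. smash_pull a b \<phi> ((push a 1 (fst (fst q)), snd (fst q)), snd q))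
     (\<lambda>q. N (l (fst (fst q))) ((base, snd (fst q)), snd q))"
  proof (rule homotopic_relI[where h="\<lambda>s q. N (s * l (fst (fst q))) ((push a 1 (fst (fst q)), snd (fst q)), snd q)"])
    have c: "continuous_on ({0..1} \<times> ?D) (\<lambda>p. (fst p * l (fst (fst (snd p))), ((push a 1 (fst (fst (snd p))), snd (fst (snd p))), snd (snd p))))"
      by (intro continuous_intros lc) auto
    show "continuous_map (top_of_set ({0..1} \<times> ?D)) W
      (\<lambda>p. N (fst p * l (fst (fst (snd p)))) ((push a 1 (fst (fst (snd p))), snd (fst (snd p))), snd (snd p)))"
      using cm_comp[OF Nc c] sl push_sph[of 1] by auto
    show "N (s * l (fst (fst q))) ((push a 1 (fst (fst q)), snd (fst q)), snd q) = w"
      if s: "0 \<le> s" "s \<le> 1" and q: "q \<in> ?C" for s q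
    proof -
      have *: "fst (fst q) \<in> sph a" "snd (fst q) \<in> sph b" "push a 1 (fst (fst q)) \<in> sph a" "0 \<le> snd q" "snd q \<le> 1"
        using q push_sph[of 1] by auto
      consider "fst (fst q) = base" | "snd (fst q) = base" | "snd q = 0" | "snd q = 1" using q by blast
      then show ?thesis
        using * Ne sl[OF s *(1)] by cases (auto simp: lb push_base N0 zero NA)
    qed
    show "N (l (fst (fst q))) ((base, snd (fst q)), snd q) = N (1 * l (fst (fst q))) ((push a 1 (fst (fst q)), snd (fst q)), snd q)"
      if "q \<in> ?D" for q
      using l1[of "fst (fst q)"] that N1 push_sph[of 1 "fst (fst q)" a] by auto
    show "smash_pull a b \<phi> ((push a 1 (fst (fst q)), snd (fst q)), snd q) =
         N (0 * l (fst (fst q))) ((push a 1 (fst (fst q)), snd (fst q)), snd q)" if "q \<in> ?D" for q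
      using that push_sph[of 1 "fst (fst q)" a] by (auto simp: N0)
  qed (rule CD)
  \<comment> \<open>What is left depends on \<open>x\<close> through \<open>l x\<close> only and is undone by running \<open>N\<close> backwards.\<close>
  also have "homotopic_rel ?D ?C W w (\<lambda>q. N (l (fst (fst q))) ((base, snd (fst q)), snd q)) (\<lambda>_. w)"
  proof (rule homotopic_relI[where h="\<lambda>s q. N ((1 - s) * l (fst (fst q))) ((base, snd (fst q)), snd q)"])
    have c: "continuous_on ({0..1} \<times> ?D) (\<lambda>p. ((1 - fst p) * l (fst (fst (snd p))), ((base::nat\<Rightarrow>real, snd (fst (snd p))), snd (snd p))))"
      by (intro continuous_intros lc)
    have sl': "0 \<le> (1 - s) * l x" "(1 - s) * l x \<le> 1" if "0 \<le> s" "s \<le> 1" "x \<in> sph a" for s x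
      using sl[of "1 - s" x] that by auto
    show "continuous_map (top_of_set ({0..1} \<times> ?D)) W
      (\<lambda>p. N ((1 - fst p) * l (fst (fst (snd p)))) ((base, snd (fst (snd p))), snd (snd p)))"
      using cm_comp[OF Nc c] sl' by auto
    show "N ((1 - s) * l (fst (fst q))) ((base, snd (fst q)), snd q) = w"
      if s: "0 \<le> s" "s \<le> 1" and q: "q \<in> ?C" for s q
    proof -
      have *: "fst (fst q) \<in> sph a" "snd (fst q) \<in> sph b" "0 \<le> snd q" "snd q \<le> 1" using q by auto
      consider "fst (fst q) = base" | "snd (fst q) = base" | "snd q = 0" | "snd q = 1" using q by blast
      then show ?thesis
        using * Ne sl'[OF s *(1)] by cases (auto simp: lb N0 zero NA)
    qed
  qed (use CD in \<open>auto simp: N0 zero\<close>)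
  finally have h: "homotopic_rel ?D ?C W w (\<lambda>q. \<phi> (?p q)) (\<lambda>_. w)" by (simp add: smash_pull_def)
  show ?thesis
  proof (rule homotopic_rel_descend[where p="?p" and D'="?D" and C'="?C", OF h compact_cylinder])
    show "continuous_on ?D ?p" by (intro continuous_intros) auto
    show "?p ` ?D = sph (Suc (a + b))"
    proof (intro equalityI subsetI)
      fix w assume "w \<in> sph (Suc (a + b))"
      then obtain v t where v: "v \<in> sph (a + b)" "0 \<le> t" "t \<le> 1" "susp_pt (a + b) v t = w" by (rule susp_surj)
      from v(1) obtain x y where "x \<in> sph a" "y \<in> sph b" "smash a b x y = v" by (rule smash_surj)
      with v show "w \<in> ?p ` ?D" by (intro image_eqI[of _ _ "((x,y),t)"]) auto
    qed (auto simp: susp_sph smash_sph)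
    show "{base} \<subseteq> ?p ` ?C"
      by (auto intro!: image_eqI[of _ _ "((base,base),0)"])
    fix q q' assume q: "q \<in> ?D" and q': "q' \<in> ?D" and e: "?p q = ?p q'"
    have p: "fst (fst q) \<in> sph a" "snd (fst q) \<in> sph b" "0 \<le> snd q" "snd q \<le> 1" using q by auto
    have p': "fst (fst q') \<in> sph a" "snd (fst q') \<in> sph b" "0 \<le> snd q'" "snd q' \<le> 1" using q' by auto
    have C: "?p q = base \<longleftrightarrow> q \<in> ?C" if q: "q \<in> ?D" for q
    proof -
      have m: "fst (fst q) \<in> sph a" "snd (fst q) \<in> sph b" "0 \<le> snd q" "snd q \<le> 1" using q by auto
      show ?thesis
        unfolding susp_eq_base[OF smash_sph[OF m(1,2)] m(3,4)] smash_eq_base[OF m(1,2)] using q by blast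
    qed
    show "q = q' \<or> q \<in> ?C \<and> q' \<in> ?C"
    proof (cases "?p q = base")
      case True
      then have "?p q' = base" using e by simp
      then show ?thesis using iffD1[OF C[OF q] True] iffD1[OF C[OF q']] by blast
    next
      case False
      then have 1: "smash a b (fst (fst q)) (snd (fst q)) = smash a b (fst (fst q')) (snd (fst q'))" "snd q = snd q'"
        using susp_inj[OF smash_sph[OF p(1,2)] smash_sph[OF p'(1,2)] p(3,4) p'(3,4) e] by simp_all
      moreover have "smash a b (fst (fst q)) (snd (fst q)) \<noteq> base" using False by auto
      ultimately have "fst (fst q) = fst (fst q')" "snd (fst q) = snd (fst q')"
        using smash_inj[OF p(1,2) p'(1,2)] by simp_all
      with 1 show ?thesis by (simp add: prod_eq_iff)
    qed
  qed
qed

section \<open>Homotopy groups as classes of loops\<close>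

definition susp_loop :: "nat \<Rightarrow> ((nat \<Rightarrow> real) \<Rightarrow> 'b) \<Rightarrow> (nat \<Rightarrow> real) \<times> real \<Rightarrow> 'b"
  where "susp_loop k \<phi> = (\<lambda>q. \<phi> (susp_pt k (fst q) (snd q)))"

text \<open>Pointed maps on \<open>\<Sigma>S\<^sup>k\<close> are families of loops over \<open>S\<^sup>k\<close>, and \<open>sphere_concat\<close> is concatenation of
  loops. The group laws for homotopy groups are therefore those for loops.\<close>

lemma susp_loop_iff:
  "loop_homotopic (sph k) {base} W w (susp_loop k \<phi>) (susp_loop k \<psi>) \<longleftrightarrow> homotopic_rel (sph (Suc k)) {base} W w \<phi> \<psi>"
proof
  have c: "continuous_on (sph k \<times> {0..1}) (\<lambda>q. susp_pt k (fst q) (snd q))" by (intro continuous_intros)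
  { assume h: "homotopic_rel (sph (Suc k)) {base} W w \<phi> \<psi>"
    have "homotopic_rel (sph k \<times> {0..1}) ({base} \<times> {0..1} \<union> sph k \<times> {0,1}) W w (susp_loop k \<phi>) (susp_loop k \<psi>)"
      unfolding susp_loop_def by (rule homotopic_rel_pre[OF h c]) (auto simp: susp_sph)
    then show "loop_homotopic (sph k) {base} W w (susp_loop k \<phi>) (susp_loop k \<psi>)" by (simp add: loop_homotopic_def) }
  assume "loop_homotopic (sph k) {base} W w (susp_loop k \<phi>) (susp_loop k \<psi>)"
  then have h: "homotopic_rel (sph k \<times> {0..1}) ({base} \<times> {0..1} \<union> sph k \<times> {0,1}) W w
     (\<lambda>q. \<phi> (susp_pt k (fst q) (snd q))) (\<lambda>q. \<psi> (susp_pt k (fst q) (snd q)))"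
    by (simp add: loop_homotopic_def susp_loop_def)
  show "homotopic_rel (sph (Suc k)) {base} W w \<phi> \<psi>"
  proof (rule homotopic_rel_descend[OF h _ c susp_image])
    show "compact (sph k \<times> {0..1::real})" by (intro compact_Times compact_sph compact_unit_interval)
    show "{base} \<subseteq> (\<lambda>q. susp_pt k (fst q) (snd q)) ` ({base} \<times> {0..1} \<union> sph k \<times> {0,1})"
      by (auto intro!: image_eqI[of _ _ "(base,0)"])
    fix x y assume xy: "x \<in> sph k \<times> {0..1::real}" "y \<in> sph k \<times> {0..1::real}"
      and e: "susp_pt k (fst x) (snd x) = susp_pt k (fst y) (snd y)"
    have m: "fst x \<in> sph k" "0 \<le> snd x" "snd x \<le> 1" "fst y \<in> sph k" "0 \<le> snd y" "snd y \<le> 1" using xy by auto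
    have "x = y \<or> (susp_pt k (fst x) (snd x) = base \<and> susp_pt k (fst y) (snd y) = base)"
      using susp_inj[OF m(1,4) m(2,3) m(5,6) e] e by (metis prod_eqI)
    then show "x = y \<or> x \<in> {base} \<times> {0..1} \<union> sph k \<times> {0,1} \<and> y \<in> {base} \<times> {0..1} \<union> sph k \<times> {0,1}"
      unfolding susp_eq_base[OF m(1-3)] susp_eq_base[OF m(4-6)] using xy by (cases x; cases y) auto
  qed
qed

definition sphere_rev :: "nat \<Rightarrow> ((nat \<Rightarrow> real) \<Rightarrow> 'b) \<Rightarrow> (nat \<Rightarrow> real) \<Rightarrow> 'b"
  where "sphere_rev k f z = (case susp_coords k z of (y, t) \<Rightarrow> f (susp_pt k y (1 - t)))"

lemma sphere_rev_susp: "y \<in> sph k \<Longrightarrow> 0 \<le> t \<Longrightarrow> t \<le> 1 \<Longrightarrow> sphere_rev k f (susp_pt k y t) = f (susp_pt k y (1 - t))"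
  unfolding sphere_rev_def by (rule susp_coords_eq[where w="f base"]) auto

lemma sphere_concat_susp:
  assumes "y \<in> sph k" "0 \<le> t" "t \<le> 1" "f base = w" "g base = w"
  shows "sphere_concat (Suc k) f g (susp_pt k y t) = (if t \<le> 1/2 then f (susp_pt k y (2 * t)) else g (susp_pt k y (2 * t - 1)))"
  unfolding sphere_concat_def diff_Suc_1
  by (rule susp_coords_eq[OF assms(1-3), where w=w]) (use assms(4,5) in auto)

lemma susp_loop_concat:
  assumes "y \<in> sph k" "0 \<le> t" "t \<le> 1" "f base = w" "g base = w"
  shows "susp_loop k (sphere_concat (Suc k) f g) (y, t) = loop_cat (susp_loop k f) (susp_loop k g) (y, t)"
  using sphere_concat_susp[OF assms(1-3), of f w g] assms(4,5) by (auto simp: susp_loop_def loop_cat_def)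

lemma smash_pull_concat:
  assumes "x \<in> sph a" "y \<in> sph b" "0 \<le> t" "t \<le> 1" "f base = w" "g base = w"
  shows "smash_pull a b (sphere_concat (Suc (a + b)) f g) ((x, y), t) = loop_cat (smash_pull a b f) (smash_pull a b g) ((x, y), t)"
  using sphere_concat_susp[OF smash_sph[OF assms(1,2)] assms(3,4), of f w g] assms(5,6) by (auto simp: smash_pull_def loop_cat_def)

lemma sphere_concat_homotopic_rel:
  assumes "homotopic_rel (sph (Suc k)) {base} W w f f'" "homotopic_rel (sph (Suc k)) {base} W w g g'"
  shows "homotopic_rel (sph (Suc k)) {base} W w (sphere_concat (Suc k) f g) (sphere_concat (Suc k) f' g')"
proof -
  have b: "f base = w" "f' base = w" "g base = w" "g' base = w"
    using homotopic_rel_base[OF homotopic_rel_reflL[OF assms(1)]] homotopic_rel_base[OF homotopic_rel_reflR[OF assms(1)]]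
      homotopic_rel_base[OF homotopic_rel_reflL[OF assms(2)]] homotopic_rel_base[OF homotopic_rel_reflR[OF assms(2)]] by auto
  have "loop_homotopic (sph k) {base} W w (loop_cat (susp_loop k f) (susp_loop k g)) (loop_cat (susp_loop k f') (susp_loop k g'))"
    by (rule loop_cat_cong) (simp_all only: susp_loop_iff assms)
  then have "loop_homotopic (sph k) {base} W w (susp_loop k (sphere_concat (Suc k) f g)) (susp_loop k (sphere_concat (Suc k) f' g'))"
    by (rule loop_homotopic_cong) (use b in \<open>simp_all add: susp_loop_concat\<close>)
  then show ?thesis by (simp only: susp_loop_iff)
qed

lemma susp_loop_concat_iff:
  assumes "f base = w" "g base = w"
  shows "loop_homotopic (sph k) {base} W w (loop_cat (susp_loop k f) (susp_loop k g)) (susp_loop k h) \<longleftrightarrow>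
    homotopic_rel (sph (Suc k)) {base} W w (sphere_concat (Suc k) f g) h"
  unfolding susp_loop_iff[symmetric]
  using loop_homotopic_cong[of "sph k" "{base}" W w "loop_cat (susp_loop k f) (susp_loop k g)" "susp_loop k h" "susp_loop k (sphere_concat (Suc k) f g)" "susp_loop k h"]
    loop_homotopic_cong[of "sph k" "{base}" W w "susp_loop k (sphere_concat (Suc k) f g)" "susp_loop k h" "loop_cat (susp_loop k f) (susp_loop k g)" "susp_loop k h"]
    assms by (auto simp: susp_loop_concat)

lemma sphere_rev_homotopic_rel:
  assumes "homotopic_rel (sph (Suc k)) {base} W w f g"
  shows "homotopic_rel (sph (Suc k)) {base} W w (sphere_rev k f) (sphere_rev k g)"
proof -
  have "loop_homotopic (sph k) {base} W w (loop_rev (susp_loop k f)) (loop_rev (susp_loop k g))"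
    by (rule loop_rev_cong) (simp only: susp_loop_iff assms)
  then have "loop_homotopic (sph k) {base} W w (susp_loop k (sphere_rev k f)) (susp_loop k (sphere_rev k g))"
    by (rule loop_homotopic_cong) (auto simp: susp_loop_def loop_rev_def sphere_rev_susp)
  then show ?thesis by (simp only: susp_loop_iff)
qed

lemma sphere_rev_susp_loop: "y \<in> sph k \<Longrightarrow> 0 \<le> t \<Longrightarrow> t \<le> 1 \<Longrightarrow> susp_loop k (sphere_rev k f) (y, t) = loop_rev (susp_loop k f) (y, t)"
  by (simp add: susp_loop_def loop_rev_def sphere_rev_susp)

lemma htpy_class_iff: "g \<in> htpy_class k W w f \<longleftrightarrow> homotopic_rel (sph k) {base} W w f g"
  by (simp add: htpy_class_def pointed_homotopic_sph)

lemma pointed_iff: "continuous_map (nsphere k) W f \<and> f base = w \<longleftrightarrow> homotopic_rel (sph k) {base} W w f f"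
proof
  assume "continuous_map (nsphere k) W f \<and> f base = w"
  then have "continuous_map (top_of_set (sph k)) W f" "f base = w" by (metis nsphere_eq, simp)
  then show "homotopic_rel (sph k) {base} W w f f" by (intro homotopic_rel_refl) auto
next
  assume "homotopic_rel (sph k) {base} W w f f"
  then show "continuous_map (nsphere k) W f \<and> f base = w"
    using homotopic_rel_cont[of "sph k"] homotopic_rel_base[of "sph k" "{base}"] by (metis nsphere_eq singletonI)
qed

lemma carrier_iff: "\<alpha> \<in> carrier (homotopy_group k W w) \<longleftrightarrow>
    (\<exists>f. homotopic_rel (sph k) {base} W w f f \<and> \<alpha> = htpy_class k W w f)"
  unfolding homotopy_group_def by (auto simp: pointed_iff)

lemma class_eq:
  assumes "homotopic_rel (sph k) {base} W w f f"
  shows "htpy_class k W w f = htpy_class k W w g \<longleftrightarrow> homotopic_rel (sph k) {base} W w f g"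
proof
  assume "htpy_class k W w f = htpy_class k W w g"
  then have "f \<in> htpy_class k W w g" using assms by (auto simp: htpy_class_iff)
  then show "homotopic_rel (sph k) {base} W w f g" by (simp add: htpy_class_iff homotopic_rel_sym)
next
  assume "homotopic_rel (sph k) {base} W w f g"
  then show "htpy_class k W w f = htpy_class k W w g"
    by (auto simp: htpy_class_iff intro: homotopic_rel_trans homotopic_rel_sym dest: homotopic_rel_trans[OF homotopic_rel_sym])
qed

lemma class_eqI: "homotopic_rel (sph k) {base} W w f g \<Longrightarrow> htpy_class k W w f = htpy_class k W w g"
proof -
  assume h: "homotopic_rel (sph k) {base} W w f g"
  show ?thesis using class_eq[OF homotopic_rel_reflL[OF h], of g] h by simp
qed

text \<open>This evaluates an operation on homotopy classes that is defined as a union over representatives.\<close>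

lemma UN_class:
  assumes f: "f \<in> S" and "\<And>g. g \<in> S \<Longrightarrow> homotopic_rel (sph k) {base} W w (T f) (T g)"
  shows "(\<Union>g\<in>S. htpy_class k W w (T g)) = htpy_class k W w (T f)"
proof -
  have "htpy_class k W w (T g) = htpy_class k W w (T f)" if "g \<in> S" for g
    using class_eqI[OF assms(2)[OF that]] by simp
  with f show ?thesis by blast
qed

lemma identity_class: "homotopic_rel (sph (Suc k)) {base} (nsphere (Suc k)) base id id"
  by (rule homotopic_rel_refl) (auto simp: cm_sph continuous_on_id)

lemma induced_class:
  assumes \<phi>: "continuous_map X Y \<phi>" "\<phi> x = y" and f: "homotopic_rel (sph k) {base} X x f f"
  shows "induced k Y y \<phi> (htpy_class k X x f) = htpy_class k Y y (\<lambda>z. \<phi> (f z))"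
  unfolding induced_def
proof (subst UN_class[where T="\<lambda>f. \<phi> \<circ> f" and f=f])
  show "homotopic_rel (sph k) {base} Y y (\<phi> \<circ> f) (\<phi> \<circ> g)" if "g \<in> htpy_class k X x f" for g
    using homotopic_rel_post[OF that[unfolded htpy_class_iff] \<phi>] by (simp add: o_def)
qed (use f in \<open>auto simp: htpy_class_iff o_def\<close>)

lemma homotopy_group_mult:
  assumes "homotopic_rel (sph (Suc k)) {base} W w f f" "homotopic_rel (sph (Suc k)) {base} W w g g"
  shows "htpy_class (Suc k) W w f \<otimes>\<^bsub>homotopy_group (Suc k) W w\<^esub> htpy_class (Suc k) W w g
     = htpy_class (Suc k) W w (sphere_concat (Suc k) f g)"
proof -
  have "(\<Union>g'\<in>htpy_class (Suc k) W w g. htpy_class (Suc k) W w (sphere_concat (Suc k) f' g'))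
     = htpy_class (Suc k) W w (sphere_concat (Suc k) f' g)" if "f' \<in> htpy_class (Suc k) W w f" for f'
    by (rule UN_class) (use that assms in \<open>auto simp: htpy_class_iff intro: sphere_concat_homotopic_rel homotopic_rel_reflR\<close>)
  then have "(\<Union>f'\<in>htpy_class (Suc k) W w f. \<Union>g'\<in>htpy_class (Suc k) W w g. htpy_class (Suc k) W w (sphere_concat (Suc k) f' g'))
     = (\<Union>f'\<in>htpy_class (Suc k) W w f. htpy_class (Suc k) W w (sphere_concat (Suc k) f' g))" by simp
  also have "\<dots> = htpy_class (Suc k) W w (sphere_concat (Suc k) f g)"
    by (rule UN_class) (use assms in \<open>auto simp: htpy_class_iff intro: sphere_concat_homotopic_rel\<close>)
  finally show ?thesis by (simp add: homotopy_group_def)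
qed

lemma homotopy_group_is_group:
  assumes w: "w \<in> topspace W"
  shows "group (homotopy_group (Suc k) W w)"
proof -
  let ?G = "homotopy_group (Suc k) W w"
  let ?R = "homotopic_rel (sph (Suc k)) {base} W w" and ?L = "loop_homotopic (sph k) {base} W w"
  have c: "?R (\<lambda>_. w) (\<lambda>_. w)" using w by (intro homotopic_rel_refl) auto
  have one: "\<one>\<^bsub>?G\<^esub> = htpy_class (Suc k) W w (\<lambda>_. w)" by (simp add: homotopy_group_def)
  have cc: "?R (sphere_concat (Suc k) f g) (sphere_concat (Suc k) f g)" if "?R f f" "?R g g" for f g
    by (rule sphere_concat_homotopic_rel[OF that])
  have bs: "f base = w" if "?R f f" for f using homotopic_rel_base[OF that] by simp
  have cl: "?L (susp_loop k (sphere_concat (Suc k) f g)) (loop_cat (susp_loop k f) (susp_loop k g))" if "?R f f" "?R g g" for f g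
    by (rule loop_homotopic_eq) (use that in \<open>simp_all add: susp_loop_iff susp_loop_concat[where w=w] bs cc\<close>)
  show ?thesis
  proof (rule groupI)
    fix x y assume "x \<in> carrier ?G" "y \<in> carrier ?G"
    then obtain f g where f: "?R f f" "?R g g" "x = htpy_class (Suc k) W w f" "y = htpy_class (Suc k) W w g"
      unfolding carrier_iff by blast
    then show "x \<otimes>\<^bsub>?G\<^esub> y \<in> carrier ?G"
      using cc[OF f(1,2)] homotopy_group_mult[OF f(1,2)] unfolding carrier_iff by blast
  next
    show "\<one>\<^bsub>?G\<^esub> \<in> carrier ?G" using c by (auto simp: carrier_iff one)
  next
    fix x y z assume "x \<in> carrier ?G" "y \<in> carrier ?G" "z \<in> carrier ?G"
    then obtain f g h where f: "?R f f" "?R g g" "?R h h"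
      and x: "x = htpy_class (Suc k) W w f" "y = htpy_class (Suc k) W w g" "z = htpy_class (Suc k) W w h"
      by (auto simp: carrier_iff)
    have l: "?L (susp_loop k f) (susp_loop k f)" "?L (susp_loop k g) (susp_loop k g)" "?L (susp_loop k h) (susp_loop k h)"
      using f by (simp_all only: susp_loop_iff)
    have "?L (susp_loop k (sphere_concat (Suc k) (sphere_concat (Suc k) f g) h)) (loop_cat (susp_loop k (sphere_concat (Suc k) f g)) (susp_loop k h))"
      by (intro cl cc f)
    also have "?L (loop_cat (susp_loop k (sphere_concat (Suc k) f g)) (susp_loop k h)) (loop_cat (loop_cat (susp_loop k f) (susp_loop k g)) (susp_loop k h))"
      by (intro loop_cat_cong cl f l)
    also have "?L (loop_cat (loop_cat (susp_loop k f) (susp_loop k g)) (susp_loop k h)) (loop_cat (susp_loop k f) (loop_cat (susp_loop k g) (susp_loop k h)))"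
      by (intro loop_cat_assoc l)
    also have "?L (loop_cat (susp_loop k f) (loop_cat (susp_loop k g) (susp_loop k h))) (loop_cat (susp_loop k f) (susp_loop k (sphere_concat (Suc k) g h)))"
      by (intro loop_cat_cong loop_homotopic_sym[OF cl] f l)
    also have "?L (loop_cat (susp_loop k f) (susp_loop k (sphere_concat (Suc k) g h))) (susp_loop k (sphere_concat (Suc k) f (sphere_concat (Suc k) g h)))"
      by (intro loop_homotopic_sym[OF cl] cc f)
    finally have "?R (sphere_concat (Suc k) (sphere_concat (Suc k) f g) h) (sphere_concat (Suc k) f (sphere_concat (Suc k) g h))"
      by (simp only: susp_loop_iff)
    then show "x \<otimes>\<^bsub>?G\<^esub> y \<otimes>\<^bsub>?G\<^esub> z = x \<otimes>\<^bsub>?G\<^esub> (y \<otimes>\<^bsub>?G\<^esub> z)"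
      unfolding x homotopy_group_mult[OF f(1,2)] homotopy_group_mult[OF f(2,3)] homotopy_group_mult[OF cc[OF f(1,2)] f(3)] homotopy_group_mult[OF f(1) cc[OF f(2,3)]]
      by (rule class_eqI)
  next
    fix x assume "x \<in> carrier ?G"
    then obtain f where f: "?R f f" and x: "x = htpy_class (Suc k) W w f" by (auto simp: carrier_iff)
    have l: "?L (susp_loop k f) (susp_loop k f)" using f by (simp only: susp_loop_iff)
    have "?L (susp_loop k (sphere_concat (Suc k) (\<lambda>_. w) f)) (loop_cat (susp_loop k (\<lambda>_. w)) (susp_loop k f))" by (rule cl[OF c f])
    also have "?L (loop_cat (susp_loop k (\<lambda>_. w)) (susp_loop k f)) (susp_loop k f)" using loop_cat_unitL[OF l] by (simp add: susp_loop_def)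
    finally have "?R (sphere_concat (Suc k) (\<lambda>_. w) f) f" by (simp only: susp_loop_iff)
    then show "\<one>\<^bsub>?G\<^esub> \<otimes>\<^bsub>?G\<^esub> x = x" unfolding x one homotopy_group_mult[OF c f] by (rule class_eqI)
    have r: "?R (sphere_rev k f) (sphere_rev k f)" by (rule sphere_rev_homotopic_rel[OF f])
    have "?L (susp_loop k (sphere_concat (Suc k) (sphere_rev k f) f)) (loop_cat (susp_loop k (sphere_rev k f)) (susp_loop k f))" by (rule cl[OF r f])
    also have "?L (loop_cat (susp_loop k (sphere_rev k f)) (susp_loop k f)) (loop_cat (loop_rev (susp_loop k f)) (susp_loop k f))"
      by (rule loop_cat_cong[OF _ l], rule loop_homotopic_eq) (use r in \<open>simp_all only: susp_loop_iff sphere_rev_susp_loop\<close>)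
    also have "?L (loop_cat (loop_rev (susp_loop k f)) (susp_loop k f)) (susp_loop k (\<lambda>_. w))"
      using loop_cat_inv(2)[OF l] by (simp add: susp_loop_def)
    finally have "?R (sphere_concat (Suc k) (sphere_rev k f) f) (\<lambda>_. w)" by (simp only: susp_loop_iff)
    then have "htpy_class (Suc k) W w (sphere_rev k f) \<otimes>\<^bsub>?G\<^esub> x = \<one>\<^bsub>?G\<^esub>"
      unfolding x one homotopy_group_mult[OF r f] by (rule class_eqI)
    moreover have "htpy_class (Suc k) W w (sphere_rev k f) \<in> carrier ?G" using r unfolding carrier_iff by blast
    ultimately show "\<exists>y\<in>carrier ?G. y \<otimes>\<^bsub>?G\<^esub> x = \<one>\<^bsub>?G\<^esub>" by blast
  qed
qed

text \<open>This is the form in which the sign in the suspension formula is established: a sum of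
  representatives is null-homotopic.\<close>

lemma homotopy_group_inv:
  assumes f: "homotopic_rel (sph (Suc k)) {base} W w f f" "homotopic_rel (sph (Suc k)) {base} W w g g"
    and fg: "homotopic_rel (sph (Suc k)) {base} W w (sphere_concat (Suc k) f g) (\<lambda>_. w)"
  shows "htpy_class (Suc k) W w f = inv\<^bsub>homotopy_group (Suc k) W w\<^esub> (htpy_class (Suc k) W w g)"
proof -
  have w: "w \<in> topspace W"
    using homotopic_rel_cont[OF f(1)] homotopic_rel_base[OF f(1)] continuous_map_image_subset_topspace by fastforce
  interpret group "homotopy_group (Suc k) W w" by (rule homotopy_group_is_group[OF w])
  show ?thesis
  proof (rule inv_equality[symmetric])
    show "htpy_class (Suc k) W w f \<otimes>\<^bsub>homotopy_group (Suc k) W w\<^esub> htpy_class (Suc k) W w g = \<one>\<^bsub>homotopy_group (Suc k) W w\<^esub>"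
      unfolding homotopy_group_mult[OF f] using class_eqI[OF fg] by (simp add: homotopy_group_def)
  qed (use f in \<open>unfold carrier_iff, blast+\<close>)
qed

text \<open>The pullback is additive, so this follows from the case of the constant map by subtraction.\<close>

lemma smash_pull_inj:
  assumes e: "loop_homotopic (sph a \<times> sph b) (sph a \<times> {base}) W w (smash_pull a b \<phi>) (smash_pull a b \<psi>)"
    and f: "homotopic_rel (sph (Suc (a + b))) {base} W w \<phi> \<phi>" "homotopic_rel (sph (Suc (a + b))) {base} W w \<psi> \<psi>"
  shows "homotopic_rel (sph (Suc (a + b))) {base} W w \<phi> \<psi>"
proof -
  let ?L = "loop_homotopic (sph a \<times> sph b) (sph a \<times> {base}) W w"
  let ?k = "a + b"
  let ?M = "loop_homotopic (sph ?k) {base} W w"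
  have r: "homotopic_rel (sph (Suc ?k)) {base} W w (sphere_rev ?k \<psi>) (sphere_rev ?k \<psi>)" by (rule sphere_rev_homotopic_rel[OF f(2)])
  have b: "\<phi> base = w" "sphere_rev ?k \<psi> base = w" using homotopic_rel_base[OF f(1)] homotopic_rel_base[OF r] by auto
  have "?L (loop_cat (smash_pull a b \<phi>) (smash_pull a b (sphere_rev ?k \<psi>))) (loop_cat (smash_pull a b \<psi>) (loop_rev (smash_pull a b \<psi>)))"
  proof (rule loop_cat_cong[OF e], rule loop_homotopic_eq[OF smash_pull_loop_homotopic[OF r]])
    show "loop_rev (smash_pull a b \<psi>) (x, t) = smash_pull a b (sphere_rev ?k \<psi>) (x, t)"
      if "x \<in> sph a \<times> sph b" "0 \<le> t" "t \<le> 1" for x t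
      using that sphere_rev_susp[OF smash_sph, of "fst x" a "snd x" b t \<psi>] by (auto simp: loop_rev_def smash_pull_def)
  qed
  also have "?L (loop_cat (smash_pull a b \<psi>) (loop_rev (smash_pull a b \<psi>))) (\<lambda>_. w)"
    by (rule loop_cat_inv(1)[OF smash_pull_loop_homotopic[OF f(2)]])
  finally have "?L (smash_pull a b (sphere_concat (Suc ?k) \<phi> (sphere_rev ?k \<psi>))) (\<lambda>_. w)"
    by (rule loop_homotopic_cong) (use b in \<open>auto simp: smash_pull_concat[where w=w]\<close>)
  from smash_pull_null[OF this sphere_concat_homotopic_rel[OF f(1) r]]
  have "homotopic_rel (sph (Suc ?k)) {base} W w (sphere_concat (Suc ?k) \<phi> (sphere_rev ?k \<psi>)) (\<lambda>_. w)" .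
  then have "?M (loop_cat (susp_loop ?k \<phi>) (susp_loop ?k (sphere_rev ?k \<psi>))) (susp_loop ?k (\<lambda>_. w))"
    using susp_loop_concat_iff[of \<phi> w "sphere_rev ?k \<psi>" ?k W "\<lambda>_. w"] b by simp
  then have 1: "?M (loop_cat (susp_loop ?k \<phi>) (loop_rev (susp_loop ?k \<psi>))) (\<lambda>_. w)"
    by (rule loop_homotopic_cong) (auto simp: loop_cat_def loop_rev_def susp_loop_def sphere_rev_susp)
  have l: "?M (susp_loop ?k \<phi>) (susp_loop ?k \<phi>)" "?M (susp_loop ?k \<psi>) (susp_loop ?k \<psi>)" using f by (simp_all only: susp_loop_iff)
  have "?M (loop_cat (susp_loop ?k \<phi>) (loop_rev (susp_loop ?k \<psi>))) (loop_cat (susp_loop ?k \<psi>) (loop_rev (susp_loop ?k \<psi>)))"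
    using 1 loop_homotopic_sym[OF loop_cat_inv(1)[OF l(2)]] by (rule loop_homotopic_trans)
  then have "?M (susp_loop ?k \<phi>) (susp_loop ?k \<psi>)" by (rule loop_cat_cancelR[OF _ l loop_rev_cong[OF l(2)]])
  then show ?thesis by (simp only: susp_loop_iff)
qed

section \<open>Suspension and the interchange law\<close>

text \<open>The representative that defines the suspension homomorphism.\<close>

definition susp_map :: "nat \<Rightarrow> nat \<Rightarrow> ((nat \<Rightarrow> real) \<Rightarrow> nat \<Rightarrow> real) \<Rightarrow> (nat \<Rightarrow> real) \<Rightarrow> nat \<Rightarrow> real"
  where "susp_map k m f z = (case susp_coords k z of (y, t) \<Rightarrow> susp_pt m (f y) t)"

lemma susp_map_susp: "y \<in> sph k \<Longrightarrow> 0 \<le> t \<Longrightarrow> t \<le> 1 \<Longrightarrow> f base = base \<Longrightarrow> susp_map k m f (susp_pt k y t) = susp_pt m (f y) t"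
  unfolding susp_map_def by (rule susp_coords_eq[where F="\<lambda>y t. susp_pt m (f y) t" and w=base]) auto

lemma homotopic_rel_susp:
  assumes "homotopic_rel D C (nsphere m) base f g"
  shows "homotopic_rel (D \<times> {0..1}) (C \<times> {0..1} \<union> D \<times> {0,1}) (nsphere (Suc m)) base
    (\<lambda>x. susp_pt m (f (fst x)) (snd x)) (\<lambda>x. susp_pt m (g (fst x)) (snd x))"
proof -
  from assms obtain h where h: "continuous_map (top_of_set ({0..1} \<times> D)) (nsphere m) (\<lambda>p. h (fst p) (snd p))" "C \<subseteq> D"
    "\<And>x. x \<in> D \<Longrightarrow> h (0::real) x = f x" "\<And>x. x \<in> D \<Longrightarrow> h 1 x = g x"
    "\<And>s x. 0 \<le> s \<Longrightarrow> s \<le> 1 \<Longrightarrow> x \<in> C \<Longrightarrow> h s x = base" by (rule homotopic_relE) blast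
  have hc: "continuous_on ({0..1} \<times> D) (\<lambda>p. h (fst p) (snd p))"
    and hm: "\<And>s x. 0 \<le> s \<Longrightarrow> s \<le> 1 \<Longrightarrow> x \<in> D \<Longrightarrow> h s x \<in> sph m"
    using h(1) unfolding cm_sph by (auto simp: image_subset_iff)
  show ?thesis
  proof (rule homotopic_relI[where h="\<lambda>s x. susp_pt m (h s (fst x)) (snd x)"])
    have "continuous_on ({0..1} \<times> D \<times> {0..1::real}) (\<lambda>p. (fst p, fst (snd p)))"
      by (intro continuous_intros)
    from continuous_on_comp[OF hc this]
    have "continuous_on ({0..1} \<times> D \<times> {0..1::real}) (\<lambda>p. h (fst p) (fst (snd p)))" by auto
    then have "continuous_on ({0..1} \<times> D \<times> {0..1::real}) (\<lambda>p. susp_pt m (h (fst p) (fst (snd p))) (snd (snd p)))"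
      by (intro continuous_intros)
    then show "continuous_map (top_of_set ({0..1} \<times> D \<times> {0..1})) (nsphere (Suc m))
       (\<lambda>p. susp_pt m (h (fst p) (fst (snd p))) (snd (snd p)))"
      unfolding cm_sph using hm by (auto intro!: susp_sph)
  qed (use h(2-5) in auto)
qed

lemma susp_map_homotopic_rel:
  assumes "homotopic_rel (sph k) {base} (nsphere m) base f g"
  shows "homotopic_rel (sph (Suc k)) {base} (nsphere (Suc m)) base (susp_map k m f) (susp_map k m g)"
proof -
  have b: "f base = base" "g base = base"
    using homotopic_rel_base[OF homotopic_rel_reflL[OF assms]] homotopic_rel_base[OF homotopic_rel_reflR[OF assms]] by auto
  have "loop_homotopic (sph k) {base} (nsphere (Suc m)) base
     (\<lambda>x. susp_pt m (f (fst x)) (snd x)) (\<lambda>x. susp_pt m (g (fst x)) (snd x))"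
    unfolding loop_homotopic_def using homotopic_rel_susp[OF assms] by simp
  then have "loop_homotopic (sph k) {base} (nsphere (Suc m)) base (susp_loop k (susp_map k m f)) (susp_loop k (susp_map k m g))"
    by (rule loop_homotopic_cong) (auto simp: susp_loop_def susp_map_susp b)
  then show ?thesis by (simp only: susp_loop_iff)
qed

lemma suspension_class:
  assumes "homotopic_rel (sph k) {base} (nsphere m) base f f"
  shows "suspension_hom k m (htpy_class k (nsphere m) base f) = htpy_class (Suc k) (nsphere (Suc m)) base (susp_map k m f)"
proof -
  have "suspension_hom k m (htpy_class k (nsphere m) base f)
    = (\<Union>f\<in>htpy_class k (nsphere m) base f. htpy_class (Suc k) (nsphere (Suc m)) base (susp_map k m f))"
    by (simp add: suspension_hom_def susp_map_def[abs_def])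
  also have "\<dots> = htpy_class (Suc k) (nsphere (Suc m)) base (susp_map k m f)"
    by (rule UN_class) (use assms in \<open>auto simp: htpy_class_iff intro: susp_map_homotopic_rel\<close>)
  finally show ?thesis .
qed

text \<open>A family of double loops is a family of loops over \<open>K \<times> [0,1]\<close>. Besides the concatenation in the
  second loop coordinate there is one in the first, obtained by exchanging the
  two coordinates.\<close>

definition swap_loops :: "('k \<times> real) \<times> real \<Rightarrow> ('k \<times> real) \<times> real"
  where "swap_loops x = ((fst (fst x), snd x), snd (fst x))"

definition first_cat :: "(('k \<times> real) \<times> real \<Rightarrow> 'b) \<Rightarrow> (('k \<times> real) \<times> real \<Rightarrow> 'b) \<Rightarrow> ('k \<times> real) \<times> real \<Rightarrow> 'b"
  where "first_cat f g = (\<lambda>x. loop_cat (\<lambda>y. f (swap_loops y)) (\<lambda>y. g (swap_loops y)) (swap_loops x))"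

definition first_rev :: "(('k \<times> real) \<times> real \<Rightarrow> 'b) \<Rightarrow> ('k \<times> real) \<times> real \<Rightarrow> 'b"
  where "first_rev f = (\<lambda>x. loop_rev (\<lambda>y. f (swap_loops y)) (swap_loops x))"

abbreviation double_homotopic :: "'k::topological_space set \<Rightarrow> 'k set \<Rightarrow> 'b topology \<Rightarrow> 'b \<Rightarrow>
    (('k \<times> real) \<times> real \<Rightarrow> 'b) \<Rightarrow> (('k \<times> real) \<times> real \<Rightarrow> 'b) \<Rightarrow> bool"
  where "double_homotopic K A W w \<equiv> loop_homotopic (K \<times> {0..1}) (A \<times> {0..1} \<union> K \<times> {0,1}) W w"

lemma double_homotopic_swap:
  assumes "double_homotopic K A W w f g"
  shows "double_homotopic K A W w (\<lambda>x. f (swap_loops x)) (\<lambda>x. g (swap_loops x))"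
proof -
  let ?K = "K \<times> {0..1::real}" and ?A = "A \<times> {0..1} \<union> K \<times> {0,1::real}"
  have A: "?A \<subseteq> ?K" and h: "homotopic_rel (?K \<times> {0..1}) (?A \<times> {0..1} \<union> ?K \<times> {0,1}) W w f g"
    using assms unfolding loop_homotopic_def by blast+
  have "homotopic_rel (?K \<times> {0..1}) (?A \<times> {0..1} \<union> ?K \<times> {0,1}) W w (\<lambda>x. f (swap_loops x)) (\<lambda>x. g (swap_loops x))"
  proof (rule homotopic_rel_pre[OF h])
    show "continuous_on (?K \<times> {0..1}) swap_loops" unfolding swap_loops_def by (intro continuous_intros)
    show "swap_loops x \<in> ?A \<times> {0..1} \<union> ?K \<times> {0,1}" if "x \<in> ?A \<times> {0..1} \<union> ?K \<times> {0,1}" for x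
      using that A by (cases x) (auto simp: swap_loops_def)
  qed (use A in \<open>auto simp: swap_loops_def\<close>)
  with A show ?thesis unfolding loop_homotopic_def by blast
qed

lemma first_cat_cong: "double_homotopic K A W w f f' \<Longrightarrow> double_homotopic K A W w g g' \<Longrightarrow> double_homotopic K A W w (first_cat f g) (first_cat f' g')"
  unfolding first_cat_def by (intro double_homotopic_swap loop_cat_cong)

lemma first_rev_cong: "double_homotopic K A W w f f' \<Longrightarrow> double_homotopic K A W w (first_rev f) (first_rev f')"
  unfolding first_rev_def by (intro double_homotopic_swap loop_rev_cong)

lemma swap_loops_twice [simp]: "swap_loops (swap_loops x) = x" by (simp add: swap_loops_def)

lemma first_cat_unitR: assumes f: "double_homotopic K A W w f f" shows "double_homotopic K A W w (first_cat f (\<lambda>_. w)) f"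
  using double_homotopic_swap[OF loop_cat_unitR[OF double_homotopic_swap[OF f]]] by (simp add: first_cat_def)

lemma first_cat_unitL: assumes f: "double_homotopic K A W w f f" shows "double_homotopic K A W w (first_cat (\<lambda>_. w) f) f"
  using double_homotopic_swap[OF loop_cat_unitL[OF double_homotopic_swap[OF f]]] by (simp add: first_cat_def)

lemma first_cat_inv: assumes f: "double_homotopic K A W w f f" shows "double_homotopic K A W w (first_cat (first_rev f) f) (\<lambda>_. w)"
  using double_homotopic_swap[OF loop_cat_inv(2)[OF double_homotopic_swap[OF f]]] by (simp add: first_cat_def first_rev_def)

lemma first_cat_assoc:
  assumes f: "double_homotopic K A W w f f" "double_homotopic K A W w g g" "double_homotopic K A W w h h"
  shows "double_homotopic K A W w (first_cat (first_cat f g) h) (first_cat f (first_cat g h))"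
  using double_homotopic_swap[OF loop_cat_assoc[OF double_homotopic_swap[OF f(1)] double_homotopic_swap[OF f(2)] double_homotopic_swap[OF f(3)]]]
  by (simp add: first_cat_def)

lemma interchange: "loop_cat (first_cat f g) (first_cat h k) = first_cat (loop_cat f h) (loop_cat g k)"
  by (auto simp: loop_cat_def first_cat_def swap_loops_def fun_eq_iff)

text \<open>The argument of Eckmann and Hilton: up to homotopy \<open>f = f + 0\<close> and \<open>g = 0 + g\<close> in the first direction,
  and the interchange law moves the sum in the second direction inside.\<close>

lemma loop_cat_first_cat:
  assumes w: "w \<in> topspace W" and f: "double_homotopic K A W w f f" "double_homotopic K A W w g g"
  shows "double_homotopic K A W w (loop_cat f g) (first_cat f g)"
proof -
  have "double_homotopic K A W w (loop_cat f g) (loop_cat (first_cat f (\<lambda>_. w)) (first_cat (\<lambda>_. w) g))"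
    by (intro loop_cat_cong loop_homotopic_sym[OF first_cat_unitR] loop_homotopic_sym[OF first_cat_unitL] f)
  also have "loop_cat (first_cat f (\<lambda>_. w)) (first_cat (\<lambda>_. w) g) = first_cat (loop_cat f (\<lambda>_. w)) (loop_cat (\<lambda>_. w) g)"
    by (rule interchange)
  also have "double_homotopic K A W w (first_cat (loop_cat f (\<lambda>_. w)) (loop_cat (\<lambda>_. w) g)) (first_cat f g)"
    by (intro first_cat_cong loop_cat_unitR loop_cat_unitL f)
  finally show ?thesis .
qed

lemma first_cat_first_rev_cancel:
  assumes w: "w \<in> topspace W" and f: "double_homotopic K A W w f f" "double_homotopic K A W w g g"
  shows "double_homotopic K A W w (loop_cat (first_cat f (first_rev g)) g) f"
proof -
  have r: "double_homotopic K A W w (first_rev g) (first_rev g)" by (rule first_rev_cong[OF f(2)])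
  have "double_homotopic K A W w (loop_cat (first_cat f (first_rev g)) g) (first_cat (first_cat f (first_rev g)) g)"
    by (intro loop_cat_first_cat first_cat_cong r f w)
  also have "double_homotopic K A W w (first_cat (first_cat f (first_rev g)) g) (first_cat f (first_cat (first_rev g) g))"
    by (intro first_cat_assoc r f)
  also have "double_homotopic K A W w (first_cat f (first_cat (first_rev g) g)) (first_cat f (\<lambda>_. w))"
    by (intro first_cat_cong first_cat_inv f)
  also have "double_homotopic K A W w (first_cat f (\<lambda>_. w)) f" by (rule first_cat_unitR[OF f(1)])
  finally show ?thesis .
qed

lemma base_nsphere: "base \<in> topspace (nsphere k)" by simp

text \<open>The loop family \<open>G base [y,t] - G x [y,t]\<close> given by \<open>join_pullback\<close> is suspended; its
  concatenation is then in the first loop coordinate. Adding the suspension of \<open>G x [y,t]\<close> in the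
  second loop coordinate cancels it, and the resulting relation descends from \<open>S\<^sup>b \<times> [0,1]\<close> to
  \<open>S\<^bsup>b+1\<^esup>\<close>.\<close>

lemma susp_pullback:
  assumes G: "continuous_on (sph a \<times> sph (Suc b)) (\<lambda>p. G (fst p) (snd p))"
     "\<And>x v. x \<in> sph a \<Longrightarrow> v \<in> sph (Suc b) \<Longrightarrow> G x v \<in> sph m"
    and Gb: "\<And>x. x \<in> sph a \<Longrightarrow> G x base = base"
  defines "c \<equiv> \<lambda>z. join_map b (\<lambda>_. base) G (join_inv_explicit a b z)"
  shows "loop_homotopic (sph a \<times> sph (Suc b)) (sph a \<times> {base}) (nsphere (Suc m)) base
     (loop_cat (smash_pull a (Suc b) (susp_map (Suc (a + b)) m c)) (\<lambda>q. susp_pt m (G (fst (fst q)) (snd (fst q))) (snd q)))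
     (\<lambda>q. susp_pt m (G base (snd (fst q))) (snd q))"
proof -
  let ?K = "sph a \<times> sph b" and ?A = "sph a \<times> {base}"
  let ?S = "\<lambda>f x. susp_pt m (f (fst x)) (snd x)"
  have G': "continuous_map (top_of_set (sph a \<times> sph (Suc b))) (nsphere m) (\<lambda>p. G (fst p) (snd p))"
    unfolding cm_sph using G by auto
  have cb: "c base = base" by (simp add: c_def join_map_def)
  have h: "loop_homotopic ?K ?A (nsphere m) base (smash_pull a b c) (loop_cat (family_loop b (\<lambda>_. G base)) (loop_rev (family_loop b G)))"
    unfolding c_def by (rule join_pullback[OF G' Gb])
  have curve: "loop_homotopic ?K ?A (nsphere m) base (family_loop b G) (family_loop b G)"
    by (intro family_loop_loop_homotopic homotopic_rel_refl G') (auto simp: Gb)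
  have "continuous_on (sph a \<times> sph (Suc b)) (\<lambda>p. (base::nat\<Rightarrow>real, snd p))" by (intro continuous_intros)
  from cm_comp[OF G' this] have Gb': "continuous_map (top_of_set (sph a \<times> sph (Suc b))) (nsphere m) (\<lambda>p. G base (snd p))" by auto
  have gb: "loop_homotopic ?K ?A (nsphere m) base (family_loop b (\<lambda>_. G base)) (family_loop b (\<lambda>_. G base))"
    by (rule family_loop_loop_homotopic, rule homotopic_rel_refl[OF Gb']) (auto simp: Gb)
  have dS: "double_homotopic ?K ?A (nsphere (Suc m)) base (?S f) (?S g)" if "loop_homotopic ?K ?A (nsphere m) base f g" for f g
    unfolding loop_homotopic_def
  proof (intro conjI)
    show "?A \<times> {0..1} \<union> ?K \<times> {0, 1} \<subseteq> ?K \<times> {0..1::real}" by auto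
    show "homotopic_rel ((?K \<times> {0..1}) \<times> {0..1}) ((?A \<times> {0..1} \<union> ?K \<times> {0, 1}) \<times> {0..1} \<union> (?K \<times> {0..1}) \<times> {0, 1})
      (nsphere (Suc m)) base (?S f) (?S g)"
      using that unfolding loop_homotopic_def by (intro homotopic_rel_susp) simp
  qed
  \<comment> \<open>Suspending leaves the old loop coordinate as the first of two.\<close>
  have eq: "?S (loop_cat f (loop_rev g)) = first_cat (?S f) (first_rev (?S g))" for f g :: "((nat \<Rightarrow> real) \<times> (nat \<Rightarrow> real)) \<times> real \<Rightarrow> nat \<Rightarrow> real"
    by (auto simp: first_cat_def first_rev_def loop_cat_def loop_rev_def swap_loops_def fun_eq_iff)
  have "double_homotopic ?K ?A (nsphere (Suc m)) base (loop_cat (?S (smash_pull a b c)) (?S (family_loop b G)))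
      (loop_cat (first_cat (?S (family_loop b (\<lambda>_. G base))) (first_rev (?S (family_loop b G)))) (?S (family_loop b G)))"
    unfolding eq[symmetric] by (intro loop_cat_cong dS h curve)
  also have "double_homotopic ?K ?A (nsphere (Suc m)) base (loop_cat (first_cat (?S (family_loop b (\<lambda>_. G base))) (first_rev (?S (family_loop b G)))) (?S (family_loop b G)))
      (?S (family_loop b (\<lambda>_. G base)))"
    by (intro first_cat_first_rev_cancel dS gb curve base_nsphere)
  finally have main: "double_homotopic ?K ?A (nsphere (Suc m)) base (loop_cat (?S (smash_pull a b c)) (?S (family_loop b G))) (?S (family_loop b (\<lambda>_. G base)))" .
  let ?p = "\<lambda>x::(((nat \<Rightarrow> real) \<times> (nat \<Rightarrow> real)) \<times> real) \<times> real. ((fst (fst (fst x)), susp_pt b (snd (fst (fst x))) (snd (fst x))), snd x)"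
  let ?f = "loop_cat (smash_pull a (Suc b) (susp_map (Suc (a + b)) m c)) (\<lambda>q. susp_pt m (G (fst (fst q)) (snd (fst q))) (snd q))"
  let ?g = "\<lambda>q::((nat \<Rightarrow> real) \<times> (nat \<Rightarrow> real)) \<times> real. susp_pt m (G base (snd (fst q))) (snd q)"
  let ?D = "(?K \<times> {0..1::real}) \<times> {0..1::real}"
  let ?C = "(?A \<times> {0..1} \<union> ?K \<times> {0, 1::real}) \<times> {0..1} \<union> (?K \<times> {0..1}) \<times> {0, 1::real}"
  have sp: "smash_pull a (Suc b) (susp_map (Suc (a + b)) m c) ((x, susp_pt b y t), r) = susp_pt m (smash_pull a b c ((x, y), t)) r"
    if "x \<in> sph a" "y \<in> sph b" "0 \<le> t" "t \<le> 1" "0 \<le> r" "r \<le> 1" for x y t r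
    using susp_map_susp[of "susp_pt (a + b) (smash a b x y) t" "Suc (a + b)" r c m] that cb
    by (simp add: smash_pull_def smash_susp susp_sph smash_sph)
  have "homotopic_rel ?D ?C (nsphere (Suc m)) base (\<lambda>x. ?f (?p x)) (\<lambda>x. ?g (?p x))"
    by (rule homotopic_rel_cong[OF conjunct2[OF main[unfolded loop_homotopic_def]]]) (auto simp: loop_cat_def sp family_loop_def)
  then have "homotopic_rel ((sph a \<times> sph (Suc b)) \<times> {0..1}) ((sph a \<times> {base}) \<times> {0..1} \<union> (sph a \<times> sph (Suc b)) \<times> {0, 1})
     (nsphere (Suc m)) base ?f ?g"
  proof (rule homotopic_rel_descend[where p="?p"])
    show "compact ?D" by (intro compact_Times compact_sph compact_unit_interval)
    show "continuous_on ?D ?p" by (intro continuous_intros)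
    show "?p ` ?D = (sph a \<times> sph (Suc b)) \<times> {0..1}"
    proof (intro equalityI subsetI)
      fix z assume z: "z \<in> (sph a \<times> sph (Suc b)) \<times> {0..1::real}"
      then have "snd (fst z) \<in> sph (Suc b)" by auto
      then obtain y t where "y \<in> sph b" "0 \<le> t" "t \<le> 1" "susp_pt b y t = snd (fst z)" by (rule susp_surj)
      with z show "z \<in> ?p ` ?D" by (intro image_eqI[of _ _ "(((fst (fst z), y), t), snd z)"]) (auto simp: prod_eq_iff)
    qed (auto simp: susp_sph)
    show "(sph a \<times> {base}) \<times> {0..1} \<union> (sph a \<times> sph (Suc b)) \<times> {0, 1} \<subseteq> ?p ` ?C"
    proof
      fix z assume "z \<in> (sph a \<times> {base}) \<times> {0..1} \<union> (sph a \<times> sph (Suc b)) \<times> {0, 1::real}"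
      then consider "fst (fst z) \<in> sph a" "snd (fst z) = base" "snd z \<in> {0..1}"
        | "fst (fst z) \<in> sph a" "snd (fst z) \<in> sph (Suc b)" "snd z \<in> {0,1}" by auto
      then show "z \<in> ?p ` ?C"
      proof cases
        case 1
        then show ?thesis by (intro image_eqI[of _ _ "(((fst (fst z), base), 0), snd z)"]) (auto simp: prod_eq_iff)
      next
        case 2
        obtain y t where "y \<in> sph b" "0 \<le> t" "t \<le> 1" "susp_pt b y t = snd (fst z)" using susp_surj[OF 2(2)] by metis
        with 2 show ?thesis by (intro image_eqI[of _ _ "(((fst (fst z), y), t), snd z)"]) (auto simp: prod_eq_iff)
      qed
    qed
    fix u v assume u: "u \<in> ?D" and v: "v \<in> ?D" and e: "?p u = ?p v"
    obtain x y t r where u': "u = (((x,y),t),r)" "x \<in> sph a" "y \<in> sph b" "0 \<le> t" "t \<le> 1" "0 \<le> r" "r \<le> 1"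
      using u by (cases u) auto
    obtain x' y' t' r' where v': "v = (((x',y'),t'),r')" "x' \<in> sph a" "y' \<in> sph b" "0 \<le> t'" "t' \<le> 1" "0 \<le> r'" "r' \<le> 1"
      using v by (cases v) auto
    have e': "x = x'" "susp_pt b y t = susp_pt b y' t'" "r = r'" using e u' v' by auto
    have "y = y' \<and> t = t' \<or> (y = base \<or> t = 0 \<or> t = 1) \<and> (y' = base \<or> t' = 0 \<or> t' = 1)"
      using susp_inj[OF u'(3) v'(3) u'(4,5) v'(4,5) e'(2)] susp_eq_base[OF u'(3-5)] susp_eq_base[OF v'(3-5)] e'(2) by metis
    then show "u = v \<or> u \<in> ?C \<and> v \<in> ?C" using u' v' e' by auto
  qed
  then show ?thesis unfolding loop_homotopic_def by auto
qed

section \<open>Orthogonal matrices and coordinate rotations\<close>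

definition orth_mat :: "nat \<Rightarrow> real mat \<Rightarrow> bool"
  where "orth_mat m A \<longleftrightarrow> A \<in> carrier_mat m m \<and> A * transpose_mat A = 1\<^sub>m m"

lemma rotate_coord: "A \<in> carrier_mat m m \<Longrightarrow> rotate A x i = (if i < m then \<Sum>j<m. A $$ (i, j) * x j else 0)"
  by (auto simp: rotate_def)

lemma rotate_mult:
  assumes "A \<in> carrier_mat m m" "B \<in> carrier_mat m m"
  shows "rotate (A * B) x = rotate A (rotate B x)"
proof
  fix i
  have AB: "A * B \<in> carrier_mat m m" using assms by simp
  have "(A * B) $$ (i,j) = (\<Sum>l<m. A $$ (i,l) * B $$ (l,j))" if "i < m" "j < m" for j
    using assms that by (auto simp: scalar_prod_def atLeast0LessThan)
  then have "(\<Sum>j<m. (A * B) $$ (i, j) * x j) = (\<Sum>j<m. \<Sum>l<m. A $$ (i,l) * B $$ (l,j) * x j)" if "i < m"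
    using that by (simp add: sum_distrib_right)
  also have "(\<Sum>j<m. \<Sum>l<m. A $$ (i,l) * B $$ (l,j) * x j) = (\<Sum>l<m. A $$ (i,l) * (\<Sum>j<m. B $$ (l,j) * x j))"
    by (subst sum.swap) (simp add: sum_distrib_left mult.assoc)
  finally show "rotate (A * B) x i = rotate A (rotate B x) i"
    by (simp add: rotate_coord[OF AB] rotate_coord[OF assms(1)] rotate_coord[OF assms(2)])
qed

lemma rotate_one:
  assumes "\<And>i. i \<ge> m \<Longrightarrow> x i = 0" shows "rotate (1\<^sub>m m) x = x"
proof
  fix i
  have "(\<Sum>j<m. (1\<^sub>m m :: real mat) $$ (i, j) * x j) = (\<Sum>j<m. if j = i then x j else 0)" if "i < m"
    using that by (intro sum.cong) auto
  then show "rotate (1\<^sub>m m) x i = x i"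
    using assms[of i] by (simp add: rotate_coord[of _ m])
qed

lemma orth_mat_transpose:
  assumes "orth_mat m A"
  shows "transpose_mat A * A = 1\<^sub>m m" "orth_mat m (transpose_mat A)"
proof -
  have A: "A \<in> carrier_mat m m" "transpose_mat A \<in> carrier_mat m m" "A * transpose_mat A = 1\<^sub>m m"
    using assms by (auto simp: orth_mat_def)
  show *: "transpose_mat A * A = 1\<^sub>m m" by (rule mat_mult_left_right_inverse[OF A])
  show "orth_mat m (transpose_mat A)" using A * by (simp add: orth_mat_def)
qed

lemma rotate_adjoint:
  assumes "A \<in> carrier_mat m m"
  shows "(\<Sum>i<m. rotate A x i * y i) = (\<Sum>j<m. x j * rotate (transpose_mat A) y j)"
proof -
  have T: "transpose_mat A \<in> carrier_mat m m" using assms by simp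
  have "(\<Sum>i<m. rotate A x i * y i) = (\<Sum>i<m. \<Sum>j<m. A $$ (i,j) * x j * y i)"
    by (simp add: rotate_coord[OF assms] sum_distrib_right)
  also have "\<dots> = (\<Sum>j<m. \<Sum>i<m. A $$ (i,j) * x j * y i)" by (rule sum.swap)
  also have "\<dots> = (\<Sum>j<m. x j * rotate (transpose_mat A) y j)"
  proof (rule sum.cong)
    fix j assume "j \<in> {..<m}"
    then show "(\<Sum>i<m. A $$ (i,j) * x j * y i) = x j * rotate (transpose_mat A) y j"
      using assms by (auto simp: rotate_coord[OF T] sum_distrib_left intro!: sum.cong)
  qed simp
  finally show ?thesis .
qed

lemma rotate_inv:
  assumes "orth_mat (Suc k) A" "\<And>i. i > k \<Longrightarrow> x i = 0"
  shows "rotate (transpose_mat A) (rotate A x) = x"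
proof -
  have A: "A \<in> carrier_mat (Suc k) (Suc k)" "transpose_mat A \<in> carrier_mat (Suc k) (Suc k)"
    using assms by (auto simp: orth_mat_def)
  show ?thesis
    unfolding rotate_mult[OF A(2,1), symmetric] orth_mat_transpose(1)[OF assms(1)]
    by (rule rotate_one) (use assms(2) in auto)
qed

lemma sqnorm_rotate:
  assumes "orth_mat (Suc k) A" "\<And>i. i > k \<Longrightarrow> x i = 0"
  shows "sqnorm k (rotate A x) = sqnorm k x"
proof -
  have A: "A \<in> carrier_mat (Suc k) (Suc k)" using assms by (simp add: orth_mat_def)
  have "(\<Sum>i<Suc k. rotate A x i * rotate A x i) = (\<Sum>j<Suc k. x j * x j)"
    using rotate_adjoint[OF A, of x "rotate A x"] rotate_inv[OF assms] by simp
  then show ?thesis by (simp add: lessThan_Suc_atMost power2_eq_square)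
qed

lemma rotate_sph:
  assumes "orth_mat (Suc k) A" "x \<in> sph k" shows "rotate A x \<in> sph k"
proof -
  have "A \<in> carrier_mat (Suc k) (Suc k)" using assms by (simp add: orth_mat_def)
  then show ?thesis using assms sqnorm_rotate[OF assms(1), of x] by (auto simp: sph_iff rotate_coord)
qed

lemma rotate_inv_sph: "orth_mat (Suc k) A \<Longrightarrow> x \<in> sph k \<Longrightarrow> rotate (transpose_mat A) (rotate A x) = x"
  by (rule rotate_inv) (auto simp: sph_iff)

lemma rotate_inv_sph': "orth_mat (Suc k) A \<Longrightarrow> x \<in> sph k \<Longrightarrow> rotate A (rotate (transpose_mat A) x) = x"
  using rotate_inv_sph[OF orth_mat_transpose(2), of k A x] by simp

lemma SO_incl_carrier: "A \<in> carrier_mat m m \<Longrightarrow> SO_incl A \<in> carrier_mat (Suc m) (Suc m)"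
  by (auto simp: SO_incl_def)

lemma SO_incl_index:
  assumes "A \<in> carrier_mat m m" "i < Suc m" "j < Suc m"
  shows "SO_incl A $$ (i, j) = (if i = 0 \<and> j = 0 then 1 else if i = 0 \<or> j = 0 then 0 else A $$ (i - 1, j - 1))"
  using assms by (auto simp: SO_incl_def)

lemma rotate_SO_incl_0: assumes "A \<in> carrier_mat m m" shows "rotate (SO_incl A) x 0 = x 0"
proof -
  have "(\<Sum>j<Suc m. SO_incl A $$ (0, j) * x j) = (\<Sum>j<Suc m. if j = 0 then x j else 0)"
    by (intro sum.cong) (auto simp: SO_incl_index[OF assms])
  then show ?thesis by (simp add: rotate_coord[OF SO_incl_carrier[OF assms]] del: sum.lessThan_Suc)
qed

lemma rotate_SO_incl_Suc:
  assumes "A \<in> carrier_mat m m" shows "rotate (SO_incl A) x (Suc i) = rotate A (\<lambda>j. x (Suc j)) i"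
proof (cases "i < m")
  case True
  have "(\<Sum>j<Suc m. SO_incl A $$ (Suc i, j) * x j) = (\<Sum>j<m. A $$ (i, j) * x (Suc j))"
    unfolding sum.lessThan_Suc_shift using True by (simp add: SO_incl_index[OF assms])
  then show ?thesis using True
    by (simp add: rotate_coord[OF SO_incl_carrier[OF assms]] rotate_coord[OF assms] del: sum.lessThan_Suc)
qed (simp add: rotate_coord[OF SO_incl_carrier[OF assms]] rotate_coord[OF assms])

lemma SO_incl_one: "SO_incl (1\<^sub>m m) = 1\<^sub>m (Suc m)"
  by (rule eq_matI) (auto simp: SO_incl_index[of _ m] SO_incl_def)

lemma SO_incl_transpose: "A \<in> carrier_mat m m \<Longrightarrow> transpose_mat (SO_incl A) = SO_incl (transpose_mat A)"
  by (rule eq_matI) (auto simp: SO_incl_index[of _ m] SO_incl_def)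

lemma SO_incl_mult:
  assumes "A \<in> carrier_mat m m" "B \<in> carrier_mat m m"
  shows "SO_incl A * SO_incl B = SO_incl (A * B)"
  using assms unfolding SO_incl_def
  by (subst mult_four_block_mat[of _ 1 1 _ m _ m _ _ 1 _ m]) auto

lemma orth_mat_SO_incl: assumes "orth_mat m A" shows "orth_mat (Suc m) (SO_incl A)"
proof -
  have A: "A \<in> carrier_mat m m" "transpose_mat A \<in> carrier_mat m m" "A * transpose_mat A = 1\<^sub>m m" using assms by (auto simp: orth_mat_def)
  show ?thesis
    unfolding orth_mat_def using SO_incl_carrier[OF A(1)] SO_incl_transpose[OF A(1)] SO_incl_mult[OF A(1,2)] A(3)
    by (simp add: SO_incl_one)
qed

lemma rotate_SO_incl_base: "A \<in> carrier_mat m m \<Longrightarrow> rotate (SO_incl A) base = base"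
proof
  fix i assume A: "A \<in> carrier_mat m m"
  show "rotate (SO_incl A) base i = base i"
    by (cases i) (simp_all add: rotate_SO_incl_0[OF A] rotate_SO_incl_Suc[OF A] rotate_coord[OF A] base_def)
qed

lemma rotate_cone_pt:
  assumes A: "A \<in> carrier_mat m m" and b: "rotate A base = base"
  shows "rotate A (cone_pt z c) = cone_pt (rotate A z) c"
proof
  fix i
  have "(\<Sum>j<m. A $$ (i, j) * cone_pt z c j) = (1 - c) * (\<Sum>j<m. A $$ (i, j) * base j) + c * (\<Sum>j<m. A $$ (i, j) * z j)"
    by (simp add: cone_pt_def sum_distrib_left sum.distrib[symmetric] algebra_simps)
  then have "i < m \<Longrightarrow> rotate A (cone_pt z c) i = (1 - c) * rotate A base i + c * rotate A z i"
    by (simp add: rotate_coord[OF A])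
  then have "i < m \<Longrightarrow> rotate A (cone_pt z c) i = cone_pt (rotate A z) c i"
    unfolding b by (simp add: cone_pt_def)
  moreover have "base i = 0" if "\<not> i < m" using fun_cong[OF b, of i] that by (simp add: rotate_coord[OF A])
  ultimately show "rotate A (cone_pt z c) i = cone_pt (rotate A z) c i"
    by (cases "i < m") (auto simp: cone_pt_def rotate_coord[OF A])
qed

definition orth_family :: "'a::topological_space set \<Rightarrow> nat \<Rightarrow> ('a \<Rightarrow> real mat) \<Rightarrow> bool"
  where "orth_family S m A \<longleftrightarrow> (\<forall>x\<in>S. orth_mat m (A x)) \<and> (\<forall>i<m. \<forall>j<m. continuous_on S (\<lambda>x. A x $$ (i, j)))"

lemma orth_family_carrier: "orth_family S m A \<Longrightarrow> x \<in> S \<Longrightarrow> A x \<in> carrier_mat m m" by (simp add: orth_family_def orth_mat_def)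
lemma orth_family_orth_mat: "orth_family S m A \<Longrightarrow> x \<in> S \<Longrightarrow> orth_mat m (A x)" by (simp add: orth_family_def)

lemma orth_family_comp: "orth_family T m A \<Longrightarrow> continuous_on S f \<Longrightarrow> (\<And>x. x \<in> S \<Longrightarrow> f x \<in> T) \<Longrightarrow> orth_family S m (\<lambda>x. A (f x))"
  unfolding orth_family_def using continuous_on_comp[of T _ S f] by blast

lemma orth_family_transpose: assumes "orth_family S m A" shows "orth_family S m (\<lambda>x. transpose_mat (A x))"
  unfolding orth_family_def
proof (intro conjI ballI allI impI)
  show "orth_mat m (transpose_mat (A x))" if "x \<in> S" for x using orth_mat_transpose(2) orth_family_orth_mat[OF assms that] by blast
  fix i j assume ij: "i < m" "j < m"
  then have "continuous_on S (\<lambda>x. A x $$ (j, i))" using assms by (auto simp: orth_family_def)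
  then show "continuous_on S (\<lambda>x. transpose_mat (A x) $$ (i, j))"
    by (rule continuous_on_eq) (use orth_family_carrier[OF assms] ij in \<open>auto dest!: orth_family_carrier[OF assms]\<close>)
qed

lemma orth_family_incl: assumes "orth_family S m A" shows "orth_family S (Suc m) (\<lambda>x. SO_incl (A x))"
  unfolding orth_family_def
proof (intro conjI ballI allI impI)
  show "orth_mat (Suc m) (SO_incl (A x))" if "x \<in> S" for x using orth_mat_SO_incl orth_family_orth_mat[OF assms that] by blast
  fix i j assume ij: "i < Suc m" "j < Suc m"
  have "continuous_on S (\<lambda>x. if i = 0 \<and> j = 0 then 1 else if i = 0 \<or> j = 0 then 0 else A x $$ (i - 1, j - 1))"
    using assms ij by (cases i; cases j) (auto simp: orth_family_def)
  then show "continuous_on S (\<lambda>x. SO_incl (A x) $$ (i, j))"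
    by (rule continuous_on_eq) (use ij in \<open>simp add: SO_incl_index[OF orth_family_carrier[OF assms]]\<close>)
qed

lemma rotate_cont:
  assumes A: "orth_family S m A" and f: "continuous_on S f"
  shows "continuous_on S (\<lambda>x. rotate (A x) (f x))"
proof (rule continuous_on_coordinatewise_then_product)
  fix i
  have c: "continuous_on S (\<lambda>x. f x j)" for j by (rule cont_coord[OF f])
  have "continuous_on S (\<lambda>x. if i < m then \<Sum>j<m. A x $$ (i, j) * f x j else 0)"
    using A by (cases "i < m") (auto simp: orth_family_def intro!: continuous_on_sum continuous_on_mult c)
  then show "continuous_on S (\<lambda>x. rotate (A x) (f x) i)"
    by (rule continuous_on_eq) (simp add: rotate_coord[OF orth_family_carrier[OF A]])
qed

lemma topspace_SO: "topspace (SO m) = SO_set m"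
  by (simp add: SO_def topspace_pullback_topology)

lemma SO_orth_family:
  assumes "continuous_map (top_of_set S) (SO m) A"
  shows "orth_family S m A"
proof -
  have mem: "A x \<in> SO_set m" if "x \<in> S" for x
    using continuous_map_image_subset_topspace[OF assms] that by (auto simp: topspace_SO)
  have "continuous_on S (\<lambda>x. A x $$ (i, j))" if ij: "i < m" "j < m" for i j
  proof -
    have "continuous_map (SO m) euclideanreal ((\<lambda>f. f (i,j)) \<circ> (\<lambda>A (i, j). if i < m \<and> j < m then A $$ (i, j) else 0))"
      unfolding SO_def by (rule continuous_map_pullback) (auto intro: continuous_map_product_projection)
    from continuous_map_compose[OF assms this] show ?thesis using ij by (simp add: o_def)
  qed
  with mem show ?thesis by (auto simp: orth_family_def orth_mat_def SO_set_def)
qed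

text \<open>The rotation by \<open>\<theta>\<close> in the plane of the coordinates \<open>j\<close> and \<open>j + 1\<close>.\<close>

definition plane_rot :: "nat \<Rightarrow> real \<Rightarrow> (nat \<Rightarrow> real) \<Rightarrow> nat \<Rightarrow> real"
  where "plane_rot j \<theta> v = (\<lambda>i. if i = j then cos \<theta> * v j - sin \<theta> * v (Suc j)
     else if i = Suc j then sin \<theta> * v j + cos \<theta> * v (Suc j) else v i)"

fun shift :: "nat \<Rightarrow> real \<Rightarrow> (nat \<Rightarrow> real) \<Rightarrow> nat \<Rightarrow> real" where
  "shift 0 \<theta> v = v"
| "shift (Suc k) \<theta> v = plane_rot (Suc k) \<theta> (shift k \<theta> v)"

fun unshift :: "nat \<Rightarrow> real \<Rightarrow> (nat \<Rightarrow> real) \<Rightarrow> nat \<Rightarrow> real" where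
  "unshift 0 \<theta> v = v"
| "unshift (Suc k) \<theta> v = unshift k \<theta> (plane_rot (Suc k) (- \<theta>) v)"

lemma plane_rot_inv: "plane_rot j \<theta> (plane_rot j (- \<theta>) v) = v"
proof
  fix i
  have 1: "cos \<theta> * (cos \<theta> * x + sin \<theta> * y) - sin \<theta> * (cos \<theta> * y - sin \<theta> * x) = x"
    "sin \<theta> * (cos \<theta> * x + sin \<theta> * y) + cos \<theta> * (cos \<theta> * y - sin \<theta> * x) = y" for x y :: real
  proof -
    have "c * (c * x + s * y) - s * (c * y - s * x) = (c * c + s * s) * x"
      "s * (c * x + s * y) + c * (c * y - s * x) = (c * c + s * s) * y" for c s :: real
      by (simp_all add: algebra_simps)
    from this[where c="cos \<theta>" and s="sin \<theta>"]
    show "cos \<theta> * (cos \<theta> * x + sin \<theta> * y) - sin \<theta> * (cos \<theta> * y - sin \<theta> * x) = x"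
      "sin \<theta> * (cos \<theta> * x + sin \<theta> * y) + cos \<theta> * (cos \<theta> * y - sin \<theta> * x) = y"
      unfolding sin_cos_squared_add3 by simp_all
  qed
  show "plane_rot j \<theta> (plane_rot j (- \<theta>) v) i = v i"
    using 1[of "v j" "v (Suc j)"] by (auto simp: plane_rot_def algebra_simps)
qed

lemma shift_unshift: "shift k \<theta> (unshift k \<theta> v) = v"
  by (induction k arbitrary: v) (simp_all add: plane_rot_inv)

lemma plane_rot_0 [simp]: "plane_rot j 0 v = v" by (auto simp: plane_rot_def)
lemma shift_0 [simp]: "shift k 0 v = v" by (induction k) auto
lemma unshift_0 [simp]: "unshift k 0 v = v" by (induction k arbitrary: v) auto

lemma plane_rot_sph:
  assumes v: "v \<in> sph m" and j: "Suc j \<le> m" shows "plane_rot j \<theta> v \<in> sph m"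
proof -
  have e: "{..m} = insert j (insert (Suc j) ({..m} - {j, Suc j}))" using j by auto
  have s: "sqnorm m u = (u j)\<^sup>2 + (u (Suc j))\<^sup>2 + (\<Sum>i\<in>{..m} - {j, Suc j}. (u i)\<^sup>2)" for u :: "nat \<Rightarrow> real"
    by (subst e, subst sum.insert, simp, simp, subst sum.insert) auto
  have "(\<Sum>i\<in>{..m} - {j, Suc j}. (plane_rot j \<theta> v i)\<^sup>2) = (\<Sum>i\<in>{..m} - {j, Suc j}. (v i)\<^sup>2)"
    by (rule sum.cong) (auto simp: plane_rot_def)
  moreover have "(c * x - s * y)\<^sup>2 + (s * x + c * y)\<^sup>2 = (c * c + s * s) * (x\<^sup>2 + y\<^sup>2)" for c s x y :: real
    by (simp add: power2_eq_square algebra_simps)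
  from this[where c="cos \<theta>" and x="v j" and s="sin \<theta>" and y="v (Suc j)"]
  have "(plane_rot j \<theta> v j)\<^sup>2 + (plane_rot j \<theta> v (Suc j))\<^sup>2 = (v j)\<^sup>2 + (v (Suc j))\<^sup>2"
    unfolding sin_cos_squared_add3 by (simp add: plane_rot_def)
  ultimately have "sqnorm m (plane_rot j \<theta> v) = sqnorm m v" unfolding s[of "plane_rot j \<theta> v"] s[of v] by simp
  with v j show ?thesis by (auto simp: sph_iff plane_rot_def)
qed

lemma shift_sph: "v \<in> sph m \<Longrightarrow> Suc k \<le> m \<Longrightarrow> shift k \<theta> v \<in> sph m"
  by (induction k) (auto intro: plane_rot_sph)

lemma unshift_sph: "v \<in> sph m \<Longrightarrow> Suc k \<le> m \<Longrightarrow> unshift k \<theta> v \<in> sph m"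
  by (induction k arbitrary: v) (auto intro: plane_rot_sph)

lemma plane_rot_base: "plane_rot (Suc j) \<theta> base = base" by (auto simp: plane_rot_def base_def)
lemma shift_base: "shift k \<theta> base = base" by (induction k) (auto simp: plane_rot_base)
lemma unshift_base: "unshift k \<theta> base = base" by (induction k) (auto simp: plane_rot_base)

lemma cont_plane_rot:
  assumes "continuous_on S f" "continuous_on S t"
  shows "continuous_on S (\<lambda>x. plane_rot j (t x) (f x))"
proof (rule continuous_on_coordinatewise_then_product)
  fix i
  have c: "continuous_on S (\<lambda>x. f x i)" for i by (rule cont_coord[OF assms(1)])
  have "continuous_on UNIV (cos :: real \<Rightarrow> real)" "continuous_on UNIV (sin :: real \<Rightarrow> real)"
    by (auto intro: continuous_intros)
  then have cs: "continuous_on S (\<lambda>x. cos (t x))" "continuous_on S (\<lambda>x. sin (t x))"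
    using continuous_on_comp[OF _ assms(2)] by auto
  show "continuous_on S (\<lambda>x. plane_rot j (t x) (f x) i)"
    unfolding plane_rot_def by (cases "i = j"; cases "i = Suc j") (simp_all add: continuous_on_add continuous_on_diff continuous_on_mult c cs)
qed

lemma cont_shift: "continuous_on S f \<Longrightarrow> continuous_on S t \<Longrightarrow> continuous_on S (\<lambda>x. shift k (t x) (f x))"
  by (induction k) (auto intro: cont_plane_rot)

lemma cont_unshift: "continuous_on S f \<Longrightarrow> continuous_on S t \<Longrightarrow> continuous_on S (\<lambda>x. unshift k (t x) (f x))"
proof (induction k arbitrary: f)
  case (Suc k)
  have "continuous_on S (\<lambda>x. - t x)" using Suc.prems(2) by (intro continuous_intros)
  then show ?case using Suc.IH[OF cont_plane_rot[OF Suc.prems(1)]] Suc.prems(2) by simp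
qed simp

text \<open>At a right angle the product of the rotations in the planes \<open>(1,2), \<dots>, (k,k+1)\<close> is, up to signs,
  the cyclic permutation of the coordinates \<open>1, \<dots>, k + 1\<close>.\<close>

lemma shift_quarter: "shift k (pi/2) v i = (if i = 0 then v 0 else if i \<le> k then - v (Suc i) else if i = Suc k then v 1 else v i)"
  by (induction k arbitrary: i) (auto simp: plane_rot_def)

text \<open>The action of \<open>diag(1, A, 1)\<close>.\<close>

definition rotate_fix_last :: "nat \<Rightarrow> real mat \<Rightarrow> (nat \<Rightarrow> real) \<Rightarrow> nat \<Rightarrow> real"
  where "rotate_fix_last q A v = (\<lambda>i. if i = Suc q then v i else rotate (SO_incl A) v i)"

lemma shift_conj:
  assumes A: "A \<in> carrier_mat q q" and w: "w \<in> sph (Suc q)"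
  shows "shift q (pi/2) (rotate (SO_incl (SO_incl A)) (unshift q (pi/2) w)) = rotate_fix_last q A w"
proof
  fix i
  define v where "v = unshift q (pi/2) w"
  have w': "w = shift q (pi/2) v" by (simp add: v_def shift_unshift)
  have I: "SO_incl A \<in> carrier_mat (Suc q) (Suc q)" by (rule SO_incl_carrier[OF A])
  let ?E = "rotate (SO_incl (SO_incl A)) v"
  have E: "?E 0 = v 0" "?E (Suc 0) = v (Suc 0)" "?E (Suc (Suc j)) = rotate A (\<lambda>j. v (Suc (Suc j))) j" for j
    by (simp_all add: rotate_SO_incl_0[OF I] rotate_SO_incl_Suc[OF I] rotate_SO_incl_0[OF A] rotate_SO_incl_Suc[OF A])
  have "shift q (pi/2) ?E i = rotate_fix_last q A w i"
  proof -
    have "i = 0 \<or> (\<exists>j. i = Suc j \<and> j < q) \<or> i = Suc q \<or> i > Suc q" by (cases i) auto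
    then consider "i = 0" | j where "i = Suc j" "j < q" | "i = Suc q" | "i > Suc q" by blast
    then show ?thesis
    proof cases
      case 1
      then show ?thesis by (simp add: shift_quarter E rotate_fix_last_def rotate_SO_incl_0[OF A] w')
    next
      case 2
      have "rotate A (\<lambda>l. w (Suc l)) j = - rotate A (\<lambda>l. v (Suc (Suc l))) j"
        unfolding w' using 2 by (simp add: rotate_coord[OF A] shift_quarter sum_negf[symmetric])
      then show ?thesis using 2 by (simp add: shift_quarter E rotate_fix_last_def rotate_SO_incl_Suc[OF A])
    next
      case 3
      then show ?thesis by (simp add: shift_quarter E rotate_fix_last_def w')
    next
      case 4
      define j where "j = i - 2"
      have j: "i = Suc (Suc j)" "j \<ge> q" using 4 by (simp_all add: j_def)
      show ?thesis using 4 j by (simp add: shift_quarter E rotate_fix_last_def rotate_SO_incl_Suc[OF A] rotate_coord[OF A])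
    qed
  qed
  then show "shift q (pi/2) (rotate (SO_incl (SO_incl A)) (unshift q (pi/2) w)) i = rotate_fix_last q A w i"
    by (simp add: v_def)
qed

text \<open>Unlike \<open>diag(1, 1, A)\<close>, which fixes the wrong coordinate, \<open>diag(1, A, 1)\<close> acts on \<open>\<Sigma>S\<^sup>q\<close> as the
  suspension of the action of \<open>diag(1, A)\<close> on \<open>S\<^sup>q\<close>.\<close>

lemma rotate_fix_last_susp:
  assumes A: "orth_mat q A" and z: "z \<in> sph q"
  shows "rotate_fix_last q A (susp_pt q z r) = susp_pt q (rotate (SO_incl A) z) r"
proof
  fix i
  have Ac: "A \<in> carrier_mat q q" using A by (simp add: orth_mat_def)
  have rz: "rotate (SO_incl A) z \<in> sph q" by (rule rotate_sph[OF orth_mat_SO_incl[OF A] z])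
  consider "i \<le> q" | "i = Suc q" | "i > Suc q" by linarith
  then show "rotate_fix_last q A (susp_pt q z r) i = susp_pt q (rotate (SO_incl A) z) r i"
  proof cases
    case 1
    let ?c = "(1 - cos (2 * pi * r)) / 2"
    have "rotate (SO_incl A) (susp_pt q z r) i = rotate (SO_incl A) (cone_pt z ?c) i"
      by (simp add: rotate_coord[OF SO_incl_carrier[OF Ac]] susp_le)
    also have "\<dots> = cone_pt (rotate (SO_incl A) z) ?c i"
      by (simp add: rotate_cone_pt[OF SO_incl_carrier[OF Ac] rotate_SO_incl_base[OF Ac]])
    finally show ?thesis using 1 by (simp add: rotate_fix_last_def susp_le)
  next
    case 2
    then show ?thesis by (simp add: rotate_fix_last_def susp_last[OF z] susp_last[OF rz] rotate_SO_incl_0[OF Ac])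
  next
    case 3
    then show ?thesis by (simp add: rotate_fix_last_def susp_beyond[OF rz] rotate_coord[OF SO_incl_carrier[OF Ac]])
  qed
qed

text \<open>Conjugation by the path of rotations from the identity to the cyclic permutation of coordinates
  joins \<open>diag(1, 1, A)\<close> to \<open>diag(1, A, 1)\<close>.\<close>

lemma shift_homotopy:
  assumes A: "orth_family (sph a) q A"
  shows "homotopic_rel (sph a \<times> sph (Suc q)) (sph a \<times> {base}) (nsphere (Suc q)) base
    (\<lambda>p. rotate (SO_incl (SO_incl (A (fst p)))) (snd p)) (\<lambda>p. rotate_fix_last q (A (fst p)) (snd p))"
proof (rule homotopic_relI[where h="\<lambda>s p. shift q (s * (pi/2)) (rotate (SO_incl (SO_incl (A (fst p)))) (unshift q (s * (pi/2)) (snd p)))"])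
  let ?D = "{0..1::real} \<times> (sph a \<times> sph (Suc q))"
  have c: "orth_family ?D (Suc (Suc q)) (\<lambda>p. SO_incl (SO_incl (A (fst (snd p)))))"
    by (intro orth_family_incl orth_family_comp[OF A] continuous_intros) auto
  have "continuous_on ?D (\<lambda>p. shift q (fst p * (pi/2)) (rotate (SO_incl (SO_incl (A (fst (snd p))))) (unshift q (fst p * (pi/2)) (snd (snd p)))))"
    by (intro cont_shift rotate_cont[OF c] cont_unshift continuous_intros)
  then show "continuous_map (top_of_set ?D) (nsphere (Suc q))
    (\<lambda>p. shift q (fst p * (pi/2)) (rotate (SO_incl (SO_incl (A (fst (snd p))))) (unshift q (fst p * (pi/2)) (snd (snd p)))))"
    unfolding cm_sph using orth_family_orth_mat[OF A]
    by (auto intro!: shift_sph rotate_sph orth_mat_SO_incl unshift_sph)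
  show "shift q (s * (pi/2)) (rotate (SO_incl (SO_incl (A (fst p)))) (unshift q (s * (pi/2)) (snd p))) = base"
    if "p \<in> sph a \<times> {base}" for p and s :: real
    using that rotate_SO_incl_base[OF SO_incl_carrier[OF orth_family_carrier[OF A]]]
    by (auto simp: unshift_base shift_base)
qed (use orth_family_carrier[OF A] in \<open>auto simp: shift_conj\<close>)

section \<open>The J-homomorphism on the image of the stabilizer\<close>

text \<open>The construction underlying the J-homomorphism, as a map \<open>S\<^bsup>a+b+1\<^esup> \<rightarrow> S\<^bsup>b+1\<^esup>\<close> for a family \<open>A\<close> of
  orthogonal matrices of size \<open>b + 1\<close>.\<close>

definition J_rep :: "nat \<Rightarrow> nat \<Rightarrow> ((nat \<Rightarrow> real) \<Rightarrow> real mat) \<Rightarrow> (nat \<Rightarrow> real) \<Rightarrow> nat \<Rightarrow> real"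
  where "J_rep a b A = (\<lambda>z. join_map b (\<lambda>_. base) (\<lambda>x v. rotate (SO_incl (A x)) v) (join_inv_explicit a b z))"

text \<open>The two families \<open>[A x y,t]\<close> and \<open>[y,t]\<close> of loops in \<open>\<Sigma>S\<^sup>q\<close>, whose difference is the pullback of
  the J-homomorphism.\<close>

definition susp_action :: "nat \<Rightarrow> ((nat \<Rightarrow> real) \<Rightarrow> real mat) \<Rightarrow> ((nat \<Rightarrow> real) \<times> (nat \<Rightarrow> real)) \<times> real \<Rightarrow> nat \<Rightarrow> real"
  where "susp_action q A = (\<lambda>p. susp_pt q (rotate (SO_incl (A (fst (fst p)))) (snd (fst p))) (snd p))"

definition susp_second :: "nat \<Rightarrow> ((nat \<Rightarrow> real) \<times> (nat \<Rightarrow> real)) \<times> real \<Rightarrow> nat \<Rightarrow> real"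
  where "susp_second q = (\<lambda>p. susp_pt q (snd (fst p)) (snd p))"

abbreviation smash_loop_homotopic :: "nat \<Rightarrow> nat \<Rightarrow> (((nat \<Rightarrow> real) \<times> (nat \<Rightarrow> real)) \<times> real \<Rightarrow> nat \<Rightarrow> real) \<Rightarrow>
    (((nat \<Rightarrow> real) \<times> (nat \<Rightarrow> real)) \<times> real \<Rightarrow> nat \<Rightarrow> real) \<Rightarrow> bool"
  where "smash_loop_homotopic a q \<equiv> loop_homotopic (sph a \<times> sph q) (sph a \<times> {base}) (nsphere (Suc q)) base"

lemma act_cont:
  assumes A: "orth_family (sph a) m A" and k: "m = Suc k"
  shows "continuous_on (sph a \<times> sph k) (\<lambda>p. rotate (A (fst p)) (snd p))"
proof -
  have "orth_family (sph a \<times> sph k) m (\<lambda>p. A (fst p))" by (rule orth_family_comp[OF A]) (auto intro!: continuous_intros)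
  then show ?thesis by (rule rotate_cont) (intro continuous_intros)
qed

lemma rotate_incl_one: "v \<in> sph k \<Longrightarrow> rotate (SO_incl (1\<^sub>m k)) v = v"
  unfolding SO_incl_one by (rule rotate_one) (auto simp: sph_iff)

lemma J_rep_homotopic_rel:
  assumes A: "orth_family (sph a) (Suc b) A"
  shows "homotopic_rel (sph (Suc (a + b))) {base} (nsphere (Suc b)) base (J_rep a b A) (J_rep a b A)"
proof -
  have c: "continuous_on (sph a \<times> sph (Suc b)) (\<lambda>p. rotate (SO_incl (A (fst p))) (snd p))"
    by (rule act_cont[OF orth_family_incl[OF A]]) simp
  have bs: "rotate (SO_incl (A x)) base = base" if "x \<in> sph a" for x
    by (rule rotate_SO_incl_base[OF orth_family_carrier[OF A that]])
  have m: "rotate (SO_incl (A x)) v \<in> sph (Suc b)" if "x \<in> sph a" "v \<in> sph (Suc b)" for x v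
    by (rule rotate_sph[OF orth_mat_SO_incl[OF orth_family_orth_mat[OF A that(1)]] that(2)])
  have "continuous_map (top_of_set (join_set a b)) (nsphere (Suc b)) (join_map b (\<lambda>_. base) (\<lambda>x v. rotate (SO_incl (A x)) v))"
    by (rule join_map_cont1) (use c bs m in \<open>auto simp: cm_sph\<close>)
  then have "continuous_map (top_of_set (sph (Suc (a + b)))) (nsphere (Suc b)) (J_rep a b A)"
    unfolding J_rep_def by (rule cm_comp[OF _ cont_join_inv_explicit]) (rule join_inv_explicit_mem)
  then show ?thesis by (rule homotopic_rel_refl) (auto simp: J_rep_def join_map_def)
qed

text \<open>\<open>\<Sigma> c(A) + [A x y,t] = [y,t]\<close> for the pullbacks.\<close>

lemma J_rep_pullback:
  assumes A: "orth_family (sph a) (Suc b) A" and b: "A base = 1\<^sub>m (Suc b)"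
  shows "smash_loop_homotopic a (Suc b) (loop_cat (smash_pull a (Suc b) (susp_map (Suc (a + b)) (Suc b) (J_rep a b A))) (susp_action (Suc b) A)) (susp_second (Suc b))"
proof -
  have c: "continuous_on (sph a \<times> sph (Suc b)) (\<lambda>p. rotate (SO_incl (A (fst p))) (snd p))"
    by (rule act_cont[OF orth_family_incl[OF A]]) simp
  have bs: "rotate (SO_incl (A x)) base = base" if "x \<in> sph a" for x
    by (rule rotate_SO_incl_base[OF orth_family_carrier[OF A that]])
  have m: "rotate (SO_incl (A x)) v \<in> sph (Suc b)" if "x \<in> sph a" "v \<in> sph (Suc b)" for x v
    by (rule rotate_sph[OF orth_mat_SO_incl[OF orth_family_orth_mat[OF A that(1)]] that(2)])
  from susp_pullback[where G="\<lambda>x v. rotate (SO_incl (A x)) v" and a=a and b=b and m="Suc b", OF c m bs]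
  show ?thesis
    by (rule loop_homotopic_cong) (auto simp: J_rep_def susp_action_def susp_second_def b rotate_incl_one)
qed

lemma homotopic_rel_rotate:
  assumes h: "homotopic_rel (sph a) {base} (SO (Suc q)) (1\<^sub>m (Suc q)) \<rho> \<rho>'"
  shows "homotopic_rel (sph a \<times> sph (Suc q)) (sph a \<times> {base}) (nsphere (Suc q)) base
    (\<lambda>p. rotate (SO_incl (\<rho> (fst p))) (snd p)) (\<lambda>p. rotate (SO_incl (\<rho>' (fst p))) (snd p))"
proof -
  from h obtain k where k: "continuous_map (top_of_set ({0..1} \<times> sph a)) (SO (Suc q)) (\<lambda>p. k (fst p) (snd p))"
    "\<And>x. x \<in> sph a \<Longrightarrow> k (0::real) x = \<rho> x" "\<And>x. x \<in> sph a \<Longrightarrow> k 1 x = \<rho>' x" by (rule homotopic_relE) blast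
  have A: "orth_family ({0..1} \<times> sph a) (Suc q) (\<lambda>p. k (fst p) (snd p))" by (rule SO_orth_family[OF k(1)])
  have o: "orth_mat (Suc q) (k s x)" if "0 \<le> s" "s \<le> 1" "x \<in> sph a" for s x
    using orth_family_orth_mat[OF A, of "(s,x)"] that by auto
  show ?thesis
  proof (rule homotopic_relI[where h="\<lambda>s p. rotate (SO_incl (k s (fst p))) (snd p)"])
    let ?D = "{0..1::real} \<times> (sph a \<times> sph (Suc q))"
    have "continuous_on ?D (\<lambda>p. (fst p, fst (snd p)))" by (intro continuous_intros)
    from orth_family_incl[OF orth_family_comp[OF A this]]
    have c: "orth_family ?D (Suc (Suc q)) (\<lambda>p. SO_incl (k (fst p) (fst (snd p))))" by auto
    have "continuous_on ?D (\<lambda>p. rotate (SO_incl (k (fst p) (fst (snd p)))) (snd (snd p)))"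
      by (intro rotate_cont[OF c] continuous_intros)
    then show "continuous_map (top_of_set ?D) (nsphere (Suc q)) (\<lambda>p. rotate (SO_incl (k (fst p) (fst (snd p)))) (snd (snd p)))"
      unfolding cm_sph using o by (auto intro!: rotate_sph orth_mat_SO_incl)
    show "rotate (SO_incl (k s (fst p))) (snd p) = base" if "0 \<le> s" "s \<le> 1" "p \<in> sph a \<times> {base}" for s p
      using that o[of s "fst p"] rotate_SO_incl_base[of "k s (fst p)" "Suc q"] by (auto simp: orth_mat_def)
  qed (auto simp: k(2,3))
qed

text \<open>\<open>J[\<rho>] + [A x y,t] = [y,t]\<close> for the pullbacks, by the rotation of axes. Together with the lemma for
  \<open>\<Sigma> c(A)\<close> this leaves only a cancellation.\<close>

lemma J_pullback:
  assumes A: "orth_family (sph a) q A"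
    and \<rho>: "homotopic_rel (sph a) {base} (SO (Suc q)) (1\<^sub>m (Suc q)) \<rho> (\<lambda>x. SO_incl (A x))"
  defines "j \<equiv> \<lambda>z. join_map q (\<lambda>_. base) (\<lambda>x v. rotate (SO_incl (\<rho> x)) v) (join_inv_explicit a q z)"
  shows "smash_loop_homotopic a q (loop_cat (smash_pull a q j) (susp_action q A)) (susp_second q)" "homotopic_rel (sph (Suc (a + q))) {base} (nsphere (Suc q)) base j j"
proof -
  let ?G = "\<lambda>x v. rotate (SO_incl (\<rho> x)) v"
  have r: "orth_family (sph a) (Suc q) \<rho>" by (rule SO_orth_family[OF homotopic_rel_cont[OF homotopic_rel_reflL[OF \<rho>]]])
  have rb: "\<rho> base = 1\<^sub>m (Suc q)" using homotopic_rel_base[OF homotopic_rel_reflL[OF \<rho>]] by simp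
  show "homotopic_rel (sph (Suc (a + q))) {base} (nsphere (Suc q)) base j j"
    using J_rep_homotopic_rel[OF r] by (simp add: J_rep_def j_def)
  have c: "continuous_map (top_of_set (sph a \<times> sph (Suc q))) (nsphere (Suc q)) (\<lambda>p. ?G (fst p) (snd p))"
    unfolding cm_sph using act_cont[OF orth_family_incl[OF r]] orth_family_orth_mat[OF r]
    by (auto intro!: rotate_sph orth_mat_SO_incl)
  have "smash_loop_homotopic a q (smash_pull a q j) (loop_cat (family_loop q (\<lambda>_. ?G base)) (loop_rev (family_loop q ?G)))"
    unfolding j_def
    by (rule join_pullback[OF c]) (rule rotate_SO_incl_base[OF orth_family_carrier[OF r]])
  then have 1: "smash_loop_homotopic a q (smash_pull a q j) (loop_cat (susp_second q) (loop_rev (family_loop q ?G)))"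
    by (rule loop_homotopic_cong) (auto simp: loop_cat_def family_loop_def susp_second_def rb rotate_incl_one susp_sph)
  have "homotopic_rel (sph a \<times> sph (Suc q)) (sph a \<times> {base}) (nsphere (Suc q)) base
    (\<lambda>p. ?G (fst p) (snd p)) (\<lambda>p. rotate_fix_last q (A (fst p)) (snd p))"
    using homotopic_rel_rotate[OF \<rho>] shift_homotopy[OF A] by (rule homotopic_rel_trans)
  then have "smash_loop_homotopic a q (family_loop q ?G) (family_loop q (\<lambda>x. rotate_fix_last q (A x)))" by (rule family_loop_loop_homotopic)
  then have 2: "smash_loop_homotopic a q (family_loop q ?G) (susp_action q A)"
    by (rule loop_homotopic_cong) (auto simp: family_loop_def susp_action_def rotate_fix_last_susp[OF orth_family_orth_mat[OF A]])
  have s: "smash_loop_homotopic a q (susp_action q A) (susp_action q A)" by (rule loop_homotopic_reflR[OF 2])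
  have "continuous_on ((sph a \<times> sph q) \<times> {0..1::real}) (susp_second q)"
    unfolding susp_second_def by (intro continuous_intros)
  then have p: "smash_loop_homotopic a q (susp_second q) (susp_second q)"
    by (intro loop_homotopic_refl) (auto simp: cm_sph susp_second_def susp_sph)
  have "smash_loop_homotopic a q (loop_cat (smash_pull a q j) (susp_action q A)) (loop_cat (loop_cat (susp_second q) (loop_rev (susp_action q A))) (susp_action q A))"
    by (intro loop_cat_cong s loop_homotopic_trans[OF 1] loop_rev_cong 2 p)
  also have "smash_loop_homotopic a q (loop_cat (loop_cat (susp_second q) (loop_rev (susp_action q A))) (susp_action q A)) (loop_cat (susp_second q) (loop_cat (loop_rev (susp_action q A)) (susp_action q A)))"
    by (intro loop_cat_assoc p s loop_rev_cong)
  also have "smash_loop_homotopic a q (loop_cat (susp_second q) (loop_cat (loop_rev (susp_action q A)) (susp_action q A))) (loop_cat (susp_second q) (\<lambda>_. base))"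
    by (intro loop_cat_cong p loop_cat_inv s)
  also have "smash_loop_homotopic a q (loop_cat (susp_second q) (\<lambda>_. base)) (susp_second q)" by (rule loop_cat_unitR[OF p])
  finally show "smash_loop_homotopic a q (loop_cat (smash_pull a q j) (susp_action q A)) (susp_second q)" .
qed

text \<open>Both sides have the same pullback along the smash product.\<close>

lemma J_eq_suspension:
  assumes A: "orth_family (sph a) (Suc b) A" and b: "A base = 1\<^sub>m (Suc b)"
    and \<rho>: "homotopic_rel (sph a) {base} (SO (Suc (Suc b))) (1\<^sub>m (Suc (Suc b))) \<rho> (\<lambda>x. SO_incl (A x))"
  shows "homotopic_rel (sph (Suc (a + Suc b))) {base} (nsphere (Suc (Suc b))) base
     (\<lambda>z. join_map (Suc b) (\<lambda>_. base) (\<lambda>x v. rotate (SO_incl (\<rho> x)) v) (join_inv_explicit a (Suc b) z))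
     (susp_map (Suc (a + b)) (Suc b) (J_rep a b A))"
proof (rule smash_pull_inj)
  let ?j = "\<lambda>z. join_map (Suc b) (\<lambda>_. base) (\<lambda>x v. rotate (SO_incl (\<rho> x)) v) (join_inv_explicit a (Suc b) z)"
  let ?c = "susp_map (Suc (a + b)) (Suc b) (J_rep a b A)"
  note J = J_pullback[OF A \<rho>]
  show j: "homotopic_rel (sph (Suc (a + Suc b))) {base} (nsphere (Suc (Suc b))) base ?j ?j" by (rule J(2))
  show c: "homotopic_rel (sph (Suc (a + Suc b))) {base} (nsphere (Suc (Suc b))) base ?c ?c"
    using susp_map_homotopic_rel[OF J_rep_homotopic_rel[OF A]] by simp
  note G = J_rep_pullback[OF A b]
  have "continuous_on (sph a \<times> sph (Suc b)) (\<lambda>p. rotate (SO_incl (A (fst p))) (snd p))"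
    by (rule act_cont[OF orth_family_incl[OF A]]) simp
  from continuous_on_comp[OF this, of "(sph a \<times> sph (Suc b)) \<times> {0..1::real}" fst]
  have "continuous_on ((sph a \<times> sph (Suc b)) \<times> {0..1::real}) (\<lambda>p. rotate (SO_incl (A (fst (fst p)))) (snd (fst p)))"
    by (simp add: continuous_on_fst mem_Times_iff)
  then have "continuous_on ((sph a \<times> sph (Suc b)) \<times> {0..1::real}) (susp_action (Suc b) A)"
    unfolding susp_action_def by (intro continuous_intros)
  then have s: "smash_loop_homotopic a (Suc b) (susp_action (Suc b) A) (susp_action (Suc b) A)"
    using rotate_sph[OF orth_mat_SO_incl[OF orth_family_orth_mat[OF A]]] rotate_SO_incl_base[OF orth_family_carrier[OF A]]
    by (intro loop_homotopic_refl) (auto simp: cm_sph susp_action_def intro!: susp_sph)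
  show "loop_homotopic (sph a \<times> sph (Suc b)) (sph a \<times> {base}) (nsphere (Suc (Suc b))) base (smash_pull a (Suc b) ?j) (smash_pull a (Suc b) ?c)"
    by (rule loop_cat_cancelR[OF loop_homotopic_trans[OF J(1) loop_homotopic_sym[OF G]] smash_pull_loop_homotopic[OF j] smash_pull_loop_homotopic[OF c] s])
qed

text \<open>The shear \<open>(x, y) \<mapsto> (x, A x y)\<close> induces a map of \<open>S\<^bsup>a+1\<^esup> \<and> S\<^sup>q\<close>. Write \<open>x = [x',\<tau>]\<close> and use the matrix
  at \<open>[x',(1-s)\<tau>]\<close> instead. This is ill defined only at \<open>x = base\<close>, where the smash
  product is collapsed anyway, and it ends at the matrix \<open>A base = 1\<close>. The argument needs a sphere of
  positive dimension, which is where \<open>n \<ge> 2\<close> enters.\<close>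

lemma shear_homotopy:
  assumes A: "orth_family (sph (Suc a)) q A" and b: "A base = 1\<^sub>m q"
    and \<phi>: "homotopic_rel (sph (Suc (Suc a + q))) {base} W w \<phi> \<phi>"
  shows "loop_homotopic (sph (Suc a) \<times> sph q) (sph (Suc a) \<times> {base}) W w
    (\<lambda>p. smash_pull (Suc a) q \<phi> ((fst (fst p), rotate (SO_incl (A (fst (fst p)))) (snd (fst p))), snd p)) (smash_pull (Suc a) q \<phi>)"
proof -
  \<comment> \<open>\<open>cx s\<close> contracts the meridian through \<open>x\<close> to \<open>base\<close>.\<close>
  define cx where "cx s x = (case susp_coords a x of (x', \<tau>) \<Rightarrow> susp_pt a x' ((1 - s) * \<tau>))" for s x
  define sh where "sh s x z = smash (Suc a) q x (rotate (SO_incl (A (cx s x))) z)" for s x z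
  have I: "orth_mat (Suc q) (SO_incl (A x))" if "x \<in> sph (Suc a)" for x
    by (rule orth_mat_SO_incl[OF orth_family_orth_mat[OF A that]])
  have sh_susp: "sh s (susp_pt a x' \<tau>) z = smash (Suc a) q (susp_pt a x' \<tau>) (rotate (SO_incl (A (susp_pt a x' ((1 - s) * \<tau>)))) z)"
    if x: "x' \<in> sph a" "0 \<le> \<tau>" "\<tau> \<le> 1" and z: "z \<in> sph q" for s x' \<tau> z
  proof (cases "susp_pt a x' \<tau> = base")
    case True
    obtain y t where y: "susp_coords a base = (y, t)" "y \<in> sph a" "0 \<le> t" "t \<le> 1" "susp_pt a y t = base"
      using susp_coords[of base a] by auto
    have "smash (Suc a) q base (rotate (SO_incl (A (susp_pt a y r))) z) = base" if "y \<in> sph a" for y r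
      using smash_eq_base[OF base_sph rotate_sph[OF I[OF susp_sph[OF that]] z]] by simp
    then show ?thesis unfolding sh_def cx_def True using y x by simp
  next
    case False
    obtain y t where y: "susp_coords a (susp_pt a x' \<tau>) = (y, t)" "y \<in> sph a" "0 \<le> t" "t \<le> 1" "susp_pt a y t = susp_pt a x' \<tau>"
      using susp_coords[OF susp_sph[OF x(1)]] by metis
    then have "y = x'" "t = \<tau>" using susp_inj[OF y(2) x(1) y(3,4) x(2,3) y(5)] False by auto
    then show ?thesis unfolding sh_def cx_def using y by simp
  qed
  let ?D = "{0..1::real} \<times> (sph (Suc a) \<times> sph q)"
  have shc: "continuous_on ?D (\<lambda>p. sh (fst p) (fst (snd p)) (snd (snd p)))"
  proof (rule continuous_on_descend[where p="\<lambda>p. (fst p, (susp_pt a (fst (fst (snd p))) (snd (fst (snd p))), snd (snd p)))"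
        and A="{0..1::real} \<times> ((sph a \<times> {0..1::real}) \<times> sph q)"])
    let ?E = "{0..1::real} \<times> ((sph a \<times> {0..1::real}) \<times> sph q)"
    show "compact ?E" by (intro compact_Times compact_sph compact_unit_interval)
    show "continuous_on ?E (\<lambda>p. (fst p, (susp_pt a (fst (fst (snd p))) (snd (fst (snd p))), snd (snd p))))"
      by (intro continuous_intros)
    show "(\<lambda>p. (fst p, (susp_pt a (fst (fst (snd p))) (snd (fst (snd p))), snd (snd p)))) ` ?E = ?D"
    proof (intro equalityI subsetI)
      fix p assume p: "p \<in> ?D"
      then have "fst (snd p) \<in> sph (Suc a)" by auto
      then obtain y t where "y \<in> sph a" "0 \<le> t" "t \<le> 1" "susp_pt a y t = fst (snd p)" by (rule susp_surj)
      with p show "p \<in> (\<lambda>p. (fst p, (susp_pt a (fst (fst (snd p))) (snd (fst (snd p))), snd (snd p)))) ` ?E"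
        by (intro image_eqI[of _ _ "(fst p, ((y,t), snd (snd p)))"]) (auto simp: prod_eq_iff)
    qed (auto simp: susp_sph)
    have "continuous_on ?E (\<lambda>p. susp_pt a (fst (fst (snd p))) ((1 - fst p) * snd (fst (snd p))))"
      by (intro continuous_intros)
    from orth_family_incl[OF orth_family_comp[OF A this]]
    have "orth_family ?E (Suc q) (\<lambda>p. SO_incl (A (susp_pt a (fst (fst (snd p))) ((1 - fst p) * snd (fst (snd p))))))"
      by (auto simp: susp_sph)
    then have "continuous_on ?E (\<lambda>p. rotate (SO_incl (A (susp_pt a (fst (fst (snd p))) ((1 - fst p) * snd (fst (snd p)))))) (snd (snd p)))"
      by (rule rotate_cont) (intro continuous_intros)
    then show "continuous_on ?E (\<lambda>p. smash (Suc a) q (susp_pt a (fst (fst (snd p))) (snd (fst (snd p))))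
        (rotate (SO_incl (A (susp_pt a (fst (fst (snd p))) ((1 - fst p) * snd (fst (snd p)))))) (snd (snd p))))"
      by (intro continuous_intros) (auto simp: susp_sph intro!: rotate_sph I)
  qed (auto simp: sh_susp)
  have cxm: "cx s x \<in> sph (Suc a)" if "x \<in> sph (Suc a)" for s x
    using susp_coords[OF that] susp_sph unfolding cx_def by (metis (no_types, lifting) case_prod_conv)
  have shm: "sh s x z \<in> sph (Suc a + q)" if "x \<in> sph (Suc a)" "z \<in> sph q" for s x z
    unfolding sh_def by (intro smash_sph rotate_sph I cxm that)
  have shb: "sh s x base = base" if "x \<in> sph (Suc a)" for s x
    unfolding sh_def using smash_eq_base[OF that base_sph] rotate_SO_incl_base[OF orth_family_carrier[OF A cxm[OF that]]] by simp
  have sh0: "sh 0 x z = smash (Suc a) q x (rotate (SO_incl (A x)) z)" if "x \<in> sph (Suc a)" for x z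
  proof -
    have "cx 0 x = x" using susp_coords[OF that] unfolding cx_def by (metis (no_types, lifting) case_prod_conv diff_zero mult_1)
    then show ?thesis by (simp add: sh_def)
  qed
  have sh1: "sh 1 x z = smash (Suc a) q x z" if "x \<in> sph (Suc a)" "z \<in> sph q" for x z
  proof -
    have "cx 1 x = base" unfolding cx_def by (simp add: case_prod_beta)
    then show ?thesis using that by (simp add: sh_def b rotate_incl_one)
  qed
  have \<phi>c: "continuous_map (top_of_set (sph (Suc (Suc a + q)))) W \<phi>" "\<phi> base = w"
    using homotopic_rel_cont[OF \<phi>] homotopic_rel_base[OF \<phi>] by auto
  show ?thesis
  proof (rule loop_homotopicI[where h="\<lambda>s p. \<phi> (susp_pt (Suc a + q) (sh s (fst (fst p)) (snd (fst p))) (snd p))"])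
    have "continuous_on ({0..1} \<times> ((sph (Suc a) \<times> sph q) \<times> {0..1::real})) (\<lambda>p. (fst p, (fst (fst (snd p)), snd (fst (snd p)))))"
      by (intro continuous_intros)
    from continuous_on_comp[OF shc this]
    have "continuous_on ({0..1} \<times> ((sph (Suc a) \<times> sph q) \<times> {0..1::real})) (\<lambda>p. sh (fst p) (fst (fst (snd p))) (snd (fst (snd p))))"
      by auto
    then have "continuous_on ({0..1} \<times> ((sph (Suc a) \<times> sph q) \<times> {0..1::real}))
       (\<lambda>p. susp_pt (Suc a + q) (sh (fst p) (fst (fst (snd p))) (snd (fst (snd p)))) (snd (snd p)))"
      by (intro continuous_intros)
    from cm_comp[OF \<phi>c(1) this] show "continuous_map (top_of_set ({0..1} \<times> ((sph (Suc a) \<times> sph q) \<times> {0..1}))) W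
       (\<lambda>p. \<phi> (susp_pt (Suc a + q) (sh (fst p) (fst (fst (snd p))) (snd (fst (snd p)))) (snd (snd p))))"
      using susp_sph shm by (auto simp del: add_Suc)
  qed (auto simp: smash_pull_def sh0 sh1 shb \<phi>c(2) simp del: add_Suc)
qed

text \<open>The shear by \<open>A\<close> turns the relation \<open>\<Sigma> c(A\<^sup>T) + [A\<^sup>T x y,t] = [y,t]\<close> into
  \<open>\<Sigma> c(A\<^sup>T) + [y,t] = [A x y,t]\<close>, which is added to the relation for \<open>J[\<rho>]\<close>.\<close>

lemma J_add_suspension:
  assumes A: "orth_family (sph (Suc a)) (Suc b) A" and b: "A base = 1\<^sub>m (Suc b)"
    and \<rho>: "homotopic_rel (sph (Suc a)) {base} (SO (Suc (Suc b))) (1\<^sub>m (Suc (Suc b))) \<rho> (\<lambda>x. SO_incl (A x))"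
  shows "homotopic_rel (sph (Suc (Suc a + Suc b))) {base} (nsphere (Suc (Suc b))) base
     (sphere_concat (Suc (Suc a + Suc b)) (\<lambda>z. join_map (Suc b) (\<lambda>_. base) (\<lambda>x v. rotate (SO_incl (\<rho> x)) v) (join_inv_explicit (Suc a) (Suc b) z))
       (susp_map (Suc (Suc a + b)) (Suc b) (J_rep (Suc a) b (\<lambda>x. transpose_mat (A x))))) (\<lambda>_. base)"
proof -
  let ?q = "Suc b" and ?a = "Suc a"
  let ?j = "\<lambda>z. join_map ?q (\<lambda>_. base) (\<lambda>x v. rotate (SO_incl (\<rho> x)) v) (join_inv_explicit ?a ?q z)"
  let ?B = "\<lambda>x. transpose_mat (A x)"
  let ?c = "susp_map (Suc (?a + b)) ?q (J_rep ?a b ?B)"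
  have B: "orth_family (sph ?a) ?q ?B" by (rule orth_family_transpose[OF A])
  have bB: "?B base = 1\<^sub>m ?q" by (simp add: b)
  note J = J_pullback[OF A \<rho>]
  have c: "homotopic_rel (sph (Suc (?a + ?q))) {base} (nsphere (Suc ?q)) base ?c ?c"
    using susp_map_homotopic_rel[OF J_rep_homotopic_rel[OF B]] by (simp add: add_Suc_right[symmetric] del: add_Suc_right)
  have cc: "continuous_on (sph ?a \<times> sph ?q) (\<lambda>k. (fst k, rotate (SO_incl (A (fst k))) (snd k)))"
    by (intro continuous_intros act_cont[OF orth_family_incl[OF A]]) simp
  have m: "rotate (SO_incl (A x)) v \<in> sph ?q" if "x \<in> sph ?a" "v \<in> sph ?q" for x v
    by (rule rotate_sph[OF orth_mat_SO_incl[OF orth_family_orth_mat[OF A that(1)]] that(2)])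
  have bs: "rotate (SO_incl (A x)) base = base" if "x \<in> sph ?a" for x
    by (rule rotate_SO_incl_base[OF orth_family_carrier[OF A that]])
  let ?sh = "\<lambda>f p. f ((fst (fst p), rotate (SO_incl (A (fst (fst p)))) (snd (fst p))), snd (p :: _ \<times> real))"
  have inv: "rotate (SO_incl (?B x)) (rotate (SO_incl (A x)) v) = v" if "x \<in> sph ?a" "v \<in> sph ?q" for x v
    using rotate_inv_sph[OF orth_mat_SO_incl[OF orth_family_orth_mat[OF A that(1)]] that(2)]
      SO_incl_transpose[OF orth_family_carrier[OF A that(1)]] by simp
  have sp: "smash_loop_homotopic ?a ?q (smash_pull ?a ?q ?c) (smash_pull ?a ?q ?c)" by (rule smash_pull_loop_homotopic[OF c])
  have 1: "smash_loop_homotopic ?a ?q (\<lambda>p. loop_cat (smash_pull ?a ?q ?c) (susp_action ?q ?B) ((\<lambda>k. (fst k, rotate (SO_incl (A (fst k))) (snd k))) (fst p), snd p))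
    (\<lambda>p. susp_second ?q ((\<lambda>k. (fst k, rotate (SO_incl (A (fst k))) (snd k))) (fst p), snd p))"
    by (rule loop_homotopic_pre[OF J_rep_pullback[OF B bB] cc]) (auto simp: m bs)
  have sa: "smash_loop_homotopic ?a ?q (loop_cat (?sh (smash_pull ?a ?q ?c)) (susp_second ?q)) (susp_action ?q A)"
    using 1 by (rule loop_homotopic_cong) (auto simp: loop_cat_def susp_action_def susp_second_def inv)
  have p: "smash_loop_homotopic ?a ?q (susp_second ?q) (susp_second ?q)" by (rule loop_homotopic_reflR[OF J(1)])
  have s: "smash_loop_homotopic ?a ?q (susp_action ?q A) (susp_action ?q A)" by (rule loop_homotopic_reflR[OF sa])
  have 2: "smash_loop_homotopic ?a ?q (susp_action ?q A) (loop_cat (smash_pull ?a ?q ?c) (susp_second ?q))"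
    using loop_homotopic_sym[OF sa] loop_cat_cong[OF shear_homotopy[OF A b c] p] by (rule loop_homotopic_trans)
  have spj: "smash_loop_homotopic ?a ?q (smash_pull ?a ?q ?j) (smash_pull ?a ?q ?j)" by (rule smash_pull_loop_homotopic[OF J(2)])
  have k: "smash_loop_homotopic ?a ?q (\<lambda>_. base) (\<lambda>_. base)" by (rule loop_homotopic_const) auto
  have "smash_loop_homotopic ?a ?q (loop_cat (loop_cat (smash_pull ?a ?q ?j) (smash_pull ?a ?q ?c)) (susp_second ?q)) (loop_cat (smash_pull ?a ?q ?j) (loop_cat (smash_pull ?a ?q ?c) (susp_second ?q)))"
    by (intro loop_cat_assoc spj sp p)
  also have "smash_loop_homotopic ?a ?q (loop_cat (smash_pull ?a ?q ?j) (loop_cat (smash_pull ?a ?q ?c) (susp_second ?q))) (loop_cat (smash_pull ?a ?q ?j) (susp_action ?q A))"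
    by (intro loop_cat_cong spj loop_homotopic_sym[OF 2])
  also have "smash_loop_homotopic ?a ?q (loop_cat (smash_pull ?a ?q ?j) (susp_action ?q A)) (susp_second ?q)" by (rule J(1))
  also have "smash_loop_homotopic ?a ?q (susp_second ?q) (loop_cat (\<lambda>_. base) (susp_second ?q))" by (rule loop_homotopic_sym[OF loop_cat_unitL[OF p]])
  finally have "smash_loop_homotopic ?a ?q (loop_cat (smash_pull ?a ?q ?j) (smash_pull ?a ?q ?c)) (\<lambda>_. base)"
    by (rule loop_cat_cancelR) (intro loop_cat_cong spj sp k p)+
  then have "smash_loop_homotopic ?a ?q (smash_pull ?a ?q (sphere_concat (Suc (?a + ?q)) ?j ?c)) (\<lambda>_. base)"
  proof (rule loop_homotopic_cong)
    have jb: "?j base = base" "?c base = base" using homotopic_rel_base[OF J(2)] homotopic_rel_base[OF c] by auto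
    fix k and t :: real assume k: "k \<in> sph ?a \<times> sph ?q" "0 \<le> t" "t \<le> 1"
    have "smash_pull ?a ?q (sphere_concat (Suc (?a + ?q)) ?j ?c) ((fst k, snd k), t) = loop_cat (smash_pull ?a ?q ?j) (smash_pull ?a ?q ?c) ((fst k, snd k), t)"
      by (rule smash_pull_concat[where w=base, OF _ _ k(2,3)]) (use k(1) jb in \<open>simp_all only: mem_Times_iff\<close>)
    then show "smash_pull ?a ?q (sphere_concat (Suc (?a + ?q)) ?j ?c) (k, t) = loop_cat (smash_pull ?a ?q ?j) (smash_pull ?a ?q ?c) (k, t)"
      by (simp only: prod.collapse)
  qed simp
  then show ?thesis by (rule smash_pull_null) (rule sphere_concat_homotopic_rel[OF J(2) c])
qed

section \<open>The sphere bundle as a family of vectors\<close>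

abbreviation hemi :: "nat \<Rightarrow> bool \<Rightarrow> (nat \<Rightarrow> real) set" where "hemi n p \<equiv> topspace (hemisphere n p)"

lemma hemi_iff: "x \<in> hemi n p \<longleftrightarrow> x \<in> sph n \<and> (if p then 0 \<le> x n else x n \<le> 0)"
  by (auto simp: hemisphere_def)

lemma hemisphere_eq: "hemisphere n p = top_of_set (hemi n p)"
proof -
  have "hemisphere n p = subtopology (top_of_set (sph n)) {x. if p then 0 \<le> x n else x n \<le> 0}"
    unfolding hemisphere_def by (metis nsphere_eq)
  also have "\<dots> = top_of_set (sph n \<inter> {x. if p then 0 \<le> x n else x n \<le> 0})" by (rule subtopology_subtopology)
  also have "sph n \<inter> {x. if p then 0 \<le> x n else x n \<le> 0} = hemi n p" by (auto simp: hemi_iff)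
  finally show ?thesis .
qed

lemma hemi_product: "prod_topology (hemisphere n p) (nsphere q) = top_of_set (hemi n p \<times> sph q)"
  using prod_topology_subtopology_eu[of "hemi n p" "sph q"] by (metis hemisphere_eq nsphere_eq)

lemma bundle_into:
  assumes "continuous_on S u" "\<And>s. s \<in> S \<Longrightarrow> u s \<in> hemi n p"
    "continuous_on S v" "\<And>s. s \<in> S \<Longrightarrow> v s \<in> sph q"
  shows "continuous_map (top_of_set S) (sphere_bundle n q \<rho>) (\<lambda>s. glue n \<rho> (p, u s, v s))"
proof -
  let ?X = "\<lambda>p. prod_topology (hemisphere n p) (nsphere q)"
  have 1: "continuous_map (top_of_set S) (?X p) (\<lambda>s. (u s, v s))"
    unfolding hemi_product using assms by (auto intro!: continuous_intros)
  have 2: "continuous_map (?X p) (sum_topology ?X UNIV) (\<lambda>x. (p, x))"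
    by (rule continuous_map_component_injection) simp
  have 3: "continuous_map (sum_topology ?X UNIV) (sphere_bundle n q \<rho>) (glue n \<rho>)"
    unfolding sphere_bundle_def by (rule quotient_imp_continuous_map[OF quotient_map_quotient_topology])
  show ?thesis
    using continuous_map_compose[OF continuous_map_compose[OF 1 2] 3] by (simp add: o_def)
qed

lemma bundle_out:
  fixes F :: "_ \<Rightarrow> 'c::topological_space"
  assumes "\<And>p. continuous_on (hemi n p \<times> sph q) (\<lambda>z. F (glue n \<rho> (p, fst z, snd z)))"
  shows "continuous_map (sphere_bundle n q \<rho>) euclidean F"
proof -
  let ?X = "\<lambda>p. prod_topology (hemisphere n p) (nsphere q)"
  have c: "continuous_map (?X p) euclidean (\<lambda>z. F (glue n \<rho> (p, z)))" for p
    unfolding hemi_product using assms[of p] by simp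
  have "continuous_map (sum_topology ?X UNIV) euclidean (F \<circ> glue n \<rho>)"
    unfolding continuous_map
  proof (intro conjI allI impI)
    fix U :: "'c set" assume U: "openin euclidean U"
    show "openin (sum_topology ?X UNIV) {x \<in> topspace (sum_topology ?X UNIV). (F \<circ> glue n \<rho>) x \<in> U}"
      unfolding openin_sum_topology
    proof (intro conjI ballI)
      fix p :: bool
      have "openin (?X p) {z \<in> topspace (?X p). F (glue n \<rho> (p, z)) \<in> U}"
        using c[of p] U unfolding continuous_map by blast
      moreover have "{x. (p, x) \<in> {x \<in> topspace (sum_topology ?X UNIV). (F \<circ> glue n \<rho>) x \<in> U}} =
        {z \<in> topspace (?X p). F (glue n \<rho> (p, z)) \<in> U}" by auto
      ultimately show "openin (?X p) {x. (p, x) \<in> {x \<in> topspace (sum_topology ?X UNIV). (F \<circ> glue n \<rho>) x \<in> U}}" by simp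
    qed auto
  qed auto
  then show ?thesis
    unfolding sphere_bundle_def by (rule continuous_compose_quotient_map[OF quotient_map_quotient_topology])
qed

lemma topspace_bundle: "topspace (sphere_bundle n q \<rho>) = glue n \<rho> ` {(p, x, y). x \<in> hemi n p \<and> y \<in> sph q}"
proof -
  let ?X = "\<lambda>p. prod_topology (hemisphere n p) (nsphere q)"
  have "topspace (sphere_bundle n q \<rho>) = glue n \<rho> ` topspace (sum_topology ?X UNIV)"
    unfolding sphere_bundle_def
    using quotient_imp_surjective_map[OF quotient_map_quotient_topology] by metis
  also have "topspace (sum_topology ?X UNIV) = {(p, x, y). x \<in> hemi n p \<and> y \<in> sph q}" by auto
  finally show ?thesis .
qed

text \<open>A point \<open>x\<close> of \<open>S\<^bsup>a+1\<^esup>\<close> is determined by its height \<open>x (a + 1)\<close> and, away from the poles, by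
  the equatorial point \<open>hat a x\<close> below it; \<open>rad a x\<close> is its distance from the axis.\<close>

definition rad :: "nat \<Rightarrow> (nat \<Rightarrow> real) \<Rightarrow> real" where "rad a x = sqrt (sqnorm a x)"

definition hat :: "nat \<Rightarrow> (nat \<Rightarrow> real) \<Rightarrow> nat \<Rightarrow> real"
  where "hat a x = (if rad a x = 0 then base else (\<lambda>i. if i \<le> a then x i / rad a x else 0))"

definition polar :: "nat \<Rightarrow> (nat \<Rightarrow> real) \<Rightarrow> real \<Rightarrow> nat \<Rightarrow> real"
  where "polar a u h = (\<lambda>i. if i = Suc a then h else sqrt (1 - h\<^sup>2) * u i)"

lemma hat_sph: "hat a x \<in> sph a"
proof (cases "rad a x = 0")
  case False
  have "rad a x ^ 2 = sqnorm a x" by (simp add: rad_def sqnorm_nonneg)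
  then have "sqnorm a (\<lambda>i. if i \<le> a then x i / rad a x else 0) = 1"
    using False by (auto simp: power_divide sum_divide_distrib[symmetric])
  then show ?thesis using False by (simp add: hat_def sph_iff)
qed (simp add: hat_def)

lemma rad_polar:
  assumes u: "u \<in> sph a" and h: "\<bar>h\<bar> \<le> 1" shows "rad a (polar a u h) = sqrt (1 - h\<^sup>2)"
proof -
  have h2: "h\<^sup>2 \<le> 1" using h by (simp add: abs_square_le_1)
  have "sqnorm a (polar a u h) = (1 - h\<^sup>2) * sqnorm a u"
    using h2 by (simp add: polar_def power_mult_distrib sum_distrib_left)
  then show ?thesis using u by (simp add: rad_def sph_iff)
qed

lemma polar_sph:
  assumes u: "u \<in> sph a" and h: "\<bar>h\<bar> \<le> 1" shows "polar a u h \<in> sph (Suc a)"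
proof -
  have h2: "h\<^sup>2 \<le> 1" using h by (simp add: abs_square_le_1)
  have "sqnorm a (polar a u h) = (1 - h\<^sup>2) * sqnorm a u"
    using h2 by (simp add: polar_def power_mult_distrib sum_distrib_left)
  then have "sqnorm (Suc a) (polar a u h) = 1" using u by (simp add: sph_iff) (simp add: polar_def)
  then show ?thesis using u by (auto simp: sph_iff polar_def)
qed

lemma hat_polar:
  assumes u: "u \<in> sph a" and h: "\<bar>h\<bar> < 1" shows "hat a (polar a u h) = u"
proof -
  have "h\<^sup>2 < 1" using h by (simp add: abs_square_less_1)
  then have "sqrt (1 - h\<^sup>2) > 0" by simp
  then show ?thesis
    using u rad_polar[OF u, of h] h by (auto simp: hat_def polar_def sph_iff fun_eq_iff)
qed

lemma polar_hat:
  assumes x: "x \<in> sph (Suc a)" shows "polar a (hat a x) (x (Suc a)) = x" "\<bar>x (Suc a)\<bar> \<le> 1"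
proof -
  have s: "sqnorm a x = 1 - (x (Suc a))\<^sup>2" using x by (simp add: sph_iff)
  have "0 \<le> sqnorm a x" by (rule sqnorm_nonneg)
  then have "(x (Suc a))\<^sup>2 \<le> 1" using s by simp
  then show "\<bar>x (Suc a)\<bar> \<le> 1" by (simp add: abs_square_le_1)
  have r: "rad a x = sqrt (1 - (x (Suc a))\<^sup>2)" by (simp add: rad_def s)
  show "polar a (hat a x) (x (Suc a)) = x"
  proof
    fix i
    consider "i = Suc a" | "i > Suc a" | "i \<le> a" by linarith
    then show "polar a (hat a x) (x (Suc a)) i = x i"
    proof cases
      case 3
      show ?thesis
      proof (cases "rad a x = 0")
        case True
        then have "sqnorm a x = 0" by (simp add: rad_def sqnorm_nonneg)
        then have "\<forall>i\<in>{..a}. (x i)\<^sup>2 = 0" by (subst (asm) sum_nonneg_eq_0_iff) auto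
        then have "x i = 0" using 3 by auto
        moreover have "sqrt (1 - (x (Suc a))\<^sup>2) = 0" using True r by simp
        ultimately show ?thesis using 3 by (simp add: polar_def)
      next
        case False
        then show ?thesis using 3 by (simp add: polar_def hat_def r)
      qed
    qed (use x hat_sph[of a x] in \<open>auto simp: polar_def sph_iff\<close>)
  qed
qed

lemma cont_polar:
  assumes "continuous_on S f" "continuous_on S g"
  shows "continuous_on S (\<lambda>x. polar a (f x) (g x))"
proof (rule continuous_on_coordinatewise_then_product)
  fix i
  have "continuous_on S (\<lambda>x. f x i)" by (rule cont_coord[OF assms(1)])
  then show "continuous_on S (\<lambda>x. polar a (f x) (g x) i)"
    unfolding polar_def by (cases "i = Suc a") (auto intro!: continuous_intros assms(2))
qed

lemma polar_image: "(\<lambda>z. polar a (fst z) (snd z)) ` (sph a \<times> {-1..1}) = sph (Suc a)"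
proof (intro equalityI subsetI)
  fix x assume "x \<in> sph (Suc a)"
  from polar_hat[OF this] show "x \<in> (\<lambda>z. polar a (fst z) (snd z)) ` (sph a \<times> {-1..1})"
    by (intro image_eqI[of _ _ "(hat a x, x (Suc a))"]) (auto simp: hat_sph abs_le_iff)
qed (auto intro!: polar_sph)

lemma equator: assumes "x \<in> sph (Suc a)" "x (Suc a) = 0" shows "x \<in> sph a" "hat a x = x" "rad a x = 1"
proof -
  show 1: "x \<in> sph a" using assms topspace_nsphere_minus1[of x "Suc a"] by simp
  then show r: "rad a x = 1" by (simp add: rad_def sph_iff)
  show "hat a x = x" using 1 r by (auto simp: hat_def sph_iff fun_eq_iff)
qed

lemma sph_equator: "x \<in> sph a \<Longrightarrow> x \<in> sph (Suc a) \<and> x (Suc a) = 0"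
  by (auto simp: sph_iff)

locale clutching =
  fixes a q :: nat and \<rho> :: "(nat \<Rightarrow> real) \<Rightarrow> real mat"
  assumes \<rho>: "orth_family (sph a) (Suc q) \<rho>" and \<rho>b: "\<rho> base = 1\<^sub>m (Suc q)"
begin

abbreviation E where "E \<equiv> sphere_bundle (Suc a) q \<rho>"

text \<open>The clutching function is extended over all of \<open>S\<^bsup>a+1\<^esup>\<close> as a homogeneous function, vanishing at the
  poles. This makes the map below continuous across both charts.\<close>

definition cone_rot :: "(nat \<Rightarrow> real) \<Rightarrow> (nat \<Rightarrow> real) \<Rightarrow> nat \<Rightarrow> real"
  where "cone_rot x y = (\<lambda>i. rad a x * rotate (\<rho> (hat a x)) y i)"

definition cone_rot_inv :: "(nat \<Rightarrow> real) \<Rightarrow> (nat \<Rightarrow> real) \<Rightarrow> nat \<Rightarrow> real"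
  where "cone_rot_inv x y = (\<lambda>i. rad a x * rotate (transpose_mat (\<rho> (hat a x))) y i)"

lemma orth_mat_\<rho>: "x \<in> sph a \<Longrightarrow> orth_mat (Suc q) (\<rho> x)" by (rule orth_family_orth_mat[OF \<rho>])
lemma orth_mat_\<rho>t: "x \<in> sph a \<Longrightarrow> orth_mat (Suc q) (transpose_mat (\<rho> x))" by (rule orth_mat_transpose(2)[OF orth_mat_\<rho>])

lemma scaled_cont:
  assumes R: "orth_family (sph a) (Suc q) R" and f: "continuous_on S f" "\<And>s. s \<in> S \<Longrightarrow> f s \<in> sph (Suc a)" and g: "continuous_on S g"
  shows "continuous_on S (\<lambda>s i. rad a (f s) * rotate (R (hat a (f s))) (g s) i)"
proof (rule continuous_on_coordinatewise_then_product)
  fix i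
  have ent: "continuous_on (sph (Suc a)) (\<lambda>x. rad a x * R (hat a x) $$ (i, j))" if ij: "i < Suc q" "j < Suc q" for i j
  proof (rule continuous_on_descend[OF _ _ polar_image, where F="\<lambda>z. sqrt (1 - (snd z)\<^sup>2) * R (fst z) $$ (i,j)"])
    show "compact (sph a \<times> {-1..1::real})" by (intro compact_Times compact_sph) simp
    show "continuous_on (sph a \<times> {-1..1}) (\<lambda>z. polar a (fst z) (snd z))"
      by (intro cont_polar continuous_intros)
    have "continuous_on (sph a) (\<lambda>x. R x $$ (i,j))" using R ij by (auto simp: orth_family_def)
    from continuous_on_comp[OF this, of "sph a \<times> {-1..1::real}" fst]
    show "continuous_on (sph a \<times> {-1..1::real}) (\<lambda>z. sqrt (1 - (snd z)\<^sup>2) * R (fst z) $$ (i, j))"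
      by (intro continuous_intros) (auto simp: continuous_on_fst)
    fix z assume z: "z \<in> sph a \<times> {-1..1::real}"
    then have m: "fst z \<in> sph a" "\<bar>snd z\<bar> \<le> 1" by (auto simp: abs_le_iff)
    show "rad a (polar a (fst z) (snd z)) * R (hat a (polar a (fst z) (snd z))) $$ (i, j) = sqrt (1 - (snd z)\<^sup>2) * R (fst z) $$ (i, j)"
    proof (cases "\<bar>snd z\<bar> < 1")
      case True
      then show ?thesis using m by (simp add: rad_polar hat_polar)
    next
      case False
      then have "(snd z)\<^sup>2 = 1" using m by (simp add: abs_square_eq_1)
      then show ?thesis using m by (simp add: rad_polar)
    qed
  qed
  have c: "continuous_on S (\<lambda>s. g s j)" for j by (rule cont_coord[OF g])
  have "continuous_on S (\<lambda>s. if i < Suc q then \<Sum>j<Suc q. (rad a (f s) * R (hat a (f s)) $$ (i, j)) * g s j else 0)"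
  proof (cases "i < Suc q")
    case True
    then have "continuous_on S (\<lambda>s. \<Sum>j<Suc q. (rad a (f s) * R (hat a (f s)) $$ (i, j)) * g s j)"
      using continuous_on_comp[OF ent f, of i] by (intro continuous_on_sum continuous_on_mult[OF _ c]) auto
    with True show ?thesis by simp
  qed simp
  then show "continuous_on S (\<lambda>s. rad a (f s) * rotate (R (hat a (f s))) (g s) i)"
    by (rule continuous_on_eq)
      (simp add: rotate_coord[OF orth_family_carrier[OF R hat_sph]] sum_distrib_left mult.assoc del: sum.lessThan_Suc)
qed

lemma cont_cone_rot: "continuous_on S f \<Longrightarrow> (\<And>s. s \<in> S \<Longrightarrow> f s \<in> sph (Suc a)) \<Longrightarrow> continuous_on S g \<Longrightarrow> continuous_on S (\<lambda>s. cone_rot (f s) (g s))"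
  unfolding cone_rot_def by (rule scaled_cont[OF \<rho>])

lemma cont_cone_rot_inv: "continuous_on S f \<Longrightarrow> (\<And>s. s \<in> S \<Longrightarrow> f s \<in> sph (Suc a)) \<Longrightarrow> continuous_on S g \<Longrightarrow> continuous_on S (\<lambda>s. cone_rot_inv (f s) (g s))"
  unfolding cone_rot_inv_def by (rule scaled_cont[OF orth_family_transpose[OF \<rho>]])

lemma rotate_scale: "A \<in> carrier_mat m m \<Longrightarrow> rotate A (\<lambda>i. c * y i) = (\<lambda>i. c * rotate A y i)"
  by (auto simp: rotate_coord sum_distrib_left algebra_simps)

lemma cone_rot_inv_cone_rot: "(\<And>i. i > q \<Longrightarrow> y i = 0) \<Longrightarrow> cone_rot_inv x (cone_rot x y) = (\<lambda>i. (rad a x)\<^sup>2 * y i)"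
  using rotate_inv[OF orth_mat_\<rho>[OF hat_sph], of y x]
  by (simp add: cone_rot_inv_def cone_rot_def rotate_scale[OF orth_family_carrier[OF orth_family_transpose[OF \<rho>] hat_sph]] power2_eq_square mult.assoc)

lemma cone_rot_cone_rot_inv: "(\<And>i. i > q \<Longrightarrow> y i = 0) \<Longrightarrow> cone_rot x (cone_rot_inv x y) = (\<lambda>i. (rad a x)\<^sup>2 * y i)"
  using rotate_inv[OF orth_mat_\<rho>t[OF hat_sph], of y x]
  by (simp add: cone_rot_inv_def cone_rot_def rotate_scale[OF orth_family_carrier[OF \<rho> hat_sph]] power2_eq_square mult.assoc)

lemma cone_rot_equator: "x \<in> sph (Suc a) \<Longrightarrow> x (Suc a) = 0 \<Longrightarrow> cone_rot x y = rotate (\<rho> x) y"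
  by (simp add: cone_rot_def equator)

lemma cone_rot_inv_equator: "x \<in> sph (Suc a) \<Longrightarrow> x (Suc a) = 0 \<Longrightarrow> cone_rot_inv x y = rotate (transpose_mat (\<rho> x)) y"
  by (simp add: cone_rot_inv_def equator)

text \<open>The bundle is embedded fibrewise into \<open>\<real>\<^bsup>q+1\<^esup> \<times> \<real>\<^bsup>q+1\<^esup>\<close>. In the upper chart the point \<open>(x, y)\<close> goes to
  \<open>(y, r \<rho> y)\<close> and in the lower one to \<open>(r \<rho>\<^sup>T y, y)\<close>, where \<open>r = rad a x\<close>; over the equator \<open>r = 1\<close>
  and both agree under the gluing. A path in \<open>E\<close> is thus a path of vectors, and nearby fibres can be
  compared by projection.\<close>

definition fibre_vec :: "bool \<Rightarrow> (nat \<Rightarrow> real) \<Rightarrow> (nat \<Rightarrow> real) \<Rightarrow> (nat \<Rightarrow> real) \<times> (nat \<Rightarrow> real)"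
  where "fibre_vec p x y = (if p then (y, cone_rot x y) else (cone_rot_inv x y, y))"

definition bundle_vec :: "bool \<times> (nat \<Rightarrow> real) \<times> (nat \<Rightarrow> real) \<Rightarrow> (nat \<Rightarrow> real) \<times> (nat \<Rightarrow> real)"
  where "bundle_vec e = fibre_vec (fst e) (fst (snd e)) (snd (snd e))"

lemma proj_glue: "bundle_proj (glue (Suc a) \<rho> (p, x, y)) = x"
  by (auto simp: bundle_proj_def glue_def)

lemma bundle_vec_glue:
  assumes x: "x \<in> hemi (Suc a) p" and y: "y \<in> sph q"
  shows "bundle_vec (glue (Suc a) \<rho> (p, x, y)) = fibre_vec p x y"
proof (cases "p \<and> x (Suc a) = 0")
  case True
  then have x': "x \<in> sph (Suc a)" "x (Suc a) = 0" "x \<in> sph a" using x equator by (auto simp: hemi_iff)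
  show ?thesis
    using True rotate_inv_sph[OF orth_mat_\<rho>[OF x'(3)] y]
    by (simp add: bundle_vec_def glue_def fibre_vec_def cone_rot_equator[OF x'(1,2)] cone_rot_inv_equator[OF x'(1,2)])
qed (auto simp: bundle_vec_def glue_def)

lemma fibre_vec_cont:
  assumes "continuous_on S f" "\<And>s. s \<in> S \<Longrightarrow> f s \<in> sph (Suc a)" "continuous_on S g"
  shows "continuous_on S (\<lambda>s. fibre_vec p (f s) (g s))"
  unfolding fibre_vec_def by (cases p) (auto intro!: continuous_intros cont_cone_rot cont_cone_rot_inv assms)

lemma cont_bundle_vec: "continuous_map E euclidean bundle_vec"
proof (rule bundle_out)
  fix p
  have "continuous_on (hemi (Suc a) p \<times> sph q) (\<lambda>z. fibre_vec p (fst z) (snd z))"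
    by (rule fibre_vec_cont) (auto intro!: continuous_intros simp: hemi_iff)
  then show "continuous_on (hemi (Suc a) p \<times> sph q) (\<lambda>z. bundle_vec (glue (Suc a) \<rho> (p, fst z, snd z)))"
    by (rule continuous_on_eq) (auto simp: bundle_vec_glue)
qed

lemma cont_proj: "continuous_map E euclidean bundle_proj"
proof (rule bundle_out)
  show "continuous_on (hemi (Suc a) p \<times> sph q) (\<lambda>z. bundle_proj (glue (Suc a) \<rho> (p, fst z, snd z)))" for p
    unfolding proj_glue by (intro continuous_intros)
qed

section \<open>Transport between fibres\<close>

definition fibre :: "(nat \<Rightarrow> real) \<Rightarrow> ((nat \<Rightarrow> real) \<times> (nat \<Rightarrow> real)) set"
  where "fibre x = {fibre_vec p x y | p y. x \<in> hemi (Suc a) p \<and> y \<in> sph q}"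

lemma E_cases:
  assumes "e \<in> topspace E"
  obtains p x y where "e = glue (Suc a) \<rho> (p, x, y)" "x \<in> hemi (Suc a) p" "y \<in> sph q"
  using assms unfolding topspace_bundle by auto

lemma bundle_vec_fibre: "e \<in> topspace E \<Longrightarrow> bundle_proj e \<in> sph (Suc a) \<and> bundle_vec e \<in> fibre (bundle_proj e)"
proof (erule E_cases)
  fix p x y assume e: "e = glue (Suc a) \<rho> (p, x, y)" "x \<in> hemi (Suc a) p" "y \<in> sph q"
  have "x \<in> sph (Suc a)" using e(2) by (simp add: hemi_iff)
  moreover have "fibre_vec p x y \<in> fibre x" unfolding fibre_def using e(2,3) by blast
  ultimately show "bundle_proj e \<in> sph (Suc a) \<and> bundle_vec e \<in> fibre (bundle_proj e)"
    unfolding e(1) proj_glue bundle_vec_glue[OF e(2,3)] by blast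
qed

text \<open>Up to a positive factor, the orthogonal projection of a vector to the linear span of the fibre over
  \<open>x\<close>, in the coordinates of the chart containing \<open>x\<close>. Normalizing it gives the nearest point
  of the fibre.\<close>

definition fibre_part :: "(nat \<Rightarrow> real) \<Rightarrow> (nat \<Rightarrow> real) \<times> (nat \<Rightarrow> real) \<Rightarrow> nat \<Rightarrow> real"
  where "fibre_part x v = (if x (Suc a) \<le> 0 then (\<lambda>i. snd v i + cone_rot x (fst v) i) else (\<lambda>i. fst v i + cone_rot_inv x (snd v) i))"

definition fibre_part_sq :: "(nat \<Rightarrow> real) \<Rightarrow> (nat \<Rightarrow> real) \<times> (nat \<Rightarrow> real) \<Rightarrow> real"
  where "fibre_part_sq x v = sqnorm q (fibre_part x v)"

definition fibre_proj :: "(nat \<Rightarrow> real) \<Rightarrow> (nat \<Rightarrow> real) \<times> (nat \<Rightarrow> real) \<Rightarrow> (nat \<Rightarrow> real) \<times> (nat \<Rightarrow> real)"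
  where "fibre_proj x v = fibre_vec (\<not> x (Suc a) \<le> 0) x (\<lambda>i. fibre_part x v i / sqrt (fibre_part_sq x v))"

definition vecs :: "((nat \<Rightarrow> real) \<times> (nat \<Rightarrow> real)) set"
  where "vecs = {v. \<forall>i>q. fst v i = 0 \<and> snd v i = 0}"

lemma cone_rot_beyond: "i > q \<Longrightarrow> cone_rot x y i = 0"
  using orth_family_carrier[OF \<rho> hat_sph[of a x]] by (simp add: cone_rot_def rotate_coord)
lemma cone_rot_inv_beyond: "i > q \<Longrightarrow> cone_rot_inv x y i = 0"
  using orth_family_carrier[OF orth_family_transpose[OF \<rho>] hat_sph[of a x]] by (simp add: cone_rot_inv_def rotate_coord)

lemma fibre_vec_vecs: "y \<in> sph q \<Longrightarrow> fibre_vec p x y \<in> vecs"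
  by (auto simp: vecs_def fibre_vec_def sph_iff cone_rot_beyond cone_rot_inv_beyond)

lemma fibre_vecs: "v \<in> fibre x \<Longrightarrow> v \<in> vecs" by (auto simp: fibre_def fibre_vec_vecs)

lemma fibre_part_beyond: "v \<in> vecs \<Longrightarrow> i > q \<Longrightarrow> fibre_part x v i = 0"
  by (auto simp: fibre_part_def vecs_def cone_rot_beyond cone_rot_inv_beyond)

lemma fibre_vec_equator:
  assumes "x \<in> sph (Suc a)" "x (Suc a) = 0" "y \<in> sph q"
  shows "fibre_vec True x y = fibre_vec False x (rotate (\<rho> x) y)"
  using rotate_inv_sph[OF orth_mat_\<rho>[OF equator(1)[OF assms(1,2)]] assms(3)]
  by (simp add: fibre_vec_def cone_rot_equator[OF assms(1,2)] cone_rot_inv_equator[OF assms(1,2)])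

lemma fibre_proj_sph: "v \<in> vecs \<Longrightarrow> fibre_part_sq x v > 0 \<Longrightarrow> (\<lambda>i. fibre_part x v i / sqrt (fibre_part_sq x v)) \<in> sph q"
  by (auto simp: sph_iff power_divide sum_divide_distrib[symmetric] fibre_part_beyond) (simp add: fibre_part_sq_def)

lemma fibre_proj_fibre: "x \<in> sph (Suc a) \<Longrightarrow> v \<in> vecs \<Longrightarrow> fibre_part_sq x v > 0 \<Longrightarrow> fibre_proj x v \<in> fibre x"
proof -
  assume x: "x \<in> sph (Suc a)" and v: "v \<in> vecs" "fibre_part_sq x v > 0"
  have "x \<in> hemi (Suc a) (\<not> x (Suc a) \<le> 0)" using x by (auto simp: hemi_iff)
  with fibre_proj_sph[OF v] show ?thesis unfolding fibre_proj_def fibre_def by blast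
qed

lemma fibre_cases:
  assumes x: "x \<in> sph (Suc a)" and v: "v \<in> fibre x"
  obtains y where "y \<in> sph q" "v = fibre_vec (\<not> x (Suc a) \<le> 0) x y"
proof -
  from v obtain p y where y: "v = fibre_vec p x y" "x \<in> hemi (Suc a) p" "y \<in> sph q" by (auto simp: fibre_def)
  show ?thesis
  proof (cases "p \<and> x (Suc a) \<le> 0")
    case True
    then have e: "x (Suc a) = 0" using y by (auto simp: hemi_iff)
    show ?thesis
      using that[of "rotate (\<rho> x) y"] y True fibre_vec_equator[OF x e y(3)] rotate_sph[OF orth_mat_\<rho>[OF equator(1)[OF x e]] y(3)] e by simp
  next
    case False
    then have "p = (\<not> x (Suc a) \<le> 0)" using y by (auto simp: hemi_iff split: if_splits)
    with y that show ?thesis by blast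
  qed
qed

lemma fibre_part_self: assumes "x \<in> sph (Suc a)" "y \<in> sph q"
  shows "fibre_part x (fibre_vec (\<not> x (Suc a) \<le> 0) x y) = (\<lambda>i. (1 + (rad a x)\<^sup>2) * y i)"
  using assms(2) cone_rot_inv_cone_rot[of y x] cone_rot_cone_rot_inv[of y x] by (auto simp: fibre_part_def fibre_vec_def sph_iff algebra_simps)

lemma fibre_part_sq_self: assumes "x \<in> sph (Suc a)" "v \<in> fibre x" shows "fibre_part_sq x v > 0" "fibre_proj x v = v"
proof -
  obtain y where y: "y \<in> sph q" "v = fibre_vec (\<not> x (Suc a) \<le> 0) x y" by (rule fibre_cases[OF assms])
  let ?c = "1 + (rad a x)\<^sup>2"
  have c: "?c > 0" by (simp add: add_pos_nonneg)
  have p: "fibre_part x v = (\<lambda>i. ?c * y i)" using fibre_part_self[OF assms(1) y(1)] y(2) by simp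
  have s: "fibre_part_sq x v = ?c\<^sup>2" unfolding fibre_part_sq_def p using y(1) by (simp add: power_mult_distrib sum_distrib_left[symmetric] sph_iff)
  show "fibre_part_sq x v > 0" unfolding s using c by simp
  have "sqrt (fibre_part_sq x v) = ?c" unfolding s using c by simp
  then show "fibre_proj x v = v" unfolding fibre_proj_def p using c y(2) by simp
qed

lemma fibre_part_cont_aux:
  assumes f: "continuous_on S f" "\<And>s. s \<in> S \<Longrightarrow> f s \<in> sph (Suc a)" and g: "continuous_on S g"
  shows "continuous_on S (\<lambda>s i. snd (g s) i + cone_rot (f s) (fst (g s)) i)" "continuous_on S (\<lambda>s i. fst (g s) i + cone_rot_inv (f s) (snd (g s)) i)"
proof -
  note g1 = continuous_on_fst[OF g] continuous_on_snd[OF g]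
  show "continuous_on S (\<lambda>s i. snd (g s) i + cone_rot (f s) (fst (g s)) i)"
    using cont_coord[OF cont_cone_rot[OF f g1(1)]] cont_coord[OF g1(2)]
    by (intro continuous_on_coordinatewise_then_product continuous_on_add) auto
  show "continuous_on S (\<lambda>s i. fst (g s) i + cone_rot_inv (f s) (snd (g s)) i)"
    using cont_coord[OF cont_cone_rot_inv[OF f g1(2)]] cont_coord[OF g1(1)]
    by (intro continuous_on_coordinatewise_then_product continuous_on_add) auto
qed

lemma fibre_part_equator:
  assumes x: "x \<in> sph (Suc a)" "x (Suc a) = 0" and v: "v \<in> vecs"
  shows "(\<lambda>i. snd v i + cone_rot x (fst v) i) = rotate (\<rho> x) (\<lambda>i. fst v i + cone_rot_inv x (snd v) i)"
proof
  fix i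
  have e: "x \<in> sph a" by (rule equator(1)[OF x])
  have A: "\<rho> x \<in> carrier_mat (Suc q) (Suc q)" by (rule orth_family_carrier[OF \<rho> e])
  have "snd v = rotate (\<rho> x) (cone_rot_inv x (snd v))"
    using rotate_inv[OF orth_mat_\<rho>t[OF e], of "snd v"] v by (simp add: cone_rot_inv_equator[OF x] vecs_def)
  then have 1: "snd v i = rotate (\<rho> x) (cone_rot_inv x (snd v)) i" by metis
  have 2: "rotate (\<rho> x) (\<lambda>i. f i + g i) i = rotate (\<rho> x) f i + rotate (\<rho> x) g i" for f g
    by (simp add: rotate_coord[OF A] distrib_left sum.distrib)
  show "snd v i + cone_rot x (fst v) i = rotate (\<rho> x) (\<lambda>i. fst v i + cone_rot_inv x (snd v) i) i"
    unfolding 2 cone_rot_equator[OF x] 1[symmetric] by simp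
qed

lemma cont_fibre_part_sq:
  assumes f: "continuous_on S f" "\<And>s. s \<in> S \<Longrightarrow> f s \<in> sph (Suc a)" and g: "continuous_on S g" "\<And>s. s \<in> S \<Longrightarrow> g s \<in> vecs"
  shows "continuous_on S (\<lambda>s. fibre_part_sq (f s) (g s))"
proof -
  have "continuous_on S (\<lambda>s. if f s (Suc a) \<le> 0 then sqnorm q (\<lambda>i. snd (g s) i + cone_rot (f s) (fst (g s)) i)
      else sqnorm q (\<lambda>i. fst (g s) i + cone_rot_inv (f s) (snd (g s)) i))"
  proof (rule continuous_onI_if)
    show "continuous_on S (\<lambda>s. f s (Suc a))" by (rule cont_coord[OF f(1)])
    show "continuous_on {s \<in> S. f s (Suc a) \<le> 0} (\<lambda>s. sqnorm q (\<lambda>i. snd (g s) i + cone_rot (f s) (fst (g s)) i))"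
      using continuous_on_subset[OF cont_coord[OF fibre_part_cont_aux(1)[OF f g(1)]]]
      by (intro continuous_on_sum continuous_on_power) auto
    show "continuous_on {s \<in> S. 0 \<le> f s (Suc a)} (\<lambda>s. sqnorm q (\<lambda>i. fst (g s) i + cone_rot_inv (f s) (snd (g s)) i))"
      using continuous_on_subset[OF cont_coord[OF fibre_part_cont_aux(2)[OF f g(1)]]]
      by (intro continuous_on_sum continuous_on_power) auto
    fix s assume s: "s \<in> S" "f s (Suc a) = 0"
    have "(\<lambda>i. snd (g s) i + cone_rot (f s) (fst (g s)) i) = rotate (\<rho> (f s)) (\<lambda>i. fst (g s) i + cone_rot_inv (f s) (snd (g s)) i)"
      by (rule fibre_part_equator[OF f(2)[OF s(1)] s(2) g(2)[OF s(1)]])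
    from arg_cong[OF this, of "sqnorm q"]
    show "sqnorm q (\<lambda>i. snd (g s) i + cone_rot (f s) (fst (g s)) i) = sqnorm q (\<lambda>i. fst (g s) i + cone_rot_inv (f s) (snd (g s)) i)"
      using sqnorm_rotate[OF orth_mat_\<rho>[OF equator(1)[OF f(2)[OF s(1)] s(2)]], of "\<lambda>i. fst (g s) i + cone_rot_inv (f s) (snd (g s)) i"] g(2)[OF s(1)]
      by (simp add: vecs_def cone_rot_inv_beyond)
  qed
  then show ?thesis by (rule continuous_on_eq) (simp add: fibre_part_sq_def fibre_part_def)
qed

lemma cont_fibre_proj:
  assumes f: "continuous_on S f" "\<And>s. s \<in> S \<Longrightarrow> f s \<in> sph (Suc a)" and g: "continuous_on S g" "\<And>s. s \<in> S \<Longrightarrow> g s \<in> vecs"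
    and pos: "\<And>s. s \<in> S \<Longrightarrow> fibre_part_sq (f s) (g s) > 0"
  shows "continuous_on S (\<lambda>s. fibre_proj (f s) (g s))"
proof -
  let ?N = "\<lambda>s i. (snd (g s) i + cone_rot (f s) (fst (g s)) i) / sqrt (fibre_part_sq (f s) (g s))"
  let ?P = "\<lambda>s i. (fst (g s) i + cone_rot_inv (f s) (snd (g s)) i) / sqrt (fibre_part_sq (f s) (g s))"
  have sc: "continuous_on S (\<lambda>s. sqrt (fibre_part_sq (f s) (g s)))" by (intro continuous_intros cont_fibre_part_sq f g)
  have nz: "sqrt (fibre_part_sq (f s) (g s)) \<noteq> 0" if "s \<in> S" for s using pos[OF that] by simp
  have N: "continuous_on S ?N" "continuous_on S ?P"
    using cont_coord[OF fibre_part_cont_aux(1)[OF f g(1)]] cont_coord[OF fibre_part_cont_aux(2)[OF f g(1)]] sc nz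
    by (auto intro!: continuous_on_coordinatewise_then_product continuous_on_divide)
  have "continuous_on S (\<lambda>s. if f s (Suc a) \<le> 0 then fibre_vec False (f s) (?N s) else fibre_vec True (f s) (?P s))"
  proof (rule continuous_onI_if)
    show "continuous_on S (\<lambda>s. f s (Suc a))" by (rule cont_coord[OF f(1)])
    show "continuous_on {s \<in> S. f s (Suc a) \<le> 0} (\<lambda>s. fibre_vec False (f s) (?N s))"
      using f(2) by (intro fibre_vec_cont continuous_on_subset[OF f(1)] continuous_on_subset[OF N(1)]) auto
    show "continuous_on {s \<in> S. 0 \<le> f s (Suc a)} (\<lambda>s. fibre_vec True (f s) (?P s))"
      using f(2) by (intro fibre_vec_cont continuous_on_subset[OF f(1)] continuous_on_subset[OF N(2)]) auto
    fix s assume s: "s \<in> S" "f s (Suc a) = 0"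
    have x: "f s \<in> sph (Suc a)" by (rule f(2)[OF s(1)])
    have A: "\<rho> (f s) \<in> carrier_mat (Suc q) (Suc q)" by (rule orth_family_carrier[OF \<rho> equator(1)[OF x s(2)]])
    note e = fibre_part_equator[OF x s(2) g(2)[OF s(1)]]
    have PQ: "?N s = rotate (\<rho> (f s)) (?P s)"
      using rotate_scale[OF A, of "1 / sqrt (fibre_part_sq (f s) (g s))" "\<lambda>i. fst (g s) i + cone_rot_inv (f s) (snd (g s)) i"] e
      by (simp add: fun_eq_iff)
    have N': "?N s = (\<lambda>i. fibre_part (f s) (g s) i / sqrt (fibre_part_sq (f s) (g s)))" using s(2) by (simp add: fibre_part_def)
    have "?N s \<in> sph q" unfolding N' by (rule fibre_proj_sph[OF g(2)[OF s(1)] pos[OF s(1)]])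
    then have "rotate (transpose_mat (\<rho> (f s))) (?N s) \<in> sph q"
      by (rule rotate_sph[OF orth_mat_\<rho>t[OF equator(1)[OF x s(2)]]])
    moreover have "rotate (transpose_mat (\<rho> (f s))) (?N s) = ?P s"
      unfolding PQ by (rule rotate_inv[OF orth_mat_\<rho>[OF equator(1)[OF x s(2)]]])
        (use g(2)[OF s(1)] in \<open>simp add: vecs_def cone_rot_inv_beyond\<close>)
    ultimately have "?P s \<in> sph q" by simp
    from fibre_vec_equator[OF x s(2) this] show "fibre_vec False (f s) (?N s) = fibre_vec True (f s) (?P s)" unfolding PQ by simp
  qed
  then show ?thesis by (rule continuous_on_eq) (simp add: fibre_proj_def fibre_part_def)
qed

end

context clutching
begin

text \<open>Projection to a fibre is defined near that fibre. By compactness one \<open>\<delta>\<close> serves for all paths of the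
  family.\<close>

lemma transport_step:
  assumes S: "compact S" and c: "continuous_on (S \<times> {0..1}) (\<lambda>p. curve (fst p) (snd p))"
    and m: "\<And>s t. s \<in> S \<Longrightarrow> 0 \<le> t \<Longrightarrow> t \<le> (1::real) \<Longrightarrow> curve s t \<in> sph (Suc a)"
  obtains \<delta> where "\<delta> > 0" "\<And>s t t' v. s \<in> S \<Longrightarrow> 0 \<le> t \<Longrightarrow> t \<le> 1 \<Longrightarrow> 0 \<le> t' \<Longrightarrow> t' \<le> 1 \<Longrightarrow>
      v \<in> fibre (curve s t) \<Longrightarrow> \<bar>t - t'\<bar> < \<delta> \<Longrightarrow> fibre_part_sq (curve s t') v > 0"
proof -
  let ?F = "(S \<times> {0..1::real}) \<times> ({0..1::real} \<times> sph q)"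
  let ?x = "\<lambda>z. curve (fst (fst z)) (snd (fst z))"
  let ?s = "\<lambda>p z. fibre_part_sq (curve (fst (fst z)) (fst (snd z))) (fibre_vec p (?x z) (snd (snd z)))"
  have F: "compact ?F" by (intro compact_Times S compact_sph compact_unit_interval)
  have "continuous_on ?F fst" "continuous_on ?F (\<lambda>z. (fst (fst z), fst (snd z)))" by (intro continuous_intros)+
  from continuous_on_comp[OF c this(1)] continuous_on_comp[OF c this(2)]
  have x: "continuous_on ?F ?x" "continuous_on ?F (\<lambda>z. curve (fst (fst z)) (fst (snd z)))" by auto
  have s: "continuous_on ?F (?s p)" for p
    by (intro cont_fibre_part_sq x fibre_vec_cont continuous_intros) (auto intro!: m fibre_vec_vecs)
  have "\<exists>\<delta>>0. \<forall>z\<in>?F. (?x z \<in> hemi (Suc a) p) \<longrightarrow> \<bar>snd (fst z) - fst (snd z)\<bar> < \<delta> \<longrightarrow> ?s p z > 0" for p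
  proof -
    let ?K = "?F \<inter> (\<lambda>z. ?s p z) -` {..0} \<inter> (?F \<inter> (\<lambda>z. ?x z (Suc a)) -` (if p then {0..} else {..0}))"
    have "closedin (top_of_set ?F) ?K"
      by (intro closedin_Int continuous_closedin_preimage s cont_coord[OF x(1)]) auto
    then have K: "compact ?K" using F closedin_compact by blast
    have mem: "z \<in> ?K" if "z \<in> ?F" "?x z \<in> hemi (Suc a) p" "\<not> ?s p z > 0" for z
      using that by (auto simp: hemi_iff)
    show ?thesis
    proof (cases "?K = {}")
      case True
      have "?s p z > 0" if "z \<in> ?F" "?x z \<in> hemi (Suc a) p" for z
      proof (rule ccontr)
        assume "\<not> ?s p z > 0"
        from mem[OF that this] show False unfolding True by blast
      qed
      then show ?thesis by (intro exI[of _ 1]) simp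
    next
      case False
      have "continuous_on ?K (\<lambda>z. \<bar>snd (fst z) - fst (snd z)\<bar>)" by (intro continuous_intros)
      from continuous_attains_inf[OF K False this] obtain z where
        z: "z \<in> ?K" "\<And>y. y \<in> ?K \<Longrightarrow> \<bar>snd (fst z) - fst (snd z)\<bar> \<le> \<bar>snd (fst y) - fst (snd y)\<bar>" by blast
      have zF: "z \<in> ?F" "?s p z \<le> 0" "?x z (Suc a) \<in> (if p then {0..} else {..0})" using z(1) by auto
      then have "?x z \<in> sph (Suc a)" "snd (snd z) \<in> sph q" by (auto intro!: m)
      then have "fibre_vec p (?x z) (snd (snd z)) \<in> fibre (?x z)" "?x z \<in> sph (Suc a)"
        unfolding fibre_def using zF(3) by (auto simp: hemi_iff split: if_splits)
      from fibre_part_sq_self(1)[OF this(2,1)] zF(2) have "snd (fst z) \<noteq> fst (snd z)" by auto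
      then have "\<bar>snd (fst z) - fst (snd z)\<bar> > 0" by simp
      moreover have "?s p y > 0" if "y \<in> ?F" "?x y \<in> hemi (Suc a) p" "\<bar>snd (fst y) - fst (snd y)\<bar> < \<bar>snd (fst z) - fst (snd z)\<bar>" for y
      proof (rule ccontr)
        assume "\<not> ?s p y > 0"
        from z(2)[OF mem[OF that(1,2) this]] that(3) show False by simp
      qed
      ultimately show ?thesis by (intro exI[of _ "\<bar>snd (fst z) - fst (snd z)\<bar>"]) blast
    qed
  qed
  then obtain d where d: "\<And>p. d p > 0"
    "\<And>p z. z \<in> ?F \<Longrightarrow> ?x z \<in> hemi (Suc a) p \<Longrightarrow> \<bar>snd (fst z) - fst (snd z)\<bar> < d p \<Longrightarrow> ?s p z > 0"
    by metis
  show ?thesis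
  proof (rule that[of "min (d True) (d False)"])
    fix s t t' v assume a: "s \<in> S" "0 \<le> t" "t \<le> 1" "0 \<le> t'" "t' \<le> 1" "v \<in> fibre (curve s t)" "\<bar>t - t'\<bar> < min (d True) (d False)"
    then obtain p y where "v = fibre_vec p (curve s t) y" "curve s t \<in> hemi (Suc a) p" "y \<in> sph q" by (auto simp: fibre_def)
    then show "fibre_part_sq (curve s t') v > 0" using d(2)[of "((s,t),(t',y))" p] a by (cases p) auto
  qed (use d(1) in auto)
qed

text \<open>After \<open>k\<close> of \<open>N\<close> steps the vector lies in the fibre over \<open>curve s (min t (1 - k / N))\<close>. Clipping at
  \<open>t\<close> makes the walk start at parameter \<open>t\<close> with one and the same number of steps for all \<open>t\<close>, so
  continuity in \<open>t\<close> is automatic.\<close>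

primrec walk where
  "walk curve N 0 s t v = v"
| "walk curve N (Suc k) s t v = fibre_proj (curve s (min t ((real N - real (Suc k)) / real N))) (walk curve N k s t v)"

text \<open>This takes the place of the homotopy lifting property: each fibre over a path is moved
  continuously back to the fibre over its starting point, and is not moved along constant paths.\<close>

lemma transport:
  assumes S: "compact S" and c: "continuous_on (S \<times> {0..1}) (\<lambda>p. curve (fst p) (snd p))"
    and m: "\<And>s t. s \<in> S \<Longrightarrow> 0 \<le> t \<Longrightarrow> t \<le> (1::real) \<Longrightarrow> curve s t \<in> sph (Suc a)"
  obtains B where
    "continuous_on {z. fst z \<in> S \<times> {0..1} \<and> snd z \<in> fibre (curve (fst (fst z)) (snd (fst z)))} (\<lambda>z. B (fst (fst z)) (snd (fst z)) (snd z))"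
    "\<And>s t v. s \<in> S \<Longrightarrow> 0 \<le> t \<Longrightarrow> t \<le> 1 \<Longrightarrow> v \<in> fibre (curve s t) \<Longrightarrow> B s t v \<in> fibre (curve s 0)"
    "\<And>s t v. s \<in> S \<Longrightarrow> 0 \<le> t \<Longrightarrow> t \<le> 1 \<Longrightarrow> (\<And>u. 0 \<le> u \<Longrightarrow> u \<le> t \<Longrightarrow> curve s u = curve s 0) \<Longrightarrow> v \<in> fibre (curve s 0) \<Longrightarrow> B s t v = v"
proof -
  obtain \<delta> where \<delta>: "\<delta> > 0" "\<And>s t t' v. s \<in> S \<Longrightarrow> 0 \<le> t \<Longrightarrow> t \<le> 1 \<Longrightarrow> 0 \<le> t' \<Longrightarrow> t' \<le> 1 \<Longrightarrow>
      v \<in> fibre (curve s t) \<Longrightarrow> \<bar>t - t'\<bar> < \<delta> \<Longrightarrow> fibre_part_sq (curve s t') v > 0"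
    using transport_step[OF S c m] by metis
  \<comment> \<open>With \<open>N\<close> steps, consecutive parameters differ by at most \<open>1 / N < \<delta>\<close>.\<close>
  obtain N :: nat where N: "1 / \<delta> < real N" using reals_Archimedean2 by blast
  have N0: "0 < real N" using N \<delta>(1) by (meson less_trans zero_less_divide_1_iff)
  have "1 / real N < \<delta>" using N N0 \<delta>(1) by (simp add: field_simps)
  let ?Z = "{z. fst z \<in> S \<times> {0..1::real} \<and> snd z \<in> fibre (curve (fst (fst z)) (snd (fst z)))}"
  let ?t = "\<lambda>k t. min t ((real N - real k) / real N)"
  have tk: "0 \<le> ?t k t" "?t k t \<le> t" if "k \<le> N" "0 \<le> t" for k t using that N0 by auto
  have tstep: "\<bar>?t k t - ?t (Suc k) t\<bar> < \<delta>" for k t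
  proof -
    have d: "(real N - real k) / real N - (real N - real (Suc k)) / real N = 1 / real N"
      using N0 by (simp add: field_simps)
    have mm: "\<bar>min t x - min t y\<bar> \<le> e" if "x - y = e" "0 < e" for x y e :: real
      using that by (auto simp: min_def)
    have "\<bar>?t k t - ?t (Suc k) t\<bar> \<le> 1 / real N" by (rule mm[OF d]) (use N0 in simp)
    then show ?thesis using \<open>1 / real N < \<delta>\<close> by simp
  qed
  have w: "walk curve N k s t v \<in> fibre (curve s (?t k t))" "k < N \<Longrightarrow> fibre_part_sq (curve s (?t (Suc k) t)) (walk curve N k s t v) > 0"
    if "k \<le> N" "s \<in> S" "0 \<le> t" "t \<le> 1" "v \<in> fibre (curve s t)" for k s t v
  proof -
    have pos: "fibre_part_sq (curve s (?t (Suc k) t)) u > 0" if "k < N" "u \<in> fibre (curve s (?t k t))" for u k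
    proof (rule \<delta>(2)[OF \<open>s \<in> S\<close> _ _ _ _ that(2) tstep])
      have "k \<le> N" "Suc k \<le> N" using that by auto
      then show "0 \<le> ?t k t" "?t k t \<le> 1" "0 \<le> ?t (Suc k) t" "?t (Suc k) t \<le> 1"
        using tk[of k t] tk[of "Suc k" t] \<open>0 \<le> t\<close> \<open>t \<le> 1\<close> by linarith+
    qed
    show f: "walk curve N k s t v \<in> fibre (curve s (?t k t))"
      using that(1)
    proof (induction k)
      case 0
      then show ?case using that(4,5) N0 by simp
    next
      case (Suc k)
      have IH: "walk curve N k s t v \<in> fibre (curve s (?t k t))" using Suc by simp
      have "curve s (?t (Suc k) t) \<in> sph (Suc a)"
        using tk[OF Suc.prems that(3)] that by (intro m) auto
      from fibre_proj_fibre[OF this fibre_vecs[OF IH] pos[OF _ IH]] show ?case using Suc.prems by simp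
    qed
    show "k < N \<Longrightarrow> fibre_part_sq (curve s (?t (Suc k) t)) (walk curve N k s t v) > 0" using pos[OF _ f] by simp
  qed
  have cw: "continuous_on ?Z (\<lambda>z. walk curve N k (fst (fst z)) (snd (fst z)) (snd z))" if "k \<le> N" for k
    using that
  proof (induction k)
    case 0
    then show ?case by (simp add: continuous_on_snd)
  next
    case (Suc k)
    have "continuous_on ?Z (\<lambda>z. (fst (fst z), ?t (Suc k) (snd (fst z))))" by (intro continuous_intros)
    from continuous_on_comp[OF c this] have x: "continuous_on ?Z (\<lambda>z. curve (fst (fst z)) (?t (Suc k) (snd (fst z))))"
      using tk[OF Suc.prems] by fastforce
    show ?case unfolding walk.simps
    proof (rule cont_fibre_proj[OF x])
      fix z assume z: "z \<in> ?Z"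
      then have zz: "fst (fst z) \<in> S" "0 \<le> snd (fst z)" "snd (fst z) \<le> 1" "snd z \<in> fibre (curve (fst (fst z)) (snd (fst z)))" by auto
      show "curve (fst (fst z)) (?t (Suc k) (snd (fst z))) \<in> sph (Suc a)"
        using tk[OF Suc.prems zz(2)] zz by (intro m) auto
      show "walk curve N k (fst (fst z)) (snd (fst z)) (snd z) \<in> vecs"
        using fibre_vecs[OF w(1)[OF _ zz]] Suc.prems by simp
      show "fibre_part_sq (curve (fst (fst z)) (?t (Suc k) (snd (fst z)))) (walk curve N k (fst (fst z)) (snd (fst z)) (snd z)) > 0"
        using w(2)[OF _ zz] Suc.prems by simp
    qed (use Suc in simp)
  qed
  show ?thesis
  proof (rule that[of "walk curve N N"])
    show "continuous_on ?Z (\<lambda>z. walk curve N N (fst (fst z)) (snd (fst z)) (snd z))" by (rule cw) simp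
    fix s t v assume st: "s \<in> S" "0 \<le> t" "t \<le> (1::real)"
    { assume "v \<in> fibre (curve s t)"
      from w(1)[OF order_refl st this] show "walk curve N N s t v \<in> fibre (curve s 0)" using N0 st by simp }
    assume const: "\<And>u. 0 \<le> u \<Longrightarrow> u \<le> t \<Longrightarrow> curve s u = curve s 0" and v: "v \<in> fibre (curve s 0)"
    have "walk curve N k s t v = v" if "k \<le> N" for k
      using that
    proof (induction k)
      case (Suc k)
      have "curve s (?t (Suc k) t) = curve s 0" using tk[OF Suc.prems st(2)] by (intro const) auto
      then show ?case using Suc fibre_part_sq_self(2)[OF m[OF st(1), of 0] v] by simp
    qed simp
    then show "walk curve N N s t v = v" by simp
  qed
qed

end

section \<open>Injectivity of the fibre inclusion and existence of a section\<close>

text \<open>Moving \<open>u\<close> in the first half of the time and \<open>v\<close> in the second half shows that \<open>\<phi> u u\<close> is the sum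
  of the restrictions of \<open>\<phi>\<close> to the two axes.\<close>

lemma diag_homotopy:
  fixes \<phi> :: "(nat \<Rightarrow> real) \<Rightarrow> (nat \<Rightarrow> real) \<Rightarrow> 'b"
  assumes c: "continuous_map (top_of_set (sph (Suc k) \<times> sph (Suc k))) W (\<lambda>p. \<phi> (fst p) (snd p))"
    and b: "\<phi> base base = w" and n: "homotopic_rel (sph (Suc k)) {base} W w (\<lambda>u. \<phi> u base) (\<lambda>_. w)"
  shows "homotopic_rel (sph (Suc k)) {base} W w (\<lambda>u. \<phi> u u) (\<lambda>v. \<phi> base v)"
proof -
  let ?L = "loop_homotopic (sph k) {base} W w"
  have "continuous_on (sph (Suc k)) (\<lambda>v. (base::nat\<Rightarrow>real, v))" by (intro continuous_intros)
  from cm_comp[OF c this] have g: "homotopic_rel (sph (Suc k)) {base} W w (\<lambda>v. \<phi> base v) (\<lambda>v. \<phi> base v)"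
    by (intro homotopic_rel_refl) (auto simp: b)
  have gl: "?L (susp_loop k (\<lambda>v. \<phi> base v)) (susp_loop k (\<lambda>v. \<phi> base v))" using g by (simp only: susp_loop_iff)
  have "?L (susp_loop k (\<lambda>u. \<phi> u u)) (loop_cat (susp_loop k (\<lambda>u. \<phi> u base)) (susp_loop k (\<lambda>v. \<phi> base v)))"
  proof (rule loop_homotopicI[where h="\<lambda>s q. \<phi> (susp_pt k (fst q) ((1 - s) * snd q + s * min 1 (2 * snd q)))
        (susp_pt k (fst q) ((1 - s) * snd q + s * max 0 (2 * snd q - 1)))"])
    have "continuous_on ({0..1} \<times> (sph k \<times> {0..1})) (\<lambda>p. (susp_pt k (fst (snd p)) ((1 - fst p) * snd (snd p) + fst p * min 1 (2 * snd (snd p))),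
       susp_pt k (fst (snd p)) ((1 - fst p) * snd (snd p) + fst p * max 0 (2 * snd (snd p) - 1))))"
      by (intro continuous_intros)
    from cm_comp[OF c this] show "continuous_map (top_of_set ({0..1} \<times> (sph k \<times> {0..1}))) W
      (\<lambda>p. \<phi> (susp_pt k (fst (snd p)) ((1 - fst p) * snd (snd p) + fst p * min 1 (2 * snd (snd p))))
        (susp_pt k (fst (snd p)) ((1 - fst p) * snd (snd p) + fst p * max 0 (2 * snd (snd p) - 1))))"
      by (auto simp: susp_sph)
    fix x and t :: real assume x: "x \<in> sph k" "0 \<le> t" "t \<le> 1"
    show "loop_cat (susp_loop k (\<lambda>u. \<phi> u base)) (susp_loop k (\<lambda>v. \<phi> base v)) (x, t) =
      \<phi> (susp_pt k (fst (x, t)) ((1 - 1) * snd (x, t) + 1 * min 1 (2 * snd (x, t))))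
         (susp_pt k (fst (x, t)) ((1 - 1) * snd (x, t) + 1 * max 0 (2 * snd (x, t) - 1)))"
      by (cases "t \<le> 1/2") (simp_all add: loop_cat_def susp_loop_def min.absorb1 min.absorb2 max.absorb1 max.absorb2)
  qed (auto simp: susp_loop_def b)
  also have "?L (loop_cat (susp_loop k (\<lambda>u. \<phi> u base)) (susp_loop k (\<lambda>v. \<phi> base v))) (loop_cat (susp_loop k (\<lambda>_. w)) (susp_loop k (\<lambda>v. \<phi> base v)))"
    by (rule loop_cat_cong[OF _ gl]) (simp only: susp_loop_iff n)
  also have "?L (loop_cat (susp_loop k (\<lambda>_. w)) (susp_loop k (\<lambda>v. \<phi> base v))) (susp_loop k (\<lambda>v. \<phi> base v))"
    using loop_cat_unitL[OF gl] by (simp add: susp_loop_def)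
  finally show ?thesis by (simp only: susp_loop_iff)
qed

context clutching
begin

lemma base_eq: "base (Suc a) = 0" by (simp add: base_def)

lemma bundle_vec_incl: "y \<in> sph q \<Longrightarrow> bundle_vec (fibre_incl y) = fibre_vec False base y"
  by (simp add: bundle_vec_def fibre_incl_def)

lemma fibre_base: "v \<in> fibre base \<longleftrightarrow> (\<exists>y\<in>sph q. v = fibre_vec False base y)"
proof
  assume "v \<in> fibre base"
  from fibre_cases[OF base_sph this] show "\<exists>y\<in>sph q. v = fibre_vec False base y" by (auto simp: base_eq)
next
  assume "\<exists>y\<in>sph q. v = fibre_vec False base y"
  then show "v \<in> fibre base" unfolding fibre_def by (auto simp: hemi_iff base_eq)
qed

lemma snd_fibre_vec: "snd (fibre_vec False x y) = y" by (simp add: fibre_vec_def)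

text \<open>A homotopy in \<open>E\<close> from \<open>f\<close> to \<open>g\<close> projects to a family of loops in the base. Transport along
  them, followed backwards to time 0, is a homotopy in the fibre from \<open>f\<close> to \<open>w \<mapsto> \<tau> w (g w)\<close>, where
  \<open>\<tau> w\<close> is the monodromy. Applied to the section instead of the given homotopy the same argument shows
  that \<open>w \<mapsto> \<tau> w base\<close> is null-homotopic, and \<open>diag_homotopy\<close> removes the monodromy.\<close>

lemma fibre_incl_inj:
  assumes sec: "pointed_section (Suc a) q \<rho> s"
    and f: "homotopic_rel (sph (Suc k)) {base} (nsphere q) base f f" "homotopic_rel (sph (Suc k)) {base} (nsphere q) base g g"
    and h: "homotopic_rel (sph (Suc k)) {base} E (fibre_incl base) (\<lambda>w. fibre_incl (f w)) (\<lambda>w. fibre_incl (g w))"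
  shows "homotopic_rel (sph (Suc k)) {base} (nsphere q) base f g"
proof -
  let ?S = "sph (Suc k)"
  have fc: "continuous_on ?S f" "\<And>w. w \<in> ?S \<Longrightarrow> f w \<in> sph q" and gc: "continuous_on ?S g" "\<And>w. w \<in> ?S \<Longrightarrow> g w \<in> sph q"
    using homotopic_rel_cont[OF f(1)] homotopic_rel_cont[OF f(2)] unfolding cm_sph by auto
  from h obtain H where H: "continuous_map (top_of_set ({0..1} \<times> ?S)) E (\<lambda>p. H (fst p) (snd p))"
    "\<And>x. x \<in> ?S \<Longrightarrow> H (0::real) x = fibre_incl (f x)" "\<And>x. x \<in> ?S \<Longrightarrow> H 1 x = fibre_incl (g x)"
    "\<And>t x. 0 \<le> t \<Longrightarrow> t \<le> 1 \<Longrightarrow> x \<in> {base} \<Longrightarrow> H t x = fibre_incl base" by (rule homotopic_relE) blast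
  have HE: "H t w \<in> topspace E" if "0 \<le> t" "t \<le> 1" "w \<in> ?S" for t w
    using continuous_map_image_subset_topspace[OF H(1)] that by force
  define curve where "curve w t = bundle_proj (H t w)" for w t
  have pi: "bundle_proj (fibre_incl y) = base" for y by (simp add: bundle_proj_def fibre_incl_def)
  have "continuous_map (top_of_set ({0..1} \<times> ?S)) euclidean (bundle_proj \<circ> (\<lambda>p. H (fst p) (snd p)))"
    by (rule continuous_map_compose[OF H(1) cont_proj])
  then have gc': "continuous_on ({0..1} \<times> ?S) (\<lambda>p. curve (snd p) (fst p))" by (simp add: curve_def o_def)
  have "continuous_on (?S \<times> {0..1}) (\<lambda>p. (snd p, fst p))" by (intro continuous_intros)
  from continuous_on_comp[OF gc' this] have ggc: "continuous_on (?S \<times> {0..1}) (\<lambda>p. curve (fst p) (snd p))" by auto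
  have ggm: "curve w t \<in> sph (Suc a)" if "w \<in> ?S" "0 \<le> t" "t \<le> 1" for w t
    using bundle_vec_fibre[OF HE] that by (simp add: curve_def)
  have gg0: "curve w 0 = base" "curve w 1 = base" if "w \<in> ?S" for w using H(2,3) that by (simp_all add: curve_def pi)
  have ggb: "curve base t = base" if "0 \<le> t" "t \<le> 1" for t using H(4) that by (simp add: curve_def pi)
  obtain B where
    Bc: "continuous_on {z. fst z \<in> ?S \<times> {0..1} \<and> snd z \<in> fibre (curve (fst (fst z)) (snd (fst z)))} (\<lambda>z. B (fst (fst z)) (snd (fst z)) (snd z))"
    and Bm: "\<And>s t v. s \<in> ?S \<Longrightarrow> 0 \<le> t \<Longrightarrow> t \<le> 1 \<Longrightarrow> v \<in> fibre (curve s t) \<Longrightarrow> B s t v \<in> fibre (curve s 0)"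
    and B0: "\<And>s t v. s \<in> ?S \<Longrightarrow> 0 \<le> t \<Longrightarrow> t \<le> 1 \<Longrightarrow> (\<And>u. 0 \<le> u \<Longrightarrow> u \<le> t \<Longrightarrow> curve s u = curve s 0) \<Longrightarrow> v \<in> fibre (curve s 0) \<Longrightarrow> B s t v = v"
  proof (rule transport[OF compact_sph ggc], goal_cases)
    case (1 s t)
    then show ?case by (intro ggm)
  next
    case (2 B)
    show ?case by (rule that[OF 2(2,3,4)])
  qed
  have Bs: "snd (B s t v) \<in> sph q" if "s \<in> ?S" "0 \<le> t" "t \<le> 1" "v \<in> fibre (curve s t)" for s t v
    using Bm[OF that] gg0(1)[OF that(1)] by (auto simp: fibre_base snd_fibre_vec)
  have fb: "fibre_vec False base y \<in> fibre base" if "y \<in> sph q" for y using that by (auto simp: fibre_base)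
  have B_0: "B s 0 v = v" if "s \<in> ?S" "v \<in> fibre base" for s v using that gg0[OF that(1)] by (intro B0) auto
  have B_b: "B base t v = v" if "0 \<le> t" "t \<le> 1" "v \<in> fibre base" for t v using that ggb by (intro B0) auto
  define \<tau> where "\<tau> w y = snd (B w 1 (fibre_vec False base y))" for w y
  \<comment> \<open>A homotopy \<open>K\<close> over the same family of loops, transported back to time 0, stays in the
    fibre over \<open>base\<close>. It is used for the given homotopy and for the section along the loops.\<close>
  have along: "homotopic_rel ?S {base} (nsphere q) base f0 (\<lambda>w. \<tau> w (g0 w))"
    if K: "continuous_map (top_of_set ({0..1} \<times> ?S)) E (\<lambda>p. K (fst p) (snd p))"
      and Kp: "\<And>t w. 0 \<le> t \<Longrightarrow> t \<le> (1::real) \<Longrightarrow> w \<in> ?S \<Longrightarrow> bundle_proj (K t w) = curve w t"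
      and K0: "\<And>w. w \<in> ?S \<Longrightarrow> K 0 w = fibre_incl (f0 w)" "\<And>w. w \<in> ?S \<Longrightarrow> K 1 w = fibre_incl (g0 w)"
      and Kb: "\<And>t. 0 \<le> t \<Longrightarrow> t \<le> 1 \<Longrightarrow> K t base = fibre_incl base"
      and y: "\<And>w. w \<in> ?S \<Longrightarrow> f0 w \<in> sph q" "\<And>w. w \<in> ?S \<Longrightarrow> g0 w \<in> sph q" for K f0 g0
  proof (rule homotopic_relI[where h="\<lambda>t w. snd (B w t (bundle_vec (K t w)))"])
    have KE: "K t w \<in> topspace E" if "0 \<le> t" "t \<le> 1" "w \<in> ?S" for t w
      using continuous_map_image_subset_topspace[OF K] that by force
    have Kf: "bundle_vec (K t w) \<in> fibre (curve w t)" if "0 \<le> t" "t \<le> 1" "w \<in> ?S" for t w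
      using bundle_vec_fibre[OF KE[OF that]] Kp[OF that] by simp
    have "continuous_map (top_of_set ({0..1} \<times> ?S)) euclidean (bundle_vec \<circ> (\<lambda>p. K (fst p) (snd p)))"
      by (rule continuous_map_compose[OF K cont_bundle_vec])
    then have "continuous_on ({0..1} \<times> ?S) (\<lambda>p. bundle_vec (K (fst p) (snd p)))" by (simp add: o_def)
    then have "continuous_on ({0..1} \<times> ?S) (\<lambda>p. ((snd p, fst p), bundle_vec (K (fst p) (snd p))))" by (intro continuous_intros)
    from continuous_on_comp[OF Bc this] have "continuous_on ({0..1} \<times> ?S) (\<lambda>p. B (snd p) (fst p) (bundle_vec (K (fst p) (snd p))))"
      using Kf by auto
    then have "continuous_on ({0..1} \<times> ?S) (\<lambda>p. snd (B (snd p) (fst p) (bundle_vec (K (fst p) (snd p)))))" by (rule continuous_on_snd)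
    then show "continuous_map (top_of_set ({0..1} \<times> ?S)) (nsphere q) (\<lambda>p. snd (B (snd p) (fst p) (bundle_vec (K (fst p) (snd p)))))"
      unfolding cm_sph by (auto intro!: Bs Kf)
    show "f0 w = snd (B w 0 (bundle_vec (K 0 w)))" if "w \<in> ?S" for w
      using that K0(1) y(1) B_0 fb by (simp add: bundle_vec_incl snd_fibre_vec)
    show "\<tau> w (g0 w) = snd (B w 1 (bundle_vec (K 1 w)))" if "w \<in> ?S" for w
      using that K0(2) y(2) by (simp add: bundle_vec_incl \<tau>_def)
    show "snd (B w t (bundle_vec (K t w))) = base" if "0 \<le> t" "t \<le> 1" "w \<in> {base}" for t w
      using that Kb B_b fb by (simp add: bundle_vec_incl snd_fibre_vec)
  qed auto
  have 1: "homotopic_rel ?S {base} (nsphere q) base f (\<lambda>w. \<tau> w (g w))"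
    by (rule along[OF H(1)]) (use H fc gc in \<open>auto simp: curve_def\<close>)
  have sc: "continuous_map (nsphere (Suc a)) E s" and sp: "\<And>x. x \<in> sph (Suc a) \<Longrightarrow> bundle_proj (s x) = x" and sb: "s base = fibre_incl base"
    using sec by (auto simp: pointed_section_def)
  have "continuous_map (top_of_set (sph (Suc a))) E s" using sc by (metis nsphere_eq)
  from cm_comp[OF this gc'] have "continuous_map (top_of_set ({0..1} \<times> ?S)) E (\<lambda>p. s (curve (snd p) (fst p)))"
    using ggm by auto
  then have 2: "homotopic_rel ?S {base} (nsphere q) base (\<lambda>_. base) (\<lambda>w. \<tau> w base)"
    by (intro along[of "\<lambda>t w. s (curve w t)" "\<lambda>_. base" "\<lambda>_. base"]) (auto simp: sp ggm gg0 ggb sb)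
  have \<tau>b: "\<tau> base y = y" if "y \<in> sph q" for y using that B_b[of 1] fb by (simp add: \<tau>_def snd_fibre_vec)
  have "homotopic_rel ?S {base} (nsphere q) base (\<lambda>u. \<tau> u (g u)) (\<lambda>v. \<tau> base (g v))"
  proof (rule diag_homotopy[where \<phi>="\<lambda>u v. \<tau> u (g v)"])
    have "continuous_on (?S \<times> ?S) (\<lambda>p. g (snd p))" by (rule continuous_on_comp[OF gc(1)]) (auto intro!: continuous_intros)
    then have "continuous_on (?S \<times> ?S) (\<lambda>p. fibre_vec False base (g (snd p)))" by (intro fibre_vec_cont continuous_intros) auto
    then have "continuous_on (?S \<times> ?S) (\<lambda>p. ((fst p, 1::real), fibre_vec False base (g (snd p))))" by (intro continuous_intros)
    from continuous_on_comp[OF Bc this] have "continuous_on (?S \<times> ?S) (\<lambda>p. B (fst p) 1 (fibre_vec False base (g (snd p))))"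
      using gg0(2) fb gc(2) by auto
    then have "continuous_on (?S \<times> ?S) (\<lambda>p. \<tau> (fst p) (g (snd p)))" unfolding \<tau>_def by (rule continuous_on_snd)
    then show "continuous_map (top_of_set (?S \<times> ?S)) (nsphere q) (\<lambda>p. \<tau> (fst p) (g (snd p)))"
      unfolding cm_sph by (auto simp: \<tau>_def gg0(2) intro!: Bs fb gc(2))
    have gb: "g base = base" using homotopic_rel_base[OF f(2)] by simp
    show "\<tau> base (g base) = base" using \<tau>b[of base] gb by simp
    show "homotopic_rel ?S {base} (nsphere q) base (\<lambda>u. \<tau> u (g base)) (\<lambda>_. base)" using homotopic_rel_sym[OF 2] gb by simp
  qed
  then have 3: "homotopic_rel ?S {base} (nsphere q) base (\<lambda>u. \<tau> u (g u)) g" by (rule homotopic_rel_cong) (auto simp: \<tau>b gc(2))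
  show ?thesis by (rule homotopic_rel_trans[OF 1 3])
qed

text \<open>Over the lower hemisphere the section is \<open>base\<close>. In the upper chart it is then \<open>\<rho>(x)\<^sup>T base\<close>
  over the equator, which extends over the hemisphere because \<open>\<rho>\<close> is homotopic to
  matrices that fix \<open>base\<close>.\<close>

lemma section_exists:
  assumes A: "orth_family (sph a) q A"
    and h: "homotopic_rel (sph a) {base} (SO (Suc q)) (1\<^sub>m (Suc q)) \<rho> (\<lambda>x. SO_incl (A x))"
  shows "\<exists>s. pointed_section (Suc a) q \<rho> s"
proof -
  from h obtain k where k: "continuous_map (top_of_set ({0..1} \<times> sph a)) (SO (Suc q)) (\<lambda>p. k (fst p) (snd p))"
    "\<And>x. x \<in> sph a \<Longrightarrow> k (0::real) x = \<rho> x" "\<And>x. x \<in> sph a \<Longrightarrow> k 1 x = SO_incl (A x)" by (rule homotopic_relE) blast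
  have K: "orth_family ({0..1} \<times> sph a) (Suc q) (\<lambda>p. k (fst p) (snd p))" by (rule SO_orth_family[OF k(1)])
  have K1: "rotate (transpose_mat (k 1 u)) base = base" if "u \<in> sph a" for u
    using k(3)[OF that] SO_incl_transpose[OF orth_family_carrier[OF A that]]
      rotate_SO_incl_base[OF orth_family_carrier[OF orth_family_transpose[OF A] that]] by simp
  define yy where "yy x = rotate (transpose_mat (k (min 1 (2 * x (Suc a))) (hat a x))) base" for x
  have polar_last: "polar a u h (Suc a) = h" for u h by (simp add: polar_def)
  have Km: "orth_mat (Suc q) (transpose_mat (k s u))" if "0 \<le> s" "s \<le> 1" "u \<in> sph a" for s u
    using orth_family_orth_mat[OF orth_family_transpose[OF K], of "(s,u)"] that by auto
  have ym: "yy x \<in> sph q" if "x \<in> hemi (Suc a) True" for x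
    unfolding yy_def using that by (intro rotate_sph Km hat_sph) (auto simp: hemi_iff)
  have yc: "continuous_on (hemi (Suc a) True) yy"
  proof (rule continuous_on_descend[where A="sph a \<times> {0..1::real}" and p="\<lambda>z. polar a (fst z) (snd z)"
        and F="\<lambda>z. rotate (transpose_mat (k (min 1 (2 * snd z)) (fst z))) base"])
    show "compact (sph a \<times> {0..1::real})" by (intro compact_Times compact_sph compact_unit_interval)
    show "continuous_on (sph a \<times> {0..1}) (\<lambda>z. polar a (fst z) (snd z))" by (intro cont_polar continuous_intros)
    show "(\<lambda>z. polar a (fst z) (snd z)) ` (sph a \<times> {0..1}) = hemi (Suc a) True"
    proof (intro equalityI subsetI)
      fix x assume "x \<in> hemi (Suc a) True"
      then have x: "x \<in> sph (Suc a)" "0 \<le> x (Suc a)" by (auto simp: hemi_iff)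
      from polar_hat[OF x(1)] x(2) show "x \<in> (\<lambda>z. polar a (fst z) (snd z)) ` (sph a \<times> {0..1})"
        by (intro image_eqI[of _ _ "(hat a x, x (Suc a))"]) (auto simp: hat_sph)
    qed (auto simp: hemi_iff polar_last intro!: polar_sph)
    have "continuous_on (sph a \<times> {0..1::real}) (\<lambda>z. (min 1 (2 * snd z), fst z))" by (intro continuous_intros)
    from orth_family_comp[OF orth_family_transpose[OF K] this]
    have "orth_family (sph a \<times> {0..1::real}) (Suc q) (\<lambda>z. transpose_mat (k (min 1 (2 * snd z)) (fst z)))" by auto
    then show "continuous_on (sph a \<times> {0..1}) (\<lambda>z. rotate (transpose_mat (k (min 1 (2 * snd z)) (fst z))) base)"
      by (rule rotate_cont) (intro continuous_intros)
    fix z assume "z \<in> sph a \<times> {0..1::real}"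
    then have z: "fst z \<in> sph a" "0 \<le> snd z" "snd z \<le> 1" by auto
    show "yy (polar a (fst z) (snd z)) = rotate (transpose_mat (k (min 1 (2 * snd z)) (fst z))) base"
    proof (cases "snd z < 1")
      case True
      then show ?thesis using z by (simp add: yy_def hat_polar polar_last)
    next
      case False
      then have "snd z = 1" using z by simp
      then show ?thesis using z K1 hat_sph by (simp add: yy_def polar_last)
    qed
  qed
  define s where "s x = (if x (Suc a) \<le> 0 then glue (Suc a) \<rho> (False, x, base) else glue (Suc a) \<rho> (True, x, yy x))" for x
  have "continuous_map (top_of_set (sph (Suc a))) E s"
    unfolding s_def
  proof (rule cm_if)
    show "continuous_on (sph (Suc a)) (\<lambda>x. x (Suc a))" by (rule cont_coord) (intro continuous_intros)
    show "continuous_map (top_of_set {x \<in> sph (Suc a). x (Suc a) \<le> 0}) E (\<lambda>x. glue (Suc a) \<rho> (False, x, base))"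
      by (rule bundle_into) (auto simp: hemi_iff intro!: continuous_intros)
    have eq: "{x \<in> sph (Suc a). 0 \<le> x (Suc a)} = hemi (Suc a) True" by (auto simp: hemi_iff)
    show "continuous_map (top_of_set {x \<in> sph (Suc a). 0 \<le> x (Suc a)}) E (\<lambda>x. glue (Suc a) \<rho> (True, x, yy x))"
      unfolding eq by (rule bundle_into) (auto intro!: continuous_intros yc ym)
    fix x assume x: "x \<in> sph (Suc a)" "x (Suc a) = 0"
    have e: "x \<in> sph a" "hat a x = x" using equator[OF x] by auto
    have "yy x = rotate (transpose_mat (\<rho> x)) base" using x(2) e k(2) by (simp add: yy_def)
    then show "glue (Suc a) \<rho> (False, x, base) = glue (Suc a) \<rho> (True, x, yy x)"
      using x(2) rotate_inv_sph'[OF orth_mat_\<rho>[OF e(1)] base_sph] by (simp add: glue_def)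
  qed
  then have "continuous_map (nsphere (Suc a)) E s" by (metis nsphere_eq)
  moreover have "bundle_proj (s x) = x" for x by (simp add: s_def proj_glue)
  moreover have "s base = fibre_incl base" by (simp add: s_def base_eq glue_def fibre_incl_def)
  ultimately show ?thesis unfolding pointed_section_def by blast
qed

end

section \<open>The brace product of the two identities\<close>

lemma susp_hemi:
  assumes u: "u \<in> sph a" and t: "0 \<le> t" "t \<le> 1"
  shows "t \<le> 1/2 \<Longrightarrow> susp_pt a u t \<in> hemi (Suc a) True" "1/2 \<le> t \<Longrightarrow> susp_pt a u t \<in> hemi (Suc a) False"
proof -
  have S: "sqrt (2 * (1 - u 0)) / 2 \<ge> 0" using sph0_le[OF u] by simp
  show "susp_pt a u t \<in> hemi (Suc a) True" if "t \<le> 1/2"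
  proof -
    have "0 \<le> sin (2 * pi * t)" using that t by (intro sin_ge_zero) auto
    then show ?thesis using S susp_sph[OF u] by (simp add: hemi_iff susp_last[OF u])
  qed
  show "susp_pt a u t \<in> hemi (Suc a) False" if h: "1/2 \<le> t"
  proof (cases "t = 1")
    case False
    have "pi * 1 \<le> pi * (2 * t)" "pi * (2 * t) < pi * 2" using h False t pi_gt_zero
      by (intro mult_left_mono mult_strict_left_mono; simp)+
    then have "sin (2 * pi * t) \<le> 0" by (intro sin_le_zero) (auto simp: algebra_simps)
    then show ?thesis using S susp_sph[OF u] by (simp add: hemi_iff susp_last[OF u] mult_nonpos_nonneg)
  qed (use base_sph in \<open>simp add: hemi_iff base_def\<close>)
qed

text \<open>The dimension of the fibre is positive from here on, so that the fibre is itself a suspension.\<close>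

locale clutching1 = clutching a "Suc b" \<rho> for a b :: nat and \<rho>
begin

lemma point_over:
  assumes e: "e \<in> topspace E" and x: "bundle_proj e = x" "x \<in> hemi (Suc a) p"
  obtains y where "y \<in> sph (Suc b)" "e = glue (Suc a) \<rho> (p, x, y)"
proof -
  from e obtain p' x' y where y: "e = glue (Suc a) \<rho> (p', x', y)" "x' \<in> hemi (Suc a) p'" "y \<in> sph (Suc b)" by (rule E_cases)
  then have xx: "x' = x" using x(1) by (simp add: proj_glue)
  show ?thesis
  proof (cases "p = p'")
    case True
    with y xx that show ?thesis by blast
  next
    case False
    then have eq: "x \<in> sph (Suc a)" "x (Suc a) = 0" using y(2) x(2) xx by (auto simp: hemi_iff split: if_splits)
    have xs: "x \<in> sph a" by (rule equator(1)[OF eq])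
    show ?thesis
    proof (cases p)
      case True
      with False have "e = glue (Suc a) \<rho> (p, x, rotate (transpose_mat (\<rho> x)) y)"
        using y xx eq(2) rotate_inv_sph'[OF orth_mat_\<rho>[OF xs] y(3)] by (simp add: glue_def)
      then show ?thesis using that rotate_sph[OF orth_mat_\<rho>t[OF xs] y(3)] by blast
    next
      case False
      with \<open>p \<noteq> p'\<close> have "e = glue (Suc a) \<rho> (p, x, rotate (\<rho> x) y)"
        using y xx eq(2) by (simp add: glue_def)
      then show ?thesis using that rotate_sph[OF orth_mat_\<rho>[OF xs] y(3)] by blast
    qed
  qed
qed

lemma rotate_\<rho>_base: "y \<in> sph (Suc b) \<Longrightarrow> rotate (\<rho> base) y = y" "y \<in> sph (Suc b) \<Longrightarrow> rotate (transpose_mat (\<rho> base)) y = y"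
  using rotate_one[of "Suc (Suc b)" y] by (auto simp: \<rho>b sph_iff)

lemma cone_rot_inv_base: "y \<in> sph (Suc b) \<Longrightarrow> cone_rot_inv base y = y"
  by (simp add: cone_rot_inv_equator[OF base_sph base_eq] rotate_\<rho>_base)

text \<open>A trivialization of the bundle over the disc \<open>D\<^sup>n \<rightarrow> S\<^sup>n\<close>. It starts at the cone point with the
  standard inclusion of the fibre and, having passed once through the gluing, ends on the boundary
  with \<open>\<rho>\<close>.\<close>

definition cone_bundle_map :: "(nat \<Rightarrow> real) \<Rightarrow> (nat \<Rightarrow> real) \<Rightarrow> bool \<times> (nat \<Rightarrow> real) \<times> (nat \<Rightarrow> real)"
  where "cone_bundle_map v y = (case cone_coords a v of (u, t) \<Rightarrow>
    if t \<le> 1/2 then glue (Suc a) \<rho> (True, susp_pt a u t, y) else glue (Suc a) \<rho> (False, susp_pt a u t, rotate (\<rho> u) y))"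

lemma cone_bundle_map_cone:
  assumes u: "u \<in> sph a" "0 \<le> t" "t \<le> 1" and y: "y \<in> sph (Suc b)"
  shows "cone_bundle_map (cone_pt u t) y = (if t \<le> 1/2 then glue (Suc a) \<rho> (True, susp_pt a u t, y) else glue (Suc a) \<rho> (False, susp_pt a u t, rotate (\<rho> u) y))"
  unfolding cone_bundle_map_def
  by (rule cone_coords_eq[OF u, where w="fibre_incl y" and F="\<lambda>u t. if t \<le> 1/2 then glue (Suc a) \<rho> (True, susp_pt a u t, y) else glue (Suc a) \<rho> (False, susp_pt a u t, rotate (\<rho> u) y)"])
    (auto simp: glue_def fibre_incl_def base_eq rotate_\<rho>_base y)

lemma cone_bundle_map_base: "y \<in> sph (Suc b) \<Longrightarrow> cone_bundle_map base y = fibre_incl y"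
  using cone_bundle_map_cone[of base 0 y] by (simp add: glue_def fibre_incl_def base_eq rotate_\<rho>_base)

lemma cone_bundle_map_sph: "u \<in> sph a \<Longrightarrow> y \<in> sph (Suc b) \<Longrightarrow> cone_bundle_map u y = fibre_incl (rotate (\<rho> u) y)"
  using cone_bundle_map_cone[of u 1 y] by (simp add: glue_def fibre_incl_def)

lemma cont_cone_bundle_map: "continuous_map (top_of_set (disc a \<times> sph (Suc b))) E (\<lambda>p. cone_bundle_map (fst p) (snd p))"
proof (rule cm_descend[where A="(sph a \<times> {0..1::real}) \<times> sph (Suc b)" and p="\<lambda>z. (cone_pt (fst (fst z)) (snd (fst z)), snd z)"
      and F="\<lambda>z. if snd (fst z) \<le> 1/2 then glue (Suc a) \<rho> (True, susp_pt a (fst (fst z)) (snd (fst z)), snd z)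
        else glue (Suc a) \<rho> (False, susp_pt a (fst (fst z)) (snd (fst z)), rotate (\<rho> (fst (fst z))) (snd z))"])
  let ?A = "(sph a \<times> {0..1::real}) \<times> sph (Suc b)"
  show "compact ?A" by (intro compact_Times compact_sph compact_unit_interval)
  show "continuous_on ?A (\<lambda>z. (cone_pt (fst (fst z)) (snd (fst z)), snd z))" by (intro continuous_intros)
  show "(\<lambda>z. (cone_pt (fst (fst z)) (snd (fst z)), snd z)) ` ?A = disc a \<times> sph (Suc b)"
  proof (intro equalityI subsetI)
    fix p assume p: "p \<in> disc a \<times> sph (Suc b)"
    then have "fst p \<in> disc a" by auto
    then obtain u t where "u \<in> sph a" "0 \<le> t" "t \<le> 1" "cone_pt u t = fst p" by (rule cone_pt_surj)
    with p show "p \<in> (\<lambda>z. (cone_pt (fst (fst z)) (snd (fst z)), snd z)) ` ?A"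
      by (intro image_eqI[of _ _ "((u,t), snd p)"]) (auto simp: prod_eq_iff)
  qed (auto simp: cone_pt_disc)
  show "continuous_map (top_of_set ?A) E (\<lambda>z. if snd (fst z) \<le> 1/2 then glue (Suc a) \<rho> (True, susp_pt a (fst (fst z)) (snd (fst z)), snd z)
        else glue (Suc a) \<rho> (False, susp_pt a (fst (fst z)) (snd (fst z)), rotate (\<rho> (fst (fst z))) (snd z)))"
  proof (rule cm_if)
    show "continuous_on ?A (\<lambda>z. snd (fst z))" by (intro continuous_intros)
    show "continuous_map (top_of_set {z \<in> ?A. snd (fst z) \<le> 1/2}) E (\<lambda>z. glue (Suc a) \<rho> (True, susp_pt a (fst (fst z)) (snd (fst z)), snd z))"
      by (rule bundle_into) (auto intro!: continuous_intros susp_hemi)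
    have "orth_family {z \<in> ?A. 1/2 \<le> snd (fst z)} (Suc (Suc b)) (\<lambda>z. \<rho> (fst (fst z)))"
      by (rule orth_family_comp[OF \<rho>]) (auto intro!: continuous_intros)
    then have "continuous_on {z \<in> ?A. 1/2 \<le> snd (fst z)} (\<lambda>z. rotate (\<rho> (fst (fst z))) (snd z))"
      by (rule rotate_cont) (intro continuous_intros)
    then show "continuous_map (top_of_set {z \<in> ?A. 1/2 \<le> snd (fst z)}) E (\<lambda>z. glue (Suc a) \<rho> (False, susp_pt a (fst (fst z)) (snd (fst z)), rotate (\<rho> (fst (fst z))) (snd z)))"
      by (intro bundle_into) (auto intro!: continuous_intros susp_hemi rotate_sph orth_mat_\<rho>)
    fix z assume z: "z \<in> ?A" "snd (fst z) = 1/2"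
    then have "fst (fst z) \<in> sph a" by auto
    then show "glue (Suc a) \<rho> (True, susp_pt a (fst (fst z)) (snd (fst z)), snd z) =
        glue (Suc a) \<rho> (False, susp_pt a (fst (fst z)) (snd (fst z)), rotate (\<rho> (fst (fst z))) (snd z))"
      unfolding z(2) using sph_equator[of "fst (fst z)" a] by (simp add: susp_half glue_def)
  qed
qed (auto simp: cone_bundle_map_cone)

text \<open>The section in the trivialization over the disc.\<close>

definition section_lift :: "((nat \<Rightarrow> real) \<Rightarrow> bool \<times> (nat \<Rightarrow> real) \<times> (nat \<Rightarrow> real)) \<Rightarrow> (nat \<Rightarrow> real) \<Rightarrow> nat \<Rightarrow> real"
  where "section_lift s v = (case cone_coords a v of (u, t) \<Rightarrow>
    if t \<le> 1/2 then fst (bundle_vec (s (susp_pt a u t))) else rotate (transpose_mat (\<rho> u)) (snd (bundle_vec (s (susp_pt a u t)))))"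

context
  fixes s
  assumes sec: "pointed_section (Suc a) (Suc b) \<rho> s"
begin

lemma section_cont: "continuous_map (top_of_set (sph (Suc a))) E s"
  and section_proj: "\<And>x. x \<in> sph (Suc a) \<Longrightarrow> bundle_proj (s x) = x" and section_base: "s base = fibre_incl base"
proof -
  show "continuous_map (top_of_set (sph (Suc a))) E s"
    using sec unfolding pointed_section_def by (metis nsphere_eq)
qed (use sec in \<open>auto simp: pointed_section_def\<close>)

lemma section_in_E: "x \<in> sph (Suc a) \<Longrightarrow> s x \<in> topspace E"
  using continuous_map_image_subset_topspace[OF section_cont] by auto

lemma section_lift_cone:
  assumes u: "u \<in> sph a" "0 \<le> t" "t \<le> 1"
  shows "section_lift s (cone_pt u t) = (if t \<le> 1/2 then fst (bundle_vec (s (susp_pt a u t))) else rotate (transpose_mat (\<rho> u)) (snd (bundle_vec (s (susp_pt a u t)))))"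
  unfolding section_lift_def
proof (rule cone_coords_eq[OF u, where w="base" and F="\<lambda>u t. if t \<le> 1/2 then fst (bundle_vec (s (susp_pt a u t))) else rotate (transpose_mat (\<rho> u)) (snd (bundle_vec (s (susp_pt a u t))))"])
  fix u and t :: real assume "u = base \<or> t = 0" and u: "u \<in> sph a" and t: "0 \<le> t" "t \<le> 1"
  then have e: "susp_pt a u t = base" and c: "t \<le> 1/2 \<or> u = base" by auto
  have "bundle_vec (s base) = (base, base)" by (simp add: section_base bundle_vec_incl fibre_vec_def cone_rot_inv_base)
  then show "(if t \<le> 1/2 then fst (bundle_vec (s (susp_pt a u t))) else rotate (transpose_mat (\<rho> u)) (snd (bundle_vec (s (susp_pt a u t))))) = base"
    unfolding e using c by (auto simp: rotate_\<rho>_base)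
qed

lemma cone_bundle_map_section_lift_aux:
  assumes u: "u \<in> sph a" "0 \<le> t" "t \<le> 1"
  shows "section_lift s (cone_pt u t) \<in> sph (Suc b) \<and> cone_bundle_map (cone_pt u t) (section_lift s (cone_pt u t)) = s (susp_pt a u t)"
proof -
  let ?x = "susp_pt a u t"
  have x: "?x \<in> sph (Suc a)" by (rule susp_sph[OF u(1)])
  show ?thesis
  proof (cases "t \<le> 1/2")
    case True
    obtain y where y: "y \<in> sph (Suc b)" "s ?x = glue (Suc a) \<rho> (True, ?x, y)"
      by (rule point_over[OF section_in_E[OF x] section_proj[OF x] susp_hemi(1)[OF u True]])
    have "section_lift s (cone_pt u t) = y"
      using True y(2) bundle_vec_glue[OF susp_hemi(1)[OF u True] y(1)] by (simp add: section_lift_cone[OF u] fibre_vec_def)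
    then show ?thesis using y True by (simp add: cone_bundle_map_cone[OF u y(1)])
  next
    case False
    then have h: "1/2 \<le> t" by simp
    obtain y where y: "y \<in> sph (Suc b)" "s ?x = glue (Suc a) \<rho> (False, ?x, y)"
      by (rule point_over[OF section_in_E[OF x] section_proj[OF x] susp_hemi(2)[OF u h]])
    have e: "section_lift s (cone_pt u t) = rotate (transpose_mat (\<rho> u)) y"
      using False y(2) bundle_vec_glue[OF susp_hemi(2)[OF u h] y(1)] by (simp add: section_lift_cone[OF u] fibre_vec_def)
    have m: "rotate (transpose_mat (\<rho> u)) y \<in> sph (Suc b)" by (rule rotate_sph[OF orth_mat_\<rho>t[OF u(1)] y(1)])
    show ?thesis unfolding e using m y False rotate_inv_sph'[OF orth_mat_\<rho>[OF u(1)] y(1)] by (simp add: cone_bundle_map_cone[OF u m])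
  qed
qed

lemma section_lift_mem: assumes "v \<in> disc a" shows "section_lift s v \<in> sph (Suc b)" "cone_bundle_map v (section_lift s v) = s (cone_collapse a v)"
proof -
  obtain u t where u: "u \<in> sph a" "0 \<le> t" "t \<le> 1" "cone_pt u t = v" by (rule cone_pt_surj[OF assms])
  then show "section_lift s v \<in> sph (Suc b)" "cone_bundle_map v (section_lift s v) = s (cone_collapse a v)"
    using cone_bundle_map_section_lift_aux[OF u(1-3)] cone_collapse_cone[OF u(1-3)] by auto
qed

lemma section_lift_sph: "u \<in> sph a \<Longrightarrow> section_lift s u = rotate (transpose_mat (\<rho> u)) base"
  using section_lift_cone[of u 1] by (simp add: section_base bundle_vec_incl fibre_vec_def)

lemma cont_section_lift: "continuous_on (disc a) (section_lift s)"
proof (rule continuous_on_descend[OF _ _ cone_image])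
  let ?A = "sph a \<times> {0..1::real}"
  show "compact ?A" by (intro compact_Times compact_sph compact_unit_interval)
  show "continuous_on ?A (\<lambda>z. cone_pt (fst z) (snd z))" by (intro continuous_intros)
  have "continuous_on ?A (\<lambda>z. susp_pt a (fst z) (snd z))" by (intro continuous_intros)
  from cm_comp[OF section_cont this] have "continuous_map (top_of_set ?A) E (\<lambda>z. s (susp_pt a (fst z) (snd z)))" by (auto simp: susp_sph)
  from continuous_map_compose[OF this cont_bundle_vec] have e: "continuous_on ?A (\<lambda>z. bundle_vec (s (susp_pt a (fst z) (snd z))))" by (simp add: o_def)
  show "continuous_on ?A (\<lambda>z. if snd z \<le> 1/2 then fst (bundle_vec (s (susp_pt a (fst z) (snd z)))) else rotate (transpose_mat (\<rho> (fst z))) (snd (bundle_vec (s (susp_pt a (fst z) (snd z))))))"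
  proof (rule continuous_onI_if)
    show "continuous_on ?A snd" by (intro continuous_intros)
    show "continuous_on {x \<in> ?A. snd x \<le> 1/2} (\<lambda>z. fst (bundle_vec (s (susp_pt a (fst z) (snd z)))))"
      by (rule continuous_on_subset[OF continuous_on_fst[OF e]]) auto
    have c: "orth_family ?A (Suc (Suc b)) (\<lambda>z. transpose_mat (\<rho> (fst z)))"
      by (rule orth_family_comp[OF orth_family_transpose[OF \<rho>]]) (auto intro!: continuous_intros)
    show "continuous_on {x \<in> ?A. 1/2 \<le> snd x} (\<lambda>z. rotate (transpose_mat (\<rho> (fst z))) (snd (bundle_vec (s (susp_pt a (fst z) (snd z))))))"
      by (rule continuous_on_subset[OF rotate_cont[OF c continuous_on_snd[OF e]]]) auto
    fix z assume z: "z \<in> ?A" "snd z = 1/2"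
    then have u: "fst z \<in> sph a" by auto
    note eq = sph_equator[OF u]
    have h: "fst z \<in> hemi (Suc a) False" using eq by (simp add: hemi_iff)
    obtain y where y: "y \<in> sph (Suc b)" "s (fst z) = glue (Suc a) \<rho> (False, fst z, y)"
      by (rule point_over[OF section_in_E[OF conjunct1[OF eq]] section_proj[OF conjunct1[OF eq]] h])
    have "bundle_vec (s (fst z)) = fibre_vec False (fst z) y" using bundle_vec_glue[OF h y(1)] y(2) by simp
    then show "fst (bundle_vec (s (susp_pt a (fst z) (snd z)))) = rotate (transpose_mat (\<rho> (fst z))) (snd (bundle_vec (s (susp_pt a (fst z) (snd z)))))"
      unfolding z(2) susp_half[OF u] using eq by (simp add: fibre_vec_def cone_rot_inv_equator)
  qed
qed (auto simp: section_lift_cone)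

abbreviation brace_map where "brace_map \<equiv> join_map b (section_lift s) (\<lambda>u v. rotate (transpose_mat (\<rho> u)) v)"

lemma brace_map_mem: "p \<in> join_set a b \<Longrightarrow> brace_map p \<in> sph (Suc b)"
  by (auto simp: join_map_def join_set_iff section_lift_mem cone_collapse_mem intro!: rotate_sph orth_mat_\<rho>t)

lemma brace_map_cont: "continuous_map (top_of_set (join_set a b)) (nsphere (Suc b)) brace_map"
proof (rule join_map_cont1)
  show "continuous_map (top_of_set (disc a)) (nsphere (Suc b)) (section_lift s)"
    unfolding cm_sph using cont_section_lift section_lift_mem by auto
  show "continuous_map (top_of_set (sph a \<times> sph (Suc b))) (nsphere (Suc b)) (\<lambda>q. rotate (transpose_mat (\<rho> (fst q))) (snd q))"
    unfolding cm_sph using act_cont[OF orth_family_transpose[OF \<rho>]] by (auto intro!: rotate_sph orth_mat_\<rho>t)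
qed (simp add: section_lift_sph)

lemma brace_map_base: "brace_map (base, base) = base"
  by (simp add: join_map_def section_lift_sph rotate_\<rho>_base)

lemma brace_map_homotopic_rel: "homotopic_rel (join_set a b) {(base,base)} (nsphere (Suc b)) base brace_map brace_map"
  by (rule homotopic_rel_refl[OF brace_map_cont]) (auto simp: brace_map_base)

text \<open>The cone coordinate in \<open>CX\<close> is contracted. At time 0 the trivialization reproduces the
  section on \<open>CX \<times> Y\<close> and the fibre inclusion on \<open>X \<times> CY\<close>, and over the cone point it
  is the fibre inclusion.\<close>

lemma whitehead_into_fibre:
  "homotopic_rel (join_set a b) {(base,base)} E (fibre_incl base) (join_map b (\<lambda>u. s (cone_collapse a u)) (\<lambda>_. fibre_incl)) (\<lambda>p. fibre_incl (brace_map p))"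
proof (rule homotopic_relI[where h="\<lambda>t p. cone_bundle_map (cone_pt (fst p) (1 - t)) (brace_map p)"])
  have g: "continuous_on (join_set a b) brace_map" using brace_map_cont unfolding cm_sph by auto
  have "continuous_on ({0..1::real} \<times> join_set a b) (\<lambda>x. brace_map (snd x))"
    by (rule continuous_on_comp[OF g]) (auto intro!: continuous_intros)
  then have "continuous_on ({0..1} \<times> join_set a b) (\<lambda>x. (cone_pt (fst (snd x)) (1 - fst x), brace_map (snd x)))"
    by (intro continuous_intros)
  moreover have "cone_pt (fst (snd x)) (1 - fst x) \<in> disc a" if "x \<in> {0..1::real} \<times> join_set a b" for x
    by (rule cone_pt_disc') (use that in \<open>auto simp: join_set_iff\<close>)
  ultimately show "continuous_map (top_of_set ({0..1} \<times> join_set a b)) E (\<lambda>x. cone_bundle_map (cone_pt (fst (snd x)) (1 - fst x)) (brace_map (snd x)))"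
    using cm_comp[OF cont_cone_bundle_map, of "{0..1} \<times> join_set a b" "\<lambda>x. (cone_pt (fst (snd x)) (1 - fst x), brace_map (snd x))"] brace_map_mem
    by (simp add: mem_Times_iff)
  fix p assume p: "p \<in> join_set a b"
  show "join_map b (\<lambda>u. s (cone_collapse a u)) (\<lambda>_. fibre_incl) p = cone_bundle_map (cone_pt (fst p) (1 - 0)) (brace_map p)"
  proof (cases "snd p \<in> sph b")
    case True
    then show ?thesis using p by (simp add: join_map_def section_lift_mem join_set_iff)
  next
    case False
    then have u: "fst p \<in> sph a" "snd p \<in> disc b" using p by (auto simp: join_set_iff)
    note k = cone_collapse_mem[OF u(2)]
    show ?thesis using False cone_bundle_map_sph[OF u(1) rotate_sph[OF orth_mat_\<rho>t[OF u(1)] k]] rotate_inv_sph'[OF orth_mat_\<rho>[OF u(1)] k]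
      by (simp add: join_map_def)
  qed
  show "fibre_incl (brace_map p) = cone_bundle_map (cone_pt (fst p) (1 - 1)) (brace_map p)"
    using cone_bundle_map_base[OF brace_map_mem[OF p]] by simp
next
  show "cone_bundle_map (cone_pt (fst p) (1 - t)) (brace_map p) = fibre_incl base" if "p \<in> {(base,base)}" for p and t :: real
    using that brace_map_base cone_bundle_map_base by simp
qed auto

lemma incl_cont: "continuous_map (nsphere (Suc b)) E fibre_incl"
proof -
  have "continuous_map (top_of_set (sph (Suc b))) E (\<lambda>y. glue (Suc a) \<rho> (False, base, y))"
    by (rule bundle_into) (auto intro!: continuous_intros simp: hemi_iff base_eq)
  then show ?thesis by (simp add: glue_def fibre_incl_def[abs_def]) (metis nsphere_eq)
qed

text \<open>The Whitehead product does not depend on the representatives of the two classes, so \<open>s\<close> and the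
  fibre inclusion may be used.\<close>

lemma whitehead_class:
  "whitehead_product (Suc a) (Suc b) E (fibre_incl base)
     (induced (Suc a) E (fibre_incl base) s (htpy_class (Suc a) (nsphere (Suc a)) base id))
     (induced (Suc b) E (fibre_incl base) fibre_incl (htpy_class (Suc b) (nsphere (Suc b)) base id))
   = htpy_class (Suc (a + b)) E (fibre_incl base) (\<lambda>z. fibre_incl (brace_map (join_inv a b z)))"
proof -
  let ?e = "fibre_incl base" and ?S = "sph (Suc (a + b))"
  have s': "continuous_map (nsphere (Suc a)) E s" using sec by (simp add: pointed_section_def)
  have 1: "induced (Suc a) E ?e s (htpy_class (Suc a) (nsphere (Suc a)) base id) = htpy_class (Suc a) E ?e s"
    using induced_class[OF s' section_base identity_class] by simp
  have 2: "induced (Suc b) E ?e fibre_incl (htpy_class (Suc b) (nsphere (Suc b)) base id) = htpy_class (Suc b) E ?e fibre_incl"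
    using induced_class[OF incl_cont refl identity_class] by simp
  let ?W = "\<lambda>f g z. join_map b (\<lambda>u. f (cone_collapse a u)) (\<lambda>_. g) (join_inv a b z)"
  have h: "homotopic_rel ?S {base} E ?e (?W f g) (?W f' g')"
    if f: "homotopic_rel (sph (Suc a)) {base} E ?e f f'" and g: "homotopic_rel (sph (Suc b)) {base} E ?e g g'" for f f' g g'
  proof -
    from f obtain F where F: "continuous_map (top_of_set ({0..1} \<times> sph (Suc a))) E (\<lambda>p. F (fst p) (snd p))"
      "\<And>x. x \<in> sph (Suc a) \<Longrightarrow> F (0::real) x = f x" "\<And>x. x \<in> sph (Suc a) \<Longrightarrow> F 1 x = f' x"
      "\<And>t x. 0 \<le> t \<Longrightarrow> t \<le> 1 \<Longrightarrow> x \<in> {base} \<Longrightarrow> F t x = ?e" by (rule homotopic_relE) blast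
    from g obtain G where G: "continuous_map (top_of_set ({0..1} \<times> sph (Suc b))) E (\<lambda>p. G (fst p) (snd p))"
      "\<And>x. x \<in> sph (Suc b) \<Longrightarrow> G (0::real) x = g x" "\<And>x. x \<in> sph (Suc b) \<Longrightarrow> G 1 x = g' x"
      "\<And>t x. 0 \<le> t \<Longrightarrow> t \<le> 1 \<Longrightarrow> x \<in> {base} \<Longrightarrow> G t x = ?e" by (rule homotopic_relE) blast
    have "homotopic_rel (join_set a b) {(base,base)} E ?e (join_map b (\<lambda>u. f (cone_collapse a u)) (\<lambda>_. g)) (join_map b (\<lambda>u. f' (cone_collapse a u)) (\<lambda>_. g'))"
    proof (rule homotopic_relI[where h="\<lambda>t. join_map b (\<lambda>u. F t (cone_collapse a u)) (\<lambda>_. G t)"])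
      show "continuous_map (top_of_set ({0..1} \<times> join_set a b)) E (\<lambda>p. join_map b (\<lambda>u. F (fst p) (cone_collapse a u)) (\<lambda>_. G (fst p)) (snd p))"
      proof (rule join_map_cont[where F="\<lambda>t u. F t (cone_collapse a u)" and G="\<lambda>t _. G t"])
        have "continuous_on ({0..1::real} \<times> disc a) (\<lambda>p. (fst p, cone_collapse a (snd p)))" by (intro continuous_intros) auto
        from cm_comp[OF F(1) this] show "continuous_map (top_of_set ({0..1} \<times> disc a)) E (\<lambda>p. F (fst p) (cone_collapse a (snd p)))"
          by (auto simp: cone_collapse_mem)
        have "continuous_on ({0..1::real} \<times> (sph a \<times> sph (Suc b))) (\<lambda>p. (fst p, snd (snd p)))" by (intro continuous_intros)
        from cm_comp[OF G(1) this] show "continuous_map (top_of_set ({0..1} \<times> (sph a \<times> sph (Suc b)))) E (\<lambda>p. G (fst p) (snd (snd p)))"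
          by auto
      qed (simp add: F(4) G(4))
    qed (auto simp: F G join_map_def cone_collapse_mem join_set_iff)
    then show ?thesis by (rule join_inv_homotopic_rel)
  qed
  have sr: "homotopic_rel (sph (Suc a)) {base} E ?e s s" by (rule homotopic_rel_refl[OF section_cont]) (auto simp: section_base)
  have ir: "homotopic_rel (sph (Suc b)) {base} E ?e fibre_incl fibre_incl"
    using incl_cont pointed_iff[of "Suc b" E fibre_incl ?e] by simp
  have inner: "(\<Union>g\<in>htpy_class (Suc b) E ?e fibre_incl. htpy_class (Suc (a + b)) E ?e (?W f g)) = htpy_class (Suc (a + b)) E ?e (?W f fibre_incl)"
    if "f \<in> htpy_class (Suc a) E ?e s" for f
    by (rule UN_class) (use that ir in \<open>auto simp: htpy_class_iff intro: h dest: homotopic_rel_reflR\<close>)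
  have "whitehead_product (Suc a) (Suc b) E ?e (htpy_class (Suc a) E ?e s) (htpy_class (Suc b) E ?e fibre_incl)
     = (\<Union>f\<in>htpy_class (Suc a) E ?e s. \<Union>g\<in>htpy_class (Suc b) E ?e fibre_incl. htpy_class (Suc (a + b)) E ?e (?W f g))"
    by (simp add: whitehead_product_def join_map_join_fun2 o_def)
  also have "\<dots> = (\<Union>f\<in>htpy_class (Suc a) E ?e s. htpy_class (Suc (a + b)) E ?e (?W f fibre_incl))"
    using inner by simp
  also have "\<dots> = htpy_class (Suc (a + b)) E ?e (?W s fibre_incl)"
    by (rule UN_class) (use sr ir in \<open>auto simp: htpy_class_iff intro: h\<close>)
  also have "\<dots> = htpy_class (Suc (a + b)) E ?e (\<lambda>z. fibre_incl (brace_map (join_inv a b z)))"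
    by (rule class_eqI[OF join_inv_homotopic_rel[OF whitehead_into_fibre]])
  finally show ?thesis unfolding 1 2 .
qed

lemma brace_class:
  "brace_product (nsphere (Suc b)) base E (fibre_incl base) fibre_incl s (Suc a) (Suc b)
     (htpy_class (Suc a) (nsphere (Suc a)) base id) (htpy_class (Suc b) (nsphere (Suc b)) base id)
   = htpy_class (Suc (a + b)) (nsphere (Suc b)) base (\<lambda>z. brace_map (join_inv a b z))"
proof -
  let ?e = "fibre_incl base" and ?k = "Suc (a + b)"
  let ?g = "\<lambda>z. brace_map (join_inv a b z)"
  have g: "homotopic_rel (sph ?k) {base} (nsphere (Suc b)) base ?g ?g" by (rule join_inv_homotopic_rel[OF brace_map_homotopic_rel])
  have k: "Suc a + Suc b - 1 = ?k" by simp
  have ind: "induced ?k E ?e fibre_incl (htpy_class ?k (nsphere (Suc b)) base f) = htpy_class ?k E ?e (\<lambda>z. fibre_incl (f z))"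
    if "homotopic_rel (sph ?k) {base} (nsphere (Suc b)) base f f" for f
    by (rule induced_class[OF incl_cont refl that])
  show ?thesis
    unfolding brace_product_def k whitehead_class
  proof (rule the_equality)
    show "htpy_class ?k (nsphere (Suc b)) base ?g \<in> carrier (homotopy_group ?k (nsphere (Suc b)) base) \<and>
      induced ?k E ?e fibre_incl (htpy_class ?k (nsphere (Suc b)) base ?g) = htpy_class ?k E ?e (\<lambda>z. fibre_incl (?g z))"
      using g ind[OF g] unfolding carrier_iff by blast
    fix \<gamma> assume \<gamma>: "\<gamma> \<in> carrier (homotopy_group ?k (nsphere (Suc b)) base) \<and>
      induced ?k E ?e fibre_incl \<gamma> = htpy_class ?k E ?e (\<lambda>z. fibre_incl (?g z))"
    then obtain f where f: "homotopic_rel (sph ?k) {base} (nsphere (Suc b)) base f f" "\<gamma> = htpy_class ?k (nsphere (Suc b)) base f"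
      unfolding carrier_iff by blast
    have fE: "homotopic_rel (sph ?k) {base} E ?e (\<lambda>z. fibre_incl (f z)) (\<lambda>z. fibre_incl (f z))"
      by (rule homotopic_rel_post[OF f(1) incl_cont]) simp
    have "htpy_class ?k E ?e (\<lambda>z. fibre_incl (f z)) = htpy_class ?k E ?e (\<lambda>z. fibre_incl (?g z))"
      using \<gamma> ind[OF f(1)] f(2) by simp
    then have "homotopic_rel (sph ?k) {base} E ?e (\<lambda>z. fibre_incl (f z)) (\<lambda>z. fibre_incl (?g z))"
      using class_eq[OF fE] by blast
    from fibre_incl_inj[OF sec f(1) g this] show "\<gamma> = htpy_class ?k (nsphere (Suc b)) base ?g"
      unfolding f(2) by (rule class_eqI)
  qed
qed

end

end

section \<open>Removal of the section by suspension\<close>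

text \<open>The homotopy extension property of the boundary of a disc. At time \<open>s\<close> the given map is shrunk to
  the disc of radius \<open>1 / (1 + s)\<close>, and the homotopy up to time \<open>s\<close> fills the remaining collar.\<close>

lemma disc_homotopy_extension:
  assumes \<phi>: "continuous_map (top_of_set (disc a)) W \<phi>"
    and K: "continuous_map (top_of_set ({0..1} \<times> sph a)) W (\<lambda>p. K (fst p) (snd p))"
    and K0: "\<And>x. x \<in> sph a \<Longrightarrow> K (0::real) x = \<phi> x"
  obtains S where "continuous_map (top_of_set ({0..1} \<times> disc a)) W (\<lambda>p. S (fst p) (snd p))"
    "\<And>v. v \<in> disc a \<Longrightarrow> S (0::real) v = \<phi> v" "\<And>s x. 0 \<le> s \<Longrightarrow> x \<in> sph a \<Longrightarrow> S s x = K s x"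
proof
  define S where "S s v = (if (1 + s) * rad a v \<le> 1 then \<phi> (\<lambda>i. (1 + s) * v i) else K ((1 + s) * rad a v - 1) (hat a v))" for s v
  let ?D = "{0..1::real} \<times> disc a"
  have rad_le: "0 \<le> rad a v" "rad a v \<le> 1" if "v \<in> disc a" for v
    using that sqnorm_nonneg[of v a] by (auto simp: disc_iff rad_def)
  have c: "continuous_on T (\<lambda>p. f p i)" if "continuous_on T f" for f :: "real \<times> (nat \<Rightarrow> real) \<Rightarrow> nat \<Rightarrow> real" and T i
    by (rule cont_coord[OF that])
  have cr: "continuous_on T (\<lambda>p. rad a (snd p))" for T :: "(real \<times> (nat \<Rightarrow> real)) set"
    unfolding rad_def by (intro continuous_intros c)
  show "continuous_map (top_of_set ?D) W (\<lambda>p. S (fst p) (snd p))"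
    unfolding S_def
  proof (rule cm_if)
    show "continuous_on ?D (\<lambda>p. (1 + fst p) * rad a (snd p))" by (intro continuous_intros cr)
    show "continuous_map (top_of_set {p \<in> ?D. (1 + fst p) * rad a (snd p) \<le> 1}) W (\<lambda>p. \<phi> (\<lambda>i. (1 + fst p) * snd p i))"
    proof (rule cm_comp[OF \<phi>])
      show "continuous_on {p \<in> ?D. (1 + fst p) * rad a (snd p) \<le> 1} (\<lambda>p i. (1 + fst p) * snd p i)"
        by (rule continuous_on_coordinatewise_then_product) (intro continuous_intros c)
      fix p assume p: "p \<in> {p \<in> ?D. (1 + fst p) * rad a (snd p) \<le> 1}"
      then have "0 \<le> (1 + fst p) * rad a (snd p)" "(1 + fst p) * rad a (snd p) \<le> 1" using rad_le[of "snd p"] by auto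
      then have "((1 + fst p) * rad a (snd p))\<^sup>2 \<le> 1" by (simp add: power_le_one)
      then have "sqnorm a (\<lambda>i. (1 + fst p) * snd p i) \<le> 1"
        by (simp add: rad_def power_mult_distrib sum_distrib_left[symmetric] sqnorm_nonneg)
      then show "(\<lambda>i. (1 + fst p) * snd p i) \<in> disc a" using p by (auto simp: disc_iff)
    qed
    let ?T = "{p \<in> ?D. 1 \<le> (1 + fst p) * rad a (snd p)}"
    have pos: "rad a (snd p) \<noteq> 0" if "p \<in> ?T" for p using that by auto
    have "continuous_on ?T (\<lambda>p i. if i \<le> a then snd p i / rad a (snd p) else 0)"
    proof (rule continuous_on_coordinatewise_then_product)
      show "continuous_on ?T (\<lambda>p. if i \<le> a then snd p i / rad a (snd p) else 0)" for i
      proof (cases "i \<le> a")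
        case True
        have "continuous_on ?T (\<lambda>p. snd p i / rad a (snd p))"
          by (rule continuous_on_divide[OF c cr]) (use pos in \<open>auto intro: continuous_intros\<close>)
        with True show ?thesis by simp
      qed simp
    qed
    then have h: "continuous_on ?T (\<lambda>p. hat a (snd p))"
      by (rule continuous_on_eq) (use pos in \<open>auto simp: hat_def\<close>)
    show "continuous_map (top_of_set ?T) W (\<lambda>p. K ((1 + fst p) * rad a (snd p) - 1) (hat a (snd p)))"
    proof -
      have "continuous_on ?T (\<lambda>p. ((1 + fst p) * rad a (snd p) - 1, hat a (snd p)))" by (intro continuous_intros cr h)
      moreover have "(1 + fst p) * rad a (snd p) \<le> 2" if "p \<in> ?T" for p
        using mult_mono[of "1 + fst p" 2 "rad a (snd p)" 1] that rad_le[of "snd p"] by auto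
      ultimately show ?thesis
        using cm_comp[OF K, of ?T "\<lambda>p. ((1 + fst p) * rad a (snd p) - 1, hat a (snd p))"] hat_sph by fastforce
    qed
    fix p assume p: "p \<in> ?D" "(1 + fst p) * rad a (snd p) = 1"
    then have r: "rad a (snd p) \<noteq> 0" and v: "snd p \<in> disc a" by auto
    have "snd p i / rad a (snd p) = (1 + fst p) * snd p i" for i
      using r p(2) by (metis (no_types) mult.commute mult.left_commute mult_1_right nonzero_divide_eq_eq)
    then have "hat a (snd p) = (\<lambda>i. (1 + fst p) * snd p i)"
      using r v by (auto simp: hat_def fun_eq_iff disc_iff)
    then show "\<phi> (\<lambda>i. (1 + fst p) * snd p i) = K ((1 + fst p) * rad a (snd p) - 1) (hat a (snd p))"
      using p(2) K0[OF hat_sph, of "snd p"] by simp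
  qed
  show "S 0 v = \<phi> v" if "v \<in> disc a" for v using rad_le[OF that] by (simp add: S_def)
  show "S s x = K s x" if "0 \<le> s" "x \<in> sph a" for s x
  proof -
    have "rad a x = 1" "hat a x = x" using that(2) by (auto simp: hat_def rad_def sph_iff fun_eq_iff)
    then show ?thesis using that K0[OF that(2)] by (cases "s = 0") (auto simp: S_def)
  qed
qed

text \<open>If \<open>S\<close> and \<open>G\<close> are \<open>base\<close> on \<open>X \<times> Y\<close>, the map on the join factors through a wedge. In the
  suspension the two halves can be moved to different parts of the loop coordinate; the half given by
  \<open>S\<close> is then contracted through the disc.\<close>

lemma suspend_join_split:
  assumes S: "continuous_map (top_of_set (disc a)) (nsphere m) S" "\<And>x. x \<in> sph a \<Longrightarrow> S x = base"
    and G: "continuous_map (top_of_set (sph a \<times> sph (Suc b))) (nsphere m) (\<lambda>p. G (fst p) (snd p))"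
      "\<And>x. x \<in> sph a \<Longrightarrow> G x base = base"
  shows "loop_homotopic (join_set a b) {(base,base)} (nsphere (Suc m)) base
    (\<lambda>q. susp_pt m (join_map b S G (fst q)) (snd q)) (\<lambda>q. susp_pt m (join_map b (\<lambda>_. base) G (fst q)) (snd q))"
proof -
  let ?L = "loop_homotopic (join_set a b) {(base,base)} (nsphere (Suc m)) base"
  let ?\<alpha> = "\<lambda>q. susp_pt m (S (fst (fst q))) (snd q)"
  let ?\<beta> = "\<lambda>q. susp_pt m (join_map b (\<lambda>_. base) G (fst q)) (snd q)"
  have sub: "{(base,base)} \<subseteq> join_set a b" by (simp add: join_set_iff sph_disc)
  have Sc: "continuous_on (disc a) S" and Sm: "\<And>x. x \<in> disc a \<Longrightarrow> S x \<in> sph m" using S(1) unfolding cm_sph by auto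
  have Gc: "continuous_on (sph a \<times> sph (Suc b)) (\<lambda>p. G (fst p) (snd p))"
    and Gm: "\<And>x v. x \<in> sph a \<Longrightarrow> v \<in> sph (Suc b) \<Longrightarrow> G x v \<in> sph m" using G(1) unfolding cm_sph by (auto simp: image_subset_iff)
  have null: "?L ?\<alpha> (\<lambda>_. base)"
  proof (rule loop_homotopicI[where h="\<lambda>s q. susp_pt m (S (cone_pt (fst (fst q)) (1 - s))) (snd q)"])
    have m: "cone_pt (fst (fst (snd z))) (1 - fst z) \<in> disc a" if "z \<in> {0..1::real} \<times> (join_set a b \<times> {0..1::real})" for z
      by (rule cone_pt_disc') (use that in \<open>auto simp: join_set_iff\<close>)
    have "continuous_on ({0..1::real} \<times> (join_set a b \<times> {0..1::real})) (\<lambda>z. S (cone_pt (fst (fst (snd z))) (1 - fst z)))"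
      by (rule continuous_on_comp[OF Sc]) (intro continuous_intros, rule m)
    then show "continuous_map (top_of_set ({0..1} \<times> (join_set a b \<times> {0..1}))) (nsphere (Suc m))
        (\<lambda>z. susp_pt m (S (cone_pt (fst (fst (snd z))) (1 - fst z))) (snd (snd z)))"
      unfolding cm_sph using m Sm susp_sph by (intro conjI continuous_intros image_subsetI) blast+
  qed (use sub S(2) in auto)
  have b: "?L ?\<beta> ?\<beta>"
  proof (rule loop_homotopic_refl)
    have "continuous_map (top_of_set (join_set a b)) (nsphere m) (join_map b (\<lambda>_. base) G)"
      by (rule join_map_cont1) (use G in auto)
    then have j: "continuous_on (join_set a b) (join_map b (\<lambda>_. base) G)" "\<And>p. p \<in> join_set a b \<Longrightarrow> join_map b (\<lambda>_. base) G p \<in> sph m"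
      unfolding cm_sph by auto
    have "continuous_on (join_set a b \<times> {0..1::real}) (\<lambda>q. join_map b (\<lambda>_. base) G (fst q))"
      by (rule continuous_on_comp[OF j(1)]) (auto intro!: continuous_intros)
    then show "continuous_map (top_of_set (join_set a b \<times> {0..1})) (nsphere (Suc m)) ?\<beta>"
      unfolding cm_sph using j(2) susp_sph by (intro conjI continuous_intros image_subsetI) auto
  qed (use sub in \<open>auto simp: join_map_def\<close>)
  \<comment> \<open>The linear change of the loop coordinate is made separately on the two halves of the
    join, which is consistent because both maps are \<open>base\<close> where they meet.\<close>
  have split: "?L (\<lambda>q. susp_pt m (join_map b S G (fst q)) (snd q)) (loop_cat ?\<alpha> ?\<beta>)"
  proof (rule loop_homotopicI[where h="\<lambda>s q. join_map b (\<lambda>u. susp_pt m (S u) ((1 - s) * snd q + s * min 1 (2 * snd q)))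
      (\<lambda>x v. susp_pt m (G x v) ((1 - s) * snd q + s * max 0 (2 * snd q - 1))) (fst q)"])
    let ?P = "{0..1::real} \<times> {0..1::real}"
    have "continuous_map (top_of_set (?P \<times> join_set a b)) (nsphere (Suc m))
      (\<lambda>z. join_map b (\<lambda>u. susp_pt m (S u) ((1 - fst (fst z)) * snd (fst z) + fst (fst z) * min 1 (2 * snd (fst z))))
        (\<lambda>x v. susp_pt m (G x v) ((1 - fst (fst z)) * snd (fst z) + fst (fst z) * max 0 (2 * snd (fst z) - 1))) (snd z))"
    proof (rule join_map_cont[where P="?P" and F="\<lambda>p u. susp_pt m (S u) ((1 - fst p) * snd p + fst p * min 1 (2 * snd p))"
          and G="\<lambda>p x v. susp_pt m (G x v) ((1 - fst p) * snd p + fst p * max 0 (2 * snd p - 1))"])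
      have "continuous_on (?P \<times> disc a) (\<lambda>z. S (snd z))" by (rule continuous_on_comp[OF Sc]) (auto intro!: continuous_intros)
      then show "continuous_map (top_of_set (?P \<times> disc a)) (nsphere (Suc m))
          (\<lambda>z. susp_pt m (S (snd z)) ((1 - fst (fst z)) * snd (fst z) + fst (fst z) * min 1 (2 * snd (fst z))))"
        unfolding cm_sph using Sm susp_sph by (intro conjI continuous_intros image_subsetI) auto
      have "continuous_on (?P \<times> (sph a \<times> sph (Suc b))) (\<lambda>z. G (fst (snd z)) (snd (snd z)))"
        by (rule continuous_on_comp[OF Gc, of _ snd, simplified]) (auto intro!: continuous_intros)
      then show "continuous_map (top_of_set (?P \<times> (sph a \<times> sph (Suc b)))) (nsphere (Suc m))
          (\<lambda>z. susp_pt m (G (fst (snd z)) (snd (snd z))) ((1 - fst (fst z)) * snd (fst z) + fst (fst z) * max 0 (2 * snd (fst z) - 1)))"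
        unfolding cm_sph using Gm susp_sph by (intro conjI continuous_intros image_subsetI) auto
    qed (use S(2) G(2) in auto)
    note cont = this
    have sw: "continuous_on ({0..1} \<times> (join_set a b \<times> {0..1})) (\<lambda>z. ((fst z, snd (snd z)), fst (snd z)) :: (real \<times> real) \<times> _)"
      by (intro continuous_intros)
    have im: "((fst z, snd (snd z)), fst (snd z)) \<in> ?P \<times> join_set a b" if "z \<in> {0..1} \<times> (join_set a b \<times> {0..1})" for z
      using that by (simp add: mem_Times_iff)
    from cm_comp[OF cont sw im]
    show "continuous_map (top_of_set ({0..1} \<times> (join_set a b \<times> {0..1}))) (nsphere (Suc m))
      (\<lambda>z. join_map b (\<lambda>u. susp_pt m (S u) ((1 - fst z) * snd (snd z) + fst z * min 1 (2 * snd (snd z))))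
        (\<lambda>x v. susp_pt m (G x v) ((1 - fst z) * snd (snd z) + fst z * max 0 (2 * snd (snd z) - 1))) (fst (snd z)))"
      by (simp only: fst_conv snd_conv)
    show "susp_pt m (join_map b S G (fst (k,t))) (snd (k,t)) = join_map b (\<lambda>u. susp_pt m (S u) ((1 - 0) * snd (k,t) + 0 * min 1 (2 * snd (k,t))))
      (\<lambda>x v. susp_pt m (G x v) ((1 - 0) * snd (k,t) + 0 * max 0 (2 * snd (k,t) - 1))) (fst (k,t))" for k t
      by (simp add: join_map_def)
    show "loop_cat ?\<alpha> ?\<beta> (k,t) = join_map b (\<lambda>u. susp_pt m (S u) ((1 - 1) * snd (k,t) + 1 * min 1 (2 * snd (k,t))))
      (\<lambda>x v. susp_pt m (G x v) ((1 - 1) * snd (k,t) + 1 * max 0 (2 * snd (k,t) - 1))) (fst (k,t))"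
      if "k \<in> join_set a b" "0 \<le> t" "t \<le> 1" for k t
    proof -
      consider "t < 1/2" | "t = 1/2" | "t > 1/2" by linarith
      then show ?thesis
      proof cases
        case 2
        show ?thesis unfolding 2 using that(1) S(2) by (auto simp: join_map_def loop_cat_def join_set_iff)
      qed (use that S(2) in \<open>auto simp: join_map_def loop_cat_def join_set_iff min_def max_def\<close>)
    qed
  qed (use sub S(2) in \<open>auto simp: join_map_def\<close>)
  show ?thesis using loop_homotopic_trans[OF split loop_homotopic_trans[OF loop_cat_cong[OF null b] loop_cat_unitL[OF b]]] .
qed

text \<open>The deformation of \<open>\<rho>\<close> to \<open>diag(1, A)\<close> is extended over the disc, so that the section becomes
  \<open>base\<close> on the boundary and can be split off after suspension.\<close>

lemma (in clutching1) suspend_brace_map: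
  assumes sec: "pointed_section (Suc a) (Suc b) \<rho> s" and A: "orth_family (sph a) (Suc b) A"
    and k: "homotopic_rel (sph a) {base} (SO (Suc (Suc b))) (1\<^sub>m (Suc (Suc b))) \<rho> (\<lambda>x. SO_incl (A x))"
  defines "c \<equiv> \<lambda>z. join_map b (section_lift s) (\<lambda>u v. rotate (transpose_mat (\<rho> u)) v) (join_inv a b z)"
  shows "homotopic_rel (sph (Suc (Suc (a + b)))) {base} (nsphere (Suc (Suc b))) base
    (susp_map (Suc (a + b)) (Suc b) c) (susp_map (Suc (a + b)) (Suc b) (J_rep a b (\<lambda>x. transpose_mat (A x))))"
proof -
  let ?W = "nsphere (Suc b)" and ?B = "\<lambda>x. transpose_mat (A x)"
  let ?G = "\<lambda>x v. rotate (SO_incl (?B x)) v"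
  note B = orth_family_transpose[OF A]
  from k obtain r where r: "continuous_map (top_of_set ({0..1} \<times> sph a)) (SO (Suc (Suc b))) (\<lambda>p. r (fst p) (snd p))"
    "\<And>x. x \<in> sph a \<Longrightarrow> r (0::real) x = \<rho> x" "\<And>x. x \<in> sph a \<Longrightarrow> r 1 x = SO_incl (A x)"
    "\<And>t x. 0 \<le> t \<Longrightarrow> t \<le> 1 \<Longrightarrow> x \<in> {base} \<Longrightarrow> r t x = 1\<^sub>m (Suc (Suc b))" by (rule homotopic_relE) blast
  have R: "orth_family ({0..1} \<times> sph a) (Suc (Suc b)) (\<lambda>p. transpose_mat (r (fst p) (snd p)))"
    by (rule orth_family_transpose[OF SO_orth_family[OF r(1)]])
  have Rm: "orth_mat (Suc (Suc b)) (transpose_mat (r t x))" if "0 \<le> t" "t \<le> 1" "x \<in> sph a" for t x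
    using orth_family_orth_mat[OF R, of "(t,x)"] that by auto
  have r1: "transpose_mat (r 1 x) = SO_incl (?B x)" if "x \<in> sph a" for x
    using r(3)[OF that] SO_incl_transpose[OF orth_family_carrier[OF A that]] by simp
  have Gb: "?G x base = base" if "x \<in> sph a" for x by (rule rotate_SO_incl_base[OF orth_family_carrier[OF B that]])
  have Gc: "continuous_map (top_of_set (sph a \<times> sph (Suc b))) ?W (\<lambda>p. ?G (fst p) (snd p))"
    unfolding cm_sph using act_cont[OF orth_family_incl[OF B]] by (auto intro!: rotate_sph orth_family_orth_mat[OF orth_family_incl[OF B]])
  have shc: "continuous_map (top_of_set (disc a)) ?W (section_lift s)"
    unfolding cm_sph using cont_section_lift[OF sec] section_lift_mem[OF sec] by auto
  have Kc: "continuous_map (top_of_set ({0..1} \<times> sph a)) ?W (\<lambda>p. rotate (transpose_mat (r (fst p) (snd p))) base)"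
    unfolding cm_sph using rotate_cont[OF R, of "\<lambda>_. base"] by (auto intro!: rotate_sph Rm)
  obtain S where S: "continuous_map (top_of_set ({0..1} \<times> disc a)) ?W (\<lambda>p. S (fst p) (snd p))"
    "\<And>v. v \<in> disc a \<Longrightarrow> S (0::real) v = section_lift s v"
    "\<And>t x. 0 \<le> t \<Longrightarrow> x \<in> sph a \<Longrightarrow> S t x = rotate (transpose_mat (r t x)) base"
    by (rule disc_homotopy_extension[OF shc Kc]) (auto simp: r(2) section_lift_sph[OF sec])
  have S1: "S 1 x = base" if "x \<in> sph a" for x using S(3)[OF _ that, of 1] r1[OF that] Gb[OF that] by simp
  have h: "homotopic_rel (join_set a b) {(base,base)} ?W base (join_map b (section_lift s) (\<lambda>u v. rotate (transpose_mat (\<rho> u)) v)) (join_map b (S 1) ?G)"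
  proof (rule homotopic_relI[where h="\<lambda>t. join_map b (S t) (\<lambda>u v. rotate (transpose_mat (r t u)) v)"])
    show "continuous_map (top_of_set ({0..1} \<times> join_set a b)) ?W (\<lambda>p. join_map b (S (fst p)) (\<lambda>u v. rotate (transpose_mat (r (fst p) u)) v) (snd p))"
    proof (rule join_map_cont[where F=S and G="\<lambda>t u v. rotate (transpose_mat (r t u)) v"])
      have "orth_family ({0..1::real} \<times> (sph a \<times> sph (Suc b))) (Suc (Suc b)) (\<lambda>p. transpose_mat (r (fst (fst p, fst (snd p))) (snd (fst p, fst (snd p)))))"
        by (rule orth_family_comp[OF R]) (auto intro!: continuous_intros)
      then have "continuous_on ({0..1::real} \<times> (sph a \<times> sph (Suc b))) (\<lambda>p. rotate (transpose_mat (r (fst p) (fst (snd p)))) (snd (snd p)))"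
        by (intro rotate_cont continuous_intros) simp
      then show "continuous_map (top_of_set ({0..1::real} \<times> (sph a \<times> sph (Suc b)))) ?W (\<lambda>p. rotate (transpose_mat (r (fst p) (fst (snd p)))) (snd (snd p)))"
        unfolding cm_sph by (auto intro!: rotate_sph Rm)
    qed (use S in auto)
    fix t :: real and p :: "(nat \<Rightarrow> real) \<times> (nat \<Rightarrow> real)" assume t: "0 \<le> t" "t \<le> 1" and p: "p \<in> {(base,base)}"
    have "rotate (1\<^sub>m (Suc (Suc b))) base = base" by (rule rotate_one) (simp add: base_def)
    then show "join_map b (S t) (\<lambda>u v. rotate (transpose_mat (r t u)) v) p = base"
      using p S(3)[OF t(1), of base] r(4)[OF t, of base] by (simp add: join_map_def)
  qed (auto simp: join_map_def join_set_iff S r(2) r1 sph_disc)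
  let ?f1 = "\<lambda>z. join_map b (S 1) ?G (join_inv a b z)" and ?f0 = "\<lambda>z. join_map b (\<lambda>_. base) ?G (join_inv a b z)"
  let ?N = "Suc (a + b)"
  have S1c: "continuous_map (top_of_set (disc a)) ?W (S 1)"
  proof -
    have "continuous_on (disc a) (\<lambda>v. (1::real, v))" by (intro continuous_intros)
    from cm_comp[OF S(1) this] show ?thesis by auto
  qed
  have e1: "homotopic_rel (sph ?N) {base} ?W base c ?f1" unfolding c_def by (rule join_inv_homotopic_rel[OF h])
  have "homotopic_rel (join_set a b) {(base,base)} ?W base (join_map b (\<lambda>_. base) ?G) (join_map b (\<lambda>_. base) ?G)"
    by (rule homotopic_rel_refl[OF join_map_cont1]) (use Gc Gb in \<open>auto simp: join_map_def join_set_iff sph_disc\<close>)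
  then have e0: "homotopic_rel (sph ?N) {base} ?W base ?f0 (J_rep a b ?B)" unfolding J_rep_def by (rule join_inv_cong)
  have b1: "?f1 base = base" "?f0 base = base" using homotopic_rel_base[OF homotopic_rel_reflR[OF e1]] homotopic_rel_base[OF homotopic_rel_reflL[OF e0]] by auto
  have ji: "continuous_map (nsphere ?N) (join a b) (join_inv a b)" "join_inv a b base = (base,base)" using join_inv_spec by auto
  have "continuous_map (top_of_set (sph ?N)) (join a b) (join_inv a b)" using ji(1) by (metis nsphere_eq)
  then have join_path: "continuous_on (sph ?N) (join_inv a b)" "\<And>z. z \<in> sph ?N \<Longrightarrow> join_inv a b z \<in> join_set a b" unfolding cm_join_set by auto
  have "loop_homotopic (sph ?N) {base} (nsphere (Suc (Suc b))) base (\<lambda>q. susp_pt (Suc b) (?f1 (fst q)) (snd q)) (\<lambda>q. susp_pt (Suc b) (?f0 (fst q)) (snd q))"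
    using loop_homotopic_pre[OF suspend_join_split[OF S1c S1 Gc Gb] join_path(1) join_path(2), of "{base}"] ji(2) by simp
  then have "loop_homotopic (sph ?N) {base} (nsphere (Suc (Suc b))) base (susp_loop ?N (susp_map ?N (Suc b) ?f1)) (susp_loop ?N (susp_map ?N (Suc b) ?f0))"
    by (rule loop_homotopic_cong) (simp_all add: susp_loop_def susp_map_susp b1)
  then have "homotopic_rel (sph (Suc ?N)) {base} (nsphere (Suc (Suc b))) base (susp_map ?N (Suc b) ?f1) (susp_map ?N (Suc b) ?f0)"
    by (simp only: susp_loop_iff)
  with susp_map_homotopic_rel[OF e1] susp_map_homotopic_rel[OF e0] show ?thesis by (meson homotopic_rel_trans)
qed

section \<open>The suspension formula\<close>

lemma J_class:
  assumes "homotopic_rel (sph a) {base} (SO (Suc q)) (1\<^sub>m (Suc q)) \<rho> \<rho>"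
  shows "J_hom (Suc a) q (htpy_class a (SO (Suc q)) (1\<^sub>m (Suc q)) \<rho>) = htpy_class (Suc a + q) (nsphere (Suc q)) base
    (\<lambda>z. join_map q (\<lambda>_. base) (\<lambda>x v. rotate (SO_incl (\<rho> x)) v) (join_inv_explicit a q z))"
proof -
  let ?T = "\<lambda>\<rho> z. join_map q (\<lambda>_. base) (\<lambda>x v. rotate (SO_incl (\<rho> x)) v) (join_inv a q z)"
  have j: "homotopic_rel (join_set a q) {(base,base)} (nsphere (Suc q)) base (join_map q (\<lambda>_. base) (\<lambda>x v. rotate (SO_incl (\<rho> x)) v))
      (join_map q (\<lambda>_. base) (\<lambda>x v. rotate (SO_incl (\<rho>' x)) v))"
    if "homotopic_rel (sph a) {base} (SO (Suc q)) (1\<^sub>m (Suc q)) \<rho> \<rho>'" for \<rho>'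
    by (rule join_map_homotopic_rel[OF homotopic_rel_rotate[OF that]]) simp
  have J: "J_hom (Suc a) q (htpy_class a (SO (Suc q)) (1\<^sub>m (Suc q)) \<rho>)
      = (\<Union>\<rho>\<in>htpy_class a (SO (Suc q)) (1\<^sub>m (Suc q)) \<rho>. htpy_class (Suc a + q) (nsphere (Suc q)) base (?T \<rho>))"
    by (simp add: J_hom_def J_join_map_def join_map_join_fun1[where G="\<lambda>x v. rotate (SO_incl (_ x)) v"] o_def)
  also have "\<dots> = htpy_class (Suc a + q) (nsphere (Suc q)) base (?T \<rho>)"
    by (rule UN_class) (use assms join_inv_homotopic_rel[OF j] in \<open>auto simp: htpy_class_iff\<close>)
  also have "\<dots> = htpy_class (Suc a + q) (nsphere (Suc q)) base
    (\<lambda>z. join_map q (\<lambda>_. base) (\<lambda>x v. rotate (SO_incl (\<rho> x)) v) (join_inv_explicit a q z))"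
    using class_eqI[OF join_inv_cong[OF j[OF assms]]] by simp
  finally show ?thesis .
qed

theorem proposition6p9:
  fixes n q :: nat and \<rho> :: "(nat \<Rightarrow> real) \<Rightarrow> real mat"
  assumes "n \<ge> 2" and "q \<ge> 2"
    and "continuous_map (nsphere (n - 1)) (SO (q + 1)) \<rho>" and "\<rho> base = 1\<^sub>m (q + 1)"
    and "htpy_class (n - 1) (SO (q + 1)) (1\<^sub>m (q + 1)) \<rho>
      \<in> induced (n - 1) (SO (q + 1)) (1\<^sub>m (q + 1)) SO_incl
          ` carrier (homotopy_group (n - 1) (SO q) (1\<^sub>m q))"
  shows "J_hom n q (htpy_class (n - 1) (SO (q + 1)) (1\<^sub>m (q + 1)) \<rho>)
      \<in> suspension_hom (n + q - 1) q ` carrier (homotopy_group (n + q - 1) (nsphere q) base)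
    \<and> (\<exists>s. pointed_section n q \<rho> s)
    \<and> (\<forall>s. pointed_section n q \<rho> s \<longrightarrow>
        J_hom n q (htpy_class (n - 1) (SO (q + 1)) (1\<^sub>m (q + 1)) \<rho>)
        = inv\<^bsub>homotopy_group (n + q) (nsphere (q + 1)) base\<^esub>
            (suspension_hom (n + q - 1) q
              (brace_product (nsphere q) base (sphere_bundle n q \<rho>) (fibre_incl base) fibre_incl s
                n q (htpy_class n (nsphere n) base id) (htpy_class q (nsphere q) base id))))"
proof -
  obtain a' where n: "n = Suc (Suc a')" using assms(1) by (metis add_2_eq_Suc le_Suc_ex)
  obtain b where q: "q = Suc b" using assms(2) by (metis add_2_eq_Suc le_Suc_ex)
  let ?a = "Suc a'" and ?S = "SO (Suc q)" and ?I = "1\<^sub>m (Suc q) :: real mat"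
  have \<rho>: "homotopic_rel (sph ?a) {base} ?S ?I \<rho> \<rho>" using assms(3,4) pointed_iff[of ?a ?S \<rho> ?I] by (simp add: n)
  from assms(5) obtain \<alpha> where \<alpha>: "\<alpha> \<in> carrier (homotopy_group ?a (SO q) (1\<^sub>m q))"
    "htpy_class ?a ?S ?I \<rho> = induced ?a ?S ?I SO_incl \<alpha>" by (auto simp: n)
  have "\<rho> \<in> htpy_class ?a ?S ?I \<rho>" using \<rho> by (simp add: htpy_class_iff)
  \<comment> \<open>A representative \<open>A\<close> of the preimage in \<open>\<pi>\<^bsub>n-1\<^esub>(SO(q))\<close> deforms \<open>\<rho>\<close> to \<open>diag(1, A)\<close>.\<close>
  then obtain A where A0: "A \<in> \<alpha>" "\<rho> \<in> htpy_class ?a ?S ?I (SO_incl \<circ> A)" unfolding \<alpha>(2) induced_def by blast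
  have Ar: "homotopic_rel (sph ?a) {base} (SO q) (1\<^sub>m q) A A"
    using \<alpha>(1) A0(1) unfolding carrier_iff by (auto simp: htpy_class_iff dest: homotopic_rel_reflR)
  have A: "orth_family (sph ?a) (Suc b) A" by (rule SO_orth_family[OF homotopic_rel_cont[OF Ar[unfolded q]]])
  have Ab: "A base = 1\<^sub>m (Suc b)" using homotopic_rel_base[OF Ar] q by simp
  have \<rho>A: "homotopic_rel (sph ?a) {base} (SO (Suc (Suc b))) (1\<^sub>m (Suc (Suc b))) \<rho> (\<lambda>x. SO_incl (A x))"
    using homotopic_rel_sym[OF A0(2)[unfolded htpy_class_iff]] by (simp add: o_def q)
  let ?k = "Suc (?a + b)" and ?W = "nsphere (Suc (Suc b))"
  let ?j = "\<lambda>z. join_map q (\<lambda>_. base) (\<lambda>x v. rotate (SO_incl (\<rho> x)) v) (join_inv_explicit ?a q z)"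
  have J: "J_hom n q (htpy_class (n - 1) (SO (q + 1)) (1\<^sub>m (q + 1)) \<rho>) = htpy_class (Suc (?a + q)) (nsphere (Suc q)) base ?j"
    using J_class[OF \<rho>] by (simp add: n)
  have dims: "n + q - 1 = ?k" "Suc (?a + q) = Suc ?k" by (simp_all add: n q)
  note eq = J_eq_suspension[OF A Ab \<rho>A]
  note g = J_rep_homotopic_rel[OF A]
  have 1: "J_hom n q (htpy_class (n - 1) (SO (q + 1)) (1\<^sub>m (q + 1)) \<rho>)
      \<in> suspension_hom (n + q - 1) q ` carrier (homotopy_group (n + q - 1) (nsphere q) base)"
  proof (rule image_eqI)
    show "htpy_class (n + q - 1) (nsphere q) base (J_rep ?a b A) \<in> carrier (homotopy_group (n + q - 1) (nsphere q) base)"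
      unfolding carrier_iff dims unfolding q using g by blast
    have "htpy_class (Suc ?k) ?W base ?j = htpy_class (Suc ?k) ?W base (susp_map ?k (Suc b) (J_rep ?a b A))"
      using class_eqI[OF eq] by (simp add: q)
    then show "J_hom n q (htpy_class (n - 1) (SO (q + 1)) (1\<^sub>m (q + 1)) \<rho>)
      = suspension_hom (n + q - 1) q (htpy_class (n + q - 1) (nsphere q) base (J_rep ?a b A))"
      unfolding J dims unfolding q suspension_class[OF g] by simp
  qed
  interpret clutching1 ?a b \<rho>
    by unfold_locales (use SO_orth_family[OF homotopic_rel_cont[OF \<rho>]] assms(4) in \<open>simp_all add: q\<close>)
  have 2: "\<exists>s. pointed_section n q \<rho> s" using section_exists[OF A \<rho>A] by (simp add: n q)
  have 3: "J_hom n q (htpy_class (n - 1) (SO (q + 1)) (1\<^sub>m (q + 1)) \<rho>)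
        = inv\<^bsub>homotopy_group (n + q) (nsphere (q + 1)) base\<^esub>
            (suspension_hom (n + q - 1) q
              (brace_product (nsphere q) base (sphere_bundle n q \<rho>) (fibre_incl base) fibre_incl s
                n q (htpy_class n (nsphere n) base id) (htpy_class q (nsphere q) base id)))"
    if s: "pointed_section n q \<rho> s" for s
  proof -
    note s' = s[unfolded n q]
    let ?c = "\<lambda>z. join_map b (section_lift s) (\<lambda>u v. rotate (transpose_mat (\<rho> u)) v) (join_inv ?a b z)"
    have c: "homotopic_rel (sph ?k) {base} (nsphere (Suc b)) base ?c ?c" by (rule join_inv_homotopic_rel[OF brace_map_homotopic_rel[OF s']])
    have S: "suspension_hom ?k (Suc b) (htpy_class ?k (nsphere (Suc b)) base ?c)
      = htpy_class (Suc ?k) ?W base (susp_map ?k (Suc b) (J_rep ?a b (\<lambda>x. transpose_mat (A x))))"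
      using suspension_class[OF c] class_eqI[OF suspend_brace_map[OF s' A \<rho>A]] by simp
    have g': "homotopic_rel (sph ?k) {base} (nsphere (Suc b)) base (J_rep ?a b (\<lambda>x. transpose_mat (A x))) (J_rep ?a b (\<lambda>x. transpose_mat (A x)))"
      by (rule J_rep_homotopic_rel[OF orth_family_transpose[OF A]])
    have "htpy_class (Suc ?k) ?W base ?j = inv\<^bsub>homotopy_group (Suc ?k) ?W base\<^esub>
        (htpy_class (Suc ?k) ?W base (susp_map ?k (Suc b) (J_rep ?a b (\<lambda>x. transpose_mat (A x)))))"
      by (rule homotopy_group_inv) (use homotopic_rel_reflL[OF eq] susp_map_homotopic_rel[OF g'] J_add_suspension[OF A Ab \<rho>A] in \<open>simp_all add: q\<close>)
    then show ?thesis
      unfolding J using brace_class[OF s'] S by (simp add: n q)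
  qed
  show ?thesis using 1 2 3 by blast
qed

end
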